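(* For all $p\ge2$ there exists a constant $C>0$, independent of $\ell$, such that for every level $1\le\ell\le L$ $$\mathbb E\Bigl[\max_{t\in\mathbf g^{c,[\ell-1]}}\bigl\|\hat X^{f,[\ell]}_t-\hat X^{c,[\ell-1]}_t\bigr\|^p\Bigr]\le C\,\Delta_{\ell-1}^p .$$
   Context: **SDE.** Let $T>0$ be real, $d\ge1$, $N_S\ge 0$, $N_R\ge 1$ integers, $N=N_S+N_R$, $x\in\mathbb{R}^N$. $B=(B^1,\dots,B^d)$ is a standard $d$-dimensional Brownian motion on $(\Omega,\mathcal F,\{\mathcal F_t\}_{t\ge0},\mathbb P)$, and $\widetilde B=(\widetilde B^2,\dots,\widetilde B^d)$ is a standard $(d-1)$-dimensional Brownian motion independent of $B$; both are adapted to $\{\mathcal F_t\}$ with increments after time $t$ independent of $\mathcal F_t$. The underlying Itô SDE is $dX_t=\sigma_0(X_t)\,dt+\sum_{1\le j\le d}\sigma_j(X_t)\,dB_t^j$, $X_0=x$, where $\sigma_0=[\sigma_{S,0}^\top,\sigma_{R,0}^\top]^\top$, $\sigma_j=[\mathbf 0_{N_S}^\top,\sigma_{R,j}^\top]^\top$ for $1\le j\le d$, with $\sigma_{S,0}:\mathbb R^N\to\mathbb R^{N_S}$, $\sigma_{R,j}:\mathbb R^N\to\mathbb R^{N_R}$. $\|\cdot\|$ is the Euclidean norm. **Operators.** $\mathcal L_0\varphi=\sum_k\sigma_0^k\partial_{x_k}\varphi+\frac12\sum_{1\le j\le d}\sum_{k_1,k_2}\sigma_j^{k_1}\sigma_j^{k_2}\partial_{x_{k_1}}\partial_{x_{k_2}}\varphi$,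 $\mathcal L_i\varphi=\sum_k\sigma_i^k\partial_{x_k}\varphi$ for $1\le i\le d$, acting componentwise on vector-valued functions. For $1\le i_1,i_2\le d$, $[\sigma_{i_1},\sigma_{i_2}]=\mathcal L_{i_1}\sigma_{i_2}-\mathcal L_{i_2}\sigma_{i_1}$. For $1\le j\le d$, $[\sigma_0,\sigma_j]=\sum_k\{\widetilde\sigma_0^k\partial_{x_k}\sigma_j-\sigma_j^k\partial_{x_k}\widetilde\sigma_0\}$ where $\widetilde\sigma_0=\sigma_0-\frac12\sum_{1\le i\le N}\sum_{1\le j\le d}\sigma_j^i\partial_i\sigma_j$. **Standing assumptions.** (1) $\sigma_j\in C_b^\infty(\mathbb R^N;\mathbb R^N)$, $0\le j\le d$, where $C_b^K(\mathbb R^n;\mathbb R^m)$ is the space of $K$-times differentiable functions whose partial derivatives up to order $K$ are bounded. (2) If $N_S=0$: $\mathrm{Span}\{\sigma_1(z),\dots,\sigma_d(z)\}=\mathbb R^N$ for all $z\in\mathbb R^N$. If $N_S\ge1$: for all $z\in\mathbb R^N$, $\mathrm{Span}\{\sigma_{R,1}(z),\dots,\sigma_{R,d}(z)\}=\mathbb R^{N_R}$ and $\mathrm{Span}\{\sigma_1(z),\dots,\sigma_d(z),[\sigma_0,\sigma_1](z),\dots,[\sigma_0,\sigma_d](z)\}=\mathbb R^N$. **Random variables.** For $0\le s\le t$: $\Delta B^j_{t,s}=B^j_t-B^j_s$ ($1\le j\le d$), $\Delta B^0_{t,s}=t-s$, $\Delta\widetilde B^j_{t,s}=\widetilde B^j_t-\widetilde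 B^j_s$, $\Delta\widetilde A^{j_1j_2}_{t,s}=\Delta B^{j_1}_{t,s}\Delta\widetilde B^{j_2}_{t,s}$ ($1\le j_1<j_2\le d$). If $N_S=0$, $\Delta\eta^{j_1j_2}_{t,s}=\frac12(\Delta B^{j_1}_{t,s}\Delta B^{j_2}_{t,s}-(t-s)\mathbf 1_{j_1=j_2\ne0})$ for all $0\le j_1,j_2\le d$. If $N_S\ge1$, the same formula is used when $1\le j_1,j_2\le d$ or $j_1=j_2=0$, while $\Delta\eta^{0j_2}_{t,s}=\int_s^t\int_s^{v}du\,dB^{j_2}_v$ ($1\le j_2\le d$) and $\Delta\eta^{j_10}_{t,s}=\int_s^t\int_s^v dB^{j_1}_u\,dv$ ($1\le j_1\le d$). **Integrators.** For $z\in\mathbb R^N$, $$\overline{\mathcal I}_{t,s}(z)=z+\sum_{0\le j\le d}\sigma_j(z)\Delta B^j_{t,s}+\sum_{0\le j_1,j_2\le d}\mathcal L_{j_1}\sigma_{j_2}(z)\Delta\eta^{j_1j_2}_{t,s}+\tfrac12\sum_{1\le j_1<j_2\le d}[\sigma_{j_1},\sigma_{j_2}](z)\Delta\widetilde A^{j_1j_2}_{t,s},$$ and $\widetilde{\mathcal I}_{t,s}(z)$ is the same expression with the sign of the last term changed to minus. **Grids and schemes.** $L\in\mathbb N$, $\Delta_\ell=T/2^\ell$. For $1\le\ell\le L$: $t_k=k\Delta_{\ell-1}$, $t_{k+1/2}=(k+\frac12)\Delta_{\ell-1}$, coarse grid $\mathbf g^{c,[\ell-1]}=\{t_k\}_{0\le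 k\le2^{\ell-1}}$. All schemes start at $x$ at time $t_0=0$, and for $0\le k\le2^{\ell-1}-1$: coarse: $\bar X^{c,[\ell-1]}_{t_{k+1}}=\overline{\mathcal I}_{t_{k+1},t_k}(\bar X^{c,[\ell-1]}_{t_k})$; antithetic coarse: $\widetilde X^{c,[\ell-1]}_{t_{k+1}}=\widetilde{\mathcal I}_{t_{k+1},t_k}(\widetilde X^{c,[\ell-1]}_{t_k})$; fine: $\bar X^{f,[\ell]}_{t_{k+1/2}}=\overline{\mathcal I}_{t_{k+1/2},t_k}(\bar X^{f,[\ell]}_{t_k})$, $\bar X^{f,[\ell]}_{t_{k+1}}=\overline{\mathcal I}_{t_{k+1},t_{k+1/2}}(\bar X^{f,[\ell]}_{t_{k+1/2}})$; antithetic fine: $\widetilde X^{f,[\ell]}_{t_{k+1/2}}=\widetilde{\mathcal I}_{t_{k+1},t_{k+1/2}}(\widetilde X^{f,[\ell]}_{t_k})$, $\widetilde X^{f,[\ell]}_{t_{k+1}}=\widetilde{\mathcal I}_{t_{k+1/2},t_k}(\widetilde X^{f,[\ell]}_{t_{k+1/2}})$. Averages: $\hat X^{c,[\ell-1]}=\frac12(\bar X^{c,[\ell-1]}+\widetilde X^{c,[\ell-1]})$, $\hat X^{f,[\ell]}=\frac12(\bar X^{f,[\ell]}+\widetilde X^{f,[\ell]})$. *)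

theory Defs
  imports "HOL-Probability.Probability"
begin

section \<open>Smooth coefficients and differential operators\<close>

definition partial_deriv ::
  "'n::finite \<Rightarrow> (real^'n \<Rightarrow> 'b::real_normed_vector) \<Rightarrow> real^'n \<Rightarrow> 'b" where
  "partial_deriv k f z = vector_derivative (\<lambda>h. f (z + h *\<^sub>R axis k 1)) (at 0)"

text \<open>
  The derivatives of order at most \<open>K\<close> include the one of order \<open>0\<close>,
  so membership entails that the function itself is bounded.
\<close>

primrec Cb :: "nat \<Rightarrow> (real^'n::finite \<Rightarrow> 'b::real_normed_vector) \<Rightarrow> bool" where
  "Cb 0 f \<longleftrightarrow> bounded (range f)"
| "Cb (Suc K) f \<longleftrightarrow>
     bounded (range f) \<and> (\<forall>z. f differentiable (at z)) \<and> (\<forall>k. Cb K (partial_deriv k f))"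

definition Cb_infinity :: "(real^'n::finite \<Rightarrow> 'b::real_normed_vector) \<Rightarrow> bool" where
  "Cb_infinity f \<longleftrightarrow> (\<forall>K. Cb K f)"

text \<open>
  The coefficients are \<open>\<sigma> 0, \<dots>, \<sigma> d\<close>; \<open>\<sigma> j\<close> for \<open>j > d\<close> is never used.
\<close>

definition gen_op ::
  "nat \<Rightarrow> (nat \<Rightarrow> real^'n::finite \<Rightarrow> real^'n) \<Rightarrow> nat \<Rightarrow>
   (real^'n \<Rightarrow> 'b::real_normed_vector) \<Rightarrow> real^'n \<Rightarrow> 'b" where
  "gen_op d \<sigma> i \<phi> z =
     (if i = 0 then
        (\<Sum>k\<in>UNIV. (\<sigma> 0 z $ k) *\<^sub>R partial_deriv k \<phi> z) +
        (1/2) *\<^sub>R (\<Sum>j\<in>{1..d}. \<Sum>k1\<in>UNIV. \<Sum>k2\<in>UNIV.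
           ((\<sigma> j z $ k1) * (\<sigma> j z $ k2)) *\<^sub>R partial_deriv k1 (partial_deriv k2 \<phi>) z)
      else (\<Sum>k\<in>UNIV. (\<sigma> i z $ k) *\<^sub>R partial_deriv k \<phi> z))"

text \<open>The bracket \<open>[\<sigma>\<^sub>i, \<sigma>\<^sub>j]\<close> for \<open>i, j \<ge> 1\<close>.\<close>

definition bracket ::
  "nat \<Rightarrow> (nat \<Rightarrow> real^'n::finite \<Rightarrow> real^'n) \<Rightarrow> nat \<Rightarrow> nat \<Rightarrow> real^'n \<Rightarrow> real^'n" where
  "bracket d \<sigma> i j z = gen_op d \<sigma> i (\<sigma> j) z - gen_op d \<sigma> j (\<sigma> i) z"

text \<open>The Stratonovich drift, and the bracket \<open>[\<sigma>\<^sub>0, \<sigma>\<^sub>j]\<close> built from it.\<close>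

definition strat_drift ::
  "nat \<Rightarrow> (nat \<Rightarrow> real^'n::finite \<Rightarrow> real^'n) \<Rightarrow> real^'n \<Rightarrow> real^'n" where
  "strat_drift d \<sigma> z = \<sigma> 0 z -
     (1/2) *\<^sub>R (\<Sum>i\<in>UNIV. \<Sum>j\<in>{1..d}. (\<sigma> j z $ i) *\<^sub>R partial_deriv i (\<sigma> j) z)"

definition drift_bracket ::
  "nat \<Rightarrow> (nat \<Rightarrow> real^'n::finite \<Rightarrow> real^'n) \<Rightarrow> nat \<Rightarrow> real^'n \<Rightarrow> real^'n" where
  "drift_bracket d \<sigma> j z =
     (\<Sum>k\<in>UNIV. (strat_drift d \<sigma> z $ k) *\<^sub>R partial_deriv k (\<sigma> j) z
               - (\<sigma> j z $ k) *\<^sub>R partial_deriv k (strat_drift d \<sigma>) z)"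

text \<open>
  The block decomposition \<open>N = N\<^sub>S + N\<^sub>R\<close> is encoded by the set \<open>S\<close> of smooth coordinates:
  \<open>N = CARD('n)\<close>, \<open>N\<^sub>S = card S\<close>, \<open>N\<^sub>R = card (- S)\<close>. Thus \<open>N\<^sub>S = 0\<close> means \<open>S = {}\<close> and
  \<open>N\<^sub>R \<ge> 1\<close> means \<open>S \<noteq> UNIV\<close>. The space of rough components is identified with the coordinate
  subspace \<open>range (rough_part S)\<close>.
\<close>

definition rough_part :: "'n::finite set \<Rightarrow> real^'n \<Rightarrow> real^'n" where
  "rough_part S v = (\<chi> i. if i \<in> S then 0 else v $ i)"

definition degenerate_structure ::
  "nat \<Rightarrow> 'n::finite set \<Rightarrow> (nat \<Rightarrow> real^'n \<Rightarrow> real^'n) \<Rightarrow> bool" where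
  "degenerate_structure d S \<sigma> \<longleftrightarrow>
     S \<noteq> UNIV \<and> (\<forall>j\<in>{1..d}. \<forall>z. \<forall>i\<in>S. \<sigma> j z $ i = 0)"

definition span_condition ::
  "nat \<Rightarrow> 'n::finite set \<Rightarrow> (nat \<Rightarrow> real^'n \<Rightarrow> real^'n) \<Rightarrow> bool" where
  "span_condition d S \<sigma> \<longleftrightarrow>
     (if S = {} then \<forall>z. span ((\<lambda>j. \<sigma> j z) ` {1..d}) = UNIV
      else \<forall>z. span ((\<lambda>j. rough_part S (\<sigma> j z)) ` {1..d}) = range (rough_part S) \<and>
               span ((\<lambda>j. \<sigma> j z) ` {1..d} \<union> (\<lambda>j. drift_bracket d \<sigma> j z) ` {1..d}) = UNIV)"


section \<open>Brownian motion and the Ito integral\<close>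

text \<open>The time set is \<open>[0, \<infinity>)\<close>; values at negative times are irrelevant.\<close>

definition filtration_on :: "'a measure \<Rightarrow> (real \<Rightarrow> 'a measure) \<Rightarrow> bool" where
  "filtration_on M F \<longleftrightarrow>
     (\<forall>t\<ge>0. subalgebra M (F t)) \<and> (\<forall>s\<ge>0. \<forall>t\<ge>s. subalgebra (F t) (F s))"

definition generated_events ::
  "'a measure \<Rightarrow> 'i set \<Rightarrow> ('i \<Rightarrow> 'a \<Rightarrow> real) \<Rightarrow> 'a set set" where
  "generated_events M I X =
     sigma_sets (space M) (\<Union>i\<in>I. {X i -` A \<inter> space M | A. A \<in> sets borel})"

text \<open>
  A standard Brownian motion relative to \<open>F\<close>, with components indexed by \<open>J\<close>. Independence of the
  increments over disjoint time intervals follows from adaptedness and from the independence of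
  future increments of the present.
\<close>

definition brownian_motion ::
  "'a measure \<Rightarrow> (real \<Rightarrow> 'a measure) \<Rightarrow> nat set \<Rightarrow> (nat \<Rightarrow> real \<Rightarrow> 'a \<Rightarrow> real) \<Rightarrow> bool" where
  "brownian_motion M F J B \<longleftrightarrow>
     (\<forall>j\<in>J. \<forall>t\<ge>0. B j t \<in> borel_measurable (F t)) \<and>
     (\<forall>j\<in>J. AE \<omega> in M. B j 0 \<omega> = 0) \<and>
     (\<forall>j\<in>J. AE \<omega> in M. continuous_on {0..} (\<lambda>t. B j t \<omega>)) \<and>
     (\<forall>t\<ge>0. prob_space.indep_set M (sets (F t))
        (generated_events M (J \<times> {t..}) (\<lambda>(j, u) \<omega>. B j u \<omega> - B j t \<omega>))) \<and>
     (\<forall>s\<ge>0. \<forall>t>s.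
        prob_space.indep_vars M (\<lambda>_. borel) (\<lambda>j \<omega>. B j t \<omega> - B j s \<omega>) J \<and>
        (\<forall>j\<in>J. distributed M lborel (\<lambda>\<omega>. B j t \<omega> - B j s \<omega>)
           (\<lambda>y. ennreal (normal_density 0 (sqrt (t - s)) y))))"

definition independent_processes ::
  "'a measure \<Rightarrow> nat set \<Rightarrow> (nat \<Rightarrow> real \<Rightarrow> 'a \<Rightarrow> real) \<Rightarrow>
   nat set \<Rightarrow> (nat \<Rightarrow> real \<Rightarrow> 'a \<Rightarrow> real) \<Rightarrow> bool" where
  "independent_processes M J B J' B' \<longleftrightarrow>
     prob_space.indep_set M
       (generated_events M (J \<times> {0..}) (\<lambda>(j, t). B j t))
       (generated_events M (J' \<times> {0..}) (\<lambda>(j, t). B' j t))"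

text \<open>
  A simple process on \<open>(s, t]\<close> is given by \<open>n\<close> subintervals with endpoints
  \<open>s = \<tau> 0 \<le> \<dots> \<le> \<tau> n = t\<close> and bounded values \<open>\<xi> i\<close>, known at time \<open>\<tau> i\<close>, on \<open>(\<tau> i, \<tau> (i + 1)]\<close>.
\<close>

definition simple_data ::
  "'a measure \<Rightarrow> (real \<Rightarrow> 'a measure) \<Rightarrow> real \<Rightarrow> real \<Rightarrow>
   nat \<Rightarrow> (nat \<Rightarrow> real) \<Rightarrow> (nat \<Rightarrow> 'a \<Rightarrow> real) \<Rightarrow> bool" where
  "simple_data M F s t n \<tau> \<xi> \<longleftrightarrow>
     \<tau> 0 = s \<and> \<tau> n = t \<and> (\<forall>i<n. \<tau> i \<le> \<tau> (Suc i)) \<and>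
     (\<forall>i<n. \<xi> i \<in> borel_measurable (F (\<tau> i)) \<and> (\<exists>b. \<forall>\<omega>\<in>space M. \<bar>\<xi> i \<omega>\<bar> \<le> b))"

definition simple_process ::
  "nat \<Rightarrow> (nat \<Rightarrow> real) \<Rightarrow> (nat \<Rightarrow> 'a \<Rightarrow> real) \<Rightarrow> real \<Rightarrow> 'a \<Rightarrow> real" where
  "simple_process n \<tau> \<xi> v \<omega> = (\<Sum>i<n. \<xi> i \<omega> * indicator {\<tau> i<..\<tau> (Suc i)} v)"

definition simple_integral ::
  "(real \<Rightarrow> 'a \<Rightarrow> real) \<Rightarrow> nat \<Rightarrow> (nat \<Rightarrow> real) \<Rightarrow> (nat \<Rightarrow> 'a \<Rightarrow> real) \<Rightarrow> 'a \<Rightarrow> real" where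
  "simple_integral W n \<tau> \<xi> \<omega> = (\<Sum>i<n. \<xi> i \<omega> * (W (\<tau> (Suc i)) \<omega> - W (\<tau> i) \<omega>))"

text \<open>
  \<open>I\<close> is a version of the Ito integral of \<open>H\<close> against \<open>W\<close> over \<open>[s, t]\<close>: the \<open>L\<^sup>2(M)\<close> limit of the
  integrals of simple processes that converge to \<open>H\<close> in \<open>L\<^sup>2([s, t] \<times> M)\<close>.
\<close>

definition has_ito_integral ::
  "'a measure \<Rightarrow> (real \<Rightarrow> 'a measure) \<Rightarrow> (real \<Rightarrow> 'a \<Rightarrow> real) \<Rightarrow> real \<Rightarrow> real \<Rightarrow>
   (real \<Rightarrow> 'a \<Rightarrow> real) \<Rightarrow> ('a \<Rightarrow> real) \<Rightarrow> bool" where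
  "has_ito_integral M F W s t H I \<longleftrightarrow>
     I \<in> borel_measurable M \<and>
     (\<lambda>(v, \<omega>). H v \<omega>) \<in> borel_measurable (lborel \<Otimes>\<^sub>M M) \<and>
     (\<exists>n \<tau> \<xi>. (\<forall>m. simple_data M F s t (n m) (\<tau> m) (\<xi> m)) \<and>
        (\<lambda>m. \<integral>\<^sup>+\<omega>. (\<integral>\<^sup>+v\<in>{s..t}.
            ennreal ((simple_process (n m) (\<tau> m) (\<xi> m) v \<omega> - H v \<omega>)\<^sup>2) \<partial>lborel) \<partial>M) \<longlonglongrightarrow> 0 \<and>
        (\<lambda>m. \<integral>\<^sup>+\<omega>.
            ennreal ((simple_integral W (n m) (\<tau> m) (\<xi> m) \<omega> - I \<omega>)\<^sup>2) \<partial>M) \<longlonglongrightarrow> 0)"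

definition ito_integral ::
  "'a measure \<Rightarrow> (real \<Rightarrow> 'a measure) \<Rightarrow> (real \<Rightarrow> 'a \<Rightarrow> real) \<Rightarrow> real \<Rightarrow> real \<Rightarrow>
   (real \<Rightarrow> 'a \<Rightarrow> real) \<Rightarrow> 'a \<Rightarrow> real" where
  "ito_integral M F W s t H = (SOME I. has_ito_integral M F W s t H I)"


section \<open>Random variables and one-step integrators\<close>

text \<open>Argument order follows the subscripts \<open>t, s\<close>: the end of the step precedes its start.\<close>

definition incr :: "(nat \<Rightarrow> real \<Rightarrow> 'a \<Rightarrow> real) \<Rightarrow> nat \<Rightarrow> real \<Rightarrow> real \<Rightarrow> 'a \<Rightarrow> real" where
  "incr B j t s \<omega> = (if j = 0 then t - s else B j t \<omega> - B j s \<omega>)"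

definition levy_proxy ::
  "(nat \<Rightarrow> real \<Rightarrow> 'a \<Rightarrow> real) \<Rightarrow> (nat \<Rightarrow> real \<Rightarrow> 'a \<Rightarrow> real) \<Rightarrow>
   nat \<Rightarrow> nat \<Rightarrow> real \<Rightarrow> real \<Rightarrow> 'a \<Rightarrow> real" where
  "levy_proxy B B' j1 j2 t s \<omega> = (B j1 t \<omega> - B j1 s \<omega>) * (B' j2 t \<omega> - B' j2 s \<omega>)"

text \<open>
  In the hypoelliptic case \<open>S \<noteq> {}\<close> the mixed time/noise terms are genuine iterated integrals. The
  inner integrals are written as \<open>\<integral>\<^sub>s\<^sup>v du\<close> and as the increment \<open>B\<^sub>v - B\<^sub>s = \<integral>\<^sub>s\<^sup>v dB\<^sub>u\<close>.
\<close>

definition eta ::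
  "'a measure \<Rightarrow> (real \<Rightarrow> 'a measure) \<Rightarrow> 'n set \<Rightarrow> (nat \<Rightarrow> real \<Rightarrow> 'a \<Rightarrow> real) \<Rightarrow>
   nat \<Rightarrow> nat \<Rightarrow> real \<Rightarrow> real \<Rightarrow> 'a \<Rightarrow> real" where
  "eta M F S B j1 j2 t s \<omega> =
     (if S \<noteq> {} \<and> j1 = 0 \<and> j2 \<noteq> 0 then
        ito_integral M F (B j2) s t (\<lambda>v _. LBINT u:{s..v}. 1) \<omega>
      else if S \<noteq> {} \<and> j1 \<noteq> 0 \<and> j2 = 0 then
        (LBINT v:{s..t}. (B j1 v \<omega> - B j1 s \<omega>))
      else (incr B j1 t s \<omega> * incr B j2 t s \<omega> - (if j1 = j2 \<and> j1 \<noteq> 0 then t - s else 0)) / 2)"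

text \<open>
  The sign \<open>\<epsilon>\<close> of the last term distinguishes the integrator (\<open>\<epsilon> = 1\<close>) from its antithetic
  version (\<open>\<epsilon> = -1\<close>).
\<close>

definition integrator ::
  "real \<Rightarrow> 'a measure \<Rightarrow> (real \<Rightarrow> 'a measure) \<Rightarrow> nat \<Rightarrow> 'n::finite set \<Rightarrow>
   (nat \<Rightarrow> real^'n \<Rightarrow> real^'n) \<Rightarrow> (nat \<Rightarrow> real \<Rightarrow> 'a \<Rightarrow> real) \<Rightarrow> (nat \<Rightarrow> real \<Rightarrow> 'a \<Rightarrow> real) \<Rightarrow>
   real \<Rightarrow> real \<Rightarrow> 'a \<Rightarrow> real^'n \<Rightarrow> real^'n" where
  "integrator \<epsilon> M F d S \<sigma> B B' t s \<omega> z =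
     z + (\<Sum>j\<in>{0..d}. incr B j t s \<omega> *\<^sub>R \<sigma> j z)
       + (\<Sum>j1\<in>{0..d}. \<Sum>j2\<in>{0..d}. eta M F S B j1 j2 t s \<omega> *\<^sub>R gen_op d \<sigma> j1 (\<sigma> j2) z)
       + (\<epsilon> / 2) *\<^sub>R (\<Sum>j1\<in>{1..d}. \<Sum>j2\<in>{j1<..d}.
            levy_proxy B B' j1 j2 t s \<omega> *\<^sub>R bracket d \<sigma> j1 j2 z)"


section \<open>Schemes\<close>

text \<open>
  \<open>grid T l r\<close> is the time \<open>r \<Delta>\<close> with coarse step \<open>\<Delta> = T / 2\<^sup>l\<^sup>-\<^sup>1\<close>, where \<open>r\<close> may be a half-integer.
  The schemes below are indexed by the number \<open>k\<close> of the coarse grid point. In \<open>coarse_scheme\<close> and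
  \<open>fine_scheme\<close> the driving noise is packaged in the one-step map \<open>\<Phi> t s\<close>; the antithetic fine
  scheme swaps the two half-steps.
\<close>

definition level_step :: "real \<Rightarrow> nat \<Rightarrow> real" where
  "level_step T l = T / 2 ^ l"

definition grid :: "real \<Rightarrow> nat \<Rightarrow> real \<Rightarrow> real" where
  "grid T l r = r * level_step T (l - 1)"

primrec coarse_scheme ::
  "(real \<Rightarrow> real \<Rightarrow> 'v \<Rightarrow> 'v) \<Rightarrow> 'v \<Rightarrow> real \<Rightarrow> nat \<Rightarrow> nat \<Rightarrow> 'v" where
  "coarse_scheme \<Phi> x T l 0 = x"
| "coarse_scheme \<Phi> x T l (Suc k) =
     \<Phi> (grid T l (real k + 1)) (grid T l (real k)) (coarse_scheme \<Phi> x T l k)"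

primrec fine_scheme ::
  "(real \<Rightarrow> real \<Rightarrow> 'v \<Rightarrow> 'v) \<Rightarrow> 'v \<Rightarrow> real \<Rightarrow> nat \<Rightarrow> nat \<Rightarrow> 'v" where
  "fine_scheme \<Phi> x T l 0 = x"
| "fine_scheme \<Phi> x T l (Suc k) =
     \<Phi> (grid T l (real k + 1)) (grid T l (real k + 1/2))
       (\<Phi> (grid T l (real k + 1/2)) (grid T l (real k)) (fine_scheme \<Phi> x T l k))"

primrec swapped_fine_scheme ::
  "(real \<Rightarrow> real \<Rightarrow> 'v \<Rightarrow> 'v) \<Rightarrow> 'v \<Rightarrow> real \<Rightarrow> nat \<Rightarrow> nat \<Rightarrow> 'v" where
  "swapped_fine_scheme \<Phi> x T l 0 = x"
| "swapped_fine_scheme \<Phi> x T l (Suc k) =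
     \<Phi> (grid T l (real k + 1/2)) (grid T l (real k))
       (\<Phi> (grid T l (real k + 1)) (grid T l (real k + 1/2)) (swapped_fine_scheme \<Phi> x T l k))"

definition coarse_average ::
  "'a measure \<Rightarrow> (real \<Rightarrow> 'a measure) \<Rightarrow> nat \<Rightarrow> 'n::finite set \<Rightarrow>
   (nat \<Rightarrow> real^'n \<Rightarrow> real^'n) \<Rightarrow> (nat \<Rightarrow> real \<Rightarrow> 'a \<Rightarrow> real) \<Rightarrow> (nat \<Rightarrow> real \<Rightarrow> 'a \<Rightarrow> real) \<Rightarrow>
   real^'n \<Rightarrow> real \<Rightarrow> nat \<Rightarrow> nat \<Rightarrow> 'a \<Rightarrow> real^'n" where
  "coarse_average M F d S \<sigma> B B' x T l k \<omega> = (1/2) *\<^sub>R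
     (coarse_scheme (\<lambda>t s. integrator 1 M F d S \<sigma> B B' t s \<omega>) x T l k +
      coarse_scheme (\<lambda>t s. integrator (-1) M F d S \<sigma> B B' t s \<omega>) x T l k)"

definition fine_average ::
  "'a measure \<Rightarrow> (real \<Rightarrow> 'a measure) \<Rightarrow> nat \<Rightarrow> 'n::finite set \<Rightarrow>
   (nat \<Rightarrow> real^'n \<Rightarrow> real^'n) \<Rightarrow> (nat \<Rightarrow> real \<Rightarrow> 'a \<Rightarrow> real) \<Rightarrow> (nat \<Rightarrow> real \<Rightarrow> 'a \<Rightarrow> real) \<Rightarrow>
   real^'n \<Rightarrow> real \<Rightarrow> nat \<Rightarrow> nat \<Rightarrow> 'a \<Rightarrow> real^'n" where
  "fine_average M F d S \<sigma> B B' x T l k \<omega> = (1/2) *\<^sub>R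
     (fine_scheme (\<lambda>t s. integrator 1 M F d S \<sigma> B B' t s \<omega>) x T l k +
      swapped_fine_scheme (\<lambda>t s. integrator (-1) M F d S \<sigma> B B' t s \<omega>) x T l k)"

end

theory Submission imports Defs begin

text \<open>
  Write \<open>h\<close> for the coarse step of the level. Each of the four schemes is, from one coarse grid point
  to the next, a recursion
  \<open>Z' = Z + P(Z) \<plusminus> \<^bold>A(Z) / 2 + R\<close>. Here \<open>P\<close> collects the drift, the noise and the second order terms
  \<open>\<eta>\<^sup>i\<^sup>j L\<^sub>i \<sigma>\<^sub>j\<close> with \<open>i, j \<ge> 1\<close>; \<open>\<^bold>A\<close> is a combination of the brackets \<open>[\<sigma>\<^sub>i, \<sigma>\<^sub>j]\<close> whose random coefficients
  (the areas) are centered and of size \<open>h\<close>; and \<open>R\<close> is a local error: a centered part of size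
  \<open>h\<^sup>3\<^sup>/\<^sup>2\<close> plus a systematic part of size \<open>h\<^sup>2\<close>.

  The point is that \<open>P\<close> is the same for all four schemes, and that partners carry the same area with
  opposite signs. For the coarse pair this is the definition. For the fine pair, a Taylor expansion
  of the second half-step at the state before the first one produces the cross terms
  \<open>\<Delta>\<^sub>1B\<^sup>i \<Delta>\<^sub>2B\<^sup>j L\<^sub>i \<sigma>\<^sub>j\<close>. Their symmetric part completes the two half-step values of \<open>\<eta>\<^sup>i\<^sup>j\<close> to the one of the
  whole step. Their antisymmetric part is an area, and exchanging the two half-steps reverses its
  sign, just as passing to the antithetic integrator reverses the sign of the Levy proxy
  (\<open>composed_main_part\<close>, \<open>composed_step_expansion\<close>).

  The area term makes partners differ by \<open>h\<^sup>1\<^sup>/\<^sup>2\<close> only (\<open>antithetic_pair_close\<close>), but it cancels in their average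
  up to a product of an area and a difference of partners, which is centered of size \<open>h\<^sup>3\<^sup>/\<^sup>2\<close>. In \<open>P\<close> the
  linear terms in the difference of partners cancel as well, and the quadratic ones, of size \<open>h\<close>, meet a noise
  of size \<open>h\<^sup>1\<^sup>/\<^sup>2\<close> or a drift of size \<open>h\<close>. Hence both averages solve \<open>Z' = Z + P(Z)\<close> up to a local error
  (\<open>antithetic_average_recursion\<close>). The theorem \<open>stability\<close>, a discrete Gronwall argument combined
  with Doob's maximal inequality, turns local errors of this size into a uniform error of size \<open>h\<close>.

  All sizes are measured by the moments \<open>E |Z|\<^sup>2\<^sup>q\<close> for all natural \<open>q\<close>, uniformly over the steps of all
  levels; a real exponent \<open>p\<close> is reached at the end by \<open>powr_le_scaled_power\<close>.

  Two points of probability need care. The processes \<open>B\<close> and \<open>B'\<close> are independent of each other, and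
  each has increments independent of the past in the given filtration, but this says nothing about
  the increments of the pair and that past. The past of a step is therefore the algebra generated by
  the increments of both processes on the elapsed half-steps, for which independence is proved in
  \<open>noise_algebra_indep\<close>. And in the hypoelliptic case \<open>\<eta>\<^sup>0\<^sup>j\<close> is an Ito integral that is determined only up to null
  sets; \<open>ito_integral_time\<close> identifies it almost surely with
  \<open>(t - s) (B\<^sub>t - B\<^sub>s) - \<integral>\<^sub>s\<^sup>t (B\<^sub>v - B\<^sub>s) dv\<close>, which is a function of the increments on \<open>[s, t]\<close>.
\<close>

section \<open>Even moments and orders of magnitude\<close>

text \<open>
  Even exponents keep \<open>\<bar>x\<bar>\<^sup>2\<^sup>q\<close> a polynomial in real coordinates \<open>x\<close>, and are cofinal among all exponents.
\<close>

definition absmom :: "'a measure \<Rightarrow> nat \<Rightarrow> ('a \<Rightarrow> 'b::real_normed_vector) \<Rightarrow> ennreal" where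
  "absmom M q f = (\<integral>\<^sup>+\<omega>. ennreal (norm (f \<omega>) ^ (2 * q)) \<partial>M)"

text \<open>
  A class of integrable variables that is closed under sums and products, so that no exponents have
  to be tracked.
\<close>

definition all_moments :: "'a measure \<Rightarrow> ('a \<Rightarrow> 'b::euclidean_space) \<Rightarrow> bool" where
  "all_moments M f \<longleftrightarrow> f \<in> borel_measurable M \<and> (\<forall>q. absmom M q f < \<infinity>)"

text \<open>
  The bound \<open>\<beta> q i\<close> may be a power of the step size, or may involve the moments of another family; both
  kinds occur below. Only the constant in front of it must not depend on \<open>i\<close>.
\<close>

definition moment_bound ::
  "'a measure \<Rightarrow> 'i set \<Rightarrow> (nat \<Rightarrow> 'i \<Rightarrow> ennreal) \<Rightarrow> ('i \<Rightarrow> 'a \<Rightarrow> 'b::euclidean_space) \<Rightarrow> bool" where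
  "moment_bound M I \<beta> Z \<longleftrightarrow> (\<forall>i\<in>I. Z i \<in> borel_measurable M) \<and>
     (\<forall>q. \<exists>C::real. \<forall>i\<in>I. absmom M q (Z i) \<le> ennreal C * \<beta> q i)"

lemma power_add_le_power_mult:
  fixes a b :: real
  assumes "0 \<le> a" "0 \<le> b"
  shows "(a + b) ^ n \<le> 2 ^ n * (a ^ n + b ^ n)"
proof -
  have "(a + b) ^ n \<le> (2 * max a b) ^ n" using assms by (intro power_mono) auto
  also have "\<dots> = 2 ^ n * (max a b) ^ n" by (simp add: power_mult_distrib)
  also have "(max a b) ^ n \<le> a ^ n + b ^ n" using assms by (auto simp: max_def)
  finally show ?thesis by simp
qed

lemma moment_boundD1: "moment_bound M I \<beta> Z \<Longrightarrow> i \<in> I \<Longrightarrow> Z i \<in> borel_measurable M"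
  by (simp add: moment_bound_def)

lemma moment_boundD2:
  assumes "moment_bound M I \<beta> Z"
  shows "\<exists>C\<ge>0. \<forall>i\<in>I. absmom M q (Z i) \<le> ennreal C * \<beta> q i"
proof -
  obtain C where C: "\<And>i. i \<in> I \<Longrightarrow> absmom M q (Z i) \<le> ennreal C * \<beta> q i"
    using assms unfolding moment_bound_def by blast
  have "absmom M q (Z i) \<le> ennreal (max C 0) * \<beta> q i" if "i \<in> I" for i
    by (rule order_trans[OF C[OF that]]) (auto intro!: mult_right_mono ennreal_leI)
  then show ?thesis by (intro exI[of _ "max C 0"]) auto
qed

lemma absmom_mono:
  assumes "\<And>\<omega>. \<omega> \<in> space M \<Longrightarrow> norm (f \<omega>) \<le> norm (g \<omega>)"
  shows "absmom M q f \<le> absmom M q g"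
  unfolding absmom_def by (intro nn_integral_mono ennreal_leI power_mono) (auto simp: assms)

lemma absmom_cmult:
  fixes f :: "'a \<Rightarrow> 'b::euclidean_space"
  assumes "f \<in> borel_measurable M"
  shows "absmom M q (\<lambda>\<omega>. K *\<^sub>R f \<omega>) = ennreal (\<bar>K\<bar> ^ (2 * q)) * absmom M q f"
  unfolding absmom_def using assms
  by (subst nn_integral_cmult[symmetric]) (auto simp: power_mult_distrib ennreal_mult)

lemma absmom_add:
  fixes f :: "'a \<Rightarrow> 'b::euclidean_space"
  assumes [measurable]: "f \<in> borel_measurable M" "g \<in> borel_measurable M"
  shows "absmom M q (\<lambda>\<omega>. f \<omega> + g \<omega>) \<le> ennreal (4 ^ q) * (absmom M q f + absmom M q g)"
proof -
  have "norm (f \<omega> + g \<omega>) ^ (2 * q) \<le> 4 ^ q * (norm (f \<omega>) ^ (2 * q) + norm (g \<omega>) ^ (2 * q))" for \<omega>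
    using order_trans[OF power_mono[OF norm_triangle_ineq] power_add_le_power_mult, of "f \<omega>" "g \<omega>" "2*q"]
    by (simp add: power_mult)
  then have "absmom M q (\<lambda>\<omega>. f \<omega> + g \<omega>)
      \<le> (\<integral>\<^sup>+\<omega>. ennreal (4 ^ q) * (ennreal (norm (f \<omega>) ^ (2 * q)) + ennreal (norm (g \<omega>) ^ (2 * q))) \<partial>M)"
    unfolding absmom_def
    by (intro nn_integral_mono) (simp flip: ennreal_plus ennreal_mult)
  also have "\<dots> = ennreal (4 ^ q) * (absmom M q f + absmom M q g)"
    unfolding absmom_def by (simp add: nn_integral_cmult nn_integral_add)
  finally show ?thesis .
qed

lemma moment_bound_add:
  assumes f: "moment_bound M I \<beta> Z" and g: "moment_bound M I \<beta> W"
  shows "moment_bound M I \<beta> (\<lambda>i \<omega>. Z i \<omega> + W i \<omega>)"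
  unfolding moment_bound_def
proof (intro conjI ballI allI)
  show "(\<lambda>\<omega>. Z i \<omega> + W i \<omega>) \<in> borel_measurable M" if "i \<in> I" for i
    using assms[THEN moment_boundD1, OF that] by measurable
  fix q
  obtain C where C: "C \<ge> 0" "\<And>i. i \<in> I \<Longrightarrow> absmom M q (Z i) \<le> ennreal C * \<beta> q i"
    using moment_boundD2[OF f, of q] by blast
  obtain D where D: "D \<ge> 0" "\<And>i. i \<in> I \<Longrightarrow> absmom M q (W i) \<le> ennreal D * \<beta> q i"
    using moment_boundD2[OF g, of q] by blast
  have "absmom M q (\<lambda>\<omega>. Z i \<omega> + W i \<omega>) \<le> ennreal (4 ^ q * (C + D)) * \<beta> q i" if i: "i \<in> I" for i
  proof -
    have "absmom M q (\<lambda>\<omega>. Z i \<omega> + W i \<omega>) \<le> ennreal (4 ^ q) * (absmom M q (Z i) + absmom M q (W i))"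
      using assms i by (intro absmom_add) (auto dest: moment_boundD1)
    also have "\<dots> \<le> ennreal (4 ^ q) * (ennreal C * \<beta> q i + ennreal D * \<beta> q i)"
      using C D i by (intro mult_left_mono add_mono) auto
    also have "\<dots> = ennreal (4 ^ q * (C + D)) * \<beta> q i"
      using C D by (simp add: ennreal_mult ennreal_plus algebra_simps)
    finally show ?thesis .
  qed
  then show "\<exists>C. \<forall>i\<in>I. absmom M q (\<lambda>\<omega>. Z i \<omega> + W i \<omega>) \<le> ennreal C * \<beta> q i" by auto
qed

lemma moment_bound_dominated:
  assumes f: "moment_bound M I \<beta> Z"
    and m: "\<And>i. i \<in> I \<Longrightarrow> W i \<in> borel_measurable M"
    and le: "\<And>i \<omega>. i \<in> I \<Longrightarrow> \<omega> \<in> space M \<Longrightarrow> norm (W i \<omega>) \<le> K * norm (Z i \<omega>)"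
  shows "moment_bound M I \<beta> W"
  unfolding moment_bound_def
proof (intro conjI ballI allI m)
  fix q
  obtain C where C: "C \<ge> 0" "\<And>i. i \<in> I \<Longrightarrow> absmom M q (Z i) \<le> ennreal C * \<beta> q i"
    using moment_boundD2[OF f, of q] by blast
  have "absmom M q (W i) \<le> ennreal (\<bar>K\<bar> ^ (2 * q) * C) * \<beta> q i" if i: "i \<in> I" for i
  proof -
    have "absmom M q (W i) \<le> absmom M q (\<lambda>\<omega>. K *\<^sub>R Z i \<omega>)"
    proof (intro absmom_mono)
      fix \<omega> assume "\<omega> \<in> space M"
      then have "norm (W i \<omega>) \<le> K * norm (Z i \<omega>)" using le[OF i] by blast
      also have "\<dots> \<le> \<bar>K\<bar> * norm (Z i \<omega>)" by (intro mult_right_mono) auto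
      finally show "norm (W i \<omega>) \<le> norm (K *\<^sub>R Z i \<omega>)" by simp
    qed
    also have "\<dots> = ennreal (\<bar>K\<bar> ^ (2 * q)) * absmom M q (Z i)"
      using f i by (intro absmom_cmult) (auto dest: moment_boundD1)
    also have "\<dots> \<le> ennreal (\<bar>K\<bar> ^ (2 * q)) * (ennreal C * \<beta> q i)"
      using C i by (intro mult_left_mono) auto
    finally show ?thesis using C by (simp add: ennreal_mult mult_ac)
  qed
  then show "\<exists>C. \<forall>i\<in>I. absmom M q (W i) \<le> ennreal C * \<beta> q i" by auto
qed

lemma moment_bound_scaleR:
  "moment_bound M I \<beta> Z \<Longrightarrow> moment_bound M I \<beta> (\<lambda>i \<omega>. K *\<^sub>R Z i \<omega>)"
  by (rule moment_bound_dominated[where K="\<bar>K\<bar>"]) (auto dest: moment_boundD1)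

lemma moment_bound_diff:
  assumes "moment_bound M I \<beta> Z" "moment_bound M I \<beta> W"
  shows "moment_bound M I \<beta> (\<lambda>i \<omega>. Z i \<omega> - W i \<omega>)"
  using moment_bound_add[OF assms(1) moment_bound_scaleR[OF assms(2), of "-1"]] by simp

lemma moment_bound_mono:
  assumes f: "moment_bound M I \<beta> Z"
    and le: "\<And>q. \<exists>K\<ge>0. \<forall>i\<in>I. \<beta> q i \<le> ennreal K * \<gamma> q i"
  shows "moment_bound M I \<gamma> Z"
  unfolding moment_bound_def
proof (intro conjI ballI allI)
  show "Z i \<in> borel_measurable M" if "i \<in> I" for i using moment_boundD1[OF f that] .
  fix q
  obtain C where C: "C \<ge> 0" "\<And>i. i \<in> I \<Longrightarrow> absmom M q (Z i) \<le> ennreal C * \<beta> q i"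
    using moment_boundD2[OF f, of q] by blast
  obtain K where K: "K \<ge> 0" "\<And>i. i \<in> I \<Longrightarrow> \<beta> q i \<le> ennreal K * \<gamma> q i"
    using le[of q] by blast
  have "absmom M q (Z i) \<le> ennreal (C * K) * \<gamma> q i" if i: "i \<in> I" for i
  proof -
    have "absmom M q (Z i) \<le> ennreal C * (ennreal K * \<gamma> q i)"
      by (rule order_trans[OF C(2)[OF i] mult_left_mono[OF K(2)[OF i]]]) simp
    then show ?thesis using C K by (simp add: ennreal_mult mult.assoc)
  qed
  then show "\<exists>C. \<forall>i\<in>I. absmom M q (Z i) \<le> ennreal C * \<gamma> q i" by blast
qed

lemma moment_bound_sum:
  assumes "\<And>a. a \<in> A \<Longrightarrow> moment_bound M I \<beta> (Z a)" "finite A"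
    and "moment_bound M I \<beta> (\<lambda>i \<omega>. 0 :: 'b::euclidean_space)"
  shows "moment_bound M I \<beta> (\<lambda>i \<omega>. (\<Sum>a\<in>A. Z a i \<omega> :: 'b))"
  using assms(2,1,3) by (induction A) (auto intro!: moment_bound_add)

lemma all_moments_scaleR:
  fixes f :: "'a \<Rightarrow> real" and g :: "'a \<Rightarrow> 'b::euclidean_space"
  assumes "all_moments M f" "all_moments M g"
  shows "all_moments M (\<lambda>\<omega>. f \<omega> *\<^sub>R g \<omega>)"
proof -
  have [measurable]: "f \<in> borel_measurable M" "g \<in> borel_measurable M"
    using assms by (auto simp: all_moments_def)
  have "absmom M q (\<lambda>\<omega>. f \<omega> *\<^sub>R g \<omega>) < \<infinity>" for q
  proof -
    have "norm (f \<omega> *\<^sub>R g \<omega>) ^ (2*q) \<le> norm (f \<omega>) ^ (2*(2*q)) + norm (g \<omega>) ^ (2*(2*q))" for \<omega>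
    proof -
      define a b where "a = norm (f \<omega>) ^ (2*q)" and "b = norm (g \<omega>) ^ (2*q)"
      have "0 \<le> a * b" by (simp add: a_def b_def)
      then have "a * b \<le> a^2 + b^2" using sum_squares_bound[of a b] by linarith
      then show ?thesis by (simp add: a_def b_def power_mult_distrib power_mult[symmetric] mult_ac)
    qed
    then have "absmom M q (\<lambda>\<omega>. f \<omega> *\<^sub>R g \<omega>) \<le> absmom M (2*q) f + absmom M (2*q) g"
      unfolding absmom_def
      by (subst nn_integral_add[symmetric]) (auto intro!: nn_integral_mono simp flip: ennreal_plus)
    also have "\<dots> < \<infinity>" using assms by (auto simp: all_moments_def)
    finally show ?thesis .
  qed
  then show ?thesis by (simp add: all_moments_def)
qed

lemma all_moments_integrable:
  assumes "all_moments M f" "finite_measure M"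
  shows "integrable M f"
proof (rule integrableI_bounded)
  interpret finite_measure M by fact
  show [measurable]: "f \<in> borel_measurable M" using assms by (simp add: all_moments_def)
  have "x \<le> 1 + x ^ 2" for x :: real
    using zero_le_power2[of "x - 1/2"] by (simp add: power2_eq_square algebra_simps)
  then have "(\<integral>\<^sup>+ x. ennreal (norm (f x)) \<partial>M) \<le> (\<integral>\<^sup>+ x. 1 + ennreal (norm (f x) ^ (2 * 1)) \<partial>M)"
    by (intro nn_integral_mono) (simp flip: ennreal_plus ennreal_1)
  also have "\<dots> = emeasure M (space M) + absmom M 1 f"
    by (simp add: nn_integral_add absmom_def)
  also have "\<dots> < \<infinity>" using assms emeasure_finite[of "space M"]
    by (auto simp: all_moments_def top.not_eq_extremum simp del: emeasure_finite)
  finally show "(\<integral>\<^sup>+ x. ennreal (norm (f x)) \<partial>M) < \<infinity>" .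
qed

lemma all_moments_add:
  assumes "all_moments M f" "all_moments M g"
  shows "all_moments M (\<lambda>\<omega>. f \<omega> + g \<omega>)"
proof -
  have [measurable]: "f \<in> borel_measurable M" "g \<in> borel_measurable M"
    using assms by (auto simp: all_moments_def)
  have "absmom M q (\<lambda>\<omega>. f \<omega> + g \<omega>) < \<infinity>" for q
    by (rule le_less_trans[OF absmom_add]) (use assms in \<open>auto simp: all_moments_def ennreal_mult_less_top\<close>)
  then show ?thesis by (simp add: all_moments_def)
qed

lemma all_moments_dominated:
  assumes "all_moments M f" "g \<in> borel_measurable M"
    "\<And>\<omega>. \<omega> \<in> space M \<Longrightarrow> norm (g \<omega>) \<le> norm (f \<omega>)"
  shows "all_moments M g"
  using assms absmom_mono[OF assms(3), of M] unfolding all_moments_def by (meson le_less_trans)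

text \<open>
  The index set will consist of the coarse steps of all levels at once. Bounds that are uniform over \<open>I\<close>
  are therefore uniform in the level.
\<close>

locale small_steps = prob_space M for M :: "'a measure" +
  fixes I :: "'i set" and h :: "'i \<Rightarrow> real" and hmax :: real
  assumes h_pos: "i \<in> I \<Longrightarrow> 0 < h i" and h_le: "i \<in> I \<Longrightarrow> h i \<le> hmax"
begin

text \<open>
  Size \<open>h\<^sup>a\<^sup>/\<^sup>2\<close> in every \<open>L\<^sup>p\<close>: for the moment of exponent \<open>2q\<close> this means \<open>h\<^sup>a\<^sup>q\<close>, so that the half-integer
  powers that are typical of Brownian motion have natural exponents. Brownian increments have
  order 1, time steps have order 2.
\<close>

definition of_order :: "nat \<Rightarrow> ('i \<Rightarrow> 'a \<Rightarrow> 'b::euclidean_space) \<Rightarrow> bool" where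
  "of_order a Z \<longleftrightarrow> moment_bound M I (\<lambda>q i. ennreal (h i ^ (a * q))) Z"

lemma of_order_measurable: "of_order a Z \<Longrightarrow> i \<in> I \<Longrightarrow> Z i \<in> borel_measurable M"
  by (simp add: of_order_def moment_bound_def)

lemma of_order_all_moments:
  assumes "of_order a Z" "i \<in> I" shows "all_moments M (Z i)"
  unfolding all_moments_def
proof (intro conjI allI)
  show "Z i \<in> borel_measurable M" using of_order_measurable[OF assms] .
  fix q
  obtain C where "absmom M q (Z i) \<le> ennreal C * ennreal (h i ^ (a * q))"
    using moment_boundD2[OF assms(1)[unfolded of_order_def], of q] assms(2) by blast
  also have "\<dots> < \<infinity>" by (simp add: ennreal_mult_less_top)
  finally show "absmom M q (Z i) < \<infinity>" .
qed

lemma of_orderI: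
  assumes "\<And>i. i \<in> I \<Longrightarrow> Z i \<in> borel_measurable M"
    and "\<And>q. \<exists>C\<ge>0. \<forall>i\<in>I. absmom M q (Z i) \<le> ennreal (C * h i ^ (a * q))"
  shows "of_order a Z"
  unfolding of_order_def moment_bound_def
proof (intro conjI ballI allI)
  fix q
  obtain C where C: "C \<ge> 0" "\<And>i. i \<in> I \<Longrightarrow> absmom M q (Z i) \<le> ennreal (C * h i ^ (a * q))"
    using assms(2)[of q] by blast
  show "\<exists>C. \<forall>i\<in>I. absmom M q (Z i) \<le> ennreal C * ennreal (h i ^ (a * q))"
    using C h_pos by (intro exI[of _ C]) (simp add: ennreal_mult' less_imp_le)
qed (use assms in auto)

lemma of_orderD:
  assumes "of_order a Z"
  shows "\<exists>C\<ge>0. \<forall>i\<in>I. absmom M q (Z i) \<le> ennreal (C * h i ^ (a * q))"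
proof -
  obtain C where C: "C \<ge> 0" "\<And>i. i \<in> I \<Longrightarrow> absmom M q (Z i) \<le> ennreal C * ennreal (h i ^ (a * q))"
    using moment_boundD2[OF assms(1)[unfolded of_order_def], of q] by blast
  have "absmom M q (Z i) \<le> ennreal (C * h i ^ (a * q))" if "i \<in> I" for i
    using C(2)[OF that] C(1) h_pos[OF that] by (simp add: ennreal_mult)
  with C(1) show ?thesis by blast
qed

lemma of_order_bounded:
  assumes "\<And>i. i \<in> I \<Longrightarrow> Z i \<in> borel_measurable M"
    and "\<And>i \<omega>. i \<in> I \<Longrightarrow> \<omega> \<in> space M \<Longrightarrow> norm (Z i \<omega>) ^ 2 \<le> K * h i ^ a"
  shows "of_order a Z"
proof (rule of_orderI[OF assms(1)])
  fix q
  have "absmom M q (Z i) \<le> ennreal (\<bar>K\<bar> ^ q * h i ^ (a * q))" if i: "i \<in> I" for i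
  proof -
    have "norm (Z i \<omega>) ^ (2 * q) \<le> \<bar>K\<bar> ^ q * h i ^ (a * q)" if "\<omega> \<in> space M" for \<omega>
    proof -
      have "norm (Z i \<omega>) ^ 2 \<le> \<bar>K\<bar> * h i ^ a"
        by (rule order_trans[OF assms(2)[OF i that]]) (use h_pos[OF i] in \<open>auto intro!: mult_right_mono\<close>)
      then have "(norm (Z i \<omega>) ^ 2) ^ q \<le> (\<bar>K\<bar> * h i ^ a) ^ q" by (intro power_mono) auto
      then show ?thesis by (simp add: power_mult power_mult_distrib)
    qed
    then have "absmom M q (Z i) \<le> (\<integral>\<^sup>+\<omega>. ennreal (\<bar>K\<bar> ^ q * h i ^ (a * q)) \<partial>M)"
      unfolding absmom_def by (intro nn_integral_mono ennreal_leI)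
    then show ?thesis by (simp add: emeasure_space_1)
  qed
  then show "\<exists>C\<ge>0. \<forall>i\<in>I. absmom M q (Z i) \<le> ennreal (C * h i ^ (a * q))"
    by (intro exI[of _ "\<bar>K\<bar> ^ q"]) auto
qed

lemma of_order_zero: "of_order a (\<lambda>i \<omega>. 0)"
  by (rule of_order_bounded[where K=0]) auto

lemma of_order_add: "of_order a Z \<Longrightarrow> of_order a W \<Longrightarrow> of_order a (\<lambda>i \<omega>. Z i \<omega> + W i \<omega>)"
  unfolding of_order_def by (rule moment_bound_add)

lemma of_order_diff: "of_order a Z \<Longrightarrow> of_order a W \<Longrightarrow> of_order a (\<lambda>i \<omega>. Z i \<omega> - W i \<omega>)"
  unfolding of_order_def by (rule moment_bound_diff)

lemma of_order_scaleR: "of_order a Z \<Longrightarrow> of_order a (\<lambda>i \<omega>. K *\<^sub>R Z i \<omega>)"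
  unfolding of_order_def by (rule moment_bound_scaleR)

lemma of_order_sum:
  "(\<And>x. x \<in> A \<Longrightarrow> of_order a (Z x)) \<Longrightarrow> finite A \<Longrightarrow> of_order a (\<lambda>i \<omega>. \<Sum>x\<in>A. Z x i \<omega>)"
  using of_order_zero unfolding of_order_def by (intro moment_bound_sum) auto

lemma of_order_dominated:
  assumes "of_order a Z" "\<And>i. i \<in> I \<Longrightarrow> W i \<in> borel_measurable M"
    "\<And>i \<omega>. i \<in> I \<Longrightarrow> \<omega> \<in> space M \<Longrightarrow> norm (W i \<omega>) \<le> K * norm (Z i \<omega>)"
  shows "of_order a W"
  using assms unfolding of_order_def by (rule moment_bound_dominated)

lemma h_power_le:
  assumes "i \<in> I" "b \<le> a"
  shows "h i ^ (a * q) \<le> max 1 hmax ^ ((a - b) * q) * h i ^ (b * q)"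
proof -
  have "h i ^ (a * q) = h i ^ ((a - b) * q) * h i ^ (b * q)"
    using assms(2) by (simp add: power_add[symmetric] algebra_simps diff_mult_distrib)
  also have "\<dots> \<le> max 1 hmax ^ ((a - b) * q) * h i ^ (b * q)"
    using h_pos[OF assms(1)] h_le[OF assms(1)] by (intro mult_right_mono power_mono) auto
  finally show ?thesis .
qed

lemma of_order_mono:
  assumes "of_order a Z" "b \<le> a"
  shows "of_order b Z"
proof -
  have "\<exists>K\<ge>0. \<forall>i\<in>I. ennreal (h i ^ (a * q)) \<le> ennreal K * ennreal (h i ^ (b * q))" for q
    using h_power_le[OF _ assms(2)] h_pos
    by (intro exI[of _ "max 1 hmax ^ ((a - b) * q)"] conjI ballI)
      (simp_all add: ennreal_mult'[symmetric] ennreal_leI less_imp_le)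
  then show ?thesis using assms(1) unfolding of_order_def by (rule moment_bound_mono[rotated])
qed

text \<open>
  Instead of Cauchy-Schwarz for integrals, the pointwise inequality
  \<open>u v \<le> (y / x) u\<^sup>2 + (x / y) v\<^sup>2\<close> is integrated, with the expected sizes \<open>x\<close> and \<open>y\<close> of the factors as weights.
\<close>

lemma of_order_mult:
  fixes Z :: "'i \<Rightarrow> 'a \<Rightarrow> real" and W :: "'i \<Rightarrow> 'a \<Rightarrow> 'b::euclidean_space"
  assumes Z: "of_order a Z" and W: "of_order b W"
  shows "of_order (a + b) (\<lambda>i \<omega>. Z i \<omega> *\<^sub>R W i \<omega>)"
proof (rule of_orderI)
  show "(\<lambda>\<omega>. Z i \<omega> *\<^sub>R W i \<omega>) \<in> borel_measurable M" if "i \<in> I" for i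
    using of_order_measurable[OF Z that] of_order_measurable[OF W that] by measurable
  fix q
  obtain C where C: "C \<ge> 0" "\<And>i. i \<in> I \<Longrightarrow> absmom M (2*q) (Z i) \<le> ennreal (C * h i ^ (a * (2*q)))"
    using of_orderD[OF Z, of "2*q"] by blast
  obtain D where D: "D \<ge> 0" "\<And>i. i \<in> I \<Longrightarrow> absmom M (2*q) (W i) \<le> ennreal (D * h i ^ (b * (2*q)))"
    using of_orderD[OF W, of "2*q"] by blast
  have "absmom M q (\<lambda>\<omega>. Z i \<omega> *\<^sub>R W i \<omega>) \<le> ennreal ((C + D) * h i ^ ((a + b) * q))" if i: "i \<in> I" for i
  proof -
    note [measurable] = of_order_measurable[OF Z i] of_order_measurable[OF W i]
    note h = h_pos[OF i]
    define x y where "x = h i ^ (a * q)" and "y = h i ^ (b * q)"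
    have xy: "x > 0" "y > 0" using h by (auto simp: x_def y_def)
    have "norm (Z i \<omega> *\<^sub>R W i \<omega>) ^ (2 * q)
        \<le> (y / x) * norm (Z i \<omega>) ^ (2 * (2 * q)) + (x / y) * norm (W i \<omega>) ^ (2 * (2 * q))" for \<omega>
    proof -
      define u v where "u = norm (Z i \<omega>) ^ (2 * q)" and "v = norm (W i \<omega>) ^ (2 * q)"
      have uv: "u \<ge> 0" "v \<ge> 0" by (auto simp: u_def v_def)
      have "u * v = (y * u) * (x * v) / (x * y)" using xy by simp
      also have "\<dots> \<le> ((y * u)^2 + (x * v)^2) / (x * y)"
      proof (intro divide_right_mono)
        have "0 \<le> (y * u) * (x * v)" using xy uv by simp
        then show "(y * u) * (x * v) \<le> (y * u)^2 + (x * v)^2"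
          using sum_squares_bound[of "y * u" "x * v"] by linarith
      qed (use xy in simp)
      also have "\<dots> = (y / x) * u^2 + (x / y) * v^2"
        using xy by (simp add: field_simps power2_eq_square)
      finally show ?thesis
        by (simp add: u_def v_def power_mult_distrib power_mult[symmetric] mult_ac)
    qed
    then have "absmom M q (\<lambda>\<omega>. Z i \<omega> *\<^sub>R W i \<omega>)
        \<le> (\<integral>\<^sup>+\<omega>. ennreal (y / x) * ennreal (norm (Z i \<omega>) ^ (2 * (2 * q)))
             + ennreal (x / y) * ennreal (norm (W i \<omega>) ^ (2 * (2 * q))) \<partial>M)"
      unfolding absmom_def using xy
      by (intro nn_integral_mono) (auto simp flip: ennreal_plus ennreal_mult intro!: ennreal_leI)
    also have "\<dots> = ennreal (y / x) * absmom M (2*q) (Z i) + ennreal (x / y) * absmom M (2*q) (W i)"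
      by (simp add: nn_integral_add nn_integral_cmult absmom_def)
    also have "\<dots> \<le> ennreal (y / x) * ennreal (C * h i ^ (a * (2*q))) + ennreal (x / y) * ennreal (D * h i ^ (b * (2*q)))"
      using C(2)[OF i] D(2)[OF i] by (intro add_mono mult_left_mono) auto
    also have "\<dots> = ennreal ((y / x) * (C * h i ^ (a * (2*q))) + (x / y) * (D * h i ^ (b * (2*q))))"
      using xy C D h by (simp flip: ennreal_plus ennreal_mult)
    also have "h i ^ (a * (2*q)) = x * x" by (simp add: x_def power_add[symmetric] mult.left_commute[of _ 2] mult_2 distrib_left)
    also have "h i ^ (b * (2*q)) = y * y" by (simp add: y_def power_add[symmetric] mult.left_commute[of _ 2] mult_2 distrib_left)
    also have "(y / x) * (C * (x * x)) + (x / y) * (D * (y * y)) = (C + D) * (x * y)"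
      using xy by (simp add: field_simps)
    also have "x * y = h i ^ ((a + b) * q)" by (simp add: x_def y_def power_add[symmetric] algebra_simps)
    finally show ?thesis .
  qed
  then show "\<exists>C\<ge>0. \<forall>i\<in>I. absmom M q (\<lambda>\<omega>. Z i \<omega> *\<^sub>R W i \<omega>) \<le> ennreal (C * h i ^ ((a + b) * q))"
    using C D by (intro exI[of _ "C + D"]) auto
qed

lemma of_order_norm:
  assumes "of_order a Z" shows "of_order a (\<lambda>i \<omega>. norm (Z i \<omega>))"
  by (rule of_order_dominated[OF assms, where K=1]) (auto dest: of_order_measurable[OF assms])

text \<open>
  Conditional expectation zero given \<open>G i\<close>, expressed by duality with the \<open>G i\<close>-measurable variables that have all moments.
\<close>

definition centered :: "('i \<Rightarrow> 'a measure) \<Rightarrow> ('i \<Rightarrow> 'a \<Rightarrow> 'b::euclidean_space) \<Rightarrow> bool" where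
  "centered G Z \<longleftrightarrow> (\<forall>i\<in>I. \<forall>c. c \<in> borel_measurable (G i) \<longrightarrow> all_moments M c \<longrightarrow>
     (\<integral>\<omega>. c \<omega> *\<^sub>R Z i \<omega> \<partial>M) = 0)"

lemma centered_zero: "centered G (\<lambda>i \<omega>. 0)"
  by (simp add: centered_def)

lemma moments_integrable: "all_moments M (c :: 'a \<Rightarrow> real) \<Longrightarrow> all_moments M Z \<Longrightarrow> integrable M (\<lambda>\<omega>. c \<omega> *\<^sub>R Z \<omega>)"
  by (intro all_moments_integrable all_moments_scaleR) (auto intro: finite_measure_axioms)

lemma centered_add:
  assumes "centered G Z" "centered G W" "of_order a Z" "of_order b W"
  shows "centered G (\<lambda>i \<omega>. Z i \<omega> + W i \<omega>)"
  unfolding centered_def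
proof (intro ballI allI impI)
  fix i and c :: "'a \<Rightarrow> real" assume A: "i \<in> I" "c \<in> borel_measurable (G i)" "all_moments M c"
  have "(\<integral>\<omega>. c \<omega> *\<^sub>R (Z i \<omega> + W i \<omega>) \<partial>M) = (\<integral>\<omega>. c \<omega> *\<^sub>R Z i \<omega> \<partial>M) + (\<integral>\<omega>. c \<omega> *\<^sub>R W i \<omega> \<partial>M)"
    unfolding scaleR_add_right
    using A assms(3,4) by (intro Bochner_Integration.integral_add moments_integrable) (auto intro: of_order_all_moments)
  then show "(\<integral>\<omega>. c \<omega> *\<^sub>R (Z i \<omega> + W i \<omega>) \<partial>M) = 0"
    using assms(1,2) A by (simp add: centered_def)
qed

lemma centered_scaleR:
  assumes "centered G Z" shows "centered G (\<lambda>i \<omega>. K *\<^sub>R Z i \<omega>)"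
proof -
  have "(\<integral>\<omega>. c \<omega> *\<^sub>R K *\<^sub>R Z i \<omega> \<partial>M) = K *\<^sub>R (\<integral>\<omega>. c \<omega> *\<^sub>R Z i \<omega> \<partial>M)" for c i
  proof -
    have "(\<lambda>\<omega>. c \<omega> *\<^sub>R K *\<^sub>R Z i \<omega>) = (\<lambda>\<omega>. K *\<^sub>R c \<omega> *\<^sub>R Z i \<omega>)"
      by (simp add: mult.commute)
    then show ?thesis by (simp only: integral_scaleR_right)
  qed
  then show ?thesis using assms unfolding centered_def by (simp del: scaleR_scaleR)
qed

lemma centered_mono:
  assumes "centered G' Z" "\<And>i. i \<in> I \<Longrightarrow> subalgebra (G' i) (G i)"
  shows "centered G Z"
  using assms unfolding centered_def by (meson measurable_from_subalg)

text \<open>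
  The factor \<open>W i\<close> joins the test variable; for vectors this is done one coordinate at a time.
\<close>

lemma centered_mult:
  fixes Z :: "'i \<Rightarrow> 'a \<Rightarrow> real" and W :: "'i \<Rightarrow> 'a \<Rightarrow> 'b::euclidean_space"
  assumes "centered G Z" "of_order a Z" "of_order b W"
    "\<And>i. i \<in> I \<Longrightarrow> W i \<in> borel_measurable (G i)"
  shows "centered G (\<lambda>i \<omega>. Z i \<omega> *\<^sub>R W i \<omega>)"
  unfolding centered_def
proof (intro ballI allI impI)
  fix i and c :: "'a \<Rightarrow> real" assume A: "i \<in> I" "c \<in> borel_measurable (G i)" "all_moments M c"
  note [measurable] = A(2) assms(4)[OF A(1)]
  have WM: "W i \<in> borel_measurable M" using of_order_measurable[OF assms(3) A(1)] .
  have int: "integrable M (\<lambda>\<omega>. c \<omega> *\<^sub>R Z i \<omega> *\<^sub>R W i \<omega>)"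
    using A assms(2,3) by (intro moments_integrable all_moments_scaleR) (auto intro: of_order_all_moments)
  show "(\<integral>\<omega>. c \<omega> *\<^sub>R Z i \<omega> *\<^sub>R W i \<omega> \<partial>M) = 0"
  proof (rule euclidean_eqI)
    fix e :: 'b assume e: "e \<in> Basis"
    have "all_moments M (\<lambda>\<omega>. W i \<omega> \<bullet> e)"
      using WM e by (intro all_moments_dominated[OF of_order_all_moments[OF assms(3) A(1)]]) (auto simp: Basis_le_norm)
    from all_moments_scaleR[OF A(3) this] have am: "all_moments M (\<lambda>\<omega>. c \<omega> * (W i \<omega> \<bullet> e))" by simp
    have "(\<integral>\<omega>. c \<omega> *\<^sub>R Z i \<omega> *\<^sub>R W i \<omega> \<partial>M) \<bullet> e = (\<integral>\<omega>. (c \<omega> *\<^sub>R Z i \<omega> *\<^sub>R W i \<omega>) \<bullet> e \<partial>M)"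
      using int by (intro integral_inner_left[symmetric])
    also have "\<dots> = (\<integral>\<omega>. (c \<omega> * (W i \<omega> \<bullet> e)) *\<^sub>R Z i \<omega> \<partial>M)" by (simp add: mult_ac)
    also have "\<dots> = 0" using assms(1) A(1) am unfolding centered_def by auto
    finally show "(\<integral>\<omega>. c \<omega> *\<^sub>R Z i \<omega> *\<^sub>R W i \<omega> \<partial>M) \<bullet> e = 0 \<bullet> e" by simp
  qed
qed

text \<open>
  These are the one-step errors whose accumulation over \<open>1 / h\<close> steps has size \<open>h\<^sup>r\<^sup>/\<^sup>2\<close>: centered
  contributions add up like square roots of sums of squares and may be larger by a factor \<open>h\<^sup>-\<^sup>1\<^sup>/\<^sup>2\<close> than
  systematic ones, which add up linearly.
\<close>

definition local_error :: "('i \<Rightarrow> 'a measure) \<Rightarrow> nat \<Rightarrow> ('i \<Rightarrow> 'a \<Rightarrow> 'b::euclidean_space) \<Rightarrow> bool" where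
  "local_error G r R \<longleftrightarrow> (\<exists>m D. R = (\<lambda>i \<omega>. m i \<omega> + D i \<omega>) \<and>
      of_order (r + 1) m \<and> centered G m \<and> of_order (r + 2) D)"

lemma local_error_martingale:
  assumes "of_order (r + 1) Z" "centered G Z" shows "local_error G r Z"
  unfolding local_error_def using assms of_order_zero by (intro exI[of _ Z] exI[of _ "\<lambda>i \<omega>. 0"]) auto

lemma local_error_drift:
  assumes "of_order (r + 2) Z" shows "local_error G r Z"
  unfolding local_error_def using assms of_order_zero centered_zero
  by (intro exI[of _ Z] exI[of _ "\<lambda>i \<omega>. 0"]) auto

lemma local_error_add:
  assumes "local_error G r Z" "local_error G r W"
  shows "local_error G r (\<lambda>i \<omega>. Z i \<omega> + W i \<omega>)"
proof -
  obtain m D where 1: "Z = (\<lambda>i \<omega>. m i \<omega> + D i \<omega>)" "of_order (r + 1) m" "centered G m" "of_order (r + 2) D"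
    using assms(1) unfolding local_error_def by blast
  obtain m' D' where 2: "W = (\<lambda>i \<omega>. m' i \<omega> + D' i \<omega>)" "of_order (r + 1) m'" "centered G m'" "of_order (r + 2) D'"
    using assms(2) unfolding local_error_def by blast
  show ?thesis unfolding local_error_def 1(1) 2(1)
    by (intro exI[of _ "\<lambda>i \<omega>. m i \<omega> + m' i \<omega>"] exI[of _ "\<lambda>i \<omega>. D i \<omega> + D' i \<omega>"] conjI
        of_order_add 1 2 centered_add[OF 1(3) 2(3) 1(2) 2(2)]) (auto simp: algebra_simps)
qed

lemma local_error_scaleR:
  assumes "local_error G r Z" shows "local_error G r (\<lambda>i \<omega>. K *\<^sub>R Z i \<omega>)"
proof -
  obtain m D where 1: "Z = (\<lambda>i \<omega>. m i \<omega> + D i \<omega>)" "of_order (r + 1) m" "centered G m" "of_order (r + 2) D"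
    using assms(1) unfolding local_error_def by blast
  show ?thesis unfolding local_error_def 1(1)
    by (intro exI[of _ "\<lambda>i \<omega>. K *\<^sub>R m i \<omega>"] exI[of _ "\<lambda>i \<omega>. K *\<^sub>R D i \<omega>"] conjI
        of_order_scaleR centered_scaleR 1) (auto simp: scaleR_add_right)
qed

lemma local_error_diff:
  assumes "local_error G r Z" "local_error G r W"
  shows "local_error G r (\<lambda>i \<omega>. Z i \<omega> - W i \<omega>)"
  using local_error_add[OF assms(1) local_error_scaleR[OF assms(2), of "-1"]] by simp

lemma local_error_sum:
  "(\<And>x. x \<in> A \<Longrightarrow> local_error G r (Z x)) \<Longrightarrow> finite A \<Longrightarrow> local_error G r (\<lambda>i \<omega>. \<Sum>x\<in>A. Z x i \<omega>)"
proof (induction A rule: infinite_finite_induct)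
  case (insert x F)
  then show ?case by (auto intro!: local_error_add)
qed (auto intro: local_error_drift of_order_zero)

lemma local_error_mono:
  assumes "local_error G' r' Z" "r \<le> r'" "\<And>i. i \<in> I \<Longrightarrow> subalgebra (G' i) (G i)"
  shows "local_error G r Z"
proof -
  obtain m D where 1: "Z = (\<lambda>i \<omega>. m i \<omega> + D i \<omega>)" "of_order (r' + 1) m" "centered G' m" "of_order (r' + 2) D"
    using assms(1) unfolding local_error_def by blast
  show ?thesis unfolding local_error_def 1(1)
    by (intro exI[of _ m] exI[of _ D] conjI of_order_mono[OF 1(2)] of_order_mono[OF 1(4)] centered_mono[OF 1(3) assms(3)])
      (use assms in auto)
qed

lemma local_error_of_order: "local_error G r Z \<Longrightarrow> of_order (r + 1) Z"
  unfolding local_error_def by (auto intro!: of_order_add elim: of_order_mono)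

end

lemma (in prob_space) indep_set_indep_var:
  assumes G: "subalgebra M G" and H: "subalgebra M H"
    and ind: "indep_set (sets G) (sets H)"
    and f: "f \<in> measurable G N" and g: "g \<in> measurable H K"
  shows "indep_var N f K g"
  unfolding indep_var_eq
proof (intro conjI)
  show "f \<in> measurable M N" "g \<in> measurable M K"
    using G H f g by (auto intro: measurable_from_subalg)
  have 1: "sigma_sets (space M) {f -` A \<inter> space M |A. A \<in> sets N} \<subseteq> sets G"
  proof -
    have sp: "space G = space M" using G by (simp add: subalgebra_def)
    have "{f -` A \<inter> space M |A. A \<in> sets N} \<subseteq> sets G"
      using measurable_sets[OF f] unfolding sp by auto
    from sets.sigma_sets_subset[OF this] show ?thesis unfolding sp .
  qed
  have 2: "sigma_sets (space M) {g -` A \<inter> space M |A. A \<in> sets K} \<subseteq> sets H"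
  proof -
    have sp: "space H = space M" using H by (simp add: subalgebra_def)
    have "{g -` A \<inter> space M |A. A \<in> sets K} \<subseteq> sets H"
      using measurable_sets[OF g] unfolding sp by auto
    from sets.sigma_sets_subset[OF this] show ?thesis unfolding sp .
  qed
  show "indep_set (sigma_sets (space M) {f -` A \<inter> space M |A. A \<in> sets N}) (sigma_sets (space M) {g -` A \<inter> space M |A. A \<in> sets K})"
    using ind unfolding indep_set_def
    by (rule indep_sets_mono_sets) (use 1 2 in \<open>auto split: bool.split\<close>)
qed

lemma (in prob_space) indep_set_integral_mult:
  fixes f g :: "'a \<Rightarrow> real"
  assumes "subalgebra M G" "subalgebra M H" "indep_set (sets G) (sets H)"
    "f \<in> borel_measurable G" "g \<in> borel_measurable H" "integrable M f" "integrable M g"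
  shows "(\<integral>\<omega>. f \<omega> * g \<omega> \<partial>M) = (\<integral>\<omega>. f \<omega> \<partial>M) * (\<integral>\<omega>. g \<omega> \<partial>M)"
  using indep_var_lebesgue_integral[OF indep_set_indep_var[OF assms(1-5)] assms(6,7)] .

text \<open>
  For independent factors moments are multiplied without a change of exponent. This is what keeps the
  Gronwall argument closed: the error enters the bound of the next error with the same moment.
\<close>

lemma (in prob_space) indep_set_absmom_mult:
  fixes f :: "'a \<Rightarrow> real" and g :: "'a \<Rightarrow> 'b::euclidean_space"
  assumes "subalgebra M G" "subalgebra M H" "indep_set (sets G) (sets H)"
    "f \<in> borel_measurable H" "g \<in> borel_measurable G"
  shows "absmom M q (\<lambda>\<omega>. f \<omega> *\<^sub>R g \<omega>) = absmom M q f * absmom M q g"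
proof -
  have "indep_var borel (\<lambda>\<omega>. ennreal (norm (g \<omega>) ^ (2*q))) borel (\<lambda>\<omega>. ennreal (norm (f \<omega>) ^ (2*q)))"
    by (rule indep_set_indep_var[OF assms(1-3)]) (use assms in measurable)
  then have ind: "indep_vars (\<lambda>_. borel) (case_bool (\<lambda>\<omega>. ennreal (norm (g \<omega>) ^ (2*q))) (\<lambda>\<omega>. ennreal (norm (f \<omega>) ^ (2*q)))) UNIV"
    unfolding indep_var_def
    by (rule back_subst[where P="\<lambda>B. indep_vars B _ UNIV"]) (auto simp: fun_eq_iff split: bool.split)
  from indep_vars_nn_integral[OF _ this] show ?thesis
    unfolding absmom_def by (simp add: UNIV_bool power_mult_distrib ennreal_mult mult_ac)
qed

lemma (in small_steps) centered_indep:
  fixes Z :: "'i \<Rightarrow> 'a \<Rightarrow> real"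
  assumes "\<And>i. i \<in> I \<Longrightarrow> subalgebra M (G i)" "\<And>i. i \<in> I \<Longrightarrow> subalgebra M (H i)"
    "\<And>i. i \<in> I \<Longrightarrow> indep_set (sets (G i)) (sets (H i))"
    "\<And>i. i \<in> I \<Longrightarrow> Z i \<in> borel_measurable (H i)" "of_order a Z"
    "\<And>i. i \<in> I \<Longrightarrow> (\<integral>\<omega>. Z i \<omega> \<partial>M) = 0"
  shows "centered G Z"
  unfolding centered_def
proof (intro ballI allI impI)
  fix i and c :: "'a \<Rightarrow> real" assume A: "i \<in> I" "c \<in> borel_measurable (G i)" "all_moments M c"
  have "(\<integral>\<omega>. c \<omega> * Z i \<omega> \<partial>M) = (\<integral>\<omega>. c \<omega> \<partial>M) * (\<integral>\<omega>. Z i \<omega> \<partial>M)"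
    using A assms by (intro indep_set_integral_mult[of "G i" "H i"] all_moments_integrable)
      (auto intro: finite_measure_axioms of_order_all_moments)
  then show "(\<integral>\<omega>. c \<omega> *\<^sub>R Z i \<omega> \<partial>M) = 0" using A assms(6) by simp
qed

section \<open>A maximal inequality for martingales with drift\<close>

lemma Max_atMost_Suc: "(MAX j\<in>{..Suc k}. a j) = max (MAX j\<in>{..k}. a j) (a (Suc k) :: real)"
  by (simp add: atMost_Suc Max_insert max.commute)

text \<open>
  The case of one time step in the pathwise maximal inequality: \<open>a\<close> is the old maximum and \<open>b\<close> the new one.
\<close>

lemma power_gap_le:
  fixes a b :: real
  assumes "0 \<le> a" "a \<le> b"
  shows "(b ^ (m + 2) - a ^ (m + 2)) / 2 \<le> b * (b ^ (m + 1) - a ^ (m + 1))"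
proof -
  have "0 \<le> a ^ m * (b - a)\<^sup>2" using assms by simp
  also have "\<dots> = b\<^sup>2 * a ^ m - 2 * b * a ^ (m + 1) + a ^ (m + 2)"
    by (simp add: power2_eq_square algebra_simps)
  also have "b\<^sup>2 * a ^ m \<le> b\<^sup>2 * b ^ m" using assms by (intro mult_left_mono power_mono) auto
  finally show ?thesis by (simp add: power2_eq_square field_simps)
qed

text \<open>
  A pathwise form of Doob's \<open>L\<^sup>p\<close> inequality. Summation by parts of \<open>A\<^sup>m\<^sup>+\<^sup>1\<close> against the increments of \<open>a\<close>
  leaves the increments of \<open>A\<^sup>m\<^sup>+\<^sup>1\<close> times \<open>a\<close>; the maximum \<open>A\<close> increases only when it equals \<open>a\<close>, so there \<open>a\<close> may be
  replaced by \<open>A\<close>. If \<open>a\<close> is a submartingale, the sum has nonnegative expectation.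
\<close>

lemma doob_pathwise:
  fixes a :: "nat \<Rightarrow> real"
  assumes "\<And>k. 0 \<le> a k" "a 0 = 0"
  defines "A \<equiv> \<lambda>k. MAX j\<in>{..k}. a j"
  shows "A n ^ (m + 2) / 2 + (\<Sum>i<n. A i ^ (m + 1) * (a (Suc i) - a i)) \<le> A n ^ (m + 1) * a n"
proof (induction n)
  case 0
  then show ?case using assms by simp
next
  case (Suc n)
  have A0: "0 \<le> A n" unfolding A_def by (rule Max_ge_iff[THEN iffD2]) (auto simp: assms(1))
  have AS: "A (Suc n) = max (A n) (a (Suc n))" unfolding A_def by (rule Max_atMost_Suc)
  have "(A (Suc n) ^ (m + 2) - A n ^ (m + 2)) / 2 \<le> a (Suc n) * (A (Suc n) ^ (m + 1) - A n ^ (m + 1))"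
  proof (cases "a (Suc n) \<le> A n")
    case True then show ?thesis by (simp add: AS max_def)
  next
    case False
    then have "A (Suc n) = a (Suc n)" by (simp add: AS)
    then show ?thesis using power_gap_le[OF A0, of "a (Suc n)" m] False by simp
  qed
  with Suc.IH show ?case by (simp add: algebra_simps diff_divide_distrib)
qed

text \<open>
  Young's inequality; the constant \<open>1 / 4\<close> is what the term \<open>A\<^sup>m\<^sup>+\<^sup>2 / 2\<close> of \<open>doob_pathwise\<close> can absorb.
\<close>

lemma power_mult_le_split:
  fixes A a :: real
  assumes "0 \<le> A" "0 \<le> a"
  shows "A ^ (m + 1) * a \<le> A ^ (m + 2) / 4 + 4 ^ (m + 1) * a ^ (m + 2)"
proof (cases "4 * a \<le> A")
  case True
  have "A ^ (m + 1) * a \<le> A ^ (m + 1) * (A / 4)" using True assms by (intro mult_left_mono) auto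
  also have "\<dots> = A ^ (m + 2) / 4" by simp
  finally show ?thesis using assms by (simp add: add_increasing2)
next
  case False
  have "A ^ (m + 1) * a \<le> (4 * a) ^ (m + 1) * a" using False assms by (intro mult_right_mono power_mono) auto
  also have "\<dots> = 4 ^ (m + 1) * a ^ (m + 2)" by (simp add: power_mult_distrib)
  finally show ?thesis using assms by (simp add: add_increasing)
qed

lemma absmom_eq_integral:
  assumes "all_moments M f"
  shows "absmom M q f = ennreal (\<integral>\<omega>. norm (f \<omega>) ^ (2 * q) \<partial>M)" "integrable M (\<lambda>\<omega>. norm (f \<omega>) ^ (2 * q))"
proof -
  have [measurable]: "f \<in> borel_measurable M" using assms by (simp add: all_moments_def)
  show int: "integrable M (\<lambda>\<omega>. norm (f \<omega>) ^ (2 * q))"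
    using assms by (intro integrableI_bounded) (auto simp: all_moments_def absmom_def)
  show "absmom M q f = ennreal (\<integral>\<omega>. norm (f \<omega>) ^ (2 * q) \<partial>M)"
    unfolding absmom_def using int by (intro nn_integral_eq_integral) auto
qed

lemma (in finite_measure) all_moments_const: "all_moments M (\<lambda>_. c)"
  by (auto simp: all_moments_def absmom_def ennreal_mult_less_top emeasure_eq_measure)

lemma all_moments_mult: "all_moments M f \<Longrightarrow> all_moments M g \<Longrightarrow> all_moments M (\<lambda>\<omega>. f \<omega> * g \<omega> :: real)"
  using all_moments_scaleR[of M f g] by simp

lemma (in finite_measure) all_moments_power:
  "all_moments M f \<Longrightarrow> all_moments M (\<lambda>\<omega>. f \<omega> ^ n :: real)"
  by (induction n) (auto intro: all_moments_mult all_moments_const)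

lemma all_moments_abs: "all_moments M f \<Longrightarrow> all_moments M (\<lambda>\<omega>. \<bar>f \<omega> :: real\<bar>)"
  by (rule all_moments_dominated[of M f]) (auto simp: all_moments_def)

lemma (in finite_measure) all_moments_sum:
  "(\<And>a. a \<in> A \<Longrightarrow> all_moments M (f a)) \<Longrightarrow> all_moments M (\<lambda>\<omega>. \<Sum>a\<in>A. f a \<omega>)"
  by (induction A rule: infinite_finite_induct) (auto intro: all_moments_add all_moments_const)

lemma Max_abs_le_sum:
  fixes x :: "nat \<Rightarrow> real"
  shows "\<bar>MAX j\<in>{..k}. \<bar>x j\<bar>\<bar> \<le> (\<Sum>j\<le>k. \<bar>x j\<bar>)"
proof -
  have "0 \<le> (MAX j\<in>{..k}. \<bar>x j\<bar>)" by (rule Max_ge_iff[THEN iffD2]) auto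
  moreover have "(MAX j\<in>{..k}. \<bar>x j\<bar>) \<le> (\<Sum>j\<le>k. \<bar>x j\<bar>)"
    by (rule Max.boundedI) (auto intro: member_le_sum)
  ultimately show ?thesis by simp
qed

text \<open>
  \<open>doob_pathwise\<close> is applied to \<open>\<bar>X\<bar>\<close>. An increment of \<open>\<bar>X\<bar>\<close> is at least \<open>sgn X \<sqdot> m - \<bar>d\<bar>\<close>; the first part
  has expectation zero against the power of the running maximum, and the second one is collected
  at the final time.
\<close>

lemma (in prob_space) doob_with_drift:
  fixes X m d :: "nat \<Rightarrow> 'a \<Rightarrow> real"
  assumes X0: "\<And>\<omega>. X 0 \<omega> = 0"
    and step: "\<And>k \<omega>. k < n \<Longrightarrow> X (Suc k) \<omega> = X k \<omega> + m k \<omega> + d k \<omega>"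
    and sub: "\<And>k. subalgebra M (G k)" "\<And>j k. j \<le> k \<Longrightarrow> subalgebra (G k) (G j)"
    and X: "\<And>k. k \<le> n \<Longrightarrow> X k \<in> borel_measurable (G k)" "\<And>k. k \<le> n \<Longrightarrow> all_moments M (X k)"
    and m: "\<And>k. k < n \<Longrightarrow> all_moments M (m k)"
      "\<And>k c. k < n \<Longrightarrow> c \<in> borel_measurable (G k) \<Longrightarrow> all_moments M c \<Longrightarrow> (\<integral>\<omega>. c \<omega> * m k \<omega> \<partial>M) = 0"
    and d: "\<And>k. k < n \<Longrightarrow> all_moments M (d k)"
    and q: "q \<ge> 1"
  shows "absmom M q (\<lambda>\<omega>. MAX k\<in>{..n}. \<bar>X k \<omega>\<bar>)
    \<le> ennreal (4 ^ (2 * q)) * absmom M q (\<lambda>\<omega>. \<bar>X n \<omega>\<bar> + (\<Sum>i<n. \<bar>d i \<omega>\<bar>))"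
proof -
  define r where "r = 2 * q - 2"
  have r: "2 * q = r + 2" using q by (simp add: r_def)
  define A where "A k \<omega> = (MAX j\<in>{..k}. \<bar>X j \<omega>\<bar>)" for k \<omega>
  define D where "D \<omega> = \<bar>X n \<omega>\<bar> + (\<Sum>i<n. \<bar>d i \<omega>\<bar>)" for \<omega>
  have A0: "0 \<le> A k \<omega>" for k \<omega> unfolding A_def by (rule Max_ge_iff[THEN iffD2]) auto
  have D0: "0 \<le> D \<omega>" for \<omega> unfolding D_def by (simp add: sum_nonneg)
  have Amono: "A k \<omega> \<le> A n \<omega>" if "k \<le> n" for k \<omega>
    unfolding A_def by (rule Max_mono) (use that in auto)
  have Ameas: "A k \<in> borel_measurable (G k)" if "k \<le> n" for k
  proof -
    have "X j \<in> borel_measurable (G k)" if "j \<le> k" for j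
      using X(1)[of j] sub(2)[OF that] that \<open>k \<le> n\<close> by (auto intro: measurable_from_subalg)
    then show ?thesis unfolding A_def[abs_def] by (intro borel_measurable_Max) auto
  qed
  have Amom: "all_moments M (A k)" if "k \<le> n" for k
  proof (rule all_moments_dominated)
    show "all_moments M (\<lambda>\<omega>. \<Sum>j\<le>k. \<bar>X j \<omega>\<bar>)" using X(2) that by (intro all_moments_sum all_moments_abs) auto
    show "A k \<in> borel_measurable M" using Ameas[OF that] sub(1) by (rule measurable_from_subalg[rotated])
    show "norm (A k \<omega>) \<le> norm (\<Sum>j\<le>k. \<bar>X j \<omega>\<bar>)" for \<omega>
      using Max_abs_le_sum[of "\<lambda>j. X j \<omega>" k] unfolding A_def by simp
  qed
  have Dmom: "all_moments M D" unfolding D_def[abs_def]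
    using X(2) d by (intro all_moments_add all_moments_sum all_moments_abs) auto
  define c where "c i \<omega> = A i \<omega> ^ (r + 1) * sgn (X i \<omega>)" for i \<omega>
  have cmeas: "c i \<in> borel_measurable (G i)" if "i < n" for i
  proof -
    have [measurable]: "A i \<in> borel_measurable (G i)" "X i \<in> borel_measurable (G i)"
      using Ameas[of i] X(1)[of i] that by auto
    show ?thesis unfolding c_def[abs_def] sgn_real_def by measurable
  qed
  have cmom: "all_moments M (c i)" if "i < n" for i
  proof (rule all_moments_dominated[OF all_moments_power[OF Amom, of i "r + 1"]])
    show "i \<le> n" using that by simp
    show "c i \<in> borel_measurable M" using cmeas[OF that] sub(1) by (rule measurable_from_subalg[rotated])
    show "norm (c i \<omega>) \<le> norm (A i \<omega> ^ (r + 1))" for \<omega>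
      using A0[of i \<omega>] by (auto simp: c_def abs_mult abs_sgn_eq)
  qed
  \<comment> \<open>\<open>c i\<close> is the predictable integrand \<open>A\<^sub>i\<^sup>r\<^sup>+\<^sup>1 sgn X\<^sub>i\<close>; its integral against \<open>m\<close> disappears in expectation.\<close>
  have path: "A n \<omega> ^ (r + 2) / 4 + (\<Sum>i<n. c i \<omega> * m i \<omega>) \<le> 4 ^ (r + 1) * D \<omega> ^ (r + 2)" for \<omega>
  proof -
    have inc: "c i \<omega> * m i \<omega> - A n \<omega> ^ (r + 1) * \<bar>d i \<omega>\<bar> \<le> A i \<omega> ^ (r + 1) * (\<bar>X (Suc i) \<omega>\<bar> - \<bar>X i \<omega>\<bar>)" if "i < n" for i
    proof -
      have 1: "sgn (X i \<omega>) * m i \<omega> - \<bar>d i \<omega>\<bar> \<le> \<bar>X (Suc i) \<omega>\<bar> - \<bar>X i \<omega>\<bar>"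
        using step[OF that, of \<omega>] by (auto simp: sgn_if)
      have "c i \<omega> * m i \<omega> - A n \<omega> ^ (r + 1) * \<bar>d i \<omega>\<bar> \<le> c i \<omega> * m i \<omega> - A i \<omega> ^ (r + 1) * \<bar>d i \<omega>\<bar>"
        using Amono[of i \<omega>] A0[of i \<omega>] that by (intro diff_left_mono mult_right_mono power_mono) auto
      also have "\<dots> = A i \<omega> ^ (r + 1) * (sgn (X i \<omega>) * m i \<omega> - \<bar>d i \<omega>\<bar>)" by (simp add: c_def algebra_simps)
      also have "\<dots> \<le> A i \<omega> ^ (r + 1) * (\<bar>X (Suc i) \<omega>\<bar> - \<bar>X i \<omega>\<bar>)"
        using 1 A0[of i \<omega>] by (intro mult_left_mono) auto
      finally show ?thesis .
    qed
    have "A n \<omega> ^ (r + 2) / 2 + (\<Sum>i<n. A i \<omega> ^ (r + 1) * (\<bar>X (Suc i) \<omega>\<bar> - \<bar>X i \<omega>\<bar>)) \<le> A n \<omega> ^ (r + 1) * \<bar>X n \<omega>\<bar>"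
      using doob_pathwise[of "\<lambda>k. \<bar>X k \<omega>\<bar>" n r] X0 unfolding A_def by simp
    moreover have "(\<Sum>i<n. c i \<omega> * m i \<omega> - A n \<omega> ^ (r + 1) * \<bar>d i \<omega>\<bar>) \<le> (\<Sum>i<n. A i \<omega> ^ (r + 1) * (\<bar>X (Suc i) \<omega>\<bar> - \<bar>X i \<omega>\<bar>))"
      using inc by (intro sum_mono) auto
    ultimately have "A n \<omega> ^ (r + 2) / 2 + (\<Sum>i<n. c i \<omega> * m i \<omega>) \<le> A n \<omega> ^ (r + 1) * D \<omega>"
      unfolding D_def by (simp add: sum_subtractf sum_distrib_left distrib_left)
    then show ?thesis using power_mult_le_split[OF A0 D0, of n \<omega> r \<omega>] by simp
  qed
  have intA: "integrable M (\<lambda>\<omega>. A n \<omega> ^ (r + 2))" and intD: "integrable M (\<lambda>\<omega>. D \<omega> ^ (r + 2))"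
    by (intro all_moments_integrable all_moments_power Amom Dmom finite_measure_axioms order_refl)+
  have intc: "integrable M (\<lambda>\<omega>. c i \<omega> * m i \<omega>)" if "i < n" for i
    using cmom[OF that] m(1)[OF that] by (intro all_moments_integrable all_moments_mult finite_measure_axioms)
  have "(\<integral>\<omega>. A n \<omega> ^ (r + 2) / 4 + (\<Sum>i<n. c i \<omega> * m i \<omega>) \<partial>M) \<le> (\<integral>\<omega>. 4 ^ (r + 1) * D \<omega> ^ (r + 2) \<partial>M)"
    using intc by (intro integral_mono path Bochner_Integration.integrable_add Bochner_Integration.integrable_sum
      integrable_mult_right intD integrable_divide intA) auto
  also have "(\<integral>\<omega>. A n \<omega> ^ (r + 2) / 4 + (\<Sum>i<n. c i \<omega> * m i \<omega>) \<partial>M) = (\<integral>\<omega>. A n \<omega> ^ (r + 2) \<partial>M) / 4"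
    using intA intc m(2)[OF _ cmeas cmom] by (subst Bochner_Integration.integral_add) auto
  finally have "(\<integral>\<omega>. A n \<omega> ^ (2 * q) \<partial>M) \<le> 4 ^ (2 * q) * (\<integral>\<omega>. D \<omega> ^ (2 * q) \<partial>M)" unfolding r by simp
  then have "absmom M q (A n) \<le> ennreal (4 ^ (2 * q) * (\<integral>\<omega>. D \<omega> ^ (2 * q) \<partial>M))"
    using absmom_eq_integral(1)[OF Amom, of n q] by (auto simp: power_even_abs intro!: ennreal_leI)
  also have "\<dots> = ennreal (4 ^ (2 * q)) * absmom M q D"
    using absmom_eq_integral(1)[OF Dmom, of q] by (simp add: ennreal_mult power_even_abs)
  finally show ?thesis unfolding A_def D_def .
qed

section \<open>A discrete Gronwall inequality for moments\<close>

lemma one_plus_power_le: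
  fixes h H :: real
  assumes "0 \<le> h" "h \<le> H"
  shows "(1 + h) ^ n \<le> 1 + (real n * (1 + H) ^ n) * h"
proof -
  have eq: "(1 + h) ^ n - 1 = h * (\<Sum>i<n. (1 + h) ^ i)"
    using power_diff_1_eq[of "1 + h" n] by simp
  have "(\<Sum>i<n. (1 + h) ^ i) \<le> (\<Sum>i<n. (1 + H) ^ n)"
  proof (rule sum_mono)
    fix i assume "i \<in> {..<n}"
    have "(1 + h) ^ i \<le> (1 + H) ^ i" using assms by (intro power_mono) auto
    also have "\<dots> \<le> (1 + H) ^ n" using assms \<open>i \<in> _\<close> by (intro power_increasing) auto
    finally show "(1 + h) ^ i \<le> (1 + H) ^ n" .
  qed
  from mult_left_mono[OF this assms(1)] have "(1 + h) ^ n - 1 \<le> h * (real n * (1 + H) ^ n)"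
    unfolding eq by simp
  then show ?thesis by (simp add: algebra_simps)
qed

text \<open>
  In the binomial expansion only the terms of degree 0 and 1 in \<open>m\<close> need exact coefficients: the first will
  be the growth factor, the second has expectation zero. Every other term lies between the
  terms of degree \<open>2\<close> and \<open>2q\<close>.
\<close>

lemma binomial_tail_bound:
  fixes u m :: real
  assumes "q \<ge> 1"
  shows "(u + m) ^ (2 * q) \<le> u ^ (2 * q) + real (2 * q) * (u ^ (2 * q - 1) * m)
      + 4 ^ q * (u ^ (2 * q - 2) * m\<^sup>2 + m ^ (2 * q))"
proof -
  obtain r where r: "2 * q = Suc (Suc r)" using assms by (cases q) auto
  have e: "even r" using r by presburger
  have trm: "real (2 * q choose k) * m ^ k * u ^ (2 * q - k) \<le> real (2 * q choose k) * (u ^ r * m\<^sup>2 + m ^ (2 * q))"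
    if "k \<in> {2..2 * q}" for k
  proof -
    define j l where "j = k - 2" and "l = 2 * q - k"
    have j: "k = 2 + j" and l: "2 * q = 2 + j + l" using that by (auto simp: j_def l_def)
    have jl: "2 * q - k = l" "r = j + l" using j l r by auto
    have nn: "0 \<le> m ^ (2 * q)" "0 \<le> u ^ r * m\<^sup>2" using e by (simp_all add: zero_le_even_power)
    have "m ^ k * u ^ (2 * q - k) \<le> \<bar>m\<bar> ^ k * \<bar>u\<bar> ^ (2 * q - k)"
      by (metis abs_ge_self abs_mult power_abs)
    also have "\<dots> \<le> u ^ r * m\<^sup>2 + m ^ (2 * q)"
    proof (cases "\<bar>m\<bar> \<le> \<bar>u\<bar>")
      case True
      have "\<bar>m\<bar> ^ k * \<bar>u\<bar> ^ (2 * q - k) = \<bar>m\<bar> ^ 2 * \<bar>m\<bar> ^ (k - 2) * \<bar>u\<bar> ^ (2 * q - k)"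
        unfolding jl(1) unfolding j by (simp add: power_add power2_eq_square)
      also have "\<dots> \<le> \<bar>m\<bar> ^ 2 * \<bar>u\<bar> ^ (k - 2) * \<bar>u\<bar> ^ (2 * q - k)"
        using True by (intro mult_right_mono mult_left_mono power_mono) auto
      also have "\<dots> = m\<^sup>2 * \<bar>u\<bar> ^ r" unfolding jl unfolding j by (simp add: power_add)
      also have "\<bar>u\<bar> ^ r = u ^ r" using e by (simp add: power_even_abs)
      finally show ?thesis using nn mult.commute[of "m\<^sup>2" "u ^ r"] by linarith
    next
      case False
      have "\<bar>m\<bar> ^ k * \<bar>u\<bar> ^ (2 * q - k) \<le> \<bar>m\<bar> ^ k * \<bar>m\<bar> ^ (2 * q - k)"
        using False by (intro mult_left_mono power_mono) auto
      also have "\<dots> = \<bar>m\<bar> ^ (2 * q)" unfolding jl j l by (simp add: power_add)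
      also have "\<dots> = m ^ (2 * q)" by (simp add: power_even_abs)
      finally show ?thesis using nn by simp
    qed
    finally have "m ^ k * u ^ (2 * q - k) \<le> u ^ r * m\<^sup>2 + m ^ (2 * q)" .
    from mult_left_mono[OF this, of "real (2 * q choose k)"] show ?thesis by (simp only: mult.assoc of_nat_0_le_iff)
  qed
  have "(u + m) ^ (2 * q) = (\<Sum>k\<le>2 * q. real (2 * q choose k) * m ^ k * u ^ (2 * q - k))"
    by (subst add.commute, subst binomial_ring) simp
  also have "{..2 * q} = {0, 1} \<union> {2..2 * q}" using assms by auto
  also have "(\<Sum>k\<in>{0, 1} \<union> {2..2 * q}. real (2 * q choose k) * m ^ k * u ^ (2 * q - k))
     = u ^ (2 * q) + real (2 * q) * (u ^ (2 * q - 1) * m) + (\<Sum>k\<in>{2..2 * q}. real (2 * q choose k) * m ^ k * u ^ (2 * q - k))"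
    by (subst sum.union_disjoint) (auto simp: mult_ac)
  also have "(\<Sum>k\<in>{2..2 * q}. real (2 * q choose k) * m ^ k * u ^ (2 * q - k))
     \<le> (\<Sum>k\<in>{2..2 * q}. real (2 * q choose k) * (u ^ r * m\<^sup>2 + m ^ (2 * q)))"
    by (intro sum_mono trm)
  also have "\<dots> = real (\<Sum>k\<in>{2..2 * q}. 2 * q choose k) * (u ^ r * m\<^sup>2 + m ^ (2 * q))"
    by (simp add: sum_distrib_right)
  also have "\<dots> \<le> 4 ^ q * (u ^ r * m\<^sup>2 + m ^ (2 * q))"
  proof (intro mult_right_mono)
    have "(\<Sum>k\<in>{2..2 * q}. 2 * q choose k) \<le> (\<Sum>k\<le>2 * q. 2 * q choose k)" by (intro sum_mono2) auto
    also have "\<dots> = 4 ^ q" by (simp add: choose_row_sum power_mult)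
    finally show "real (\<Sum>k\<in>{2..2 * q}. 2 * q choose k) \<le> 4 ^ q" by (metis of_nat_le_iff of_nat_numeral of_nat_power)
    show "0 \<le> u ^ r * m\<^sup>2 + m ^ (2 * q)" using e by (simp add: zero_le_even_power)
  qed
  finally show ?thesis using r by simp
qed

text \<open>
  The factor \<open>h\<close> on the power of \<open>u\<close> makes that term harmless in a Gronwall argument; the price
  \<open>h\<^sup>1\<^sup>-\<^sup>q\<close> on the power of \<open>m\<close> is affordable because martingale increments \<open>m\<close> of order 1 have moment \<open>h\<^sup>q\<close>.
\<close>

lemma young_step:
  fixes u m h :: real
  assumes "q \<ge> 1" "h > 0"
  shows "u ^ (2 * q - 2) * m\<^sup>2 \<le> h * u ^ (2 * q) + m ^ (2 * q) / h ^ (q - 1)"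
proof -
  obtain r where r: "q = Suc r" using assms by (cases q) auto
  have "(u\<^sup>2) ^ r * m\<^sup>2 \<le> h * (u\<^sup>2) ^ Suc r + (m\<^sup>2) ^ Suc r / h ^ r"
  proof (cases "m\<^sup>2 \<le> h * u\<^sup>2")
    case True
    have "(u\<^sup>2) ^ r * m\<^sup>2 \<le> (u\<^sup>2) ^ r * (h * u\<^sup>2)" using True by (intro mult_left_mono) auto
    also have "\<dots> = h * (u\<^sup>2) ^ Suc r" by simp
    finally show ?thesis using assms by (simp add: add_increasing2)
  next
    case False
    then have "u\<^sup>2 \<le> m\<^sup>2 / h" using assms by (simp add: field_simps)
    then have "(u\<^sup>2) ^ r * m\<^sup>2 \<le> (m\<^sup>2 / h) ^ r * m\<^sup>2" by (intro mult_right_mono power_mono) auto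
    also have "\<dots> = (m\<^sup>2) ^ Suc r / h ^ r" by (simp add: power_divide)
    finally show ?thesis using assms by (simp add: add_increasing)
  qed
  moreover have "u ^ (2 * q - 2) = (u\<^sup>2) ^ r" by (simp add: r power_mult)
  ultimately show ?thesis by (simp only: r power_mult diff_Suc_1)
qed

text \<open>
  Convexity, applied to \<open>x + d\<close> as the average of \<open>(1 + h) x\<close> and \<open>(1 + h) d / h\<close> with weights
  \<open>1 / (1 + h)\<close> and \<open>h / (1 + h)\<close>.
\<close>

lemma power_add_le_weighted:
  fixes x d h :: real
  assumes "h > 0" "q \<ge> 1"
  shows "(x + d) ^ (2 * q) \<le> (1 + h) ^ (2 * q - 1) * x ^ (2 * q) + (1 + h) ^ (2 * q - 1) * (d ^ (2 * q) / h ^ (2 * q - 1))"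
proof -
  obtain r where r: "2 * q = Suc r" using assms by (cases q) auto
  have "convex_on UNIV (\<lambda>x::real. x ^ (2 * q))"
    by (intro convex_power_even) simp
  then have "((1 - h / (1 + h)) *\<^sub>R ((1 + h) * x) + (h / (1 + h)) *\<^sub>R ((1 + h) * d / h)) ^ (2 * q)
    \<le> (1 - h / (1 + h)) * ((1 + h) * x) ^ (2 * q) + (h / (1 + h)) * ((1 + h) * d / h) ^ (2 * q)"
    using assms by (intro convex_onD) auto
  also have w: "1 - h / (1 + h) = 1 / (1 + h)" using assms by (simp add: field_simps)
  also have "(1 / (1 + h)) *\<^sub>R ((1 + h) * x) + (h / (1 + h)) *\<^sub>R ((1 + h) * d / h) = x + d"
    using assms by simp
  also have "(1 / (1 + h)) * ((1 + h) * x) ^ (2 * q) = (1 + h) ^ r * x ^ (2 * q)"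
    using assms by (simp add: r power_mult_distrib)
  also have "(h / (1 + h)) * ((1 + h) * d / h) ^ (2 * q) = (1 + h) ^ r * (d ^ (2 * q) / h ^ r)"
    using assms by (simp add: r power_mult_distrib power_divide)
  finally show ?thesis by (simp add: r)
qed

text \<open>
  If \<open>m\<close> and \<open>d\<close> have moments of size \<open>h\<^sup>q\<close> and \<open>h\<^sup>2\<^sup>q\<close>, relative to those of \<open>u\<close>, then the right-hand side is
  \<open>1 + O(h)\<close> times the moment of \<open>u\<close>. The term of \<open>(u + m)\<^sup>2\<^sup>q\<close> that is linear in \<open>m\<close> would be too large, and
  vanishes by orthogonality.
\<close>

lemma (in prob_space) one_step_growth:
  assumes "q \<ge> 1" "H > 0"
  shows "\<exists>K>0. \<forall>h u m d. 0 < h \<longrightarrow> h \<le> H \<longrightarrow> all_moments M u \<longrightarrow> all_moments M m \<longrightarrow> all_moments M d \<longrightarrow>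
     (\<integral>\<omega>. u \<omega> ^ (2 * q - 1) * m \<omega> \<partial>M) = (0::real) \<longrightarrow>
     (\<integral>\<omega>. (u \<omega> + m \<omega> + d \<omega>) ^ (2 * q) \<partial>M) \<le> (1 + K * h) * (\<integral>\<omega>. u \<omega> ^ (2 * q) \<partial>M)
        + K * ((\<integral>\<omega>. m \<omega> ^ (2 * q) \<partial>M) / h ^ (q - 1)) + K * ((\<integral>\<omega>. d \<omega> ^ (2 * q) \<partial>M) / h ^ (2 * q - 1))"
proof -
  define R where "R = (1 + H) ^ (2 * q - 1)"
  define K0 where "K0 = real (2 * q - 1) * R"
  define K1 where "K1 = (4::real) ^ q * (1 + H ^ (q - 1))"
  define K where "K = K0 + R * (4 ^ q + K1 + 1)"
  have pos: "R > 0" "K0 \<ge> 0" "K1 > 0" using assms by (auto simp: R_def K0_def K1_def intro!: mult_pos_pos add_pos_nonneg)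
  have Kpos: "K > 0" unfolding K_def using pos by (intro add_nonneg_pos mult_pos_pos add_pos_pos) auto
  show ?thesis
  proof (intro exI[of _ K] conjI Kpos allI impI)
    fix h :: real and u m d :: "'a \<Rightarrow> real"
    assume h: "0 < h" "h \<le> H" and mom: "all_moments M u" "all_moments M m" "all_moments M d"
      and zero: "(\<integral>\<omega>. u \<omega> ^ (2 * q - 1) * m \<omega> \<partial>M) = 0"
    define w where "w = (1 + h) ^ (2 * q - 1)"
    have w: "1 \<le> w" "w \<le> R" "w \<le> 1 + K0 * h"
      using h one_plus_power_le[of h H "2 * q - 1"]
      by (auto simp: w_def R_def K0_def intro!: power_mono one_le_power)
    have int: "integrable M (\<lambda>\<omega>. u \<omega> ^ (2*q))" "integrable M (\<lambda>\<omega>. m \<omega> ^ (2*q))" "integrable M (\<lambda>\<omega>. d \<omega> ^ (2*q))"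
      "integrable M (\<lambda>\<omega>. u \<omega> ^ (2 * q - 1) * m \<omega>)" "integrable M (\<lambda>\<omega>. (u \<omega> + m \<omega> + d \<omega>) ^ (2 * q))"
      using mom by (auto intro!: all_moments_integrable all_moments_power all_moments_mult all_moments_add finite_measure_axioms)
    define U V W where "U = (\<integral>\<omega>. u \<omega> ^ (2 * q) \<partial>M)" and "V = (\<integral>\<omega>. m \<omega> ^ (2 * q) \<partial>M)" and "W = (\<integral>\<omega>. d \<omega> ^ (2 * q) \<partial>M)"
    have nn: "0 \<le> U" "0 \<le> V" "0 \<le> W" unfolding U_def V_def W_def by (auto intro!: integral_nonneg zero_le_even_power)
    have point: "(u \<omega> + m \<omega> + d \<omega>) ^ (2 * q) \<le> w * ((1 + 4 ^ q * h) * u \<omega> ^ (2 * q) + real (2 * q) * (u \<omega> ^ (2 * q - 1) * m \<omega>)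
        + K1 / h ^ (q - 1) * m \<omega> ^ (2 * q)) + w / h ^ (2 * q - 1) * d \<omega> ^ (2 * q)" for \<omega>
    proof -
      have "m \<omega> ^ (2 * q) = h ^ (q - 1) * (m \<omega> ^ (2 * q) / h ^ (q - 1))" using h by simp
      also have "\<dots> \<le> H ^ (q - 1) * (m \<omega> ^ (2 * q) / h ^ (q - 1))"
        using h by (intro mult_right_mono power_mono divide_nonneg_pos) (auto simp: zero_le_even_power)
      finally have m1: "m \<omega> ^ (2 * q) \<le> H ^ (q - 1) * (m \<omega> ^ (2 * q) / h ^ (q - 1))" .
      have "(u \<omega> + m \<omega>) ^ (2 * q) \<le> u \<omega> ^ (2 * q) + real (2 * q) * (u \<omega> ^ (2 * q - 1) * m \<omega>)
         + 4 ^ q * (u \<omega> ^ (2 * q - 2) * (m \<omega>)\<^sup>2 + m \<omega> ^ (2 * q))" by (rule binomial_tail_bound) fact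
      also have "\<dots> \<le> u \<omega> ^ (2 * q) + real (2 * q) * (u \<omega> ^ (2 * q - 1) * m \<omega>)
         + 4 ^ q * ((h * u \<omega> ^ (2 * q) + m \<omega> ^ (2 * q) / h ^ (q - 1)) + H ^ (q - 1) * (m \<omega> ^ (2 * q) / h ^ (q - 1)))"
        using young_step[OF assms(1) h(1), of "u \<omega>" "m \<omega>"] m1 by (intro add_left_mono mult_left_mono add_mono) auto
      also have "\<dots> = (1 + 4 ^ q * h) * u \<omega> ^ (2 * q) + real (2 * q) * (u \<omega> ^ (2 * q - 1) * m \<omega>)
        + K1 / h ^ (q - 1) * m \<omega> ^ (2 * q)" unfolding K1_def by (simp add: algebra_simps add_divide_distrib)
      finally have 1: "(u \<omega> + m \<omega>) ^ (2 * q) \<le> \<dots>" .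
      have "(u \<omega> + m \<omega> + d \<omega>) ^ (2 * q) \<le> w * (u \<omega> + m \<omega>) ^ (2 * q) + w * (d \<omega> ^ (2 * q) / h ^ (2 * q - 1))"
        unfolding w_def by (rule power_add_le_weighted) (use h assms in auto)
      also have "\<dots> \<le> w * ((1 + 4 ^ q * h) * u \<omega> ^ (2 * q) + real (2 * q) * (u \<omega> ^ (2 * q - 1) * m \<omega>)
        + K1 / h ^ (q - 1) * m \<omega> ^ (2 * q)) + w * (d \<omega> ^ (2 * q) / h ^ (2 * q - 1))"
        using 1 w(1) by (intro add_mono mult_left_mono) auto
      finally show ?thesis by simp
    qed
    have "(\<integral>\<omega>. (u \<omega> + m \<omega> + d \<omega>) ^ (2 * q) \<partial>M) \<le> (\<integral>\<omega>. w * ((1 + 4 ^ q * h) * u \<omega> ^ (2 * q) + real (2 * q) * (u \<omega> ^ (2 * q - 1) * m \<omega>)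
        + K1 / h ^ (q - 1) * m \<omega> ^ (2 * q)) + w / h ^ (2 * q - 1) * d \<omega> ^ (2 * q) \<partial>M)"
      by (intro integral_mono point Bochner_Integration.integrable_add integrable_mult_right int)
    also have "\<dots> = w * ((1 + 4 ^ q * h) * U + K1 / h ^ (q - 1) * V) + w / h ^ (2 * q - 1) * W"
    proof -
      note hb = has_bochner_integral_integrable[OF int(1), folded U_def] has_bochner_integral_integrable[OF int(2), folded V_def]
        has_bochner_integral_integrable[OF int(3), folded W_def] has_bochner_integral_integrable[OF int(4), unfolded zero]
      have "has_bochner_integral M (\<lambda>\<omega>. w * ((1 + 4 ^ q * h) * u \<omega> ^ (2 * q) + real (2 * q) * (u \<omega> ^ (2 * q - 1) * m \<omega>)
        + K1 / h ^ (q - 1) * m \<omega> ^ (2 * q)) + w / h ^ (2 * q - 1) * d \<omega> ^ (2 * q))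
        (w * ((1 + 4 ^ q * h) * U + real (2 * q) * 0 + K1 / h ^ (q - 1) * V) + w / h ^ (2 * q - 1) * W)"
        by (intro has_bochner_integral_add has_bochner_integral_mult_right hb)
      then show ?thesis by (simp add: has_bochner_integral_integral_eq)
    qed
    also have "\<dots> \<le> (1 + K * h) * U + K * (V / h ^ (q - 1)) + K * (W / h ^ (2 * q - 1))"
    proof -
      have "w * (1 + 4 ^ q * h) = w + w * 4 ^ q * h" by (simp add: algebra_simps)
      also have "\<dots> \<le> (1 + K0 * h) + R * 4 ^ q * h" using w h pos by (intro add_mono mult_right_mono) auto
      also have "\<dots> \<le> 1 + K * h" using pos h unfolding K_def by (simp add: algebra_simps)
      finally have a: "w * (1 + 4 ^ q * h) * U \<le> (1 + K * h) * U" using nn by (intro mult_right_mono)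
      have "w * K1 \<le> R * K1" using w pos by (intro mult_right_mono) auto
      also have "\<dots> \<le> K" unfolding K_def using pos by (simp add: algebra_simps)
      finally have b: "w * K1 * (V / h ^ (q - 1)) \<le> K * (V / h ^ (q - 1))" using nn h by (intro mult_right_mono) auto
      have "0 \<le> R * 4 ^ q" "0 \<le> R * K1" using pos by simp_all
      then have "w \<le> K" unfolding K_def distrib_left using w pos by linarith
      then have c: "w * (W / h ^ (2 * q - 1)) \<le> K * (W / h ^ (2 * q - 1))" using nn h by (intro mult_right_mono) auto
      show ?thesis using a b c by (simp add: algebra_simps)
    qed
    finally show "(\<integral>\<omega>. (u \<omega> + m \<omega> + d \<omega>) ^ (2 * q) \<partial>M) \<le> (1 + K * h) * (\<integral>\<omega>. u \<omega> ^ (2 * q) \<partial>M)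
        + K * ((\<integral>\<omega>. m \<omega> ^ (2 * q) \<partial>M) / h ^ (q - 1)) + K * ((\<integral>\<omega>. d \<omega> ^ (2 * q) \<partial>M) / h ^ (2 * q - 1))"
      unfolding U_def V_def W_def .
  qed
qed

lemma norm_power_le_Basis:
  fixes x :: "'b::euclidean_space"
  shows "norm x ^ n \<le> real DIM('b) ^ n * (\<Sum>e\<in>Basis. \<bar>x \<bullet> e\<bar> ^ n)"
proof -
  define B where "B = (MAX e\<in>Basis. \<bar>x \<bullet> e\<bar>)"
  have B: "\<bar>x \<bullet> e\<bar> \<le> B" if "e \<in> Basis" for e unfolding B_def using that by (intro Max_ge) auto
  have "norm x \<le> (\<Sum>e\<in>Basis. \<bar>x \<bullet> e\<bar>)" by (rule norm_le_l1)
  also have "\<dots> \<le> (\<Sum>e\<in>(Basis::'b set). B)" by (intro sum_mono B)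
  finally have "norm x ^ n \<le> (real DIM('b) * B) ^ n" by (intro power_mono) auto
  also have "\<dots> = real DIM('b) ^ n * B ^ n" by (rule power_mult_distrib)
  also have "B ^ n \<le> (\<Sum>e\<in>Basis. \<bar>x \<bullet> e\<bar> ^ n)"
  proof -
    have "B \<in> (\<lambda>e. \<bar>x \<bullet> e\<bar>) ` Basis" unfolding B_def by (intro Max_in) auto
    then show ?thesis by (auto intro!: member_le_sum[where f="\<lambda>e. \<bar>x \<bullet> e\<bar> ^ n"])
  qed
  finally show ?thesis by (simp add: mult_left_mono)
qed

lemma sum_power_le_card:
  fixes a :: "'c \<Rightarrow> real"
  assumes "finite A" "q \<ge> 1"
  shows "(\<Sum>i\<in>A. a i) ^ (2 * q) \<le> real (card A) ^ (2 * q - 1) * (\<Sum>i\<in>A. a i ^ (2 * q))"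
proof (cases "A = {}")
  case True then show ?thesis using assms by (simp add: zero_power)
next
  case False
  define N where "N = real (card A)"
  have N: "N > 0" using False assms by (simp add: N_def card_gt_0_iff)
  have "(\<Sum>i\<in>A. (1 / N) *\<^sub>R a i) ^ (2 * q) \<le> (\<Sum>i\<in>A. (1 / N) * a i ^ (2 * q))"
    using convex_on_sum[OF assms(1) False convex_power_even[of "2 * q"], of "\<lambda>_. 1 / N" a] N
    by (simp add: N_def)
  also have "(\<Sum>i\<in>A. (1 / N) *\<^sub>R a i) = (\<Sum>i\<in>A. a i) / N" by (simp add: sum_divide_distrib)
  also have "(\<Sum>i\<in>A. (1 / N) * a i ^ (2 * q)) = (\<Sum>i\<in>A. a i ^ (2 * q)) / N" by (simp add: sum_divide_distrib)
  finally have "(\<Sum>i\<in>A. a i) ^ (2 * q) \<le> N ^ (2 * q) * ((\<Sum>i\<in>A. a i ^ (2 * q)) / N)"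
    using N by (simp add: power_divide field_simps)
  also have "N ^ (2 * q) = N ^ (2 * q - 1) * N" using assms(2) by (cases "2 * q") auto
  finally show ?thesis using N by (simp add: N_def)
qed

lemma absmom_sum_le:
  fixes f :: "nat \<Rightarrow> 'a \<Rightarrow> real"
  assumes "\<And>i. i < n \<Longrightarrow> f i \<in> borel_measurable M" "q \<ge> 1"
    and "\<And>i. i < n \<Longrightarrow> absmom M q (f i) \<le> B"
  shows "absmom M q (\<lambda>\<omega>. \<Sum>i<n. \<bar>f i \<omega>\<bar>) \<le> ennreal (real n ^ (2 * q)) * B"
proof -
  have p: "norm (\<Sum>i<n. \<bar>f i \<omega>\<bar>) ^ (2 * q) \<le> real n ^ (2 * q - 1) * (\<Sum>i<n. norm (f i \<omega>) ^ (2 * q))" for \<omega>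
    using sum_power_le_card[of "{..<n}" q "\<lambda>i. \<bar>f i \<omega>\<bar>"] assms(2) by (simp add: power_even_abs)
  have "absmom M q (\<lambda>\<omega>. \<Sum>i<n. \<bar>f i \<omega>\<bar>) \<le> (\<integral>\<^sup>+\<omega>. ennreal (real n ^ (2 * q - 1)) * (\<Sum>i<n. ennreal (norm (f i \<omega>) ^ (2 * q))) \<partial>M)"
    unfolding absmom_def
  proof (rule nn_integral_mono)
    fix \<omega>
    have "ennreal (norm (\<Sum>i<n. \<bar>f i \<omega>\<bar>) ^ (2 * q)) \<le> ennreal (real n ^ (2 * q - 1) * (\<Sum>i<n. norm (f i \<omega>) ^ (2 * q)))"
      by (rule ennreal_leI[OF p])
    also have "\<dots> = ennreal (real n ^ (2 * q - 1)) * (\<Sum>i<n. ennreal (norm (f i \<omega>) ^ (2 * q)))"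
      by (subst ennreal_mult) (auto intro!: sum_nonneg simp: sum_ennreal)
    finally show "ennreal (norm (\<Sum>i<n. \<bar>f i \<omega>\<bar>) ^ (2 * q)) \<le> \<dots>" .
  qed
  also have "\<dots> = ennreal (real n ^ (2 * q - 1)) * (\<Sum>i<n. absmom M q (f i))"
  proof -
    have [measurable]: "\<And>i. i \<in> {..<n} \<Longrightarrow> f i \<in> borel_measurable M" using assms(1) by simp
    have "(\<lambda>\<omega>. \<Sum>i<n. ennreal (norm (f i \<omega>) ^ (2 * q))) \<in> borel_measurable M"
      by (intro borel_measurable_sum) measurable
    then show ?thesis unfolding absmom_def by (subst nn_integral_cmult) (simp_all add: nn_integral_sum del: sum_ennreal)
  qed
  also have "\<dots> \<le> ennreal (real n ^ (2 * q - 1)) * (\<Sum>i<n. B)"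
    using assms(3) by (intro mult_left_mono sum_mono) auto
  also have "\<dots> = ennreal (real n ^ (2 * q - 1)) * (ennreal (real n) * B)" by (simp add: ennreal_of_nat_eq_real_of_nat)
  also have "\<dots> = ennreal (real n ^ (2 * q - 1) * real n) * B" by (simp add: ennreal_mult mult.assoc)
  also have "real n ^ (2 * q - 1) * real n = real n ^ (2 * q)" using assms(2) by (cases "2 * q") auto
  finally show ?thesis .
qed

context small_steps
begin

text \<open>
  Size \<open>h\<^sup>b\<^sup>/\<^sup>2 (E + h\<^sup>r\<^sup>/\<^sup>2)\<close>: noise of order \<open>b\<close> times a difference of coefficients that is controlled by the
  current error \<open>E\<close>, up to the order \<open>r\<close> that is to be proved for \<open>E\<close>.
\<close>

definition relative_order :: "nat \<Rightarrow> nat \<Rightarrow> ('i \<Rightarrow> 'a \<Rightarrow> 'b::euclidean_space) \<Rightarrow> ('i \<Rightarrow> 'a \<Rightarrow> 'c::euclidean_space) \<Rightarrow> bool" where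
  "relative_order r b E Z \<longleftrightarrow>
     moment_bound M I (\<lambda>q i. ennreal (h i ^ (b * q)) * (absmom M q (E i) + ennreal (h i ^ (r * q)))) Z"

lemma relative_order_of_order:
  assumes "of_order (r + b) Z" shows "relative_order r b E Z"
  unfolding relative_order_def
proof (rule moment_bound_mono[OF assms[unfolded of_order_def]])
  fix q
  have "ennreal (h i ^ ((r + b) * q)) \<le> ennreal 1 * (ennreal (h i ^ (b * q)) * (absmom M q (E i) + ennreal (h i ^ (r * q))))" if "i \<in> I" for i
  proof -
    have "ennreal (h i ^ ((r + b) * q)) = ennreal (h i ^ (b * q)) * ennreal (h i ^ (r * q))"
      using h_pos[OF that] by (simp add: ennreal_mult[symmetric] power_add[symmetric] algebra_simps)
    also have "\<dots> \<le> ennreal (h i ^ (b * q)) * (absmom M q (E i) + ennreal (h i ^ (r * q)))"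
      by (intro mult_left_mono) auto
    finally show ?thesis by simp
  qed
  then show "\<exists>K\<ge>0. \<forall>i\<in>I. ennreal (h i ^ ((r + b) * q)) \<le> ennreal K * (ennreal (h i ^ (b * q)) * (absmom M q (E i) + ennreal (h i ^ (r * q))))"
    by (intro exI[of _ 1]) auto
qed

lemma relative_order_indep_mult:
  fixes \<theta> :: "'i \<Rightarrow> 'a \<Rightarrow> real"
  assumes G: "\<And>i. i \<in> I \<Longrightarrow> subalgebra M (G i)" and H: "\<And>i. i \<in> I \<Longrightarrow> subalgebra M (H i)"
    and ind: "\<And>i. i \<in> I \<Longrightarrow> indep_set (sets (G i)) (sets (H i))"
    and t: "of_order b \<theta>" "\<And>i. i \<in> I \<Longrightarrow> \<theta> i \<in> borel_measurable (H i)"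
    and c: "\<And>i. i \<in> I \<Longrightarrow> c i \<in> borel_measurable (G i)"
    and E: "\<And>i. i \<in> I \<Longrightarrow> E i \<in> borel_measurable M"
    and le: "\<And>i \<omega>. i \<in> I \<Longrightarrow> \<omega> \<in> space M \<Longrightarrow> norm (c i \<omega>) \<le> K * norm (E i \<omega>)"
  shows "relative_order r b E (\<lambda>i \<omega>. \<theta> i \<omega> *\<^sub>R c i \<omega>)"
  unfolding relative_order_def moment_bound_def
proof (intro conjI ballI allI)
  show "(\<lambda>\<omega>. \<theta> i \<omega> *\<^sub>R c i \<omega>) \<in> borel_measurable M" if "i \<in> I" for i
    using measurable_from_subalg[OF G[OF that] c[OF that]] of_order_measurable[OF t(1) that] by measurable
  fix q
  obtain C where C: "C \<ge> 0" "\<And>i. i \<in> I \<Longrightarrow> absmom M q (\<theta> i) \<le> ennreal (C * h i ^ (b * q))"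
    using of_orderD[OF t(1), of q] by blast
  have "absmom M q (\<lambda>\<omega>. \<theta> i \<omega> *\<^sub>R c i \<omega>) \<le> ennreal (C * \<bar>K\<bar> ^ (2 * q)) * (ennreal (h i ^ (b * q)) * (absmom M q (E i) + ennreal (h i ^ (r * q))))" if i: "i \<in> I" for i
  proof -
    have "absmom M q (\<lambda>\<omega>. \<theta> i \<omega> *\<^sub>R c i \<omega>) = absmom M q (\<theta> i) * absmom M q (c i)"
      by (rule indep_set_absmom_mult[OF G[OF i] H[OF i] ind[OF i] t(2)[OF i] c[OF i]])
    also have "\<dots> \<le> ennreal (C * h i ^ (b * q)) * absmom M q (\<lambda>\<omega>. K *\<^sub>R E i \<omega>)"
    proof (intro mult_mono C(2)[OF i] absmom_mono)
      fix \<omega> assume "\<omega> \<in> space M"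
      then have "norm (c i \<omega>) \<le> K * norm (E i \<omega>)" using le[OF i] by blast
      also have "\<dots> \<le> \<bar>K\<bar> * norm (E i \<omega>)" by (intro mult_right_mono) auto
      finally show "norm (c i \<omega>) \<le> norm (K *\<^sub>R E i \<omega>)" by simp
    qed auto
    also have "absmom M q (\<lambda>\<omega>. K *\<^sub>R E i \<omega>) = ennreal (\<bar>K\<bar> ^ (2 * q)) * absmom M q (E i)"
      by (rule absmom_cmult[OF E[OF i]])
    also have "ennreal (C * h i ^ (b * q)) * (ennreal (\<bar>K\<bar> ^ (2 * q)) * absmom M q (E i))
      = ennreal (C * \<bar>K\<bar> ^ (2 * q)) * (ennreal (h i ^ (b * q)) * absmom M q (E i))"
      using C h_pos[OF i] by (simp add: ennreal_mult mult_ac)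
    also have "\<dots> \<le> ennreal (C * \<bar>K\<bar> ^ (2 * q)) * (ennreal (h i ^ (b * q)) * (absmom M q (E i) + ennreal (h i ^ (r * q))))"
      by (intro mult_left_mono) auto
    finally show ?thesis .
  qed
  then show "\<exists>C. \<forall>i\<in>I. absmom M q (\<lambda>\<omega>. \<theta> i \<omega> *\<^sub>R c i \<omega>) \<le> ennreal C * (ennreal (h i ^ (b * q)) * (absmom M q (E i) + ennreal (h i ^ (r * q))))"
    by blast
qed

lemma relative_order_zero: "relative_order r b E (\<lambda>i \<omega>. 0)"
  by (rule relative_order_of_order[OF of_order_zero])

lemma relative_order_add:
  "relative_order r b E Z \<Longrightarrow> relative_order r b E W \<Longrightarrow> relative_order r b E (\<lambda>i \<omega>. Z i \<omega> + W i \<omega>)"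
  unfolding relative_order_def by (rule moment_bound_add)

lemma relative_order_sum:
  "(\<And>x. x \<in> A \<Longrightarrow> relative_order r b E (Z x)) \<Longrightarrow> finite A \<Longrightarrow> relative_order r b E (\<lambda>i \<omega>. \<Sum>x\<in>A. Z x i \<omega>)"
  using relative_order_zero unfolding relative_order_def by (intro moment_bound_sum) auto

end

text \<open>
  The pair \<open>(n, k)\<close> stands for the step that starts at the grid point \<open>k\<close> of the grid with \<open>2\<^sup>n\<close> steps.
\<close>

abbreviation dyadic_steps :: "(nat \<times> nat) set" where
  "dyadic_steps \<equiv> {(n, k). k < 2 ^ n}"

text \<open>
  \<open>G (n, k)\<close> is the information available at the grid point \<open>k\<close> of level \<open>n\<close>; here \<open>k = 2\<^sup>n\<close>, the final time,
  occurs too, although no step starts there.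
\<close>

locale dyadic_filtration = prob_space M for M :: "'a measure" +
  fixes T :: real and G :: "nat \<times> nat \<Rightarrow> 'a measure"
  assumes T_pos: "T > 0"
    and G_sub: "subalgebra M (G i)"
    and G_mono: "j \<le> k \<Longrightarrow> subalgebra (G (n, k)) (G (n, j))"

sublocale dyadic_filtration \<subseteq> small_steps M "dyadic_steps" "\<lambda>i. T / 2 ^ fst i" T
proof
  fix i :: "nat \<times> nat" assume "i \<in> dyadic_steps"
  show "0 < T / 2 ^ fst i" using T_pos by simp
  have "T / 2 ^ fst i \<le> T / 1" using T_pos by (intro divide_left_mono) auto
  then show "T / 2 ^ fst i \<le> T" by simp
qed

context dyadic_filtration
begin

text \<open>
  By \<open>one_step_growth\<close>, applied to each coordinate, the quantity
  \<open>(\<Sum>e\<in>Basis. E (E\<^sub>k \<bullet> e)\<^sup>2\<^sup>q) + h\<^sup>r\<^sup>q\<close> is multiplied by at most \<open>1 + L h\<close> in each of the \<open>T / h\<close> steps, hence by at most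
  \<open>exp (L T)\<close> in total, and it starts at \<open>h\<^sup>r\<^sup>q\<close>. With this bound at each time the maximum over all times follows
  from \<open>doob_with_drift\<close>: the total drift consists of \<open>T / h\<close> terms of order \<open>r + 2\<close>, so it has order \<open>r\<close>.
\<close>

theorem stability:
  fixes E m d :: "nat \<times> nat \<Rightarrow> 'a \<Rightarrow> 'b::euclidean_space"
  assumes E0: "\<And>n \<omega>. E (n, 0) \<omega> = 0"
    and step: "\<And>n k \<omega>. k < 2 ^ n \<Longrightarrow> E (n, Suc k) \<omega> = E (n, k) \<omega> + m (n, k) \<omega> + d (n, k) \<omega>"
    and E: "\<And>n k. k \<le> 2 ^ n \<Longrightarrow> E (n, k) \<in> borel_measurable (G (n, k))"
    and cm: "centered G m"
    and m: "relative_order r 1 E m" and d: "relative_order r 2 E d"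
  shows stability_moments: "\<exists>C\<ge>0. \<forall>n. \<forall>k\<le>2 ^ n. absmom M q (E (n, k)) \<le> ennreal (C * (T / 2 ^ n) ^ (r * q))" (is ?A)
    and stability_max: "q \<ge> 1 \<Longrightarrow> \<exists>C\<ge>0. \<forall>n. (\<integral>\<^sup>+\<omega>. ennreal (MAX k\<in>{..2 ^ n}. norm (E (n, k) \<omega>) ^ (2 * q)) \<partial>M)
           \<le> ennreal (C * (T / 2 ^ n) ^ (r * q))"
proof -
  have EM: "E (n, k) \<in> borel_measurable M" if "k \<le> 2 ^ n" for n k
    using E[OF that] G_sub by (rule measurable_from_subalg[rotated])
  have rel_fin: "all_moments M (Z (n, k))" if Z: "relative_order r b E Z" "k < 2 ^ n" "all_moments M (E (n, k))"
    for Z :: "nat \<times> nat \<Rightarrow> 'a \<Rightarrow> 'b" and b n k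
    unfolding all_moments_def
  proof (intro conjI allI)
    have i: "(n, k) \<in> dyadic_steps" using that by simp
    show "Z (n, k) \<in> borel_measurable M" using moment_boundD1[OF Z(1)[unfolded relative_order_def] i] .
    fix q
    obtain C where "absmom M q (Z (n, k)) \<le> ennreal C * (ennreal ((T / 2 ^ fst (n,k)) ^ (b * q)) * (absmom M q (E (n, k)) + ennreal ((T / 2 ^ fst (n,k)) ^ (r * q))))"
      using moment_boundD2[OF Z(1)[unfolded relative_order_def], of q] i by (auto dest!: bspec)
    also have "\<dots> < \<infinity>" using Z(3) by (auto simp: all_moments_def ennreal_mult_less_top)
    finally show "absmom M q (Z (n, k)) < \<infinity>" .
  qed
  have Emom: "all_moments M (E (n, k))" if "k \<le> 2 ^ n" for n k
    using that
  proof (induction k)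
    case 0
    have "E (n, 0) = (\<lambda>_. 0)" by (auto simp: E0)
    then show ?case by (simp add: all_moments_const)
  next
    case (Suc k)
    then have k: "k < 2 ^ n" "all_moments M (E (n, k))" by auto
    have "E (n, Suc k) = (\<lambda>\<omega>. E (n, k) \<omega> + m (n, k) \<omega> + d (n, k) \<omega>)" using step[OF k(1)] by auto
    then show ?case using rel_fin[OF m k] rel_fin[OF d k] k by (auto intro!: all_moments_add)
  qed
  have mmom: "all_moments M (m (n, k))" and dmom: "all_moments M (d (n, k))" if "k < 2 ^ n" for n k
    using rel_fin[OF m that Emom] rel_fin[OF d that Emom] that by auto
  have inner_mom: "all_moments M (\<lambda>\<omega>. Z \<omega> \<bullet> e)" if "all_moments M Z" "e \<in> Basis" for Z :: "'a \<Rightarrow> 'b" and e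
    using that by (intro all_moments_dominated[OF that(1)]) (auto simp: Basis_le_norm all_moments_def)
  have orth: "(\<integral>\<omega>. c \<omega> * (m (n, k) \<omega> \<bullet> e) \<partial>M) = 0"
    if "k < 2 ^ n" "c \<in> borel_measurable (G (n, k))" "all_moments M c" "e \<in> Basis" for n k c e
  proof -
    have "(\<integral>\<omega>. c \<omega> * (m (n, k) \<omega> \<bullet> e) \<partial>M) = (\<integral>\<omega>. (c \<omega> *\<^sub>R m (n, k) \<omega>) \<bullet> e \<partial>M)" by simp
    also have "\<dots> = (\<integral>\<omega>. c \<omega> *\<^sub>R m (n, k) \<omega> \<partial>M) \<bullet> e"
      using moments_integrable[OF that(3) mmom[OF that(1)]] by (intro integral_inner_left)
    also have "\<dots> = 0" using cm that unfolding centered_def by auto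
    finally show ?thesis .
  qed
  have main: "\<exists>C\<ge>0. \<forall>n. \<forall>k\<le>2 ^ n. absmom M q (E (n, k)) \<le> ennreal (C * (T / 2 ^ n) ^ (r * q))" if q: "q \<ge> 1" for q
  proof -
    from one_step_growth[OF q T_pos] obtain K where K: "K > 0" and growth': "\<forall>h u m d. 0 < h \<longrightarrow> h \<le> T \<longrightarrow> all_moments M u \<longrightarrow> all_moments M m \<longrightarrow> all_moments M d \<longrightarrow>
       (\<integral>\<omega>. u \<omega> ^ (2 * q - 1) * m \<omega> \<partial>M) = (0::real) \<longrightarrow>
       (\<integral>\<omega>. (u \<omega> + m \<omega> + d \<omega>) ^ (2 * q) \<partial>M) \<le> (1 + K * h) * (\<integral>\<omega>. u \<omega> ^ (2 * q) \<partial>M)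
        + K * ((\<integral>\<omega>. m \<omega> ^ (2 * q) \<partial>M) / h ^ (q - 1)) + K * ((\<integral>\<omega>. d \<omega> ^ (2 * q) \<partial>M) / h ^ (2 * q - 1))"
      by (elim exE conjE)
    note growth = growth'[rule_format]
    define D where "D = real DIM('b) ^ (2 * q)"
    have D: "D \<ge> 1" unfolding D_def by (intro one_le_power) (simp add: Suc_leI)
    define v where "v n k = (\<Sum>e\<in>Basis. \<integral>\<omega>. (E (n, k) \<omega> \<bullet> e) ^ (2 * q) \<partial>M)" for n k
    have v0: "0 \<le> v n k" for n k unfolding v_def by (intro sum_nonneg integral_nonneg) (auto simp: zero_le_even_power)
    have Ev: "(\<integral>\<omega>. norm (E (n, k) \<omega>) ^ (2 * q) \<partial>M) \<le> D * v n k" if "k \<le> 2 ^ n" for n k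
    proof -
      have int: "integrable M (\<lambda>\<omega>. (E (n, k) \<omega> \<bullet> e) ^ (2 * q))" if "e \<in> Basis" for e
        using inner_mom[OF Emom[OF \<open>k \<le> 2 ^ n\<close>] that] by (intro all_moments_integrable all_moments_power finite_measure_axioms)
      have "norm (E (n, k) \<omega>) ^ (2 * q) \<le> D * (\<Sum>e\<in>Basis. (E (n, k) \<omega> \<bullet> e) ^ (2 * q))" for \<omega>
        using norm_power_le_Basis[of "E (n, k) \<omega>" "2 * q"] by (simp add: D_def power_even_abs)
      then have "(\<integral>\<omega>. norm (E (n, k) \<omega>) ^ (2 * q) \<partial>M) \<le> (\<integral>\<omega>. D * (\<Sum>e\<in>Basis. (E (n, k) \<omega> \<bullet> e) ^ (2 * q)) \<partial>M)"
        using int by (intro integral_mono absmom_eq_integral(2)[OF Emom[OF that]] integrable_mult_right Bochner_Integration.integrable_sum) auto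
      also have "\<dots> = D * v n k" unfolding v_def using int by (simp add: Bochner_Integration.integral_sum)
      finally show ?thesis .
    qed
    have rel: "\<exists>C\<ge>0. \<forall>n k e. k < 2 ^ n \<longrightarrow> e \<in> Basis \<longrightarrow> (\<integral>\<omega>. (Z (n, k) \<omega> \<bullet> e) ^ (2 * q) \<partial>M) \<le> C * ((T / 2 ^ n) ^ (b * q) * (v n k + (T / 2 ^ n) ^ (r * q)))"
      if Z: "relative_order r b E Z" for Z :: "nat \<times> nat \<Rightarrow> 'a \<Rightarrow> 'b" and b
    proof -
      obtain C where C: "C \<ge> 0" "\<And>i. i \<in> dyadic_steps \<Longrightarrow> absmom M q (Z i) \<le> ennreal C * (ennreal ((T / 2 ^ fst i) ^ (b * q)) * (absmom M q (E i) + ennreal ((T / 2 ^ fst i) ^ (r * q))))"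
        using moment_boundD2[OF Z[unfolded relative_order_def], of q] by blast
      have "(\<integral>\<omega>. (Z (n, k) \<omega> \<bullet> e) ^ (2 * q) \<partial>M) \<le> C * D * ((T / 2 ^ n) ^ (b * q) * (v n k + (T / 2 ^ n) ^ (r * q)))"
        if k: "k < 2 ^ n" and e: "e \<in> Basis" for n k e
      proof -
        define h where "h = T / 2 ^ n"
        have h: "h > 0" using T_pos by (simp add: h_def)
        have Zm: "all_moments M (Z (n, k))" using rel_fin[OF Z k Emom] k by simp
        have "(\<integral>\<omega>. (Z (n, k) \<omega> \<bullet> e) ^ (2 * q) \<partial>M) \<le> (\<integral>\<omega>. norm (Z (n, k) \<omega>) ^ (2 * q) \<partial>M)"
        proof (intro integral_mono absmom_eq_integral(2)[OF Zm])
          show "integrable M (\<lambda>\<omega>. (Z (n, k) \<omega> \<bullet> e) ^ (2 * q))"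
            using inner_mom[OF Zm e] by (intro all_moments_integrable all_moments_power finite_measure_axioms)
          show "(Z (n, k) \<omega> \<bullet> e) ^ (2 * q) \<le> norm (Z (n, k) \<omega>) ^ (2 * q)" for \<omega>
            using power_mono[OF Basis_le_norm[OF e, of "Z (n, k) \<omega>"], of "2 * q"] by (simp add: power_even_abs)
        qed
        also have "\<dots> \<le> C * (h ^ (b * q) * ((\<integral>\<omega>. norm (E (n, k) \<omega>) ^ (2 * q) \<partial>M) + h ^ (r * q)))"
        proof -
          have "ennreal (\<integral>\<omega>. norm (Z (n, k) \<omega>) ^ (2 * q) \<partial>M) \<le> ennreal C * (ennreal (h ^ (b * q)) * (ennreal (\<integral>\<omega>. norm (E (n, k) \<omega>) ^ (2 * q) \<partial>M) + ennreal (h ^ (r * q))))"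
            using C(2)[of "(n, k)"] k absmom_eq_integral(1)[OF Zm, of q] absmom_eq_integral(1)[OF Emom, of k n q] by (simp add: h_def)
          also have "\<dots> = ennreal (C * (h ^ (b * q) * ((\<integral>\<omega>. norm (E (n, k) \<omega>) ^ (2 * q) \<partial>M) + h ^ (r * q))))"
            using C h by (simp add: ennreal_mult ennreal_plus integral_nonneg)
          finally show ?thesis using C h by (subst (asm) ennreal_le_iff) (auto intro!: mult_nonneg_nonneg add_nonneg_nonneg integral_nonneg)
        qed
        also have "\<dots> \<le> C * (h ^ (b * q) * (D * v n k + D * h ^ (r * q)))"
          using Ev[of k n] k C h D by (intro mult_left_mono add_mono) (auto simp: mult_le_cancel_right1)
        finally show ?thesis by (simp add: h_def algebra_simps)
      qed
      then show ?thesis using C(1) D by (intro exI[of _ "C * D"]) auto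
    qed
    obtain Cm where Cm: "Cm \<ge> 0" "\<And>n k e. k < 2 ^ n \<Longrightarrow> e \<in> Basis \<Longrightarrow> (\<integral>\<omega>. (m (n, k) \<omega> \<bullet> e) ^ (2 * q) \<partial>M) \<le> Cm * ((T / 2 ^ n) ^ (1 * q) * (v n k + (T / 2 ^ n) ^ (r * q)))"
      using rel[OF m] by blast
    obtain Cd where Cd: "Cd \<ge> 0" "\<And>n k e. k < 2 ^ n \<Longrightarrow> e \<in> Basis \<Longrightarrow> (\<integral>\<omega>. (d (n, k) \<omega> \<bullet> e) ^ (2 * q) \<partial>M) \<le> Cd * ((T / 2 ^ n) ^ (2 * q) * (v n k + (T / 2 ^ n) ^ (r * q)))"
      using rel[OF d] by blast
    define L where "L = K + real DIM('b) * (K * (Cm + Cd))"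
    have L0: "L \<ge> 0" unfolding L_def using K Cm Cd by auto
    \<comment> \<open>Adding \<open>h\<^sup>r\<^sup>q\<close> to \<open>v\<close> makes the inhomogeneous one-step inequality a homogeneous one.\<close>
    have grow: "v n k + (T / 2 ^ n) ^ (r * q) \<le> (1 + L * (T / 2 ^ n)) ^ k * (T / 2 ^ n) ^ (r * q)" if "k \<le> 2 ^ n" for n k
      using that
    proof (induction k)
      case 0
      then show ?case using q by (simp add: v_def E0 power_0_left)
    next
      case (Suc k)
      then have k: "k < 2 ^ n" by simp
      define h where "h = T / 2 ^ n"
      have h: "0 < h" "h \<le> T" using h_pos[of "(n, k)"] h_le[of "(n, k)"] k by (auto simp: h_def)
      define s where "s = v n k + h ^ (r * q)"
      have s: "0 \<le> s" "v n k \<le> s" using v0[of n k] h by (auto simp: s_def)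
      have "(\<integral>\<omega>. (E (n, Suc k) \<omega> \<bullet> e) ^ (2 * q) \<partial>M) \<le> (1 + K * h) * (\<integral>\<omega>. (E (n, k) \<omega> \<bullet> e) ^ (2 * q) \<partial>M) + K * (Cm + Cd) * h * s"
        if e: "e \<in> Basis" for e
      proof -
        have c: "(\<lambda>\<omega>. (E (n, k) \<omega> \<bullet> e) ^ (2 * q - 1)) \<in> borel_measurable (G (n, k))"
          using E[of k n] k by (auto intro!: borel_measurable_power borel_measurable_inner)
        have "(\<integral>\<omega>. (E (n, Suc k) \<omega> \<bullet> e) ^ (2 * q) \<partial>M) = (\<integral>\<omega>. (E (n, k) \<omega> \<bullet> e + m (n, k) \<omega> \<bullet> e + d (n, k) \<omega> \<bullet> e) ^ (2 * q) \<partial>M)"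
          by (simp add: step[OF k] inner_add_left)
        also have "\<dots> \<le> (1 + K * h) * (\<integral>\<omega>. (E (n, k) \<omega> \<bullet> e) ^ (2 * q) \<partial>M)
          + K * ((\<integral>\<omega>. (m (n, k) \<omega> \<bullet> e) ^ (2 * q) \<partial>M) / h ^ (q - 1)) + K * ((\<integral>\<omega>. (d (n, k) \<omega> \<bullet> e) ^ (2 * q) \<partial>M) / h ^ (2 * q - 1))"
          using k e by (intro growth h inner_mom Emom mmom dmom orth c all_moments_power) auto
        also have "\<dots> \<le> (1 + K * h) * (\<integral>\<omega>. (E (n, k) \<omega> \<bullet> e) ^ (2 * q) \<partial>M)
          + K * ((Cm * (h ^ (1 * q) * s)) / h ^ (q - 1)) + K * ((Cd * (h ^ (2 * q) * s)) / h ^ (2 * q - 1))"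
          using Cm(2)[OF k e] Cd(2)[OF k e] K h unfolding s_def h_def[symmetric]
          by (intro add_mono mult_left_mono divide_right_mono) auto
        also have "h ^ (1 * q) = h * h ^ (q - 1)" using q by (cases q) auto
        also have "h ^ (2 * q) = h * h ^ (2 * q - 1)" using q by (cases "2 * q") auto
        finally show ?thesis using h by (simp add: algebra_simps)
      qed
      then have "v n (Suc k) \<le> (\<Sum>e\<in>(Basis::'b set). (1 + K * h) * (\<integral>\<omega>. (E (n, k) \<omega> \<bullet> e) ^ (2 * q) \<partial>M) + K * (Cm + Cd) * h * s)"
        unfolding v_def by (intro sum_mono) auto
      also have "\<dots> = (1 + K * h) * v n k + real DIM('b) * (K * (Cm + Cd)) * h * s"
        unfolding v_def by (simp add: sum.distrib sum_distrib_left)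
      finally have "v n (Suc k) \<le> (1 + K * h) * v n k + real DIM('b) * (K * (Cm + Cd)) * h * s" .
      moreover have "1 * h ^ (r * q) \<le> (1 + K * h) * h ^ (r * q)" using K h by (intro mult_right_mono) auto
      ultimately have "v n (Suc k) + h ^ (r * q) \<le> (1 + K * h) * v n k + (1 + K * h) * h ^ (r * q) + real DIM('b) * (K * (Cm + Cd)) * h * s"
        by linarith
      also have "\<dots> = (1 + L * h) * s" unfolding L_def s_def by (simp add: algebra_simps)
      also have "\<dots> \<le> (1 + L * h) * ((1 + L * h) ^ k * h ^ (r * q))"
        using Suc.IH k L0 h unfolding s_def h_def by (intro mult_left_mono) auto
      finally show ?case unfolding h_def by (simp add: mult.assoc)
    qed
    have "absmom M q (E (n, k)) \<le> ennreal (D * exp (L * T) * (T / 2 ^ n) ^ (r * q))" if k: "k \<le> 2 ^ n" for n k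
    proof -
      define h where "h = T / 2 ^ n"
      have h: "0 < h" using T_pos by (auto simp: h_def)
      have "(1 + L * h) ^ k \<le> exp (L * h) ^ k" using L0 h by (intro power_mono) (auto simp: exp_ge_add_one_self)
      also have "\<dots> = exp (real k * (L * h))" by (simp add: exp_of_nat_mult)
      also have "\<dots> \<le> exp (L * T)"
      proof -
        have "real k * h \<le> 2 ^ n * h" using k h by (intro mult_right_mono) (auto simp flip: of_nat_le_iff)
        also have "\<dots> = T" by (simp add: h_def)
        finally show ?thesis using L0 by (simp add: mult_left_mono mult.left_commute)
      qed
      finally have "(1 + L * h) ^ k * h ^ (r * q) \<le> exp (L * T) * h ^ (r * q)" using h by (intro mult_right_mono) auto
      with grow[OF k] have "v n k \<le> exp (L * T) * h ^ (r * q)" unfolding h_def[symmetric] using zero_less_power[OF h, of "r * q"] by linarith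
      then have "D * v n k \<le> D * (exp (L * T) * h ^ (r * q))" using D by (intro mult_left_mono) auto
      with Ev[OF k] have "(\<integral>\<omega>. norm (E (n, k) \<omega>) ^ (2 * q) \<partial>M) \<le> D * exp (L * T) * h ^ (r * q)" by simp
      then show ?thesis using absmom_eq_integral(1)[OF Emom[OF k], of q] by (simp add: ennreal_leI h_def)
    qed
    then show ?thesis using D by (intro exI[of _ "D * exp (L * T)"]) auto
  qed
  show ?A
  proof (cases "q \<ge> 1")
    case True then show ?thesis by (rule main)
  next
    case False
    then have "q = 0" by simp
    then show ?thesis by (intro exI[of _ 1]) (simp add: absmom_def emeasure_space_1)
  qed
  assume q: "q \<ge> 1"
  obtain C where C: "C \<ge> 0" "\<And>n k. k \<le> 2 ^ n \<Longrightarrow> absmom M q (E (n, k)) \<le> ennreal (C * (T / 2 ^ n) ^ (r * q))"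
    using main[OF q] by blast
  \<comment> \<open>With the moments of the error known, relative bounds become absolute ones.\<close>
  have dord: "\<exists>C'\<ge>0. \<forall>n k. k < 2 ^ n \<longrightarrow> absmom M q (d (n, k)) \<le> ennreal (C' * (T / 2 ^ n) ^ ((r + 2) * q))"
  proof -
    obtain Cd where Cd: "Cd \<ge> 0" "\<And>i. i \<in> dyadic_steps \<Longrightarrow> absmom M q (d i) \<le> ennreal Cd * (ennreal ((T / 2 ^ fst i) ^ (2 * q)) * (absmom M q (E i) + ennreal ((T / 2 ^ fst i) ^ (r * q))))"
      using moment_boundD2[OF d[unfolded relative_order_def], of q] by blast
    have "absmom M q (d (n, k)) \<le> ennreal (Cd * (C + 1) * (T / 2 ^ n) ^ ((r + 2) * q))" if k: "k < 2 ^ n" for n k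
    proof -
      define h where "h = T / 2 ^ n"
      have h: "0 < h" using T_pos by (auto simp: h_def)
      have "absmom M q (d (n, k)) \<le> ennreal Cd * (ennreal (h ^ (2 * q)) * (ennreal (C * h ^ (r * q)) + ennreal (h ^ (r * q))))"
        using Cd(2)[of "(n, k)"] C(2)[of k n] k unfolding h_def
        by (auto elim!: order_trans intro!: mult_left_mono add_mono)
      also have "\<dots> = ennreal (Cd * (h ^ (2 * q) * (C * h ^ (r * q) + h ^ (r * q))))"
        using Cd C h by (simp add: ennreal_mult ennreal_plus)
      also have "Cd * (h ^ (2 * q) * (C * h ^ (r * q) + h ^ (r * q))) = Cd * (C + 1) * h ^ ((r + 2) * q)"
      proof -
        have "h ^ ((r + 2) * q) = h ^ (2 * q) * h ^ (r * q)"           unfolding power_add[symmetric] by (rule arg_cong[of _ _ "power h"]) (simp add: algebra_simps)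
        then show ?thesis by (simp add: algebra_simps)
      qed
      finally show ?thesis by (simp add: h_def)
    qed
    then show ?thesis using Cd C by (intro exI[of _ "Cd * (C + 1)"]) auto
  qed
  then obtain C' where C': "C' \<ge> 0" "\<And>n k. k < 2 ^ n \<Longrightarrow> absmom M q (d (n, k)) \<le> ennreal (C' * (T / 2 ^ n) ^ ((r + 2) * q))"
    by blast
  define Q where "Q = 4 ^ (2 * q) * (4 ^ q * (C + T ^ (2 * q) * C'))"
  have Q: "Q \<ge> 0" unfolding Q_def using C C' T_pos by auto
  have coord: "absmom M q (\<lambda>\<omega>. MAX k\<in>{..2 ^ n}. \<bar>E (n, k) \<omega> \<bullet> e\<bar>) \<le> ennreal (Q * (T / 2 ^ n) ^ (r * q))" if e: "e \<in> Basis" for n e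
  proof -
    define h where "h = T / 2 ^ n"
    have h: "0 < h" using T_pos by (auto simp: h_def)
    have inner_le: "absmom M q (\<lambda>\<omega>. \<bar>Z \<omega> \<bullet> e\<bar>) \<le> absmom M q Z" for Z :: "'a \<Rightarrow> 'b"
      by (rule absmom_mono) (simp add: Basis_le_norm e)
    have meas: "(\<lambda>\<omega>. \<bar>E (n, 2 ^ n) \<omega> \<bullet> e\<bar>) \<in> borel_measurable M" "\<And>i. i < 2 ^ n \<Longrightarrow> (\<lambda>\<omega>. d (n, i) \<omega> \<bullet> e) \<in> borel_measurable M"
      using EM[of "2^n" n] dmom by (auto simp: all_moments_def intro!: borel_measurable_abs borel_measurable_inner)
    have "absmom M q (\<lambda>\<omega>. MAX k\<in>{..2 ^ n}. \<bar>E (n, k) \<omega> \<bullet> e\<bar>)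
      \<le> ennreal (4 ^ (2 * q)) * absmom M q (\<lambda>\<omega>. \<bar>E (n, 2 ^ n) \<omega> \<bullet> e\<bar> + (\<Sum>i<2 ^ n. \<bar>d (n, i) \<omega> \<bullet> e\<bar>))"
    proof (rule doob_with_drift[where G="\<lambda>k. G (n, k)" and m="\<lambda>k \<omega>. m (n, k) \<omega> \<bullet> e"])
      show "(\<lambda>\<omega>. E (n, k) \<omega> \<bullet> e) \<in> borel_measurable (G (n, k))" if "k \<le> 2 ^ n" for k
        using E[OF that] by (intro borel_measurable_inner) auto
    qed (use e q in \<open>auto simp: E0 step inner_add_left intro: G_sub G_mono inner_mom Emom mmom dmom orth\<close>)
    also have "\<dots> \<le> ennreal (4 ^ (2 * q)) * (ennreal (4 ^ q) * (absmom M q (\<lambda>\<omega>. \<bar>E (n, 2 ^ n) \<omega> \<bullet> e\<bar>) + absmom M q (\<lambda>\<omega>. \<Sum>i<2 ^ n. \<bar>d (n, i) \<omega> \<bullet> e\<bar>)))"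
      by (intro mult_left_mono absmom_add borel_measurable_sum meas(1) borel_measurable_abs[OF meas(2)]) auto
    also have "\<dots> \<le> ennreal (4 ^ (2 * q)) * (ennreal (4 ^ q) * (ennreal (C * h ^ (r * q)) + ennreal (real (2 ^ n) ^ (2 * q)) * ennreal (C' * h ^ ((r + 2) * q))))"
    proof (intro mult_left_mono add_mono)
      show "absmom M q (\<lambda>\<omega>. \<bar>E (n, 2 ^ n) \<omega> \<bullet> e\<bar>) \<le> ennreal (C * h ^ (r * q))"
        using order_trans[OF inner_le C(2)[of "2 ^ n" n]] by (simp add: h_def)
      show "absmom M q (\<lambda>\<omega>. \<Sum>i<2 ^ n. \<bar>d (n, i) \<omega> \<bullet> e\<bar>) \<le> ennreal (real (2 ^ n) ^ (2 * q)) * ennreal (C' * h ^ ((r + 2) * q))"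
      proof (rule absmom_sum_le[OF meas(2) q])
        fix i :: nat assume i: "i < 2 ^ n"
        have "absmom M q (\<lambda>\<omega>. d (n, i) \<omega> \<bullet> e) \<le> absmom M q (d (n, i))" by (rule absmom_mono) (simp add: Basis_le_norm e)
        also have "\<dots> \<le> ennreal (C' * h ^ ((r + 2) * q))" using C'(2)[OF i] by (simp add: h_def)
        finally show "absmom M q (\<lambda>\<omega>. d (n, i) \<omega> \<bullet> e) \<le> ennreal (C' * h ^ ((r + 2) * q))" .
      qed auto
    qed auto
    also have "\<dots> = ennreal (4 ^ (2 * q) * (4 ^ q * (C * h ^ (r * q) + real (2 ^ n) ^ (2 * q) * (C' * h ^ ((r + 2) * q)))))"
      using C C' h by (simp add: ennreal_mult ennreal_plus)
    also have "real (2 ^ n) ^ (2 * q) * (C' * h ^ ((r + 2) * q)) = C' * (real (2 ^ n) * h) ^ (2 * q) * h ^ (r * q)"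
    proof -
      have "h ^ ((r + 2) * q) = h ^ (2 * q) * h ^ (r * q)"
        unfolding power_add[symmetric] by (rule arg_cong[of _ _ "power h"]) (simp add: algebra_simps)
      then show ?thesis by (simp add: power_mult_distrib)
    qed
    also have "real (2 ^ n) * h = T" by (simp add: h_def)
    finally show ?thesis by (simp add: Q_def h_def algebra_simps)
  qed
  define D where "D = real DIM('b) ^ (2 * q)"
  have "(\<integral>\<^sup>+\<omega>. ennreal (MAX k\<in>{..2 ^ n}. norm (E (n, k) \<omega>) ^ (2 * q)) \<partial>M) \<le> ennreal (D * (real DIM('b) * Q) * (T / 2 ^ n) ^ (r * q))" for n
  proof -
    define A where "A e \<omega> = (MAX k\<in>{..2 ^ n}. \<bar>E (n, k) \<omega> \<bullet> e\<bar>)" for e \<omega>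
    have Ameas [measurable]: "A e \<in> borel_measurable M" for e
      unfolding A_def[abs_def] using EM by (intro borel_measurable_Max) (auto intro!: borel_measurable_abs borel_measurable_inner)
    have "(MAX k\<in>{..2 ^ n}. norm (E (n, k) \<omega>) ^ (2 * q)) \<le> D * (\<Sum>e\<in>Basis. norm (A e \<omega>) ^ (2 * q))" for \<omega>
    proof (rule Max.boundedI)
      fix y assume "y \<in> (\<lambda>k. norm (E (n, k) \<omega>) ^ (2 * q)) ` {..2 ^ n}"
      then obtain k where k: "k \<le> 2 ^ n" "y = norm (E (n, k) \<omega>) ^ (2 * q)" by auto
      have "y \<le> D * (\<Sum>e\<in>Basis. \<bar>E (n, k) \<omega> \<bullet> e\<bar> ^ (2 * q))" unfolding k D_def by (rule norm_power_le_Basis)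
      also have "\<dots> \<le> D * (\<Sum>e\<in>Basis. norm (A e \<omega>) ^ (2 * q))"
      proof (intro mult_left_mono sum_mono power_mono)
        show "\<bar>E (n, k) \<omega> \<bullet> e\<bar> \<le> norm (A e \<omega>)" for e
          unfolding A_def using k by (auto intro!: order_trans[OF _ abs_ge_self] Max_ge)
      qed (auto simp: D_def)
      finally show "y \<le> D * (\<Sum>e\<in>Basis. norm (A e \<omega>) ^ (2 * q))" .
    qed auto
    then have "(\<integral>\<^sup>+\<omega>. ennreal (MAX k\<in>{..2 ^ n}. norm (E (n, k) \<omega>) ^ (2 * q)) \<partial>M)
      \<le> (\<integral>\<^sup>+\<omega>. ennreal (D * (\<Sum>e\<in>Basis. norm (A e \<omega>) ^ (2 * q))) \<partial>M)" by (intro nn_integral_mono ennreal_leI)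
    also have "\<dots> = (\<integral>\<^sup>+\<omega>. ennreal D * (\<Sum>e\<in>Basis. ennreal (norm (A e \<omega>) ^ (2 * q))) \<partial>M)"
      by (intro nn_integral_cong) (simp add: ennreal_mult D_def sum_nonneg sum_ennreal)
    also have "\<dots> = ennreal D * (\<Sum>e\<in>Basis. absmom M q (A e))"
      unfolding absmom_def by (subst nn_integral_cmult) (auto simp: nn_integral_sum simp del: sum_ennreal)
    also have "\<dots> \<le> ennreal D * (\<Sum>e\<in>(Basis::'b set). ennreal (Q * (T / 2 ^ n) ^ (r * q)))"
      using coord unfolding A_def[abs_def] by (intro mult_left_mono sum_mono) auto
    also have "\<dots> = ennreal D * (ennreal (real DIM('b)) * ennreal (Q * (T / 2 ^ n) ^ (r * q)))"
      by (simp add: ennreal_of_nat_eq_real_of_nat)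
    also have "\<dots> = ennreal (D * (real DIM('b) * Q) * (T / 2 ^ n) ^ (r * q))"
      using Q T_pos by (simp add: ennreal_mult D_def mult.assoc)
    finally show ?thesis .
  qed
  then show "\<exists>C\<ge>0. \<forall>n. (\<integral>\<^sup>+\<omega>. ennreal (MAX k\<in>{..2 ^ n}. norm (E (n, k) \<omega>) ^ (2 * q)) \<partial>M)
           \<le> ennreal (C * (T / 2 ^ n) ^ (r * q))"
    using Q by (intro exI[of _ "D * (real DIM('b) * Q)"]) (auto simp: D_def)
qed

end

section \<open>Smooth bounded coefficients\<close>

text \<open>
  All that the schemes require of their coefficients, apart from a Taylor expansion of the \<open>\<sigma>\<^sub>j\<close>. Unlike
  differentiability of a given order, this property is inherited by all products and derivatives that occur.
\<close>

definition bounded_Lipschitz :: "('c::real_normed_vector \<Rightarrow> 'b::real_normed_vector) \<Rightarrow> bool" where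
  "bounded_Lipschitz f \<longleftrightarrow> (\<exists>K. \<forall>x. norm (f x) \<le> K) \<and> (\<exists>L. \<forall>x y. norm (f x - f y) \<le> L * norm (x - y))"

lemma bounded_LipschitzD1:
  assumes "bounded_Lipschitz f" shows "\<exists>K\<ge>0. \<forall>x. norm (f x) \<le> K"
proof -
  obtain K where K: "norm (f x) \<le> K" for x
    using assms unfolding bounded_Lipschitz_def by blast
  then have "K \<ge> 0" using norm_ge_zero order_trans by blast
  then show ?thesis using K by blast
qed

lemma bounded_LipschitzD2:
  assumes "bounded_Lipschitz f" shows "\<exists>L\<ge>0. \<forall>x y. norm (f x - f y) \<le> L * norm (x - y)"
proof -
  obtain L where L: "norm (f x - f y) \<le> L * norm (x - y)" for x y
    using assms unfolding bounded_Lipschitz_def by blast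
  have "norm (f x - f y) \<le> \<bar>L\<bar> * norm (x - y)" for x y
    by (rule order_trans[OF L]) (intro mult_right_mono, auto)
  then show ?thesis by (intro exI[of _ "\<bar>L\<bar>"]) simp
qed

lemma bounded_Lipschitz_const: "bounded_Lipschitz (\<lambda>_. c)"
  unfolding bounded_Lipschitz_def by (intro conjI exI[of _ "norm c"] exI[of _ 0]) simp_all

lemma bounded_Lipschitz_add:
  assumes "bounded_Lipschitz f" "bounded_Lipschitz g"
  shows "bounded_Lipschitz (\<lambda>x. f x + g x)"
proof -
  obtain K where K: "norm (f x) \<le> K" for x using bounded_LipschitzD1[OF assms(1)] by blast
  obtain K' where K': "norm (g x) \<le> K'" for x using bounded_LipschitzD1[OF assms(2)] by blast
  obtain L where L: "norm (f x - f y) \<le> L * norm (x - y)" for x y using bounded_LipschitzD2[OF assms(1)] by blast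
  obtain L' where L': "norm (g x - g y) \<le> L' * norm (x - y)" for x y using bounded_LipschitzD2[OF assms(2)] by blast
  have "norm (f x + g x) \<le> K + K'" for x using K K' norm_triangle_mono by blast
  moreover have "norm (f x + g x - (f y + g y)) \<le> (L + L') * norm (x - y)" for x y
    using norm_triangle_mono[OF L[of x y] L'[of x y]] by (simp add: algebra_simps)
  ultimately show ?thesis unfolding bounded_Lipschitz_def by blast
qed

lemma bounded_Lipschitz_scaleR:
  fixes f :: "'c::real_normed_vector \<Rightarrow> real"
  assumes "bounded_Lipschitz f" "bounded_Lipschitz g"
  shows "bounded_Lipschitz (\<lambda>x. f x *\<^sub>R g x)"
proof -
  obtain K where K: "K \<ge> 0" "norm (f x) \<le> K" for x using bounded_LipschitzD1[OF assms(1)] by blast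
  obtain K' where K': "K' \<ge> 0" "norm (g x) \<le> K'" for x using bounded_LipschitzD1[OF assms(2)] by blast
  obtain L where L: "L \<ge> 0" "norm (f x - f y) \<le> L * norm (x - y)" for x y using bounded_LipschitzD2[OF assms(1)] by blast
  obtain L' where L': "L' \<ge> 0" "norm (g x - g y) \<le> L' * norm (x - y)" for x y using bounded_LipschitzD2[OF assms(2)] by blast
  have "norm (f x *\<^sub>R g x) \<le> K * K'" for x using K K' by (auto intro!: mult_mono)
  moreover have "norm (f x *\<^sub>R g x - f y *\<^sub>R g y) \<le> (L * K' + K * L') * norm (x - y)" for x y
  proof -
    have "f x *\<^sub>R g x - f y *\<^sub>R g y = (f x - f y) *\<^sub>R g x + f y *\<^sub>R (g x - g y)" by (simp add: algebra_simps)
    also have "norm \<dots> \<le> norm (f x - f y) * norm (g x) + norm (f y) * norm (g x - g y)"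
      by (rule order_trans[OF norm_triangle_ineq]) simp
    also have "\<dots> \<le> (L * norm (x - y)) * K' + K * (L' * norm (x - y))"
      using K K' L L' by (intro add_mono mult_mono) auto
    finally show ?thesis by (simp add: algebra_simps)
  qed
  ultimately show ?thesis unfolding bounded_Lipschitz_def by blast
qed

lemma bounded_Lipschitz_scaleR_const: "bounded_Lipschitz f \<Longrightarrow> bounded_Lipschitz (\<lambda>x. c *\<^sub>R f x)"
  by (rule bounded_Lipschitz_scaleR[OF bounded_Lipschitz_const])

lemma bounded_Lipschitz_diff:
  "bounded_Lipschitz f \<Longrightarrow> bounded_Lipschitz g \<Longrightarrow> bounded_Lipschitz (\<lambda>x. f x - g x)"
  using bounded_Lipschitz_add[OF _ bounded_Lipschitz_scaleR_const[of g "-1"], of f] by simp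

lemma bounded_Lipschitz_sum:
  "(\<And>a. a \<in> A \<Longrightarrow> bounded_Lipschitz (f a)) \<Longrightarrow> bounded_Lipschitz (\<lambda>x. \<Sum>a\<in>A. f a x)"
  by (induction A rule: infinite_finite_induct) (auto intro: bounded_Lipschitz_add bounded_Lipschitz_const)

lemma bounded_Lipschitz_nth:
  fixes f :: "'c::real_normed_vector \<Rightarrow> real ^ 'n"
  assumes "bounded_Lipschitz f" shows "bounded_Lipschitz (\<lambda>x. f x $ k)"
proof -
  obtain K where K: "norm (f x) \<le> K" for x using bounded_LipschitzD1[OF assms(1)] by blast
  obtain L where L: "norm (f x - f y) \<le> L * norm (x - y)" for x y using bounded_LipschitzD2[OF assms(1)] by blast
  have "norm (f x $ k) \<le> K" for x using order_trans[OF Finite_Cartesian_Product.norm_nth_le K[of x]] .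
  moreover have "norm (f x $ k - f y $ k) \<le> L * norm (x - y)" for x y
    using order_trans[OF Finite_Cartesian_Product.norm_nth_le[of "f x - f y" k] L[of x y]] by simp
  ultimately show ?thesis unfolding bounded_Lipschitz_def by blast
qed

lemma bounded_Lipschitz_measurable:
  fixes f :: "'c::euclidean_space \<Rightarrow> 'b::euclidean_space"
  assumes "bounded_Lipschitz f" shows "f \<in> borel_measurable borel"
proof (rule borel_measurable_continuous_onI)
  obtain L where L: "L \<ge> 0" "norm (f x - f y) \<le> L * norm (x - y)" for x y using bounded_LipschitzD2[OF assms(1)] by blast
  have "L-lipschitz_on UNIV f" using L by (intro lipschitz_onI) (auto simp: dist_norm)
  then show "continuous_on UNIV f" by (rule lipschitz_on_continuous_on)
qed

definition directional_deriv :: "(real ^ 'n \<Rightarrow> 'b::real_normed_vector) \<Rightarrow> real ^ 'n \<Rightarrow> real ^ 'n \<Rightarrow> 'b" where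
  "directional_deriv f z v = (\<Sum>k\<in>UNIV. (v $ k) *\<^sub>R partial_deriv k f z)"

lemma has_derivative_directional_deriv:
  fixes f :: "real ^ 'n \<Rightarrow> 'b::real_normed_vector"
  assumes "f differentiable (at z)"
  shows "(f has_derivative directional_deriv f z) (at z)"
proof -
  obtain D where D: "(f has_derivative D) (at z)" using assms by (auto simp: differentiable_def)
  have lin: "linear D" using D by (rule has_derivative_linear)
  have p: "partial_deriv k f z = D (axis k 1)" for k
  proof -
    have 1: "((\<lambda>h::real. z + h *\<^sub>R axis k 1) has_derivative (\<lambda>h. h *\<^sub>R axis k 1)) (at 0)"
      by (rule has_derivative_eq_rhs[OF has_derivative_add[OF has_derivative_const has_derivative_scaleR_left[OF has_derivative_ident]]]) simp
    have "((\<lambda>h. f (z + h *\<^sub>R axis k 1)) has_derivative (\<lambda>h. D (h *\<^sub>R axis k 1))) (at 0)"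
      by (rule has_derivative_compose[OF 1]) (use D in simp)
    then have "((\<lambda>h. f (z + h *\<^sub>R axis k 1)) has_vector_derivative D (axis k 1)) (at 0)"
      unfolding has_vector_derivative_def by (simp add: linear_scale[OF lin])
    then show ?thesis unfolding partial_deriv_def by (rule vector_derivative_at)
  qed
  have e: "D v = (\<Sum>k\<in>UNIV. (v $ k) *\<^sub>R D (axis k 1))" for v
  proof -
    have "v = (\<Sum>k\<in>UNIV. (v $ k) *\<^sub>R axis k 1)"
      using basis_expansion[of v] by (simp add: scalar_mult_eq_scaleR)
    then have "D v = D (\<Sum>k\<in>UNIV. (v $ k) *\<^sub>R axis k 1)" by (rule arg_cong)
    also have "\<dots> = (\<Sum>k\<in>UNIV. (v $ k) *\<^sub>R D (axis k 1))"
      by (simp add: linear_sum[OF lin] linear_scale[OF lin])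
    finally show ?thesis .
  qed
  have "D v = directional_deriv f z v" for v
    unfolding directional_deriv_def p by (rule e)
  then have "D = directional_deriv f z" by (rule ext)
  with D show ?thesis by simp
qed

lemma norm_directional_deriv_le:
  "norm (directional_deriv f z v) \<le> (\<Sum>k\<in>UNIV. norm (partial_deriv k f z)) * norm v"
proof -
  have "norm (directional_deriv f z v) \<le> (\<Sum>k\<in>UNIV. norm v * norm (partial_deriv k f z))"
    unfolding directional_deriv_def
    by (rule sum_norm_le) (simp add: mult_right_mono component_le_norm_cart)
  then show ?thesis by (simp add: sum_distrib_left mult.commute)
qed

lemma directional_deriv_linear:
  "directional_deriv f z (u + v) = directional_deriv f z u + directional_deriv f z v"
  "directional_deriv f z (c *\<^sub>R v) = c *\<^sub>R directional_deriv f z v"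
  "directional_deriv f z (\<Sum>i\<in>A. g i) = (\<Sum>i\<in>A. directional_deriv f z (g i))"
proof -
  show 1: "directional_deriv f z (u + v) = directional_deriv f z u + directional_deriv f z v" for u v
    by (simp add: directional_deriv_def sum.distrib scaleR_add_left)
  show "directional_deriv f z (c *\<^sub>R v) = c *\<^sub>R directional_deriv f z v"
    by (simp add: directional_deriv_def scaleR_sum_right)
  show "directional_deriv f z (\<Sum>i\<in>A. g i) = (\<Sum>i\<in>A. directional_deriv f z (g i))"
    by (induction A rule: infinite_finite_induct) (simp_all add: 1, simp_all add: directional_deriv_def)
qed

lemma Cb_Suc_bounded_Lipschitz:
  fixes f :: "real ^ 'n \<Rightarrow> 'b::real_normed_vector"
  assumes "Cb (Suc K) f" shows "bounded_Lipschitz f"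
proof -
  have "\<exists>B. \<forall>z. norm (partial_deriv k f z) \<le> B" for k
  proof -
    have "bounded (range (partial_deriv k f))" using assms by (cases K) auto
    then show ?thesis by (auto simp: bounded_iff)
  qed
  then obtain B where B: "norm (partial_deriv k f z) \<le> B k" for k z by metis
  have "norm (f x - f y) \<le> (\<Sum>k\<in>UNIV. B k) * norm (x - y)" for x y
  proof (rule differentiable_bound[where S=UNIV and f'="directional_deriv f"])
    show "(f has_derivative directional_deriv f x) (at x within UNIV)" for x
      using assms by (auto intro: has_derivative_directional_deriv)
    have B0: "0 \<le> B k" for k using B[of k 0] norm_ge_zero order_trans by blast
    show "onorm (directional_deriv f x) \<le> (\<Sum>k\<in>UNIV. B k)" for x
    proof (rule onorm_bound)
      show "norm (directional_deriv f x v) \<le> (\<Sum>k\<in>UNIV. B k) * norm v" for v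
        by (rule order_trans[OF norm_directional_deriv_le mult_right_mono]) (auto intro: sum_mono B)
    qed (auto intro: sum_nonneg B0)
  qed auto
  moreover obtain K where "norm (f x) \<le> K" for x using assms by (auto simp: bounded_iff)
  ultimately show ?thesis unfolding bounded_Lipschitz_def by blast
qed

text \<open>
  The mean value inequality for \<open>w \<mapsto> f w - f'(z) w\<close>, whose derivative at \<open>w\<close> is small since the partial
  derivatives are Lipschitz.
\<close>

lemma Cb_second_order_Taylor:
  fixes f :: "real ^ 'n \<Rightarrow> 'b::real_normed_vector"
  assumes "Cb (Suc (Suc K)) f"
  shows "\<exists>C\<ge>0. \<forall>z v. norm (f (z + v) - f z - directional_deriv f z v) \<le> C * norm v ^ 2"
proof -
  have "bounded_Lipschitz (partial_deriv k f)" for k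
    using assms by (intro Cb_Suc_bounded_Lipschitz[of K]) simp
  then have "\<exists>L. L \<ge> 0 \<and> (\<forall>x y. norm (partial_deriv k f x - partial_deriv k f y) \<le> L * norm (x - y))" for k
    using bounded_LipschitzD2[of "partial_deriv k f"] by auto
  then obtain L where L: "L k \<ge> 0" "norm (partial_deriv k f x - partial_deriv k f y) \<le> L k * norm (x - y)" for k x y by metis
  define C where "C = (\<Sum>k\<in>UNIV. L k)"
  have C: "C \<ge> 0" unfolding C_def by (intro sum_nonneg L)
  have "norm (f (z + v) - f z - directional_deriv f z v) \<le> C * norm v ^ 2" for z v
  proof -
    define g where "g w = f w - directional_deriv f z w" for w
    have lin: "linear (directional_deriv f z)" by (intro linearI directional_deriv_linear)
    have "norm (g (z + v) - g z) \<le> (C * norm v) * norm (z + v - z)"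
    proof (rule differentiable_bound[where S="cball z (norm v)" and f'="\<lambda>w u. directional_deriv f w u - directional_deriv f z u"])
      fix w assume w: "w \<in> cball z (norm v)"
      show "(g has_derivative (\<lambda>u. directional_deriv f w u - directional_deriv f z u)) (at w within cball z (norm v))"
        unfolding g_def[abs_def] using assms
        by (intro has_derivative_diff has_derivative_at_withinI[OF has_derivative_directional_deriv]
            linear_imp_has_derivative lin) auto
      show "onorm (\<lambda>u. directional_deriv f w u - directional_deriv f z u) \<le> C * norm v"
      proof (rule onorm_bound)
        fix u
        have "norm (directional_deriv f w u - directional_deriv f z u)
            = norm (\<Sum>k\<in>UNIV. (u $ k) *\<^sub>R (partial_deriv k f w - partial_deriv k f z))"
          by (simp add: directional_deriv_def scaleR_diff_right sum_subtractf)
        also have "\<dots> \<le> (\<Sum>k\<in>UNIV. norm u * (L k * norm v))"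
        proof (rule sum_norm_le)
          fix k
          have "norm (w - z) \<le> norm v" using w by (simp add: dist_norm norm_minus_commute)
          then have "norm (partial_deriv k f w - partial_deriv k f z) \<le> L k * norm v"
            using L(2)[of k w z] L(1)[of k] by (meson mult_left_mono order_trans)
          then show "norm ((u $ k) *\<^sub>R (partial_deriv k f w - partial_deriv k f z)) \<le> norm u * (L k * norm v)"
            by (simp add: mult_mono component_le_norm_cart)
        qed
        also have "\<dots> = C * norm v * norm u" by (simp add: C_def sum_distrib_left sum_distrib_right mult_ac)
        finally show "norm (directional_deriv f w u - directional_deriv f z u) \<le> C * norm v * norm u" .
      qed (use C in auto)
    qed (auto simp: dist_norm)
    also have "g (z + v) - g z = f (z + v) - f z - directional_deriv f z v"
      by (simp add: g_def directional_deriv_linear)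
    finally show ?thesis by (simp add: power2_eq_square)
  qed
  with C show ?thesis by blast
qed

locale smooth_coefficients =
  fixes d :: nat and \<sigma> :: "nat \<Rightarrow> real ^ 'n \<Rightarrow> real ^ 'n"
  assumes smooth: "j \<le> d \<Longrightarrow> Cb_infinity (\<sigma> j)"
begin

lemma Cb_sigma: "j \<le> d \<Longrightarrow> Cb K (\<sigma> j)"
  using smooth by (simp add: Cb_infinity_def)

lemma bounded_Lipschitz_sigma: "j \<le> d \<Longrightarrow> bounded_Lipschitz (\<sigma> j)"
  using Cb_sigma[of j "Suc 0"] by (rule Cb_Suc_bounded_Lipschitz)

lemma bounded_Lipschitz_partial: "j \<le> d \<Longrightarrow> bounded_Lipschitz (partial_deriv k (\<sigma> j))"
  using Cb_sigma[of j "Suc (Suc 0)"] by (intro Cb_Suc_bounded_Lipschitz[of 0]) auto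

lemma bounded_Lipschitz_partial2: "j \<le> d \<Longrightarrow> bounded_Lipschitz (partial_deriv k (partial_deriv l (\<sigma> j)))"
  using Cb_sigma[of j "Suc (Suc (Suc 0))"] by (intro Cb_Suc_bounded_Lipschitz[of 0]) auto

text \<open>
  For \<open>i = 0\<close> the operator has a second order part; it occurs only in terms that are local errors
  in any case, where boundedness is enough.
\<close>

lemma gen_op_eq_directional_deriv: "i \<ge> 1 \<Longrightarrow> gen_op d \<sigma> i f z = directional_deriv f z (\<sigma> i z)"
  by (simp add: gen_op_def directional_deriv_def)

lemma bounded_Lipschitz_gen_op:
  assumes "i \<le> d" "j \<le> d" shows "bounded_Lipschitz (gen_op d \<sigma> i (\<sigma> j))"
proof (cases "i = 0")
  case True
  have 0: "bounded_Lipschitz (\<lambda>z. ((\<sigma> l z $ k1) * (\<sigma> l z $ k2)) *\<^sub>R partial_deriv k1 (partial_deriv k2 (\<sigma> j)) z)"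
    if "l \<in> {1..d}" for l k1 k2
  proof (rule bounded_Lipschitz_scaleR)
    show "bounded_Lipschitz (\<lambda>z. (\<sigma> l z $ k1) * (\<sigma> l z $ k2))"
      using bounded_Lipschitz_scaleR[of "\<lambda>z. \<sigma> l z $ k1" "\<lambda>z. \<sigma> l z $ k2"] that
      by (simp add: bounded_Lipschitz_nth bounded_Lipschitz_sigma)
  qed (rule bounded_Lipschitz_partial2[OF assms(2)])
  have 1: "bounded_Lipschitz (\<lambda>z. \<Sum>k\<in>UNIV. (\<sigma> 0 z $ k) *\<^sub>R partial_deriv k (\<sigma> j) z)"
    by (intro bounded_Lipschitz_sum bounded_Lipschitz_scaleR bounded_Lipschitz_nth bounded_Lipschitz_sigma
        bounded_Lipschitz_partial assms) auto
  have 2: "bounded_Lipschitz (\<lambda>z. (1/2) *\<^sub>R (\<Sum>l\<in>{1..d}. \<Sum>k1\<in>UNIV. \<Sum>k2\<in>UNIV.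
           ((\<sigma> l z $ k1) * (\<sigma> l z $ k2)) *\<^sub>R partial_deriv k1 (partial_deriv k2 (\<sigma> j)) z))"
    by (intro bounded_Lipschitz_scaleR_const bounded_Lipschitz_sum 0)
  have "gen_op d \<sigma> i (\<sigma> j) = (\<lambda>z. (\<Sum>k\<in>UNIV. (\<sigma> 0 z $ k) *\<^sub>R partial_deriv k (\<sigma> j) z)
     + (1/2) *\<^sub>R (\<Sum>l\<in>{1..d}. \<Sum>k1\<in>UNIV. \<Sum>k2\<in>UNIV.
           ((\<sigma> l z $ k1) * (\<sigma> l z $ k2)) *\<^sub>R partial_deriv k1 (partial_deriv k2 (\<sigma> j)) z))"
    unfolding gen_op_def[abs_def] True by (simp only: refl if_True)
  then show ?thesis using bounded_Lipschitz_add[OF 1 2] by simp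
next
  case False
  then show ?thesis using assms unfolding gen_op_def[abs_def]
    by (simp add: bounded_Lipschitz_sum bounded_Lipschitz_scaleR
      bounded_Lipschitz_nth bounded_Lipschitz_sigma bounded_Lipschitz_partial)
qed

lemma bounded_Lipschitz_bracket:
  assumes "i \<le> d" "j \<le> d" shows "bounded_Lipschitz (bracket d \<sigma> i j)"
  unfolding bracket_def[abs_def] using assms by (intro bounded_Lipschitz_diff bounded_Lipschitz_gen_op)

lemma sigma_Taylor:
  "j \<le> d \<Longrightarrow> \<exists>C\<ge>0. \<forall>z v. norm (\<sigma> j (z + v) - \<sigma> j z - directional_deriv (\<sigma> j) z v) \<le> C * norm v ^ 2"
  by (rule Cb_second_order_Taylor[OF Cb_sigma])

lemma directional_deriv_sigma_bounded:
  assumes "j \<le> d" shows "\<exists>C\<ge>0. \<forall>z v. norm (directional_deriv (\<sigma> j) z v) \<le> C * norm v"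
proof -
  have "\<exists>B\<ge>0. \<forall>z. norm (partial_deriv k (\<sigma> j) z) \<le> B" for k
    using bounded_LipschitzD1[OF bounded_Lipschitz_partial[OF assms, of k]] by auto
  then obtain B where B: "B k \<ge> 0" "norm (partial_deriv k (\<sigma> j) z) \<le> B k" for k z by metis
  have "norm (directional_deriv (\<sigma> j) z v) \<le> (\<Sum>k\<in>UNIV. B k) * norm v" for z v
    by (rule order_trans[OF norm_directional_deriv_le mult_right_mono]) (auto intro: sum_mono B)
  then show ?thesis using B by (intro exI[of _ "\<Sum>k\<in>UNIV. B k"]) (auto intro: sum_nonneg)
qed

end

section \<open>Expansion of one step and of two consecutive steps\<close>

text \<open>
  The source of the brackets: antisymmetric coefficients see only the antisymmetric part of \<open>g\<close>.
\<close>

lemma sum_pairs_antisymmetric: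
  fixes c :: "nat \<Rightarrow> nat \<Rightarrow> real" and g :: "nat \<Rightarrow> nat \<Rightarrow> 'b::real_vector"
  assumes anti: "\<And>i j. c i j = - c j i"
  shows "(\<Sum>i\<in>{1..d}. \<Sum>j\<in>{1..d}. c i j *\<^sub>R g i j) = (\<Sum>i\<in>{1..d}. \<Sum>j\<in>{i<..d}. c i j *\<^sub>R (g i j - g j i))"
proof -
  have diag: "c i i = 0" for i using anti[of i i] by simp
  have split: "{1..d} = {1..<i} \<union> ({i} \<union> {i<..d})" if "i \<in> {1..d}" for i using that by auto
  have "(\<Sum>i\<in>{1..d}. \<Sum>j\<in>{1..d}. c i j *\<^sub>R g i j)
      = (\<Sum>i\<in>{1..d}. (\<Sum>j\<in>{1..<i}. c i j *\<^sub>R g i j) + (\<Sum>j\<in>{i<..d}. c i j *\<^sub>R g i j))"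
  proof (rule sum.cong[OF refl])
    fix i assume "i \<in> {1..d}"
    then show "(\<Sum>j\<in>{1..d}. c i j *\<^sub>R g i j) = (\<Sum>j\<in>{1..<i}. c i j *\<^sub>R g i j) + (\<Sum>j\<in>{i<..d}. c i j *\<^sub>R g i j)"
      by (subst split, assumption) (subst sum.union_disjoint, auto simp: diag)
  qed
  also have "\<dots> = (\<Sum>i\<in>{1..d}. \<Sum>j\<in>{1..<i}. c i j *\<^sub>R g i j) + (\<Sum>i\<in>{1..d}. \<Sum>j\<in>{i<..d}. c i j *\<^sub>R g i j)"
    by (rule sum.distrib)
  also have "(\<Sum>i\<in>{1..d}. \<Sum>j\<in>{1..<i}. c i j *\<^sub>R g i j) = (\<Sum>j\<in>{1..d}. \<Sum>i\<in>{j<..d}. c i j *\<^sub>R g i j)"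
  proof -
    have "(\<Sum>i\<in>{1..d}. \<Sum>j\<in>{1..<i}. c i j *\<^sub>R g i j) = (\<Sum>i\<in>{1..d}. \<Sum>j | j \<in> {1..d} \<and> j < i. c i j *\<^sub>R g i j)"
      by (intro sum.cong refl) auto
    also have "\<dots> = (\<Sum>j\<in>{1..d}. \<Sum>i | i \<in> {1..d} \<and> j < i. c i j *\<^sub>R g i j)"
      by (rule sum.swap_restrict) auto
    also have "\<dots> = (\<Sum>j\<in>{1..d}. \<Sum>i\<in>{j<..d}. c i j *\<^sub>R g i j)"
      by (intro sum.cong refl) auto
    finally show ?thesis .
  qed
  also have "\<dots> = (\<Sum>j\<in>{1..d}. \<Sum>i\<in>{j<..d}. - (c j i *\<^sub>R g i j))"
    by (intro sum.cong refl) (subst anti, simp)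
  finally show ?thesis by (simp add: scaleR_diff_right sum_subtractf sum_negf)
qed

context smooth_coefficients
begin

abbreviation Lop :: "nat \<Rightarrow> nat \<Rightarrow> real ^ 'n \<Rightarrow> real ^ 'n" where
  "Lop i j \<equiv> gen_op d \<sigma> i (\<sigma> j)"

text \<open>
  One step of a scheme is split by the role of its terms. \<open>main_part\<close> is shared by all schemes,
  \<open>area_part\<close> changes sign between partners, and \<open>time_part\<close>, which contains the coefficients \<open>\<eta>\<^sup>i\<^sup>j\<close> with a
  time index, is a local error already.
\<close>

definition main_part :: "(nat \<Rightarrow> real) \<Rightarrow> (nat \<Rightarrow> nat \<Rightarrow> real) \<Rightarrow> real ^ 'n \<Rightarrow> real ^ 'n" where
  "main_part w \<theta> z = (\<Sum>j\<in>{0..d}. w j *\<^sub>R \<sigma> j z) + (\<Sum>i\<in>{1..d}. \<Sum>j\<in>{1..d}. \<theta> i j *\<^sub>R Lop i j z)"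

definition area_part :: "(nat \<Rightarrow> nat \<Rightarrow> real) \<Rightarrow> real ^ 'n \<Rightarrow> real ^ 'n" where
  "area_part a z = (\<Sum>i\<in>{1..d}. \<Sum>j\<in>{i<..d}. a i j *\<^sub>R bracket d \<sigma> i j z)"

definition time_part :: "(nat \<Rightarrow> nat \<Rightarrow> real) \<Rightarrow> real ^ 'n \<Rightarrow> real ^ 'n" where
  "time_part \<theta> z = \<theta> 0 0 *\<^sub>R Lop 0 0 z + (\<Sum>j\<in>{1..d}. \<theta> 0 j *\<^sub>R Lop 0 j z + \<theta> j 0 *\<^sub>R Lop j 0 z)"

definition step_map :: "real \<Rightarrow> (nat \<Rightarrow> real) \<Rightarrow> (nat \<Rightarrow> nat \<Rightarrow> real) \<Rightarrow> (nat \<Rightarrow> nat \<Rightarrow> real) \<Rightarrow> real ^ 'n \<Rightarrow> real ^ 'n" where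
  "step_map \<epsilon> w \<theta> a z = z + main_part w \<theta> z + (\<epsilon> / 2) *\<^sub>R area_part a z + time_part \<theta> z"

lemma sum_from_zero: "(\<Sum>j\<in>{0..d}. f j) = f 0 + (\<Sum>j\<in>{1..d}. f j :: 'z::comm_monoid_add)"
  by (simp add: sum.atLeast_Suc_atMost)

lemma step_map_eq:
  "step_map \<epsilon> w \<theta> a z = z + (\<Sum>j\<in>{0..d}. w j *\<^sub>R \<sigma> j z)
       + (\<Sum>j1\<in>{0..d}. \<Sum>j2\<in>{0..d}. \<theta> j1 j2 *\<^sub>R gen_op d \<sigma> j1 (\<sigma> j2) z)
       + (\<epsilon> / 2) *\<^sub>R (\<Sum>j1\<in>{1..d}. \<Sum>j2\<in>{j1<..d}. a j1 j2 *\<^sub>R bracket d \<sigma> j1 j2 z)"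
  unfolding step_map_def main_part_def area_part_def time_part_def
  by (simp only: sum_from_zero sum.distrib) (simp add: algebra_simps)

lemma main_part_cong:
  assumes "\<And>j. j \<le> d \<Longrightarrow> w j = w' j" "\<And>j l. j \<in> {1..d} \<Longrightarrow> l \<in> {1..d} \<Longrightarrow> \<theta> j l = \<theta>' j l"
  shows "main_part w \<theta> z = main_part w' \<theta>' z"
  unfolding main_part_def using assms by (intro arg_cong2[where f="(+)"] sum.cong refl) auto

lemma area_part_cong:
  assumes "\<And>j l. j \<in> {1..d} \<Longrightarrow> l \<in> {j<..d} \<Longrightarrow> a j l = a' j l"
  shows "area_part a z = area_part a' z"
  unfolding area_part_def using assms by (intro sum.cong refl) auto

text \<open>
  Composing two steps produces the product terms \<open>w1\<^sub>i w2\<^sub>j L\<^sub>i \<sigma>\<^sub>j\<close>. Their symmetric part is merged into \<open>\<theta>\<close>. Their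
  antisymmetric part is an area, by \<open>sum_pairs_antisymmetric\<close>, and is
  written as an area with sign \<open>\<epsilon>\<close>. Exchanging the two steps together with reversing \<open>\<epsilon>\<close> therefore leaves the
  total area unchanged.
\<close>

lemma composed_main_part:
  assumes "\<epsilon> * \<epsilon> = 1"
  shows "main_part w1 \<theta>1 z + main_part w2 \<theta>2 z + (\<Sum>i\<in>{1..d}. \<Sum>j\<in>{1..d}. (w1 i * w2 j) *\<^sub>R Lop i j z)
      + (\<epsilon> / 2) *\<^sub>R (area_part a1 z + area_part a2 z)
    = main_part (\<lambda>j. w1 j + w2 j) (\<lambda>i j. \<theta>1 i j + \<theta>2 i j + (w1 i * w2 j + w2 i * w1 j) / 2) z
      + (\<epsilon> / 2) *\<^sub>R area_part (\<lambda>i j. a1 i j + a2 i j + \<epsilon> * (w1 i * w2 j - w2 i * w1 j)) z"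
proof -
  define c where "c i j = (w1 i * w2 j - w2 i * w1 j) / 2" for i j
  have "(\<Sum>i\<in>{1..d}. \<Sum>j\<in>{1..d}. (w1 i * w2 j) *\<^sub>R Lop i j z)
     = (\<Sum>i\<in>{1..d}. \<Sum>j\<in>{1..d}. ((w1 i * w2 j + w2 i * w1 j) / 2) *\<^sub>R Lop i j z + c i j *\<^sub>R Lop i j z)"
    unfolding c_def by (intro sum.cong refl) (simp add: scaleR_add_left[symmetric] field_simps)
  also have "\<dots> = (\<Sum>i\<in>{1..d}. \<Sum>j\<in>{1..d}. ((w1 i * w2 j + w2 i * w1 j) / 2) *\<^sub>R Lop i j z)
       + (\<Sum>i\<in>{1..d}. \<Sum>j\<in>{1..d}. c i j *\<^sub>R Lop i j z)"
    by (simp add: sum.distrib)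
  also have "(\<Sum>i\<in>{1..d}. \<Sum>j\<in>{1..d}. c i j *\<^sub>R Lop i j z) = (\<Sum>i\<in>{1..d}. \<Sum>j\<in>{i<..d}. c i j *\<^sub>R bracket d \<sigma> i j z)"
    unfolding bracket_def by (rule sum_pairs_antisymmetric) (simp add: c_def diff_divide_distrib mult.commute)
  also have "\<dots> = (\<epsilon> / 2) *\<^sub>R area_part (\<lambda>i j. \<epsilon> * (w1 i * w2 j - w2 i * w1 j)) z"
    unfolding area_part_def c_def scaleR_sum_right
    by (intro sum.cong refl) (use assms in \<open>simp add: mult.assoc[symmetric]\<close>)
  finally have X: "(\<Sum>i\<in>{1..d}. \<Sum>j\<in>{1..d}. (w1 i * w2 j) *\<^sub>R Lop i j z) =
      (\<Sum>i\<in>{1..d}. \<Sum>j\<in>{1..d}. ((w1 i * w2 j + w2 i * w1 j) / 2) *\<^sub>R Lop i j z)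
      + (\<epsilon> / 2) *\<^sub>R area_part (\<lambda>i j. \<epsilon> * (w1 i * w2 j - w2 i * w1 j)) z" .
  show ?thesis unfolding X
    by (simp add: main_part_def area_part_def scaleR_add_left sum.distrib scaleR_add_right)
qed

lemma step_map_measurable:
  assumes Z: "Z \<in> borel_measurable N" and w: "\<And>j. j \<in> {0..d} \<Longrightarrow> w j \<in> borel_measurable N"
    and \<theta>: "\<And>j l. j \<in> {0..d} \<Longrightarrow> l \<in> {0..d} \<Longrightarrow> \<theta> j l \<in> borel_measurable N"
    and a: "\<And>j l. j \<in> {1..d} \<Longrightarrow> l \<in> {j<..d} \<Longrightarrow> a j l \<in> borel_measurable N"
  shows "(\<lambda>\<omega>. step_map \<epsilon> (\<lambda>j. w j \<omega>) (\<lambda>j l. \<theta> j l \<omega>) (\<lambda>j l. a j l \<omega>) (Z \<omega>)) \<in> borel_measurable N"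
proof -
  have meas: "(\<lambda>\<omega>. f (Z \<omega>)) \<in> borel_measurable N" if "bounded_Lipschitz f" for f :: "real ^ 'n \<Rightarrow> real ^ 'n"
    using measurable_compose[OF Z bounded_Lipschitz_measurable[OF that]] .
  show ?thesis
    unfolding step_map_def main_part_def area_part_def time_part_def
    by (rule borel_measurable_add[OF borel_measurable_add[OF borel_measurable_add[OF Z]]];
      intro borel_measurable_add borel_measurable_sum borel_measurable_scaleR borel_measurable_const meas w \<theta> a
        bounded_Lipschitz_sigma bounded_Lipschitz_gen_op bounded_Lipschitz_bracket; simp)
qed

end

locale weak_steps = small_steps M I h hmax + smooth_coefficients d \<sigma>
  for M :: "'a measure" and I :: "'i set" and h hmax and d and \<sigma> :: "nat \<Rightarrow> real ^ 'n \<Rightarrow> real ^ 'n"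
begin

text \<open>
  Sizes of the random coefficients of a step, relative to an algebra \<open>G\<close> of past events. Index 0 is time:
  each index \<open>j \<ge> 1\<close> contributes 1 to the order, and each index 0 contributes 2. Pure time terms
  are the only ones that are not centered.
\<close>

definition step_noise :: "('i \<Rightarrow> 'a measure) \<Rightarrow> (nat \<Rightarrow> 'i \<Rightarrow> 'a \<Rightarrow> real) \<Rightarrow> (nat \<Rightarrow> nat \<Rightarrow> 'i \<Rightarrow> 'a \<Rightarrow> real) \<Rightarrow>
    (nat \<Rightarrow> nat \<Rightarrow> 'i \<Rightarrow> 'a \<Rightarrow> real) \<Rightarrow> bool" where
  "step_noise G w \<theta> a \<longleftrightarrow>
     of_order 2 (w 0) \<and> of_order 4 (\<theta> 0 0) \<and>
     (\<forall>j\<in>{1..d}. of_order 1 (w j) \<and> centered G (w j)) \<and>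
     (\<forall>j\<in>{1..d}. of_order 3 (\<theta> 0 j) \<and> centered G (\<theta> 0 j) \<and> of_order 3 (\<theta> j 0) \<and> centered G (\<theta> j 0)) \<and>
     (\<forall>i\<in>{1..d}. \<forall>j\<in>{1..d}. of_order 2 (\<theta> i j) \<and> centered G (\<theta> i j)) \<and>
     (\<forall>i\<in>{1..d}. \<forall>j\<in>{i<..d}. of_order 2 (a i j) \<and> centered G (a i j))"

definition adapted :: "('i \<Rightarrow> 'a measure) \<Rightarrow> ('i \<Rightarrow> 'a \<Rightarrow> 'z::euclidean_space) \<Rightarrow> bool" where
  "adapted G Z \<longleftrightarrow> (\<forall>i\<in>I. subalgebra M (G i) \<and> Z i \<in> borel_measurable (G i))"

lemma adapted_measurable: "adapted G Z \<Longrightarrow> i \<in> I \<Longrightarrow> Z i \<in> borel_measurable M"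
  unfolding adapted_def by (auto intro: measurable_from_subalg)

lemma adapted_compose:
  fixes f :: "'z::euclidean_space \<Rightarrow> 'y::euclidean_space"
  assumes "adapted G Z" "bounded_Lipschitz f" shows "adapted G (\<lambda>i \<omega>. f (Z i \<omega>))"
  using assms bounded_Lipschitz_measurable[OF assms(2)] unfolding adapted_def
  by (auto intro: measurable_compose)

lemma of_order_compose:
  fixes f :: "'z::euclidean_space \<Rightarrow> 'y::euclidean_space"
  assumes "adapted G Z" "bounded_Lipschitz f" shows "of_order 0 (\<lambda>i \<omega>. f (Z i \<omega>))"
proof -
  obtain K where K: "norm (f x) \<le> K" for x using bounded_LipschitzD1[OF assms(2)] by blast
  show ?thesis
    by (rule of_order_bounded[where K="K\<^sup>2"])
      (auto intro: power_mono K adapted_measurable[OF adapted_compose[OF assms]])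
qed

lemma of_order_coeff:
  fixes f :: "'z::euclidean_space \<Rightarrow> 'y::euclidean_space"
  assumes "of_order r \<theta>" "adapted G Z" "bounded_Lipschitz f"
  shows "of_order r (\<lambda>i \<omega>. \<theta> i \<omega> *\<^sub>R f (Z i \<omega>))"
  using of_order_mult[OF assms(1) of_order_compose[OF assms(2,3)]] by simp

lemma local_error_coeff:
  fixes f :: "'z::euclidean_space \<Rightarrow> 'y::euclidean_space"
  assumes "of_order (r + 1) \<theta>" "centered G \<theta>" "adapted G Z" "bounded_Lipschitz f"
  shows "local_error G r (\<lambda>i \<omega>. \<theta> i \<omega> *\<^sub>R f (Z i \<omega>))"
  using assms(1-2) adapted_compose[OF assms(3,4)]
  by (intro local_error_martingale of_order_coeff[OF assms(1,3,4)] centered_mult[OF _ _ of_order_compose[OF assms(3,4)]])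
    (auto simp: adapted_def)

lemma local_error_mult:
  assumes "of_order b \<theta>" "centered G \<theta>" "of_order c W" "\<And>i. i \<in> I \<Longrightarrow> W i \<in> borel_measurable (G i)" "b + c \<ge> r + 1"
  shows "local_error G r (\<lambda>i \<omega>. \<theta> i \<omega> *\<^sub>R W i \<omega>)"
  by (intro local_error_martingale of_order_mono[OF of_order_mult[OF assms(1,3)] assms(5)] centered_mult[OF assms(2,1,3,4)])

lemma of_order_Lipschitz_diff:
  fixes f :: "'z::euclidean_space \<Rightarrow> 'y::euclidean_space"
  assumes f: "bounded_Lipschitz f" and "adapted G1 Y" "adapted G2 Z" "of_order r (\<lambda>i \<omega>. Y i \<omega> - Z i \<omega>)"
  shows "of_order r (\<lambda>i \<omega>. f (Y i \<omega>) - f (Z i \<omega>))"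
proof -
  obtain L where L: "norm (f x - f y) \<le> L * norm (x - y)" for x y using bounded_LipschitzD2[OF f] by blast
  show ?thesis
    by (rule of_order_dominated[OF assms(4)])
      (auto intro: L borel_measurable_diff adapted_measurable[OF adapted_compose[OF assms(2) f]] adapted_measurable[OF adapted_compose[OF assms(3) f]])
qed

text \<open>
  The mixed terms have order 3 and are centered, and the pure time term has order 4: exactly what a
  local error of degree 2 allows.
\<close>

lemma local_error_time_part:
  assumes N: "step_noise G w \<theta> a" and Z: "adapted G Z"
  shows "local_error G 2 (\<lambda>i \<omega>. time_part (\<lambda>j1 j2. \<theta> j1 j2 i \<omega>) (Z i \<omega>))"
  unfolding time_part_def
proof (intro local_error_add local_error_sum)
  show "local_error G 2 (\<lambda>i \<omega>. \<theta> 0 0 i \<omega> *\<^sub>R Lop 0 0 (Z i \<omega>))"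
    using N by (intro local_error_drift of_order_coeff[OF _ Z bounded_Lipschitz_gen_op]) (auto simp: step_noise_def)
  fix j assume "j \<in> {1..d}"
  then show "local_error G 2 (\<lambda>i \<omega>. \<theta> 0 j i \<omega> *\<^sub>R Lop 0 j (Z i \<omega>))" "local_error G 2 (\<lambda>i \<omega>. \<theta> j 0 i \<omega> *\<^sub>R Lop j 0 (Z i \<omega>))"
    using N by (auto intro!: local_error_coeff[OF _ _ Z bounded_Lipschitz_gen_op] simp: step_noise_def)
qed auto

text \<open>
  The coefficients of the second step are expanded at the initial state \<open>Z\<close>. For \<open>\<sigma>\<^sub>j\<close> the linear term of
  the expansion, driven by the noise \<open>w1\<close> of the first step, yields the product terms of
  \<open>composed_main_part\<close>; the rest of \<open>\<sigma>\<^sub>j\<close> has order 2, and the increments of the other coefficients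
  have order 1. Multiplied by noise of the second step of order 1 or 2, both become terms of order 3. These
  are centered given \<open>G1\<close>, the past including the first step, and a fortiori given \<open>G\<close>. The drift of the
  second step is not centered, but its length is deterministic, so that its
  product with the first noise \<open>w1\<close> is centered given \<open>G\<close>; what else it multiplies has order 2, which gives
  order 4 in total.
\<close>

theorem composed_step_expansion:
  assumes N1: "step_noise G w1 \<theta>1 a1" and N2: "step_noise G1 w2 \<theta>2 a2"
    and Z: "adapted G Z"
    and sub: "\<And>i. i \<in> I \<Longrightarrow> subalgebra (G1 i) (G i)" "\<And>i. i \<in> I \<Longrightarrow> subalgebra M (G1 i)"
    and m1: "\<And>j i. j \<in> {0..d} \<Longrightarrow> i \<in> I \<Longrightarrow> w1 j i \<in> borel_measurable (G1 i)"
      "\<And>j l i. j \<in> {0..d} \<Longrightarrow> l \<in> {0..d} \<Longrightarrow> i \<in> I \<Longrightarrow> \<theta>1 j l i \<in> borel_measurable (G1 i)"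
      "\<And>j l i. j \<in> {1..d} \<Longrightarrow> l \<in> {j<..d} \<Longrightarrow> i \<in> I \<Longrightarrow> a1 j l i \<in> borel_measurable (G1 i)"
    and time: "\<And>i \<omega>. w2 0 i \<omega> = \<tau> i"
    and eps: "\<epsilon> * \<epsilon> = 1"
  shows "\<exists>R. local_error G 2 R \<and>
     (\<forall>i \<omega>. step_map \<epsilon> (\<lambda>j. w2 j i \<omega>) (\<lambda>j l. \<theta>2 j l i \<omega>) (\<lambda>j l. a2 j l i \<omega>)
            (step_map \<epsilon> (\<lambda>j. w1 j i \<omega>) (\<lambda>j l. \<theta>1 j l i \<omega>) (\<lambda>j l. a1 j l i \<omega>) (Z i \<omega>))
        = Z i \<omega> + main_part (\<lambda>j. w1 j i \<omega> + w2 j i \<omega>)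
              (\<lambda>j l. \<theta>1 j l i \<omega> + \<theta>2 j l i \<omega> + (w1 j i \<omega> * w2 l i \<omega> + w2 j i \<omega> * w1 l i \<omega>) / 2) (Z i \<omega>)
          + (\<epsilon> / 2) *\<^sub>R area_part (\<lambda>j l. a1 j l i \<omega> + a2 j l i \<omega> + \<epsilon> * (w1 j i \<omega> * w2 l i \<omega> - w2 j i \<omega> * w1 l i \<omega>)) (Z i \<omega>)
          + R i \<omega>)"
proof -
  have ZG1: "adapted G1 Z" using Z sub by (auto simp: adapted_def intro: measurable_from_subalg)
  define Y where "Y i \<omega> = step_map \<epsilon> (\<lambda>j. w1 j i \<omega>) (\<lambda>j l. \<theta>1 j l i \<omega>) (\<lambda>j l. a1 j l i \<omega>) (Z i \<omega>)" for i \<omega>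
  have meas: "(\<lambda>\<omega>. f (Z i \<omega>)) \<in> borel_measurable (G1 i)" if "bounded_Lipschitz f" "i \<in> I" for f :: "real ^ 'n \<Rightarrow> real ^ 'n" and i
    using adapted_compose[OF ZG1 that(1)] that(2) by (simp add: adapted_def)
  \<comment> \<open>The first step is the noise of order 1 plus \<open>\<rho>\<close>, which has order 2.\<close>
  define \<rho> where "\<rho> i \<omega> = w1 0 i \<omega> *\<^sub>R \<sigma> 0 (Z i \<omega>) + (\<Sum>j\<in>{1..d}. \<Sum>l\<in>{1..d}. \<theta>1 j l i \<omega> *\<^sub>R Lop j l (Z i \<omega>))
      + (\<epsilon> / 2) *\<^sub>R area_part (\<lambda>j l. a1 j l i \<omega>) (Z i \<omega>) + time_part (\<lambda>j l. \<theta>1 j l i \<omega>) (Z i \<omega>)" for i \<omega>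
  have Y_eq: "Y i \<omega> = Z i \<omega> + ((\<Sum>j\<in>{1..d}. w1 j i \<omega> *\<^sub>R \<sigma> j (Z i \<omega>)) + \<rho> i \<omega>)" for i \<omega>
    unfolding Y_def \<rho>_def step_map_def main_part_def by (simp add: sum_from_zero algebra_simps)
  have \<rho>: "of_order 2 \<rho>" unfolding \<rho>_def area_part_def
  proof (intro of_order_add of_order_sum of_order_scaleR of_order_mono[OF local_error_of_order[OF local_error_time_part[OF N1 Z]]])
    show "of_order 2 (\<lambda>i \<omega>. w1 0 i \<omega> *\<^sub>R \<sigma> 0 (Z i \<omega>))"
      using N1 by (intro of_order_coeff[OF _ Z] bounded_Lipschitz_sigma) (auto simp: step_noise_def)
    show "of_order 2 (\<lambda>i \<omega>. \<theta>1 j l i \<omega> *\<^sub>R Lop j l (Z i \<omega>))" if "j \<in> {1..d}" "l \<in> {1..d}" for j l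
      using N1 that by (intro of_order_coeff[OF _ Z] bounded_Lipschitz_gen_op) (auto simp: step_noise_def)
    show "of_order 2 (\<lambda>i \<omega>. a1 j l i \<omega> *\<^sub>R bracket d \<sigma> j l (Z i \<omega>))" if "j \<in> {1..d}" "l \<in> {j<..d}" for j l
      using N1 that by (intro of_order_coeff[OF _ Z] bounded_Lipschitz_bracket) (auto simp: step_noise_def)
  qed auto
  have inc: "of_order 1 (\<lambda>i \<omega>. Y i \<omega> - Z i \<omega>)"
    unfolding Y_eq add_diff_cancel_left'
    using N1 by (intro of_order_add of_order_sum of_order_mono[OF \<rho>] of_order_coeff[OF _ Z] bounded_Lipschitz_sigma) (auto simp: step_noise_def)
  have YG1: "adapted G1 Y"
    unfolding adapted_def
  proof (intro ballI conjI sub(2))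
    fix i assume i: "i \<in> I"
    have Zi: "Z i \<in> borel_measurable (G1 i)" using ZG1 i by (simp add: adapted_def)
    show "Y i \<in> borel_measurable (G1 i)"
      unfolding Y_def[abs_def] by (intro step_map_measurable Zi m1 i)
  qed
  \<comment> \<open>\<open>Q j\<close> is what remains of \<open>\<sigma>\<^sub>j (Y) - \<sigma>\<^sub>j (Z)\<close> without the part that is linear in the noise \<open>w1\<close>.\<close>
  define Q where "Q j i \<omega> = \<sigma> j (Y i \<omega>) - \<sigma> j (Z i \<omega>) - (\<Sum>l\<in>{1..d}. w1 l i \<omega> *\<^sub>R Lop l j (Z i \<omega>))" for j i \<omega>
  have QG1: "Q j i \<in> borel_measurable (G1 i)" if "j \<le> d" "i \<in> I" for j i
  proof -
    have sY: "(\<lambda>\<omega>. \<sigma> j (Y i \<omega>)) \<in> borel_measurable (G1 i)"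
      using adapted_compose[OF YG1 bounded_Lipschitz_sigma[OF that(1)]] that(2) by (simp add: adapted_def)
    show ?thesis unfolding Q_def[abs_def]
      by (rule borel_measurable_diff[OF borel_measurable_diff[OF sY meas[OF bounded_Lipschitz_sigma[OF that(1)] that(2)]]];
        intro borel_measurable_sum borel_measurable_scaleR meas[OF _ that(2)] m1(1)[OF _ that(2)] bounded_Lipschitz_gen_op; use that in simp)
  qed
  have Q: "of_order 2 (Q j)" if j: "j \<le> d" for j
  proof -
    obtain C where C: "C \<ge> 0" "norm (\<sigma> j (z + v) - \<sigma> j z - directional_deriv (\<sigma> j) z v) \<le> C * norm v ^ 2" for z v
      using sigma_Taylor[OF j] by blast
    obtain D where D: "D \<ge> 0" "norm (directional_deriv (\<sigma> j) z v) \<le> D * norm v" for z v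
      using directional_deriv_sigma_bounded[OF j] by blast
    define V where "V i \<omega> = norm (Y i \<omega> - Z i \<omega>) * norm (Y i \<omega> - Z i \<omega>) + norm (\<rho> i \<omega>)" for i \<omega>
    have V: "of_order 2 V" unfolding V_def[abs_def]
      using of_order_mult[OF of_order_norm[OF inc] of_order_norm[OF inc]]
      by (intro of_order_add of_order_norm \<rho>) (simp add: numeral_2_eq_2)
    have "norm (Q j i \<omega>) \<le> (C + D) * norm (V i \<omega>)" for i \<omega>
    proof -
      define v where "v = Y i \<omega> - Z i \<omega>"
      have "directional_deriv (\<sigma> j) (Z i \<omega>) v = (\<Sum>l\<in>{1..d}. w1 l i \<omega> *\<^sub>R Lop l j (Z i \<omega>)) + directional_deriv (\<sigma> j) (Z i \<omega>) (\<rho> i \<omega>)"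
        unfolding v_def Y_eq add_diff_cancel_left' directional_deriv_linear
        by (simp add: gen_op_eq_directional_deriv)
      then have "Q j i \<omega> = (\<sigma> j (Z i \<omega> + v) - \<sigma> j (Z i \<omega>) - directional_deriv (\<sigma> j) (Z i \<omega>) v) + directional_deriv (\<sigma> j) (Z i \<omega>) (\<rho> i \<omega>)"
        by (simp add: Q_def v_def)
      also have "norm \<dots> \<le> C * norm v ^ 2 + D * norm (\<rho> i \<omega>)"
        by (intro norm_triangle_mono C D)
      also have "\<dots> \<le> (C + D) * norm v ^ 2 + (C + D) * norm (\<rho> i \<omega>)"
        using C D by (intro add_mono mult_right_mono) auto
      also have "\<dots> = (C + D) * norm (V i \<omega>)" by (simp add: V_def v_def power2_eq_square distrib_left)
      finally show ?thesis .
    qed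
    moreover have "Q j i \<in> borel_measurable M" if "i \<in> I" for i
      using QG1[OF j that] sub(2)[OF that] by (rule measurable_from_subalg[rotated])
    ultimately show ?thesis by (intro of_order_dominated[OF V]) auto
  qed
  \<comment> \<open>\<open>Ra\<close> has order 4, \<open>Rb\<close> is centered given \<open>G\<close>, and \<open>Rc\<close> is a local error relative to \<open>G1\<close>.\<close>
  define Ra where "Ra i \<omega> = w2 0 i \<omega> *\<^sub>R Q 0 i \<omega>" for i \<omega>
  define Rb where "Rb i \<omega> = (\<Sum>l\<in>{1..d}. w1 l i \<omega> *\<^sub>R (\<tau> i *\<^sub>R Lop l 0 (Z i \<omega>)))" for i \<omega>
  define Rc where "Rc i \<omega> = (\<Sum>j\<in>{1..d}. w2 j i \<omega> *\<^sub>R Q j i \<omega>)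
       + (\<Sum>j\<in>{1..d}. \<Sum>l\<in>{1..d}. \<theta>2 j l i \<omega> *\<^sub>R (Lop j l (Y i \<omega>) - Lop j l (Z i \<omega>)))
       + (\<epsilon> / 2) *\<^sub>R (\<Sum>j\<in>{1..d}. \<Sum>l\<in>{j<..d}. a2 j l i \<omega> *\<^sub>R (bracket d \<sigma> j l (Y i \<omega>) - bracket d \<sigma> j l (Z i \<omega>)))
       + time_part (\<lambda>j l. \<theta>2 j l i \<omega>) (Y i \<omega>)" for i \<omega>
  define R where "R i \<omega> = Ra i \<omega> + (Rb i \<omega> + (time_part (\<lambda>j l. \<theta>1 j l i \<omega>) (Z i \<omega>) + Rc i \<omega>))" for i \<omega>
  have Ra: "local_error G 2 Ra" unfolding Ra_def[abs_def]
    using of_order_mult[OF _ Q[of 0], of 2 "w2 0"] N2 by (intro local_error_drift) (simp add: step_noise_def)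
  have Rb: "local_error G 2 Rb" unfolding Rb_def[abs_def]
  proof (intro local_error_sum)
    fix l assume l: "l \<in> {1..d}"
    have "of_order 2 (\<lambda>i \<omega>. w2 0 i \<omega> *\<^sub>R Lop l 0 (Z i \<omega>))"
      using N2 l by (intro of_order_coeff[OF _ Z] bounded_Lipschitz_gen_op) (auto simp: step_noise_def)
    then have o: "of_order 2 (\<lambda>i \<omega>. \<tau> i *\<^sub>R Lop l 0 (Z i \<omega>))" by (simp add: time)
    have "(\<lambda>\<omega>. Lop l 0 (Z i \<omega>)) \<in> borel_measurable (G i)" if "i \<in> I" for i
      using adapted_compose[OF Z bounded_Lipschitz_gen_op[of l 0]] l that by (simp add: adapted_def)
    then show "local_error G 2 (\<lambda>i \<omega>. w1 l i \<omega> *\<^sub>R (\<tau> i *\<^sub>R Lop l 0 (Z i \<omega>)))"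
      using N1 l by (intro local_error_mult[OF _ _ o, of 1]) (auto simp: step_noise_def)
  qed auto
  have diff_meas: "(\<lambda>\<omega>. f (Y i \<omega>) - f (Z i \<omega>)) \<in> borel_measurable (G1 i)" if "bounded_Lipschitz f" "i \<in> I" for f :: "real ^ 'n \<Rightarrow> real ^ 'n" and i
    using adapted_compose[OF YG1 that(1)] adapted_compose[OF ZG1 that(1)] that(2)
    by (intro borel_measurable_diff) (auto simp: adapted_def)
  have Rc: "local_error G1 2 Rc" unfolding Rc_def[abs_def]
  proof (intro local_error_add local_error_sum local_error_scaleR local_error_time_part[OF N2 YG1])
    fix j assume j: "j \<in> {1..d}"
    show "local_error G1 2 (\<lambda>i \<omega>. w2 j i \<omega> *\<^sub>R Q j i \<omega>)"
      using N2 j QG1 by (intro local_error_mult[OF _ _ Q, of 1]) (auto simp: step_noise_def)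
    show "local_error G1 2 (\<lambda>i \<omega>. \<theta>2 j l i \<omega> *\<^sub>R (Lop j l (Y i \<omega>) - Lop j l (Z i \<omega>)))" if "l \<in> {1..d}" for l
      using N2 j that
      by (intro local_error_mult[OF _ _ of_order_Lipschitz_diff[OF _ YG1 ZG1 inc], of 2] diff_meas bounded_Lipschitz_gen_op) (auto simp: step_noise_def)
    show "local_error G1 2 (\<lambda>i \<omega>. a2 j l i \<omega> *\<^sub>R (bracket d \<sigma> j l (Y i \<omega>) - bracket d \<sigma> j l (Z i \<omega>)))" if "l \<in> {j<..d}" for l
      using N2 j that
      by (intro local_error_mult[OF _ _ of_order_Lipschitz_diff[OF _ YG1 ZG1 inc], of 2] diff_meas bounded_Lipschitz_bracket) (auto simp: step_noise_def)
  qed auto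
  have Rerr: "local_error G 2 R" unfolding R_def[abs_def]
    by (intro local_error_add Ra Rb local_error_time_part[OF N1 Z] local_error_mono[OF Rc _ sub(1)]) simp_all
  have main_diff: "main_part (\<lambda>j. w2 j i \<omega>) (\<lambda>j l. \<theta>2 j l i \<omega>) (Y i \<omega>) = main_part (\<lambda>j. w2 j i \<omega>) (\<lambda>j l. \<theta>2 j l i \<omega>) (Z i \<omega>)
      + (\<Sum>j\<in>{1..d}. \<Sum>l\<in>{1..d}. (w1 j i \<omega> * w2 l i \<omega>) *\<^sub>R Lop j l (Z i \<omega>))
      + (Ra i \<omega> + Rb i \<omega> + (\<Sum>j\<in>{1..d}. w2 j i \<omega> *\<^sub>R Q j i \<omega>)
       + (\<Sum>j\<in>{1..d}. \<Sum>l\<in>{1..d}. \<theta>2 j l i \<omega> *\<^sub>R (Lop j l (Y i \<omega>) - Lop j l (Z i \<omega>))))" for i \<omega>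
  proof -
    have s: "\<sigma> j (Y i \<omega>) = \<sigma> j (Z i \<omega>) + (\<Sum>l\<in>{1..d}. w1 l i \<omega> *\<^sub>R Lop l j (Z i \<omega>)) + Q j i \<omega>" for j
      by (simp add: Q_def)
    have sw: "(\<Sum>j\<in>{1..d}. \<Sum>l\<in>{1..d}. (w1 j i \<omega> * w2 l i \<omega>) *\<^sub>R Lop j l (Z i \<omega>)) = (\<Sum>j\<in>{1..d}. \<Sum>l\<in>{1..d}. (w1 l i \<omega> * w2 j i \<omega>) *\<^sub>R Lop l j (Z i \<omega>))"
      by (rule sum.swap)
    have Rb': "Rb i \<omega> = w2 0 i \<omega> *\<^sub>R (\<Sum>l\<in>{1..d}. w1 l i \<omega> *\<^sub>R Lop l 0 (Z i \<omega>))"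
      by (simp add: Rb_def time scaleR_sum_right mult.commute)
    show ?thesis unfolding main_part_def sum_from_zero s sw Rb' Ra_def
      by (simp add: scaleR_add_right sum.distrib scaleR_diff_right sum_subtractf scaleR_sum_right mult.commute)
  qed
  have area_diff: "area_part (\<lambda>j l. a2 j l i \<omega>) (Y i \<omega>) = area_part (\<lambda>j l. a2 j l i \<omega>) (Z i \<omega>)
      + (\<Sum>j\<in>{1..d}. \<Sum>l\<in>{j<..d}. a2 j l i \<omega> *\<^sub>R (bracket d \<sigma> j l (Y i \<omega>) - bracket d \<sigma> j l (Z i \<omega>)))" for i \<omega>
    by (simp add: area_part_def scaleR_diff_right sum_subtractf)
  have "step_map \<epsilon> (\<lambda>j. w2 j i \<omega>) (\<lambda>j l. \<theta>2 j l i \<omega>) (\<lambda>j l. a2 j l i \<omega>) (Y i \<omega>)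
        = Z i \<omega> + (main_part (\<lambda>j. w1 j i \<omega>) (\<lambda>j l. \<theta>1 j l i \<omega>) (Z i \<omega>) + main_part (\<lambda>j. w2 j i \<omega>) (\<lambda>j l. \<theta>2 j l i \<omega>) (Z i \<omega>)
          + (\<Sum>j\<in>{1..d}. \<Sum>l\<in>{1..d}. (w1 j i \<omega> * w2 l i \<omega>) *\<^sub>R Lop j l (Z i \<omega>))
          + (\<epsilon> / 2) *\<^sub>R (area_part (\<lambda>j l. a1 j l i \<omega>) (Z i \<omega>) + area_part (\<lambda>j l. a2 j l i \<omega>) (Z i \<omega>))) + R i \<omega>" for i \<omega>
    unfolding step_map_def main_diff area_diff R_def Rc_def
    unfolding Y_def step_map_def by (simp add: scaleR_add_right)
  then show ?thesis unfolding composed_main_part[OF eps] Y_def using Rerr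
    by (intro exI[of _ R] conjI allI) (auto simp: add.assoc)
qed

end

section \<open>Antithetic averages\<close>

text \<open>
  \<open>G i\<close> is the past of the step \<open>i\<close> and \<open>H i\<close> the algebra of the noise in that step; \<open>w\<close> and \<open>\<theta>\<close> are the
  coefficients in the common \<open>main_part\<close> of the schemes.
\<close>

locale driven_scheme = dyadic_filtration M T G + smooth_coefficients d \<sigma>
  for M :: "'a measure" and T and G and d and \<sigma> :: "nat \<Rightarrow> real ^ 'n \<Rightarrow> real ^ 'n" +
  fixes H :: "nat \<times> nat \<Rightarrow> 'a measure"
    and w :: "nat \<Rightarrow> nat \<times> nat \<Rightarrow> 'a \<Rightarrow> real" and \<theta> :: "nat \<Rightarrow> nat \<Rightarrow> nat \<times> nat \<Rightarrow> 'a \<Rightarrow> real"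
  assumes H_sub: "\<And>i. subalgebra M (H i)"
    and GH_indep: "\<And>i. i \<in> dyadic_steps \<Longrightarrow> indep_set (sets (G i)) (sets (H i))"
    and w_time: "of_order 2 (w 0)"
    and w_noise: "\<And>j. j \<in> {1..d} \<Longrightarrow> of_order 1 (w j) \<and> centered G (w j)"
    and \<theta>_noise: "\<And>j l. j \<in> {1..d} \<Longrightarrow> l \<in> {1..d} \<Longrightarrow> of_order 2 (\<theta> j l) \<and> centered G (\<theta> j l)"
    and w_H: "\<And>j i. j \<le> d \<Longrightarrow> i \<in> dyadic_steps \<Longrightarrow> w j i \<in> borel_measurable (H i)"
    and \<theta>_H: "\<And>j l i. j \<in> {1..d} \<Longrightarrow> l \<in> {1..d} \<Longrightarrow> i \<in> dyadic_steps \<Longrightarrow> \<theta> j l i \<in> borel_measurable (H i)"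

sublocale driven_scheme \<subseteq> weak_steps M "dyadic_steps" "\<lambda>i. T / 2 ^ fst i" T d \<sigma>
  by unfold_locales

context driven_scheme
begin

abbreviation main :: "nat \<times> nat \<Rightarrow> 'a \<Rightarrow> real ^ 'n \<Rightarrow> real ^ 'n" where
  "main i \<omega> \<equiv> main_part (\<lambda>j. w j i \<omega>) (\<lambda>j l. \<theta> j l i \<omega>)"

definition state_process :: "(nat \<times> nat \<Rightarrow> 'a \<Rightarrow> 'z::euclidean_space) \<Rightarrow> bool" where
  "state_process Z \<longleftrightarrow> (\<forall>n k. k \<le> 2 ^ n \<longrightarrow> Z (n, k) \<in> borel_measurable (G (n, k)))"

lemma state_process_adapted: "state_process Z \<Longrightarrow> adapted G Z"
  using G_sub by (auto simp: state_process_def adapted_def)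

lemma of_order_0_diff:
  fixes f :: "'z::euclidean_space \<Rightarrow> 'y::euclidean_space"
  assumes "adapted G U" "adapted G V" "bounded_Lipschitz f"
  shows "of_order 0 (\<lambda>i \<omega>. f (U i \<omega>) - f (V i \<omega>))"
  by (intro of_order_diff of_order_compose[OF assms(1,3)] of_order_compose[OF assms(2,3)])

lemma adapted_diff_measurable:
  fixes f :: "'z::euclidean_space \<Rightarrow> 'y::euclidean_space"
  assumes "adapted G U" "adapted G V" "bounded_Lipschitz f" "i \<in> dyadic_steps"
  shows "(\<lambda>\<omega>. f (U i \<omega>) - f (V i \<omega>)) \<in> borel_measurable (G i)"
  using adapted_compose[OF assms(1,3)] adapted_compose[OF assms(2,3)] assms(4)
  by (intro borel_measurable_diff) (auto simp: adapted_def)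

text \<open>
  The difference of the coefficients is known in the past, so it is independent of the noise.
\<close>

lemma relative_order_Lipschitz_noise:
  fixes f :: "'z::euclidean_space \<Rightarrow> 'y::euclidean_space"
  assumes U: "adapted G U" and V: "adapted G V" and f: "bounded_Lipschitz f"
    and "of_order b \<phi>" "\<And>i. i \<in> dyadic_steps \<Longrightarrow> \<phi> i \<in> borel_measurable (H i)"
  shows "relative_order r b (\<lambda>i \<omega>. U i \<omega> - V i \<omega>) (\<lambda>i \<omega>. \<phi> i \<omega> *\<^sub>R (f (U i \<omega>) - f (V i \<omega>)))"
proof -
  obtain L where L: "norm (f x - f y) \<le> L * norm (x - y)" for x y using bounded_LipschitzD2[OF f] by blast
  show ?thesis
  proof (rule relative_order_indep_mult[of G H])
    show "norm (f (U i \<omega>) - f (V i \<omega>)) \<le> L * norm (U i \<omega> - V i \<omega>)" for i \<omega> by (rule L)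
    show "(\<lambda>\<omega>. U i \<omega> - V i \<omega>) \<in> borel_measurable M" if "i \<in> dyadic_steps" for i
      by (intro borel_measurable_diff adapted_measurable[OF U that] adapted_measurable[OF V that])
  qed (use assms in \<open>auto intro: G_sub H_sub GH_indep adapted_diff_measurable[OF U V f]\<close>)
qed

lemma main_part_diff:
  "main i \<omega> u - main i \<omega> v = w 0 i \<omega> *\<^sub>R (\<sigma> 0 u - \<sigma> 0 v) + ((\<Sum>j\<in>{1..d}. w j i \<omega> *\<^sub>R (\<sigma> j u - \<sigma> j v))
     + (\<Sum>j\<in>{1..d}. \<Sum>l\<in>{1..d}. \<theta> j l i \<omega> *\<^sub>R (Lop j l u - Lop j l v)))"
  unfolding main_part_def sum_from_zero by (simp add: scaleR_diff_right sum_subtractf)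

text \<open>
  Two solutions of the common recursion, up to a local error, satisfy the hypotheses of \<open>stability\<close>:
  the difference of the main parts is a martingale increment of relative order 1 plus, from the
  drift, a term of relative order 2.
\<close>

theorem main_part_stability:
  assumes U: "state_process U" and V: "state_process V"
    and init: "\<And>n \<omega>. U (n, 0) \<omega> = V (n, 0) \<omega>"
    and step: "\<And>n k \<omega>. k < 2 ^ n \<Longrightarrow> U (n, Suc k) \<omega> - V (n, Suc k) \<omega>
        = (U (n, k) \<omega> - V (n, k) \<omega>) + (main (n, k) \<omega> (U (n, k) \<omega>) - main (n, k) \<omega> (V (n, k) \<omega>)) + R (n, k) \<omega>"
    and R: "local_error G r R"
  shows stability_of_order: "of_order r (\<lambda>i \<omega>. U i \<omega> - V i \<omega>)"
    and stability_maximum: "q \<ge> 1 \<Longrightarrow> \<exists>C\<ge>0. \<forall>n.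
        (\<integral>\<^sup>+\<omega>. ennreal (MAX k\<in>{..2 ^ n}. norm (U (n, k) \<omega> - V (n, k) \<omega>) ^ (2 * q)) \<partial>M) \<le> ennreal (C * (T / 2 ^ n) ^ (r * q))"
proof -
  note UA = state_process_adapted[OF U] and VA = state_process_adapted[OF V]
  obtain mR dR where R_eq: "R = (\<lambda>i \<omega>. mR i \<omega> + dR i \<omega>)" and mR: "of_order (r + 1) mR" "centered G mR" and dR: "of_order (r + 2) dR"
    using R unfolding local_error_def by blast
  define E where "E i \<omega> = U i \<omega> - V i \<omega>" for i \<omega>
  define P where "P i \<omega> = (\<Sum>j\<in>{1..d}. w j i \<omega> *\<^sub>R (\<sigma> j (U i \<omega>) - \<sigma> j (V i \<omega>)))
     + (\<Sum>j\<in>{1..d}. \<Sum>l\<in>{1..d}. \<theta> j l i \<omega> *\<^sub>R (Lop j l (U i \<omega>) - Lop j l (V i \<omega>)))" for i \<omega>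
  define m where "m i \<omega> = P i \<omega> + mR i \<omega>" for i \<omega>
  define D where "D i \<omega> = w 0 i \<omega> *\<^sub>R (\<sigma> 0 (U i \<omega>) - \<sigma> 0 (V i \<omega>)) + dR i \<omega>" for i \<omega>
  have E: "E (n, k) \<in> borel_measurable (G (n, k))" if "k \<le> 2 ^ n" for n k
    unfolding E_def[abs_def] using U V that by (intro borel_measurable_diff) (auto simp: state_process_def)
  have "local_error G 0 P" unfolding P_def[abs_def]
    using w_noise \<theta>_noise
    by (intro local_error_add local_error_sum local_error_mult[OF _ _ of_order_0_diff[OF UA VA], of 1]
        local_error_mult[OF _ _ of_order_0_diff[OF UA VA], of 2] adapted_diff_measurable[OF UA VA]
        bounded_Lipschitz_sigma bounded_Lipschitz_gen_op) auto
  then have Po: "of_order 1 P" using local_error_of_order by fastforce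
  have Pc: "centered G P"
  proof -
    have c1: "centered G (\<lambda>i \<omega>. \<phi> i \<omega> *\<^sub>R (f (U i \<omega>) - f (V i \<omega>)))" "of_order b (\<lambda>i \<omega>. \<phi> i \<omega> *\<^sub>R (f (U i \<omega>) - f (V i \<omega>)))"
      if "centered G \<phi>" "of_order b \<phi>" "bounded_Lipschitz f" for \<phi> b and f :: "real ^ 'n \<Rightarrow> real ^ 'n"
      using centered_mult[OF that(1,2) of_order_0_diff[OF UA VA that(3)]] adapted_diff_measurable[OF UA VA that(3)]
        of_order_mult[OF that(2) of_order_0_diff[OF UA VA that(3)]] by auto
    have csum: "centered G (\<lambda>i \<omega>. \<Sum>x\<in>A. Z x i \<omega>)" if "\<And>x. x \<in> A \<Longrightarrow> centered G (Z x) \<and> of_order b (Z x)" "finite A"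
      for A :: "'y set" and Z :: "'y \<Rightarrow> nat \<times> nat \<Rightarrow> 'a \<Rightarrow> real ^ 'n" and b
      using that(2,1)
    proof (induction A)
      case (insert x F)
      then show ?case by (simp, intro centered_add[of _ _ _ b b] of_order_sum) auto
    qed (simp add: centered_zero)
    show ?thesis unfolding P_def[abs_def]
      using w_noise \<theta>_noise
      by (intro centered_add[of _ _ _ 1 2] csum[of _ _ 1] csum[of _ _ 2] conjI c1 of_order_sum bounded_Lipschitz_sigma bounded_Lipschitz_gen_op) auto
  qed
  have mc: "centered G m" unfolding m_def[abs_def] by (rule centered_add[OF Pc mR(2) Po mR(1)])
  have mrel: "relative_order r 1 E m" unfolding m_def[abs_def] P_def[abs_def] E_def[abs_def]
  proof (intro relative_order_add relative_order_sum finite_atLeastAtMost)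
    show "relative_order r 1 (\<lambda>i \<omega>. U i \<omega> - V i \<omega>) mR" by (rule relative_order_of_order[OF mR(1)])
    fix j assume j: "j \<in> {1..d}"
    show "relative_order r 1 (\<lambda>i \<omega>. U i \<omega> - V i \<omega>) (\<lambda>i \<omega>. w j i \<omega> *\<^sub>R (\<sigma> j (U i \<omega>) - \<sigma> j (V i \<omega>)))"
      using w_noise[OF j] w_H j by (intro relative_order_Lipschitz_noise UA VA bounded_Lipschitz_sigma) auto
    show "relative_order r 1 (\<lambda>i \<omega>. U i \<omega> - V i \<omega>) (\<lambda>i \<omega>. \<theta> j l i \<omega> *\<^sub>R (Lop j l (U i \<omega>) - Lop j l (V i \<omega>)))"
      if l: "l \<in> {1..d}" for l
      using of_order_mono[of 2 "\<theta> j l" 1] \<theta>_noise[OF j l] \<theta>_H[OF j l] j l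
      by (intro relative_order_Lipschitz_noise UA VA bounded_Lipschitz_gen_op) auto
  qed
  have drel: "relative_order r 2 E D" unfolding D_def[abs_def] E_def[abs_def]
    by (intro relative_order_add relative_order_of_order dR relative_order_Lipschitz_noise UA VA
        bounded_Lipschitz_sigma w_time w_H) auto
  have E0: "E (n, 0) \<omega> = 0" for n \<omega> by (simp add: E_def init)
  have Estep: "E (n, Suc k) \<omega> = E (n, k) \<omega> + m (n, k) \<omega> + D (n, k) \<omega>" if "k < 2 ^ n" for n k \<omega>
    unfolding E_def step[OF that] main_part_diff m_def D_def P_def R_eq by simp
  show "of_order r (\<lambda>i \<omega>. U i \<omega> - V i \<omega>)"
  proof (rule of_orderI)
    show "(\<lambda>\<omega>. U i \<omega> - V i \<omega>) \<in> borel_measurable M" if "i \<in> dyadic_steps" for i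
      by (intro borel_measurable_diff adapted_measurable[OF UA that] adapted_measurable[OF VA that])
    fix q
    obtain C where "C \<ge> 0" "\<And>n k. k \<le> 2 ^ n \<Longrightarrow> absmom M q (E (n, k)) \<le> ennreal (C * (T / 2 ^ n) ^ (r * q))"
      using stability_moments[OF E0 Estep E mc mrel drel, of q] by blast
    then show "\<exists>C\<ge>0. \<forall>i\<in>dyadic_steps. absmom M q (\<lambda>\<omega>. U i \<omega> - V i \<omega>) \<le> ennreal (C * (T / 2 ^ fst i) ^ (r * q))"
      unfolding E_def[abs_def] by (intro exI[of _ C]) auto
  qed
  assume "q \<ge> 1"
  from stability_max[OF E0 Estep E mc mrel drel this]
  show "\<exists>C\<ge>0. \<forall>n. (\<integral>\<^sup>+\<omega>. ennreal (MAX k\<in>{..2 ^ n}. norm (U (n, k) \<omega> - V (n, k) \<omega>) ^ (2 * q)) \<partial>M) \<le> ennreal (C * (T / 2 ^ n) ^ (r * q))"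
    unfolding E_def .
qed

text \<open>
  Two schemes with the common main part and the same areas \<open>a\<close>, taken with opposite signs.
\<close>

definition antithetic_pair where
  "antithetic_pair x a Zp Zm \<longleftrightarrow> state_process Zp \<and> state_process Zm \<and>
     (\<forall>n \<omega>. Zp (n, 0) \<omega> = x \<and> Zm (n, 0) \<omega> = x) \<and>
     (\<forall>j\<in>{1..d}. \<forall>l\<in>{j<..d}. of_order 2 (a j l) \<and> centered G (a j l)) \<and>
     (\<exists>Rp Rm. local_error G 2 Rp \<and> local_error G 2 Rm \<and>
       (\<forall>n k \<omega>. k < 2 ^ n \<longrightarrow>
          Zp (n, Suc k) \<omega> = Zp (n, k) \<omega> + main (n, k) \<omega> (Zp (n, k) \<omega>)
             + (1 / 2) *\<^sub>R area_part (\<lambda>j l. a j l (n, k) \<omega>) (Zp (n, k) \<omega>) + Rp (n, k) \<omega> \<and>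
          Zm (n, Suc k) \<omega> = Zm (n, k) \<omega> + main (n, k) \<omega> (Zm (n, k) \<omega>)
             + (-1 / 2) *\<^sub>R area_part (\<lambda>j l. a j l (n, k) \<omega>) (Zm (n, k) \<omega>) + Rm (n, k) \<omega>))"

text \<open>
  An area term is centered of order 2, so it is a local error of degree 1 only.
\<close>

lemma antithetic_pair_close:
  assumes "antithetic_pair x a Zp Zm"
  shows "of_order 1 (\<lambda>i \<omega>. Zp i \<omega> - Zm i \<omega>)"
proof -
  obtain Rp Rm where P: "state_process Zp" "state_process Zm" "\<And>n \<omega>. Zp (n, 0) \<omega> = x" "\<And>n \<omega>. Zm (n, 0) \<omega> = x"
    and a: "\<And>j l. j \<in> {1..d} \<Longrightarrow> l \<in> {j<..d} \<Longrightarrow> of_order 2 (a j l) \<and> centered G (a j l)"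
    and R: "local_error G 2 Rp" "local_error G 2 Rm"
    and Zp: "\<And>n k \<omega>. k < 2 ^ n \<Longrightarrow> Zp (n, Suc k) \<omega> = Zp (n, k) \<omega> + main (n, k) \<omega> (Zp (n, k) \<omega>)
             + (1 / 2) *\<^sub>R area_part (\<lambda>j l. a j l (n, k) \<omega>) (Zp (n, k) \<omega>) + Rp (n, k) \<omega>"
    and Zm: "\<And>n k \<omega>. k < 2 ^ n \<Longrightarrow> Zm (n, Suc k) \<omega> = Zm (n, k) \<omega> + main (n, k) \<omega> (Zm (n, k) \<omega>)
             + (-1 / 2) *\<^sub>R area_part (\<lambda>j l. a j l (n, k) \<omega>) (Zm (n, k) \<omega>) + Rm (n, k) \<omega>"
    using assms unfolding antithetic_pair_def by blast
  define R where "R i \<omega> = (1 / 2) *\<^sub>R area_part (\<lambda>j l. a j l i \<omega>) (Zp i \<omega>) + Rp i \<omega>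
      - ((-1 / 2) *\<^sub>R area_part (\<lambda>j l. a j l i \<omega>) (Zm i \<omega>) + Rm i \<omega>)" for i \<omega>
  have area: "local_error G 1 (\<lambda>i \<omega>. area_part (\<lambda>j l. a j l i \<omega>) (Z i \<omega>))" if "state_process Z" for Z
    unfolding area_part_def using a
    by (intro local_error_sum local_error_coeff[OF _ _ state_process_adapted[OF that]] bounded_Lipschitz_bracket) (auto simp: numeral_2_eq_2)
  have mono: "local_error G 1 Z" if "local_error G 2 Z" for Z :: "nat \<times> nat \<Rightarrow> 'a \<Rightarrow> real ^ 'n"
    by (rule local_error_mono[OF that]) (auto simp: subalgebra_def)
  show ?thesis
  proof (rule stability_of_order[OF P(1,2)])
    show "local_error G 1 R" unfolding R_def[abs_def]
      by (intro local_error_diff local_error_add local_error_scaleR area P mono R)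
    show "Zp (n, Suc k) \<omega> - Zm (n, Suc k) \<omega>
        = (Zp (n, k) \<omega> - Zm (n, k) \<omega>) + (main (n, k) \<omega> (Zp (n, k) \<omega>) - main (n, k) \<omega> (Zm (n, k) \<omega>)) + R (n, k) \<omega>" if "k < 2 ^ n" for n k \<omega>
      unfolding Zp[OF that] Zm[OF that] R_def by (simp add: algebra_simps)
  qed (simp add: P)
qed

text \<open>
  Let \<open>\<delta>\<close> be half the difference of the partners, so that they are \<open>A \<plusminus> \<delta>\<close> and \<open>\<delta>\<close> has order 1. For a
  coefficient \<open>f\<close>, let \<open>S f\<close> be the average of \<open>f\<close> over the partners minus \<open>f(A)\<close>. It has order 1, and for
  \<open>f = \<sigma>\<^sub>j\<close> even order 2, because the linear terms in \<open>\<delta>\<close> cancel. So in the main part the noise of order 1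
  meets \<open>S \<sigma>\<^sub>j\<close> of order 2, and the noise of order 2 meets terms of order 1; the areas of order 2 meet
  the difference of the brackets at the partners, of order 1. All these are centered of order 3,
  while drift times \<open>S \<sigma>\<^sub>0\<close> has order 4.
\<close>

theorem antithetic_average_recursion:
  assumes pair: "antithetic_pair x a Zp Zm"
  defines "A \<equiv> \<lambda>i \<omega>. (1 / 2) *\<^sub>R (Zp i \<omega> + Zm i \<omega>)"
  shows "state_process A" "\<And>n \<omega>. A (n, 0) \<omega> = x"
    "\<exists>R. local_error G 2 R \<and> (\<forall>n k \<omega>. k < 2 ^ n \<longrightarrow> A (n, Suc k) \<omega> = A (n, k) \<omega> + main (n, k) \<omega> (A (n, k) \<omega>) + R (n, k) \<omega>)"
proof -
  obtain Rp Rm where P: "state_process Zp" "state_process Zm" "\<And>n \<omega>. Zp (n, 0) \<omega> = x" "\<And>n \<omega>. Zm (n, 0) \<omega> = x"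
    and a: "\<And>j l. j \<in> {1..d} \<Longrightarrow> l \<in> {j<..d} \<Longrightarrow> of_order 2 (a j l) \<and> centered G (a j l)"
    and R: "local_error G 2 Rp" "local_error G 2 Rm"
    and Zp: "\<And>n k \<omega>. k < 2 ^ n \<Longrightarrow> Zp (n, Suc k) \<omega> = Zp (n, k) \<omega> + main (n, k) \<omega> (Zp (n, k) \<omega>)
             + (1 / 2) *\<^sub>R area_part (\<lambda>j l. a j l (n, k) \<omega>) (Zp (n, k) \<omega>) + Rp (n, k) \<omega>"
    and Zm: "\<And>n k \<omega>. k < 2 ^ n \<Longrightarrow> Zm (n, Suc k) \<omega> = Zm (n, k) \<omega> + main (n, k) \<omega> (Zm (n, k) \<omega>)
             + (-1 / 2) *\<^sub>R area_part (\<lambda>j l. a j l (n, k) \<omega>) (Zm (n, k) \<omega>) + Rm (n, k) \<omega>"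
    using pair unfolding antithetic_pair_def by blast
  show A: "state_process A"
    unfolding A_def state_process_def using P(1,2)
    by (auto intro!: borel_measurable_scaleR borel_measurable_add simp: state_process_def)
  show "\<And>n \<omega>. A (n, 0) \<omega> = x" unfolding A_def by (simp add: P scaleR_2[symmetric])
  note AA = state_process_adapted[OF A] and PA = state_process_adapted[OF P(1)] and MA = state_process_adapted[OF P(2)]
  define \<delta> where "\<delta> i \<omega> = (1 / 2) *\<^sub>R (Zp i \<omega> - Zm i \<omega>)" for i \<omega>
  have \<delta>: "of_order 1 \<delta>" unfolding \<delta>_def[abs_def] by (intro of_order_scaleR antithetic_pair_close[OF pair])
  have Zpm: "Zp i \<omega> = A i \<omega> + \<delta> i \<omega>" "Zm i \<omega> = A i \<omega> + - \<delta> i \<omega>" for i \<omega>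
    by (simp_all add: A_def \<delta>_def scaleR_add_right scaleR_diff_right flip: scaleR_left.add)
  have \<delta>p: "of_order 1 (\<lambda>i \<omega>. Zp i \<omega> - A i \<omega>)" and \<delta>m: "of_order 1 (\<lambda>i \<omega>. Zm i \<omega> - A i \<omega>)"
    using \<delta> of_order_scaleR[OF \<delta>, of "-1"] by (simp_all add: Zpm)
  \<comment> \<open>The second order difference of \<open>f\<close> at \<open>A\<close> in the direction \<open>\<delta>\<close>.\<close>
  define S where "S f i \<omega> = (1 / 2) *\<^sub>R ((f (Zp i \<omega>) - f (A i \<omega>)) + (f (Zm i \<omega>) - f (A i \<omega>)))" for f :: "real ^ 'n \<Rightarrow> real ^ 'n" and i \<omega>
  have SG: "S f i \<in> borel_measurable (G i)" if "bounded_Lipschitz f" "i \<in> dyadic_steps" for f i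
    unfolding S_def[abs_def]
    by (intro borel_measurable_scaleR borel_measurable_const borel_measurable_add adapted_diff_measurable[OF _ AA that] PA MA)
  have S1: "of_order 1 (S f)" if "bounded_Lipschitz f" for f
    unfolding S_def[abs_def]
    by (intro of_order_scaleR of_order_add of_order_Lipschitz_diff[OF that PA AA \<delta>p] of_order_Lipschitz_diff[OF that MA AA \<delta>m])
  have S2: "of_order 2 (S (\<sigma> j))" if j: "j \<le> d" for j
  proof -
    obtain C where C: "C \<ge> 0" "norm (\<sigma> j (z + v) - \<sigma> j z - directional_deriv (\<sigma> j) z v) \<le> C * norm v ^ 2" for z v
      using sigma_Taylor[OF j] by blast
    have o: "of_order 2 (\<lambda>i \<omega>. norm (\<delta> i \<omega>) * norm (\<delta> i \<omega>))"
      using of_order_mult[OF of_order_norm[OF \<delta>] of_order_norm[OF \<delta>]] by (simp add: numeral_2_eq_2)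
    have "norm (S (\<sigma> j) i \<omega>) \<le> C * norm (norm (\<delta> i \<omega>) * norm (\<delta> i \<omega>))" for i \<omega>
    proof -
      define z v where "z = A i \<omega>" and "v = \<delta> i \<omega>"
      have "directional_deriv (\<sigma> j) z (- v) = - directional_deriv (\<sigma> j) z v"
        using directional_deriv_linear(2)[of "\<sigma> j" z "-1" v] by simp
      then have "S (\<sigma> j) i \<omega> = (1 / 2) *\<^sub>R ((\<sigma> j (z + v) - \<sigma> j z - directional_deriv (\<sigma> j) z v) + (\<sigma> j (z + - v) - \<sigma> j z - directional_deriv (\<sigma> j) z (- v)))"
        unfolding S_def Zpm z_def[symmetric] v_def[symmetric] by simp
      also have "norm \<dots> \<le> (1 / 2) * (C * norm v ^ 2 + C * norm (- v) ^ 2)"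
        unfolding norm_scaleR by (intro mult_mono norm_triangle_mono C) auto
      finally show ?thesis by (simp add: v_def power2_eq_square)
    qed
    then show ?thesis
      using measurable_from_subalg[OF G_sub SG[OF bounded_Lipschitz_sigma[OF j]]] by (intro of_order_dominated[OF o]) auto
  qed
  define Q where "Q i \<omega> = w 0 i \<omega> *\<^sub>R S (\<sigma> 0) i \<omega> + ((\<Sum>j\<in>{1..d}. w j i \<omega> *\<^sub>R S (\<sigma> j) i \<omega>)
      + ((\<Sum>j\<in>{1..d}. \<Sum>l\<in>{1..d}. \<theta> j l i \<omega> *\<^sub>R S (Lop j l) i \<omega>)
      + ((1 / 4) *\<^sub>R (\<Sum>j\<in>{1..d}. \<Sum>l\<in>{j<..d}. a j l i \<omega> *\<^sub>R (bracket d \<sigma> j l (Zp i \<omega>) - bracket d \<sigma> j l (Zm i \<omega>)))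
      + (1 / 2) *\<^sub>R (Rp i \<omega> + Rm i \<omega>))))" for i \<omega>
  have "local_error G 2 Q" unfolding Q_def[abs_def]
  proof (intro local_error_add local_error_sum local_error_scaleR R)
    show "local_error G 2 (\<lambda>i \<omega>. w 0 i \<omega> *\<^sub>R S (\<sigma> 0) i \<omega>)"
      using of_order_mult[OF w_time S2[of 0]] by (intro local_error_drift) simp
    fix j assume j: "j \<in> {1..d}"
    show "local_error G 2 (\<lambda>i \<omega>. w j i \<omega> *\<^sub>R S (\<sigma> j) i \<omega>)"
      using w_noise[OF j] j by (intro local_error_mult[OF _ _ S2, of 1] SG bounded_Lipschitz_sigma) auto
    show "local_error G 2 (\<lambda>i \<omega>. \<theta> j l i \<omega> *\<^sub>R S (Lop j l) i \<omega>)" if l: "l \<in> {1..d}" for l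
      using \<theta>_noise[OF j l] j l by (intro local_error_mult[OF _ _ S1, of 2] SG bounded_Lipschitz_gen_op) auto
    show "local_error G 2 (\<lambda>i \<omega>. a j l i \<omega> *\<^sub>R (bracket d \<sigma> j l (Zp i \<omega>) - bracket d \<sigma> j l (Zm i \<omega>)))" if l: "l \<in> {j<..d}" for l
      using a[OF j l] j l
      by (intro local_error_mult[OF _ _ of_order_Lipschitz_diff[OF _ PA MA antithetic_pair_close[OF pair]], of 2]
          adapted_diff_measurable[OF PA MA] bounded_Lipschitz_bracket) auto
  qed auto
  moreover have "A (n, Suc k) \<omega> = A (n, k) \<omega> + main (n, k) \<omega> (A (n, k) \<omega>) + Q (n, k) \<omega>" if k: "k < 2 ^ n" for n k \<omega>
  proof -
    define i where "i = (n, k)"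
    have mm: "main i \<omega> (Zp i \<omega>) + main i \<omega> (Zm i \<omega>) = 2 *\<^sub>R main i \<omega> (A i \<omega>) + 2 *\<^sub>R (w 0 i \<omega> *\<^sub>R S (\<sigma> 0) i \<omega> + ((\<Sum>j\<in>{1..d}. w j i \<omega> *\<^sub>R S (\<sigma> j) i \<omega>)
      + (\<Sum>j\<in>{1..d}. \<Sum>l\<in>{1..d}. \<theta> j l i \<omega> *\<^sub>R S (Lop j l) i \<omega>)))"
    proof -
      have "main i \<omega> (Zp i \<omega>) + main i \<omega> (Zm i \<omega>) = 2 *\<^sub>R main i \<omega> (A i \<omega>) + ((main i \<omega> (Zp i \<omega>) - main i \<omega> (A i \<omega>)) + (main i \<omega> (Zm i \<omega>) - main i \<omega> (A i \<omega>)))"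
        by (simp add: scaleR_2)
      also have "(main i \<omega> (Zp i \<omega>) - main i \<omega> (A i \<omega>)) + (main i \<omega> (Zm i \<omega>) - main i \<omega> (A i \<omega>)) = 2 *\<^sub>R (w 0 i \<omega> *\<^sub>R S (\<sigma> 0) i \<omega> + ((\<Sum>j\<in>{1..d}. w j i \<omega> *\<^sub>R S (\<sigma> j) i \<omega>)
        + (\<Sum>j\<in>{1..d}. \<Sum>l\<in>{1..d}. \<theta> j l i \<omega> *\<^sub>R S (Lop j l) i \<omega>)))"
      proof -
        have tt: "x *\<^sub>R (f (Zp i \<omega>) - f (A i \<omega>)) + x *\<^sub>R (f (Zm i \<omega>) - f (A i \<omega>)) = 2 *\<^sub>R (x *\<^sub>R S f i \<omega>)" for x f
          unfolding S_def scaleR_add_right[symmetric] by simp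
        have "(main i \<omega> (Zp i \<omega>) - main i \<omega> (A i \<omega>)) + (main i \<omega> (Zm i \<omega>) - main i \<omega> (A i \<omega>))
          = (w 0 i \<omega> *\<^sub>R (\<sigma> 0 (Zp i \<omega>) - \<sigma> 0 (A i \<omega>)) + w 0 i \<omega> *\<^sub>R (\<sigma> 0 (Zm i \<omega>) - \<sigma> 0 (A i \<omega>)))
          + ((\<Sum>j\<in>{1..d}. w j i \<omega> *\<^sub>R (\<sigma> j (Zp i \<omega>) - \<sigma> j (A i \<omega>)) + w j i \<omega> *\<^sub>R (\<sigma> j (Zm i \<omega>) - \<sigma> j (A i \<omega>)))
          + (\<Sum>j\<in>{1..d}. \<Sum>l\<in>{1..d}. \<theta> j l i \<omega> *\<^sub>R (Lop j l (Zp i \<omega>) - Lop j l (A i \<omega>))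
              + \<theta> j l i \<omega> *\<^sub>R (Lop j l (Zm i \<omega>) - Lop j l (A i \<omega>))))"
          unfolding main_part_diff by (simp only: sum.distrib add_ac)
        also have "\<dots> = 2 *\<^sub>R (w 0 i \<omega> *\<^sub>R S (\<sigma> 0) i \<omega> + ((\<Sum>j\<in>{1..d}. w j i \<omega> *\<^sub>R S (\<sigma> j) i \<omega>)
          + (\<Sum>j\<in>{1..d}. \<Sum>l\<in>{1..d}. \<theta> j l i \<omega> *\<^sub>R S (Lop j l) i \<omega>)))"
          unfolding tt by (simp only: scaleR_add_right scaleR_sum_right)
        finally show ?thesis .
      qed
      finally show ?thesis .
    qed
    have aa: "(1 / 2) *\<^sub>R area_part (\<lambda>j l. a j l i \<omega>) (Zp i \<omega>) + (-1 / 2) *\<^sub>R area_part (\<lambda>j l. a j l i \<omega>) (Zm i \<omega>)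
      = 2 *\<^sub>R ((1 / 4) *\<^sub>R (\<Sum>j\<in>{1..d}. \<Sum>l\<in>{j<..d}. a j l i \<omega> *\<^sub>R (bracket d \<sigma> j l (Zp i \<omega>) - bracket d \<sigma> j l (Zm i \<omega>))))"
      by (simp add: area_part_def scaleR_diff_right sum_subtractf)
    have "A (n, Suc k) \<omega> = (1 / 2) *\<^sub>R ((Zp i \<omega> + Zm i \<omega>) + (main i \<omega> (Zp i \<omega>) + main i \<omega> (Zm i \<omega>))
       + ((1 / 2) *\<^sub>R area_part (\<lambda>j l. a j l i \<omega>) (Zp i \<omega>) + (-1 / 2) *\<^sub>R area_part (\<lambda>j l. a j l i \<omega>) (Zm i \<omega>)) + (Rp i \<omega> + Rm i \<omega>))"
      unfolding A_def Zp[OF k] Zm[OF k] i_def by (simp add: algebra_simps)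
    also have "Zp i \<omega> + Zm i \<omega> = 2 *\<^sub>R A i \<omega>" by (simp add: A_def)
    finally show ?thesis unfolding mm aa Q_def i_def[symmetric] by (simp add: scaleR_add_right)
  qed
  ultimately show "\<exists>R. local_error G 2 R \<and> (\<forall>n k \<omega>. k < 2 ^ n \<longrightarrow> A (n, Suc k) \<omega> = A (n, k) \<omega> + main (n, k) \<omega> (A (n, k) \<omega>) + R (n, k) \<omega>)"
    by blast
qed

text \<open>
  The areas of the two pairs may be unrelated: they no longer occur in the recursions of the averages.
\<close>

theorem antithetic_averages_close:
  assumes "antithetic_pair x a Yp Ym" "antithetic_pair x b Zp Zm" "q \<ge> 1"
  shows "\<exists>C\<ge>0. \<forall>n. (\<integral>\<^sup>+\<omega>. ennreal (MAX k\<in>{..2 ^ n}.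
      norm ((1 / 2) *\<^sub>R (Yp (n, k) \<omega> + Ym (n, k) \<omega>) - (1 / 2) *\<^sub>R (Zp (n, k) \<omega> + Zm (n, k) \<omega>)) ^ (2 * q)) \<partial>M)
    \<le> ennreal (C * (T / 2 ^ n) ^ (2 * q))"
proof -
  note Y = antithetic_average_recursion[OF assms(1)] and Z = antithetic_average_recursion[OF assms(2)]
  obtain R where R: "local_error G 2 R" "\<And>n k \<omega>. k < 2 ^ n \<Longrightarrow> (1 / 2) *\<^sub>R (Yp (n, Suc k) \<omega> + Ym (n, Suc k) \<omega>)
     = (1 / 2) *\<^sub>R (Yp (n, k) \<omega> + Ym (n, k) \<omega>) + main (n, k) \<omega> ((1 / 2) *\<^sub>R (Yp (n, k) \<omega> + Ym (n, k) \<omega>)) + R (n, k) \<omega>"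
    using Y(3) by blast
  obtain R' where R': "local_error G 2 R'" "\<And>n k \<omega>. k < 2 ^ n \<Longrightarrow> (1 / 2) *\<^sub>R (Zp (n, Suc k) \<omega> + Zm (n, Suc k) \<omega>)
     = (1 / 2) *\<^sub>R (Zp (n, k) \<omega> + Zm (n, k) \<omega>) + main (n, k) \<omega> ((1 / 2) *\<^sub>R (Zp (n, k) \<omega> + Zm (n, k) \<omega>)) + R' (n, k) \<omega>"
    using Z(3) by blast
  show ?thesis
    by (rule stability_maximum[OF Y(1) Z(1) _ _ local_error_diff[OF R(1) R'(1)] assms(3)])
      (simp only: Y(2) Z(2), simp only: R(2) R'(2), simp only: add_diff_add add.assoc)
qed

end

section \<open>Increments of Brownian motion\<close>

lemma generated_events_subset:
  assumes "space N = space M" "\<And>i. i \<in> I \<Longrightarrow> X i \<in> borel_measurable N"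
  shows "generated_events M I X \<subseteq> sets N"
proof -
  have "(\<Union>i\<in>I. {X i -` A \<inter> space M | A. A \<in> sets borel}) \<subseteq> sets N"
    using measurable_sets[OF assms(2)] assms(1) by auto
  from sets.sigma_sets_subset[OF this] show ?thesis
    unfolding generated_events_def using assms(1) by simp
qed

text \<open>
  Only the space and the measurable sets of this object matter; its measure is the null measure.
\<close>

definition generated_algebra :: "'a measure \<Rightarrow> 'i set \<Rightarrow> ('i \<Rightarrow> 'a \<Rightarrow> real) \<Rightarrow> 'a measure" where
  "generated_algebra M I X = sigma (space M) (generated_events M I X)"

lemma generated_events_Pow: "generated_events M I X \<subseteq> Pow (space M)"
  unfolding generated_events_def by (rule subsetI, drule sigma_sets_into_sp[rotated]) auto

lemma sigma_algebra_generated_events: "sigma_algebra (space M) (generated_events M I X)"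
  unfolding generated_events_def by (rule sigma_algebra_sigma_sets) auto

lemma space_generated_algebra [simp]: "space (generated_algebra M I X) = space M"
  by (simp add: generated_algebra_def generated_events_Pow)

lemma sets_generated_algebra [simp]: "sets (generated_algebra M I X) = generated_events M I X"
  unfolding generated_algebra_def
  by (simp add: generated_events_Pow sigma_algebra.sigma_sets_eq[OF sigma_algebra_generated_events])

lemma measurable_generated_algebra:
  assumes "i \<in> I" shows "X i \<in> borel_measurable (generated_algebra M I X)"
proof (rule measurableI)
  fix A :: "real set" assume "A \<in> sets borel"
  then have "X i -` A \<inter> space M \<in> (\<Union>i\<in>I. {X i -` A \<inter> space M | A. A \<in> sets borel})"
    using assms by blast
  then have "X i -` A \<inter> space M \<in> generated_events M I X"
    unfolding generated_events_def by (rule sigma_sets.Basic)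
  then show "X i -` A \<inter> space (generated_algebra M I X) \<in> sets (generated_algebra M I X)" by simp
qed simp

lemma generated_algebra_subalgebra:
  assumes "space N = space M" "\<And>i. i \<in> I \<Longrightarrow> X i \<in> borel_measurable N"
  shows "subalgebra N (generated_algebra M I X)"
  using generated_events_subset[OF assms] assms(1) by (simp add: subalgebra_def)

locale brownian = prob_space M for M :: "'a measure" +
  fixes F :: "real \<Rightarrow> 'a measure" and J :: "nat set" and W :: "nat \<Rightarrow> real \<Rightarrow> 'a \<Rightarrow> real"
  assumes filt: "filtration_on M F" and bm: "brownian_motion M F J W"
begin

lemma F_sub: "0 \<le> t \<Longrightarrow> subalgebra M (F t)"
  using filt by (simp add: filtration_on_def)

lemma F_mono: "0 \<le> s \<Longrightarrow> s \<le> t \<Longrightarrow> subalgebra (F t) (F s)"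
  using filt by (simp add: filtration_on_def)

lemma W_F: "j \<in> J \<Longrightarrow> 0 \<le> s \<Longrightarrow> s \<le> t \<Longrightarrow> W j s \<in> borel_measurable (F t)"
  using bm F_mono[of s t] unfolding brownian_motion_def by (auto intro: measurable_from_subalg)

lemma W_measurable: "j \<in> J \<Longrightarrow> 0 \<le> t \<Longrightarrow> W j t \<in> borel_measurable M"
  using W_F[of j t t] F_sub[of t] by (auto intro: measurable_from_subalg)

lemma AE_continuous: "j \<in> J \<Longrightarrow> AE \<omega> in M. continuous_on {0..} (\<lambda>t. W j t \<omega>)"
  using bm by (simp add: brownian_motion_def)

definition future :: "real \<Rightarrow> 'a measure" where
  "future t = generated_algebra M (J \<times> {t..}) (\<lambda>(j, u) \<omega>. W j u \<omega> - W j t \<omega>)"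

lemma future_sub: "0 \<le> t \<Longrightarrow> subalgebra M (future t)"
  unfolding future_def by (rule generated_algebra_subalgebra) (auto intro!: borel_measurable_diff W_measurable)

lemma future_indep: "0 \<le> t \<Longrightarrow> indep_set (sets (F t)) (sets (future t))"
  using bm by (simp add: brownian_motion_def future_def)

lemma future_measurable:
  assumes "j \<in> J" "t \<le> u" shows "(\<lambda>\<omega>. W j u \<omega> - W j t \<omega>) \<in> borel_measurable (future t)"
  using measurable_generated_algebra[of "(j, u)" "J \<times> {t..}" "\<lambda>(j, u) \<omega>. W j u \<omega> - W j t \<omega>" M] assms
  by (simp add: future_def)

text \<open>
  The moment of exponent \<open>2q\<close> of the standard normal distribution.
\<close>

definition normal_moment_const :: "nat \<Rightarrow> real" where
  "normal_moment_const q = fact (2 * q) / (2 ^ q * fact q)"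

lemma increment_moment:
  assumes j: "j \<in> J" and st: "0 \<le> s" "s < t"
  shows "integrable M (\<lambda>\<omega>. (W j t \<omega> - W j s \<omega>) ^ k)"
    and "(\<integral>\<omega>. (W j t \<omega> - W j s \<omega>) ^ (2 * q) \<partial>M) = normal_moment_const q * (t - s) ^ q"
    and "(\<integral>\<omega>. (W j t \<omega> - W j s \<omega>) \<partial>M) = 0"
proof -
  define \<sigma> where "\<sigma> = sqrt (t - s)"
  have \<sigma>: "\<sigma> > 0" "\<sigma>\<^sup>2 = t - s" using st by (auto simp: \<sigma>_def)
  have D: "distributed M lborel (\<lambda>\<omega>. W j t \<omega> - W j s \<omega>) (\<lambda>y. ennreal (normal_density 0 \<sigma> y))"
    using bm j st unfolding brownian_motion_def \<sigma>_def by blast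
  show "integrable M (\<lambda>\<omega>. (W j t \<omega> - W j s \<omega>) ^ k)"
    using distributed_integrable[OF D, of "\<lambda>x. x ^ k"] integrable_normal_moment[OF \<sigma>(1), of 0 k] by simp
  have "(\<integral>\<omega>. (W j t \<omega> - W j s \<omega>) ^ (2 * q) \<partial>M) = (LBINT x. normal_density 0 \<sigma> x * (x - 0) ^ (2 * q))"
    using distributed_integral[OF D, of "\<lambda>x. x ^ (2 * q)"] by simp
  also have "\<dots> = fact (2 * q) / ((2 / \<sigma>\<^sup>2) ^ q * fact q)" by (rule integral_normal_moment_even[OF \<sigma>(1)])
  also have "\<dots> = normal_moment_const q * (t - s) ^ q"
    unfolding \<sigma>(2) normal_moment_const_def using st by (simp add: power_divide)
  finally show "(\<integral>\<omega>. (W j t \<omega> - W j s \<omega>) ^ (2 * q) \<partial>M) = normal_moment_const q * (t - s) ^ q" .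
  show "(\<integral>\<omega>. (W j t \<omega> - W j s \<omega>) \<partial>M) = 0"
    using distributed_integral[OF D, of "\<lambda>x. x"] integral_normal_moment_nz_1[OF \<sigma>(1), of 0] by simp
qed

lemma normal_moment_const_nonneg: "normal_moment_const q \<ge> 0"
  by (simp add: normal_moment_const_def)

lemma absmom_increment:
  assumes j: "j \<in> J" and st: "0 \<le> s" "s \<le> t"
  shows "absmom M q (\<lambda>\<omega>. W j t \<omega> - W j s \<omega>) \<le> ennreal (normal_moment_const q * (t - s) ^ q)"
proof (cases "s = t")
  case True
  then show ?thesis by (cases "q = 0") (simp_all add: absmom_def emeasure_space_1 normal_moment_const_def power_0_left)
next
  case False
  then have "s < t" using st by simp
  note m = increment_moment[OF j st(1) this]
  have "absmom M q (\<lambda>\<omega>. W j t \<omega> - W j s \<omega>) = ennreal (\<integral>\<omega>. (W j t \<omega> - W j s \<omega>) ^ (2 * q) \<partial>M)"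
    unfolding absmom_def using m(1) by (simp add: power_even_abs nn_integral_eq_integral zero_le_even_power)
  then show ?thesis by (simp add: m)
qed

lemma absmom_increment_abs:
  assumes j: "j \<in> J" and st: "0 \<le> s" "0 \<le> t"
  shows "absmom M q (\<lambda>\<omega>. W j t \<omega> - W j s \<omega>) \<le> ennreal (normal_moment_const q * \<bar>t - s\<bar> ^ q)"
proof (cases "s \<le> t")
  case True then show ?thesis using absmom_increment[OF j st(1)] by simp
next
  case False
  then show ?thesis using absmom_increment[OF j st(2), of s q] by (simp add: absmom_def abs_minus_commute)
qed

lemma all_moments_increment:
  assumes j: "j \<in> J" and st: "0 \<le> s" "0 \<le> t"
  shows "all_moments M (\<lambda>\<omega>. W j t \<omega> - W j s \<omega>)"
  unfolding all_moments_def using W_measurable[OF j] st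
  by (auto intro: le_less_trans[OF absmom_increment_abs[OF j st]])

lemma expectation_increment:
  assumes j: "j \<in> J" and st: "0 \<le> s" "s \<le> t"
  shows "(\<integral>\<omega>. (W j t \<omega> - W j s \<omega>) \<partial>M) = 0"
  using increment_moment(3)[OF j st(1), of t] st by (cases "s = t") auto

lemma expectation_increment_sq:
  assumes j: "j \<in> J" and st: "0 \<le> s" "s \<le> t"
  shows "(\<integral>\<omega>. (W j t \<omega> - W j s \<omega>)\<^sup>2 \<partial>M) = t - s"
  using increment_moment(2)[OF j st(1), of t 1] st by (cases "s = t") (auto simp: normal_moment_const_def)

lemma expectation_increment_mult:
  assumes j: "i \<in> J" "j \<in> J" "i \<noteq> j" and st: "0 \<le> s" "s \<le> t"
  shows "(\<integral>\<omega>. (W i t \<omega> - W i s \<omega>) * (W j t \<omega> - W j s \<omega>) \<partial>M) = 0"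
proof (cases "s = t")
  case False
  then have "s < t" using st by simp
  then have "indep_vars (\<lambda>_. borel) (\<lambda>j \<omega>. W j t \<omega> - W j s \<omega>) J"
    using bm st by (simp add: brownian_motion_def)
  then have "indep_vars (\<lambda>_. borel) (\<lambda>j \<omega>. W j t \<omega> - W j s \<omega>) {i, j}"
    by (rule indep_vars_subset) (use j in auto)
  then have "(\<integral>\<omega>. (\<Prod>l\<in>{i, j}. W l t \<omega> - W l s \<omega>) \<partial>M) = (\<Prod>l\<in>{i, j}. \<integral>\<omega>. (W l t \<omega> - W l s \<omega>) \<partial>M)"
    using st j by (intro indep_vars_lebesgue_integral)
      (auto intro!: all_moments_integrable all_moments_increment finite_measure_axioms)
  then show ?thesis using expectation_increment[OF j(1) st] j(3) by simp
qed simp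

text \<open>
  What an observer of the increments within \<open>[a, b]\<close> knows. These events belong to the past \<open>F b\<close> as well
  as to \<open>future a\<close>, so the algebras of successive intervals are independent.
\<close>

definition incr_events :: "real \<Rightarrow> real \<Rightarrow> 'a set set" where
  "incr_events a b = generated_events M (J \<times> {a..b}) (\<lambda>(j, u) \<omega>. W j u \<omega> - W j a \<omega>)"

lemma incr_events_F: "0 \<le> a \<Longrightarrow> b \<le> c \<Longrightarrow> 0 \<le> c \<Longrightarrow> incr_events a b \<subseteq> sets (F c)"
  unfolding incr_events_def
  by (rule generated_events_subset) (use F_sub[of c] in \<open>auto simp: subalgebra_def intro!: borel_measurable_diff W_F\<close>)

lemma incr_events_future: "0 \<le> a \<Longrightarrow> incr_events a b \<subseteq> sets (future a)"
  unfolding incr_events_def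
  by (rule generated_events_subset) (use future_sub[of a] in \<open>auto simp: subalgebra_def intro!: future_measurable\<close>)

lemma incr_events_path: "0 \<le> a \<Longrightarrow> incr_events a b \<subseteq> generated_events M (J \<times> {0..}) (\<lambda>(j, t). W j t)"
proof -
  assume a: "0 \<le> a"
  have "W j t \<in> borel_measurable (generated_algebra M (J \<times> {0..}) (\<lambda>(j, t). W j t))" if "j \<in> J" "0 \<le> t" for j t
    using measurable_generated_algebra[of "(j, t)" "J \<times> {0..}" "\<lambda>(j, t). W j t" M] that by simp
  then have "incr_events a b \<subseteq> sets (generated_algebra M (J \<times> {0..}) (\<lambda>(j, t). W j t))"
    unfolding incr_events_def using a by (intro generated_events_subset) (auto intro!: borel_measurable_diff)
  then show ?thesis by simp
qed

lemma incr_events_sub: "0 \<le> a \<Longrightarrow> incr_events a b \<subseteq> sets M"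
  using incr_events_future[of a b] future_sub[of a] by (auto simp: subalgebra_def)

lemma space_incr_events: "space M \<in> incr_events a b"
  using sets.top[of "generated_algebra M (J \<times> {a..b}) (\<lambda>(j, u) \<omega>. W j u \<omega> - W j a \<omega>)"]
  unfolding incr_events_def by simp

text \<open>
  The last interval is split off: its event is in the future of \<open>t n\<close>, all others are in \<open>F (t n)\<close>.
\<close>

lemma prob_INT_increments:
  assumes t: "0 \<le> t 0" "\<And>k. t k \<le> t (Suc k)"
    and A: "\<And>k. k < n \<Longrightarrow> A k \<in> incr_events (t k) (t (Suc k))"
  shows "prob (space M \<inter> (\<Inter>k\<in>{..<n}. A k)) = (\<Prod>k\<in>{..<n}. prob (A k))"
  using A
proof (induction n)
  case 0
  then show ?case by (simp add: prob_space)
next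
  case (Suc n)
  have mono: "t i \<le> t j" if "i \<le> j" for i j using lift_Suc_mono_le[of t, OF t(2) that] .
  have tpos: "0 \<le> t k" for k using t(1) mono[of 0 k] by simp
  have "space M \<inter> (\<Inter>k\<in>{..<n}. A k) \<in> sets (F (t n))"
  proof -
    have "A k \<in> sets (F (t n))" if "k < n" for k
      using incr_events_F[OF tpos mono[of "Suc k" n] tpos] Suc.prems[of k] that by auto
    moreover have "space M = space (F (t n))" using F_sub[OF tpos] by (simp add: subalgebra_def)
    ultimately show ?thesis by (cases "n = 0") (auto intro!: sets.Int sets.finite_INT)
  qed
  moreover have "A n \<in> sets (future (t n))" using incr_events_future[OF tpos] Suc.prems[of n] by auto
  ultimately have "prob ((space M \<inter> (\<Inter>k\<in>{..<n}. A k)) \<inter> A n) = prob (space M \<inter> (\<Inter>k\<in>{..<n}. A k)) * prob (A n)"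
    by (rule indep_setD[OF future_indep[OF tpos]])
  moreover have "space M \<inter> (\<Inter>k\<in>{..<Suc n}. A k) = (space M \<inter> (\<Inter>k\<in>{..<n}. A k)) \<inter> A n"
    by (auto simp: less_Suc_eq)
  ultimately show ?case using Suc by simp
qed

end

section \<open>The time integral of Brownian motion\<close>

lemma right_Riemann_sum_error:
  fixes f :: "real \<Rightarrow> real" and u :: "nat \<Rightarrow> real"
  assumes "\<And>k. k < K \<Longrightarrow> u k \<le> u (Suc k)" "continuous_on {u 0..u K} f"
    and "\<And>k v. k < K \<Longrightarrow> v \<in> {u k..u (Suc k)} \<Longrightarrow> \<bar>f (u (Suc k)) - f v\<bar> \<le> \<epsilon>"
  shows "u 0 \<le> u K \<and> \<bar>(\<Sum>k<K. (u (Suc k) - u k) * f (u (Suc k))) - integral {u 0..u K} f\<bar> \<le> \<epsilon> * (u K - u 0)"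
  using assms
proof (induction K)
  case (Suc K)
  have uK: "u K \<le> u (Suc K)" using Suc.prems(1) by simp
  have "continuous_on {u 0..u K} f" using Suc.prems(2) uK by (elim continuous_on_subset) auto
  then have IH: "u 0 \<le> u K" "\<bar>(\<Sum>k<K. (u (Suc k) - u k) * f (u (Suc k))) - integral {u 0..u K} f\<bar> \<le> \<epsilon> * (u K - u 0)"
    using Suc.IH Suc.prems by auto
  have cont: "continuous_on {u K..u (Suc K)} f" using Suc.prems(2) IH(1) by (elim continuous_on_subset) auto
  have comb: "integral {u 0..u (Suc K)} f = integral {u 0..u K} f + integral {u K..u (Suc K)} f"
    using Suc.prems(2) IH(1) uK
    by (intro Henstock_Kurzweil_Integration.integral_combine[symmetric] integrable_continuous_real)
  have cont': "continuous_on {u K..u (Suc K)} (\<lambda>v. f (u (Suc K)) - f v)"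
    using cont by (intro continuous_on_diff continuous_on_const)
  have "\<bar>(u (Suc K) - u K) * f (u (Suc K)) - integral {u K..u (Suc K)} f\<bar> = \<bar>integral {u K..u (Suc K)} (\<lambda>v. f (u (Suc K)) - f v)\<bar>"
    using cont uK by (subst Henstock_Kurzweil_Integration.integral_diff) (auto intro!: integrable_continuous_real)
  also have "\<dots> \<le> \<epsilon> * (u (Suc K) - u K)"
    using integral_bound[OF uK cont', of \<epsilon>] Suc.prems(3)[of K] by simp
  finally show ?case using IH comb uK by (simp add: algebra_simps abs_le_iff)
qed simp

text \<open>
  Arbitrary partitions are allowed since refinements of the partition of a simple process, which need not be
  equidistant, are used later.
\<close>

lemma right_Riemann_sums_converge:
  fixes f :: "real \<Rightarrow> real" and u :: "nat \<Rightarrow> nat \<Rightarrow> real"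
  assumes f: "continuous_on {s..t} f"
    and u: "\<And>m k. k < K m \<Longrightarrow> u m k \<le> u m (Suc k)" "\<And>m. u m 0 = s" "\<And>m. u m (K m) = t"
    and mesh: "\<And>m k. k < K m \<Longrightarrow> u m (Suc k) - u m k \<le> \<delta> m" "\<delta> \<longlonglongrightarrow> 0"
  shows "(\<lambda>m. \<Sum>k<K m. (u m (Suc k) - u m k) * f (u m (Suc k))) \<longlonglongrightarrow> integral {s..t} f"
proof (rule LIMSEQ_I)
  fix r :: real assume r: "r > 0"
  have in_st: "u m k \<in> {s..t}" if "k \<le> K m" for m k
  proof -
    have "u m 0 \<le> u m k" using that
    proof (induction k)
      case (Suc k) then show ?case using u(1)[of k m] by simp
    qed simp
    moreover have "u m k \<le> u m (K m)" using that
    proof (induction "K m - k" arbitrary: k)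
      case 0 then show ?case by simp
    next
      case (Suc l)
      then have "k < K m" "l = K m - Suc k" "Suc k \<le> K m" by auto
      then show ?case using Suc.hyps(1)[of "Suc k"] u(1)[of k m] by simp
    qed
    ultimately show ?thesis using u(2,3)[of m] by simp
  qed
  have st: "s \<le> t" using in_st[of 0 0] by simp
  define \<epsilon> where "\<epsilon> = r / (2 * (t - s + 1))"
  have \<epsilon>: "\<epsilon> > 0" using r st by (simp add: \<epsilon>_def)
  have "uniformly_continuous_on {s..t} f" using f by (intro compact_uniformly_continuous) auto
  then obtain e where e: "e > 0" "\<And>x y. x \<in> {s..t} \<Longrightarrow> y \<in> {s..t} \<Longrightarrow> dist y x < e \<Longrightarrow> dist (f y) (f x) < \<epsilon>"
    unfolding uniformly_continuous_on_def using \<epsilon> by metis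
  obtain m0 where m0: "\<And>m. m \<ge> m0 \<Longrightarrow> \<delta> m < e"
    using order_tendstoD(2)[OF mesh(2) e(1)] by (auto simp: eventually_sequentially)
  have "norm ((\<Sum>k<K m. (u m (Suc k) - u m k) * f (u m (Suc k))) - integral {s..t} f) < r" if m: "m \<ge> m0" for m
  proof -
    have "\<bar>f (u m (Suc k)) - f v\<bar> \<le> \<epsilon>" if k: "k < K m" and v: "v \<in> {u m k..u m (Suc k)}" for k v
    proof -
      have "v \<in> {s..t}" using in_st[of k m] in_st[of "Suc k" m] k v by auto
      moreover have "dist (u m (Suc k)) v < e" using v mesh(1)[OF k] m0[OF m] by (auto simp: dist_real_def)
      ultimately show ?thesis using e(2)[of v "u m (Suc k)"] in_st[of "Suc k" m] k by (auto simp: dist_real_def)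
    qed
    then have "\<bar>(\<Sum>k<K m. (u m (Suc k) - u m k) * f (u m (Suc k))) - integral {s..t} f\<bar> \<le> \<epsilon> * (t - s)"
      using right_Riemann_sum_error[of "K m" "u m" f \<epsilon>] u f by simp
    also have "\<dots> < \<epsilon> * (2 * (t - s + 1))" using \<epsilon> st by (intro mult_strict_left_mono) auto
    also have "\<dots> = r" using st by (simp add: \<epsilon>_def)
    finally show ?thesis by simp
  qed
  then show "\<exists>no. \<forall>n\<ge>no. norm ((\<Sum>k<K n. (u n (Suc k) - u n k) * f (u n (Suc k))) - integral {s..t} f) < r" by blast
qed

lemma (in prob_space) absmom_Fatou:
  fixes X :: "'a \<Rightarrow> real"
  assumes "\<And>m. Y m \<in> borel_measurable M" "AE \<omega> in M. (\<lambda>m. Y m \<omega>) \<longlonglongrightarrow> X \<omega>" "\<And>m. absmom M q (Y m) \<le> B m"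
  shows "absmom M q X \<le> liminf B"
proof -
  have "absmom M q X = (\<integral>\<^sup>+\<omega>. liminf (\<lambda>m. ennreal (norm (Y m \<omega>) ^ (2 * q))) \<partial>M)"
    unfolding absmom_def
  proof (rule nn_integral_cong_AE, use assms(2) in eventually_elim)
    fix \<omega> assume "(\<lambda>m. Y m \<omega>) \<longlonglongrightarrow> X \<omega>"
    then have "(\<lambda>m. ennreal (norm (Y m \<omega>) ^ (2 * q))) \<longlonglongrightarrow> ennreal (norm (X \<omega>) ^ (2 * q))"
      by (intro tendsto_intros) auto
    from lim_imp_Liminf[OF _ this] show "ennreal (norm (X \<omega>) ^ (2 * q)) = liminf (\<lambda>m. ennreal (norm (Y m \<omega>) ^ (2 * q)))"
      by simp
  qed
  also have "\<dots> \<le> liminf (\<lambda>m. absmom M q (Y m))"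
    unfolding absmom_def using assms(1) by (intro nn_integral_liminf) measurable
  also have "\<dots> \<le> liminf B" using assms(3) by (intro Liminf_mono) auto
  finally show ?thesis .
qed

text \<open>
  Bounded second moments give uniform integrability, in the form \<open>y \<le> e y\<^sup>2 + min y (1 / e)\<close>: the first term is
  small in expectation, and dominated convergence applies to the second one.
\<close>

lemma (in prob_space) expectation_limit_zero:
  fixes X :: "'a \<Rightarrow> real"
  assumes Y: "\<And>m. all_moments M (Y m)" "\<And>m. (\<integral>\<omega>. Y m \<omega> \<partial>M) = 0" "\<And>m. absmom M 1 (Y m) \<le> ennreal B"
    and X: "all_moments M X" and lim: "AE \<omega> in M. (\<lambda>m. Y m \<omega>) \<longlonglongrightarrow> X \<omega>" and B: "B \<ge> 0"
  shows "(\<integral>\<omega>. X \<omega> \<partial>M) = 0"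
proof -
  have XB: "absmom M 1 X \<le> ennreal B"
    using absmom_Fatou[of Y X 1 "\<lambda>_. ennreal B"] Y(1,3) lim by (simp add: all_moments_def Liminf_const)
  have [measurable]: "X \<in> borel_measurable M" "Y m \<in> borel_measurable M" for m
    using X Y(1) by (auto simp: all_moments_def)
  have D: "all_moments M (\<lambda>\<omega>. X \<omega> - Y m \<omega>)" for m
    using all_moments_add[OF X, of "\<lambda>\<omega>. (-1) *\<^sub>R Y m \<omega>"] all_moments_scaleR[OF all_moments_const[of "-1"] Y(1)[of m]] by simp
  \<comment> \<open>Fatou's lemma bounds the second moment of \<open>X\<close>, and hence those of all differences, uniformly.\<close>
  have DB: "(\<integral>\<omega>. (X \<omega> - Y m \<omega>)\<^sup>2 \<partial>M) \<le> 8 * B" for m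
  proof -
    have "absmom M 1 (\<lambda>\<omega>. X \<omega> - Y m \<omega>) \<le> ennreal (4 ^ 1) * (absmom M 1 X + absmom M 1 (\<lambda>\<omega>. - Y m \<omega>))"
      using absmom_add[of X M "\<lambda>\<omega>. - Y m \<omega>" 1] by simp
    also have "\<dots> \<le> ennreal (4 ^ 1) * (ennreal B + ennreal B)"
      using XB Y(3)[of m] by (intro mult_left_mono add_mono) (auto simp: absmom_def)
    also have "ennreal B + ennreal B = ennreal (B + B)" using B by (simp only: ennreal_plus)
    also have "ennreal (4 ^ 1) * ennreal (B + B) = ennreal (4 ^ 1 * (B + B))" using B by (intro ennreal_mult[symmetric]) auto
    also have "4 ^ 1 * (B + B) = 8 * B" by simp
    finally have "ennreal (\<integral>\<omega>. norm (X \<omega> - Y m \<omega>) ^ (2 * 1) \<partial>M) \<le> ennreal (8 * B)"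
      using absmom_eq_integral(1)[OF D, of 1] by simp
    then show ?thesis using B by (simp add: ennreal_le_iff)
  qed
  have key: "\<bar>\<integral>\<omega>. X \<omega> \<partial>M\<bar> \<le> 8 * B * e" if e: "e > 0" for e
  proof -
    have "(\<lambda>m. \<integral>\<omega>. min \<bar>X \<omega> - Y m \<omega>\<bar> (1 / e) \<partial>M) \<longlonglongrightarrow> (\<integral>\<omega>. 0 \<partial>M)"
    proof (rule integral_dominated_convergence[where w="\<lambda>_. 1 / e"])
      show "AE \<omega> in M. (\<lambda>m. min \<bar>X \<omega> - Y m \<omega>\<bar> (1 / e)) \<longlonglongrightarrow> 0"
        using lim
      proof eventually_elim
        fix \<omega> assume "(\<lambda>m. Y m \<omega>) \<longlonglongrightarrow> X \<omega>"
        then have "(\<lambda>m. min \<bar>X \<omega> - Y m \<omega>\<bar> (1 / e)) \<longlonglongrightarrow> min \<bar>X \<omega> - X \<omega>\<bar> (1 / e)"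
          by (intro tendsto_intros)
        then show "(\<lambda>m. min \<bar>X \<omega> - Y m \<omega>\<bar> (1 / e)) \<longlonglongrightarrow> 0" using e by simp
      qed
    qed (use e in auto)
    then have lim0: "(\<lambda>m. e * (8 * B) + (\<integral>\<omega>. min \<bar>X \<omega> - Y m \<omega>\<bar> (1 / e) \<partial>M)) \<longlonglongrightarrow> e * (8 * B) + 0"
      by (intro tendsto_intros) simp
    have "\<bar>\<integral>\<omega>. X \<omega> \<partial>M\<bar> \<le> e * (8 * B) + (\<integral>\<omega>. min \<bar>X \<omega> - Y m \<omega>\<bar> (1 / e) \<partial>M)" for m
    proof -
      have i: "integrable M (\<lambda>\<omega>. X \<omega> - Y m \<omega>)" "integrable M (\<lambda>\<omega>. (X \<omega> - Y m \<omega>)\<^sup>2)"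
        "integrable M X" "integrable M (Y m)"
        by (intro all_moments_integrable D X Y all_moments_power finite_measure_axioms)+
      have imin: "integrable M (\<lambda>\<omega>. min \<bar>X \<omega> - Y m \<omega>\<bar> (1 / e))"
        using e by (intro integrable_const_bound[where B="1 / e"]) auto
      have "(\<integral>\<omega>. X \<omega> \<partial>M) = (\<integral>\<omega>. X \<omega> - Y m \<omega> \<partial>M)" using i Y(2) by simp
      also have "\<bar>\<dots>\<bar> \<le> (\<integral>\<omega>. \<bar>X \<omega> - Y m \<omega>\<bar> \<partial>M)" by (rule integral_abs_bound)
      also have "\<dots> \<le> (\<integral>\<omega>. e * (X \<omega> - Y m \<omega>)\<^sup>2 + min \<bar>X \<omega> - Y m \<omega>\<bar> (1 / e) \<partial>M)"
      proof (intro integral_mono Bochner_Integration.integrable_add integrable_mult_right i imin integrable_abs)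
        fix \<omega>
        define y where "y = \<bar>X \<omega> - Y m \<omega>\<bar>"
        have "y \<le> e * y\<^sup>2 + min y (1 / e)"
        proof (cases "y \<le> 1 / e")
          case True then show ?thesis using e by simp
        next
          case False
          then have "1 \<le> e * y" using e by (simp add: field_simps)
          moreover have "y \<ge> 0" by (simp add: y_def)
          ultimately have "1 * y \<le> (e * y) * y" by (intro mult_right_mono)
          then have "y \<le> e * y\<^sup>2" by (simp add: power2_eq_square mult.assoc)
          moreover have "0 \<le> min y (1 / e)" using e by (simp add: y_def)
          ultimately show ?thesis by linarith
        qed
        then show "\<bar>X \<omega> - Y m \<omega>\<bar> \<le> e * (X \<omega> - Y m \<omega>)\<^sup>2 + min \<bar>X \<omega> - Y m \<omega>\<bar> (1 / e)"
          by (simp add: y_def)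
      qed
      also have "\<dots> = e * (\<integral>\<omega>. (X \<omega> - Y m \<omega>)\<^sup>2 \<partial>M) + (\<integral>\<omega>. min \<bar>X \<omega> - Y m \<omega>\<bar> (1 / e) \<partial>M)"
        using i imin by simp
      also have "\<dots> \<le> e * (8 * B) + (\<integral>\<omega>. min \<bar>X \<omega> - Y m \<omega>\<bar> (1 / e) \<partial>M)"
        using DB[of m] e by (intro add_right_mono mult_left_mono) auto
      finally show ?thesis .
    qed
    from LIMSEQ_le_const[OF lim0, of "\<bar>\<integral>\<omega>. X \<omega> \<partial>M\<bar>"] this show ?thesis by (auto simp: mult_ac)
  qed
  show ?thesis
  proof (rule ccontr)
    assume n: "(\<integral>\<omega>. X \<omega> \<partial>M) \<noteq> 0"
    define a where "a = \<bar>\<integral>\<omega>. X \<omega> \<partial>M\<bar>"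
    have a: "a > 0" using n by (simp add: a_def)
    have "a \<le> 8 * B * (a / (16 * (B + 1)))" using key[of "a / (16 * (B + 1))"] a B by (simp add: a_def)
    also have "\<dots> = a * (8 * B / (16 * (B + 1)))" by simp
    also have "\<dots> < a * 1" using a B by (intro mult_strict_left_mono) (auto simp: field_simps)
    finally show False by simp
  qed
qed

context brownian
begin

definition dyadic_point :: "real \<Rightarrow> real \<Rightarrow> nat \<Rightarrow> nat \<Rightarrow> real" where
  "dyadic_point s t m k = s + real k * ((t - s) / 2 ^ m)"

definition time_average :: "nat \<Rightarrow> real \<Rightarrow> real \<Rightarrow> nat \<Rightarrow> 'a \<Rightarrow> real" where
  "time_average j s t m \<omega> = (\<Sum>k<2 ^ m. ((t - s) / 2 ^ m) * (W j (dyadic_point s t m (Suc k)) \<omega> - W j s \<omega>))"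

text \<open>
  The limit of dyadic Riemann sums equals the Lebesgue integral only on continuous paths, but it is
  measurable with respect to the increments on \<open>[s, t]\<close> in any case. The integral itself need not be, because
  the null set of discontinuous paths need not belong to the algebra of these increments.
\<close>

definition time_integral :: "nat \<Rightarrow> real \<Rightarrow> real \<Rightarrow> 'a \<Rightarrow> real" where
  "time_integral j s t \<omega> = lim (\<lambda>m. time_average j s t m \<omega>)"

lemma dyadic_point_in: "s \<le> t \<Longrightarrow> k \<le> 2 ^ m \<Longrightarrow> dyadic_point s t m k \<in> {s..t}"
proof -
  assume st: "s \<le> t" "k \<le> 2 ^ m"
  then have "real k * ((t - s) / 2 ^ m) \<le> 2 ^ m * ((t - s) / 2 ^ m)"
    by (intro mult_right_mono) (auto simp: of_nat_le_iff[symmetric] simp del: of_nat_le_iff)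
  then show ?thesis using st by (simp add: dyadic_point_def)
qed

lemma time_integral_measurable:
  assumes "\<And>u. u \<in> {s..t} \<Longrightarrow> (\<lambda>\<omega>. W j u \<omega> - W j s \<omega>) \<in> borel_measurable N" "s \<le> t"
  shows "time_integral j s t \<in> borel_measurable N"
  unfolding time_integral_def[abs_def] time_average_def[abs_def]
  using assms dyadic_point_in[OF assms(2)]
  by (intro borel_measurable_lim_metric borel_measurable_sum borel_measurable_times borel_measurable_const assms(1)) auto

lemma
  assumes j: "j \<in> J" and st: "0 \<le> s" "s \<le> t"
  shows time_average_converges: "AE \<omega> in M. (\<lambda>m. time_average j s t m \<omega>) \<longlonglongrightarrow> time_integral j s t \<omega>"
    and time_integral_eq: "AE \<omega> in M. time_integral j s t \<omega> = (LBINT v:{s..t}. (W j v \<omega> - W j s \<omega>))"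
proof -
  have A: "AE \<omega> in M. (\<lambda>m. time_average j s t m \<omega>) \<longlonglongrightarrow> (LBINT v:{s..t}. (W j v \<omega> - W j s \<omega>))"
    using AE_continuous[OF j]
  proof eventually_elim
    fix \<omega> assume c: "continuous_on {0..} (\<lambda>t. W j t \<omega>)"
    then have c: "continuous_on {s..t} (\<lambda>v. W j v \<omega> - W j s \<omega>)"
      using st by (intro continuous_intros) (auto elim: continuous_on_subset)
    have "(\<lambda>m. \<Sum>k<2 ^ m. (dyadic_point s t m (Suc k) - dyadic_point s t m k) * (W j (dyadic_point s t m (Suc k)) \<omega> - W j s \<omega>))
        \<longlonglongrightarrow> integral {s..t} (\<lambda>v. W j v \<omega> - W j s \<omega>)"
    proof (rule right_Riemann_sums_converge[OF c, where \<delta>="\<lambda>m. (t - s) / 2 ^ m"])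
      show "(\<lambda>m. (t - s) / 2 ^ m) \<longlonglongrightarrow> 0" by (rule LIMSEQ_divide_realpow_zero) simp
    qed (use st in \<open>auto simp: dyadic_point_def divide_simps ring_distribs\<close>)
    moreover have "dyadic_point s t m (Suc k) - dyadic_point s t m k = (t - s) / 2 ^ m" for m k
    proof -
      have "s + real (Suc k) * y - (s + real k * y) = y" for y by (simp add: algebra_simps)
      then show ?thesis unfolding dyadic_point_def .
    qed
    moreover have "integral {s..t} (\<lambda>v. W j v \<omega> - W j s \<omega>) = (LBINT v:{s..t}. (W j v \<omega> - W j s \<omega>))"
      by (rule set_borel_integral_eq_integral(2)[symmetric]) (rule borel_integrable_atLeastAtMost'[OF c])
    ultimately show "(\<lambda>m. time_average j s t m \<omega>) \<longlonglongrightarrow> (LBINT v:{s..t}. (W j v \<omega> - W j s \<omega>))"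
      by (simp add: time_average_def)
  qed
  show "AE \<omega> in M. time_integral j s t \<omega> = (LBINT v:{s..t}. (W j v \<omega> - W j s \<omega>))"
    using A by eventually_elim (auto simp: time_integral_def limI)
  with A show "AE \<omega> in M. (\<lambda>m. time_average j s t m \<omega>) \<longlonglongrightarrow> time_integral j s t \<omega>"
    by eventually_elim simp
qed

text \<open>
  The average of \<open>2\<^sup>m\<close> variables of size \<open>h\<^sup>1\<^sup>/\<^sup>2\<close>, times \<open>h\<close>, by Jensen's inequality.
\<close>

lemma time_average_moments:
  assumes j: "j \<in> J" and st: "0 \<le> s" "s \<le> t"
  shows "all_moments M (time_average j s t m)" "(\<integral>\<omega>. time_average j s t m \<omega> \<partial>M) = 0"
    and "q \<ge> 1 \<Longrightarrow> absmom M q (time_average j s t m) \<le> ennreal (normal_moment_const q * (t - s) ^ (3 * q))"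
proof -
  have p: "s \<le> dyadic_point s t m (Suc k)" "dyadic_point s t m (Suc k) \<le> t" "0 \<le> dyadic_point s t m (Suc k)" if "k < 2 ^ m" for k
    using dyadic_point_in[OF st(2), of "Suc k" m] that st by auto
  have am: "all_moments M (\<lambda>\<omega>. ((t - s) / 2 ^ m) * (W j (dyadic_point s t m (Suc k)) \<omega> - W j s \<omega>))" if "k < 2 ^ m" for k
    by (intro all_moments_mult all_moments_const all_moments_increment j st p that)
  show AM: "all_moments M (time_average j s t m)"
    unfolding time_average_def[abs_def] by (intro all_moments_sum am) auto
  have "(\<integral>\<omega>. time_average j s t m \<omega> \<partial>M) = (\<Sum>k<2 ^ m. (\<integral>\<omega>. ((t - s) / 2 ^ m) * (W j (dyadic_point s t m (Suc k)) \<omega> - W j s \<omega>) \<partial>M))"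
    unfolding time_average_def using am by (intro Bochner_Integration.integral_sum all_moments_integrable finite_measure_axioms) auto
  also have "\<dots> = 0"
  proof (rule sum.neutral, rule ballI)
    fix k :: nat assume "k \<in> {..<2 ^ m}"
    then show "(\<integral>\<omega>. ((t - s) / 2 ^ m) * (W j (dyadic_point s t m (Suc k)) \<omega> - W j s \<omega>) \<partial>M) = 0"
      using expectation_increment[OF j st(1) p(1)[of k]] by simp
  qed
  finally show "(\<integral>\<omega>. time_average j s t m \<omega> \<partial>M) = 0" .
  assume q: "q \<ge> 1"
  define h where "h = t - s"
  have h: "h \<ge> 0" using st by (simp add: h_def)
  define c where "c = normal_moment_const q"
  have c: "c \<ge> 0" by (simp add: c_def normal_moment_const_nonneg)
  define f where "f k \<omega> = (h / 2 ^ m) * (W j (dyadic_point s t m (Suc k)) \<omega> - W j s \<omega>)" for k \<omega>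
  have "absmom M q (time_average j s t m) \<le> absmom M q (\<lambda>\<omega>. \<Sum>k<2 ^ m. \<bar>f k \<omega>\<bar>)"
  proof (rule absmom_mono)
    show "norm (time_average j s t m \<omega>) \<le> norm (\<Sum>k<2 ^ m. \<bar>f k \<omega>\<bar>)" for \<omega>
      unfolding time_average_def f_def h_def real_norm_def by (rule order_trans[OF sum_abs abs_ge_self])
  qed
  also have "\<dots> \<le> ennreal (real (2 ^ m) ^ (2 * q)) * ennreal ((h / 2 ^ m) ^ (2 * q) * (c * h ^ q))"
  proof (rule absmom_sum_le[OF _ q])
    fix k :: nat assume k: "k < 2 ^ m"
    show "f k \<in> borel_measurable M" using am[OF k] by (simp add: all_moments_def f_def[abs_def] h_def)
    have "absmom M q (f k) = ennreal (\<bar>h / 2 ^ m\<bar> ^ (2 * q)) * absmom M q (\<lambda>\<omega>. W j (dyadic_point s t m (Suc k)) \<omega> - W j s \<omega>)"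
      using absmom_cmult[of "\<lambda>\<omega>. W j (dyadic_point s t m (Suc k)) \<omega> - W j s \<omega>" M q "h / 2 ^ m"]
        all_moments_increment[OF j st(1) p(3)[OF k]] by (simp add: all_moments_def f_def[abs_def])
    also have "\<dots> \<le> ennreal (\<bar>h / 2 ^ m\<bar> ^ (2 * q)) * ennreal (c * h ^ q)"
    proof (intro mult_left_mono)
      have "absmom M q (\<lambda>\<omega>. W j (dyadic_point s t m (Suc k)) \<omega> - W j s \<omega>) \<le> ennreal (c * (dyadic_point s t m (Suc k) - s) ^ q)"
        unfolding c_def by (rule absmom_increment[OF j st(1) p(1)[OF k]])
      also have "\<dots> \<le> ennreal (c * h ^ q)"
        using p[OF k] c unfolding h_def by (intro ennreal_leI mult_left_mono power_mono) auto
      finally show "absmom M q (\<lambda>\<omega>. W j (dyadic_point s t m (Suc k)) \<omega> - W j s \<omega>) \<le> ennreal (c * h ^ q)" .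
    qed simp
    finally show "absmom M q (f k) \<le> ennreal ((h / 2 ^ m) ^ (2 * q) * (c * h ^ q))"
      using h c by (simp add: ennreal_mult)
  qed
  also have "\<dots> = ennreal (real (2 ^ m) ^ (2 * q) * ((h / 2 ^ m) ^ (2 * q) * (c * h ^ q)))"
    using h c by (intro ennreal_mult[symmetric]) auto
  also have "real (2 ^ m) ^ (2 * q) * ((h / 2 ^ m) ^ (2 * q) * (c * h ^ q)) = (real (2 ^ m) * (h / 2 ^ m)) ^ (2 * q) * (c * h ^ q)"
    by (simp only: power_mult_distrib mult.assoc)
  also have "\<dots> = c * h ^ (3 * q)"
  proof -
    have "h ^ (3 * q) = h ^ (2 * q) * h ^ q" unfolding power_add[symmetric] by (rule arg_cong[of _ _ "power h"]) simp
    then show ?thesis by simp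
  qed
  finally show "absmom M q (time_average j s t m) \<le> ennreal (normal_moment_const q * (t - s) ^ (3 * q))"
    by (simp add: c_def h_def)
qed

lemma time_integral_moments:
  assumes j: "j \<in> J" and st: "0 \<le> s" "s \<le> t"
  shows "absmom M q (time_integral j s t) \<le> ennreal (normal_moment_const q * (t - s) ^ (3 * q))"
    and "all_moments M (time_integral j s t)" and "(\<integral>\<omega>. time_integral j s t \<omega> \<partial>M) = 0"
proof -
  have meas: "time_integral j s t \<in> borel_measurable M"
    by (rule time_integral_measurable) (use j st in \<open>auto intro!: borel_measurable_diff W_measurable\<close>)
  show bound: "absmom M q (time_integral j s t) \<le> ennreal (normal_moment_const q * (t - s) ^ (3 * q))" for q
  proof (cases "q = 0")
    case True then show ?thesis by (simp add: absmom_def emeasure_space_1 normal_moment_const_def)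
  next
    case False
    then show ?thesis
      using absmom_Fatou[of "time_average j s t" "time_integral j s t" q "\<lambda>_. ennreal (normal_moment_const q * (t - s) ^ (3 * q))"]
        time_average_moments[OF j st] time_average_converges[OF j st]
      by (simp add: all_moments_def Liminf_const)
  qed
  show am: "all_moments M (time_integral j s t)"
    unfolding all_moments_def using meas by (auto intro: le_less_trans[OF bound])
  show "(\<integral>\<omega>. time_integral j s t \<omega> \<partial>M) = 0"
    using expectation_limit_zero[OF time_average_moments(1,2)[OF j st] time_average_moments(3)[OF j st order_refl] am time_average_converges[OF j st]]
      st normal_moment_const_nonneg by simp
qed

end

section \<open>The Ito integral of elapsed time\<close>

lemma sum_indicator_step:
  fixes g :: "nat \<Rightarrow> 'b::semiring_1" and u :: "nat \<Rightarrow> real"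
  assumes mono: "\<And>k. k < K \<Longrightarrow> u k \<le> u (Suc k)" and k: "k < K" and v: "v \<in> {u k<..u (Suc k)}"
  shows "(\<Sum>l<K. g l * indicator {u l<..u (Suc l)} v) = g k"
proof -
  have le: "u i \<le> u l" if "i \<le> l" "l \<le> K" for i l
    using that
  proof (induction l)
    case (Suc l)
    show ?case
    proof (cases "i = Suc l")
      case False
      then show ?thesis using Suc mono[of l] by auto
    qed simp
  qed simp
  have "indicator {u l<..u (Suc l)} v = (if l = k then 1 else 0 :: 'b)" if "l < K" for l
  proof -
    consider "l < k" | "l = k" | "k < l" by linarith
    then show ?thesis
    proof cases
      case 1 then show ?thesis using le[of "Suc l" k] k v by (auto simp: indicator_def)
    next
      case 2 then show ?thesis using v by simp
    next
      case 3 then show ?thesis using le[of "Suc k" l] that v by (auto simp: indicator_def)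
    qed
  qed
  then have "(\<Sum>l<K. g l * indicator {u l<..u (Suc l)} v) = (\<Sum>l<K. if l = k then g l else 0)"
    by (intro sum.cong refl) auto
  then show ?thesis using k by simp
qed

text \<open>
  With \<open>w\<close> a path, the discrete form of \<open>\<integral> (v - s) dW\<^sub>v = (t - s) W\<^sub>t - \<integral> W\<^sub>v dv\<close>.
\<close>

lemma sum_by_parts:
  fixes u w :: "nat \<Rightarrow> real"
  shows "(\<Sum>k<K. (u k - u 0) * (w (Suc k) - w k)) = (u K - u 0) * w K - (\<Sum>k<K. (u (Suc k) - u k) * w (Suc k))"
  by (induction K) (simp_all add: algebra_simps)

text \<open>
  The partition obtained from \<open>\<tau>\<close> by dividing each interval into \<open>N\<close> equal parts.
\<close>

definition refine :: "(nat \<Rightarrow> real) \<Rightarrow> nat \<Rightarrow> nat \<Rightarrow> real" where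
  "refine \<tau> N k = \<tau> (k div N) + real (k mod N) / real N * (\<tau> (Suc (k div N)) - \<tau> (k div N))"

lemma refine_Suc:
  assumes "N > 0"
  shows "refine \<tau> N (Suc k) = \<tau> (k div N) + (real (k mod N) + 1) / real N * (\<tau> (Suc (k div N)) - \<tau> (k div N))"
proof (cases "Suc (k mod N) = N")
  case True
  then have 1: "Suc k mod N = 0" "Suc k div N = Suc (k div N)" by (simp_all add: mod_Suc div_Suc)
  have "real (k mod N) + 1 = real N" using True by linarith
  then show ?thesis using assms unfolding refine_def 1 by simp
next
  case False
  then have 1: "Suc k mod N = Suc (k mod N)" "Suc k div N = k div N" using assms by (simp_all add: mod_Suc div_Suc)
  then show ?thesis unfolding refine_def by (simp add: add.commute)
qed

lemma refine_mult: "N > 0 \<Longrightarrow> refine \<tau> N (i * N) = \<tau> i"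
  by (simp add: refine_def)

context brownian
begin

text \<open>
  The next increment is independent of the sum so far and of its own coefficient, and has expectation zero: mixed
  terms vanish and squares are multiplied.
\<close>

lemma ito_isometry:
  assumes j: "j \<in> J" and u0: "0 \<le> u 0" and mono: "\<And>k. k < K \<Longrightarrow> u k \<le> u (Suc k)"
    and c: "\<And>k. k < K \<Longrightarrow> c k \<in> borel_measurable (F (u k))" "\<And>k. k < K \<Longrightarrow> all_moments M (c k)"
  defines "X \<equiv> \<lambda>K \<omega>. \<Sum>k<K. c k \<omega> * (W j (u (Suc k)) \<omega> - W j (u k) \<omega>)"
  shows "all_moments M (X K) \<and> X K \<in> borel_measurable (F (u K)) \<and> 0 \<le> u K \<and>
    (\<integral>\<omega>. (X K \<omega>)\<^sup>2 \<partial>M) = (\<Sum>k<K. (\<integral>\<omega>. (c k \<omega>)\<^sup>2 \<partial>M) * (u (Suc k) - u k))"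
  using mono c
proof (induction K)
  case 0
  then show ?case by (simp add: X_def u0 all_moments_const)
next
  case (Suc K)
  note cK = Suc.prems(2,3)[of K, simplified]
  define D where "D \<omega> = W j (u (Suc K)) \<omega> - W j (u K) \<omega>" for \<omega>
  have IH: "all_moments M (X K)" "X K \<in> borel_measurable (F (u K))" "0 \<le> u K"
    "(\<integral>\<omega>. (X K \<omega>)\<^sup>2 \<partial>M) = (\<Sum>k<K. (\<integral>\<omega>. (c k \<omega>)\<^sup>2 \<partial>M) * (u (Suc k) - u k))"
    using Suc.IH Suc.prems by auto
  have uK: "u K \<le> u (Suc K)" using Suc.prems(1) by simp
  have uS: "0 \<le> u (Suc K)" using IH(3) uK by simp
  have D: "all_moments M D" unfolding D_def[abs_def] by (rule all_moments_increment[OF j IH(3) uS])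
  have Df: "D \<in> borel_measurable (future (u K))" unfolding D_def[abs_def] by (rule future_measurable[OF j uK])
  note ind = indep_set_integral_mult[OF F_sub[OF IH(3)] future_sub[OF IH(3)] future_indep[OF IH(3)]]
  have XS: "X (Suc K) = (\<lambda>\<omega>. X K \<omega> + c K \<omega> * D \<omega>)" by (auto simp: X_def D_def)
  have mom: "all_moments M (X (Suc K))" unfolding XS by (intro all_moments_add all_moments_mult IH cK D)
  have meas: "X (Suc K) \<in> borel_measurable (F (u (Suc K)))"
  proof -
    have "X K \<in> borel_measurable (F (u (Suc K)))" "c K \<in> borel_measurable (F (u (Suc K)))"
      using measurable_from_subalg[OF F_mono[OF IH(3) uK]] IH(2) cK(1) by auto
    then show ?thesis unfolding XS D_def using IH(3) uK uS
      by (intro borel_measurable_add borel_measurable_times borel_measurable_diff W_F[OF j]) auto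
  qed
  have int: "integrable M (\<lambda>\<omega>. (X K \<omega>)\<^sup>2)" "integrable M (\<lambda>\<omega>. (X K \<omega> * c K \<omega>) * D \<omega>)" "integrable M (\<lambda>\<omega>. (c K \<omega>)\<^sup>2 * (D \<omega>)\<^sup>2)"
    "integrable M (\<lambda>\<omega>. X K \<omega> * c K \<omega>)" "integrable M D" "integrable M (\<lambda>\<omega>. (c K \<omega>)\<^sup>2)" "integrable M (\<lambda>\<omega>. (D \<omega>)\<^sup>2)"
    by (intro all_moments_integrable all_moments_mult all_moments_power IH cK D finite_measure_axioms)+
  have "(\<integral>\<omega>. (X (Suc K) \<omega>)\<^sup>2 \<partial>M) = (\<integral>\<omega>. (X K \<omega>)\<^sup>2 + 2 * ((X K \<omega> * c K \<omega>) * D \<omega>) + (c K \<omega>)\<^sup>2 * (D \<omega>)\<^sup>2 \<partial>M)"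
    by (simp add: XS power2_eq_square algebra_simps)
  also have "\<dots> = (\<integral>\<omega>. (X K \<omega>)\<^sup>2 \<partial>M) + 2 * (\<integral>\<omega>. (X K \<omega> * c K \<omega>) * D \<omega> \<partial>M) + (\<integral>\<omega>. (c K \<omega>)\<^sup>2 * (D \<omega>)\<^sup>2 \<partial>M)"
    using int by simp
  also have "(\<integral>\<omega>. (X K \<omega> * c K \<omega>) * D \<omega> \<partial>M) = (\<integral>\<omega>. X K \<omega> * c K \<omega> \<partial>M) * (\<integral>\<omega>. D \<omega> \<partial>M)"
    using IH(2) cK(1) by (intro ind Df int) auto
  also have "(\<integral>\<omega>. D \<omega> \<partial>M) = 0" unfolding D_def by (rule expectation_increment[OF j IH(3) uK])
  also have "(\<integral>\<omega>. (c K \<omega>)\<^sup>2 * (D \<omega>)\<^sup>2 \<partial>M) = (\<integral>\<omega>. (c K \<omega>)\<^sup>2 \<partial>M) * (\<integral>\<omega>. (D \<omega>)\<^sup>2 \<partial>M)"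
    using cK(1) Df by (intro ind int) auto
  also have "(\<integral>\<omega>. (D \<omega>)\<^sup>2 \<partial>M) = u (Suc K) - u K" unfolding D_def by (rule expectation_increment_sq[OF j IH(3) uK])
  finally show ?case using mom meas uS IH(4) by simp
qed

lemma all_moments_bounded:
  assumes "f \<in> borel_measurable M" "\<And>\<omega>. \<omega> \<in> space M \<Longrightarrow> norm (f \<omega> :: real) \<le> b"
  shows "all_moments M f"
proof (rule all_moments_dominated[OF all_moments_const[of b] assms(1)])
  fix \<omega> assume "\<omega> \<in> space M"
  then show "norm (f \<omega>) \<le> norm b" using assms(2)[of \<omega>] by simp
qed

text \<open>
  The value of \<open>\<integral>\<^sub>s\<^sup>t (v - s) dW\<^sub>v\<close> after integration by parts.
\<close>

definition time_weighted_integral :: "nat \<Rightarrow> real \<Rightarrow> real \<Rightarrow> 'a \<Rightarrow> real" where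
  "time_weighted_integral j s t \<omega> = (t - s) * (W j t \<omega> - W j s \<omega>) - time_integral j s t \<omega>"

lemma simple_data_partition:
  assumes sd: "simple_data M F s t n \<tau> \<xi>"
  shows "i \<le> n \<Longrightarrow> s \<le> \<tau> i" "i \<le> n \<Longrightarrow> \<tau> i \<le> t" "s \<le> t"
proof -
  have le: "\<tau> i \<le> \<tau> l" if "i \<le> l" "l \<le> n" for i l
    using that
  proof (induction l)
    case (Suc l)
    show ?case
    proof (cases "i = Suc l")
      case False
      then show ?thesis using Suc sd by (auto simp: simple_data_def intro: order_trans)
    qed simp
  qed simp
  show "i \<le> n \<Longrightarrow> s \<le> \<tau> i" "i \<le> n \<Longrightarrow> \<tau> i \<le> t" "s \<le> t"
    using le[of 0 i] le[of i n] le[of 0 n] sd by (auto simp: simple_data_def)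
qed

text \<open>
  An inequality of isometry type for the distance to the integrand \<open>v - s\<close>, which is not simple. On the
  partition of the simple process, refined \<open>2\<^sup>m\<close> times, \<open>v - s\<close> is replaced by its left endpoint values. The
  isometry holds for the difference \<open>X m\<close> of the two simple integrals. As \<open>m\<close> grows, \<open>X m\<close> converges to the
  variable on the left by summation by parts, and Fatou's lemma gives the bound. The factor 2 comes
  from \<open>(a + b)\<^sup>2 \<le> 2 a\<^sup>2 + 2 b\<^sup>2\<close>, which separates the discretisation error.
\<close>

lemma simple_integral_error:
  assumes j: "j \<in> J" and s: "0 \<le> s" and sd: "simple_data M F s t n \<tau> \<xi>"
    and H: "\<And>v. v \<in> {s..t} \<Longrightarrow> H v = v - s" "H \<in> borel_measurable borel"
  shows "absmom M 1 (\<lambda>\<omega>. simple_integral (W j) n \<tau> \<xi> \<omega> - time_weighted_integral j s t \<omega>)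
    \<le> 2 * (\<integral>\<^sup>+\<omega>. (\<integral>\<^sup>+v\<in>{s..t}. ennreal ((simple_process n \<tau> \<xi> v \<omega> - H v)\<^sup>2) \<partial>lborel) \<partial>M)" (is "_ \<le> 2 * ?A")
proof -
  have \<tau>: "\<tau> 0 = s" "\<tau> n = t" "\<And>i. i < n \<Longrightarrow> \<tau> i \<le> \<tau> (Suc i)" and \<xi>F: "\<And>i. i < n \<Longrightarrow> \<xi> i \<in> borel_measurable (F (\<tau> i))"
    and \<xi>b: "\<And>i. i < n \<Longrightarrow> \<exists>b. \<forall>\<omega>\<in>space M. \<bar>\<xi> i \<omega>\<bar> \<le> b"
    using sd by (auto simp: simple_data_def)
  note part = simple_data_partition[OF sd]
  note st = part(3)
  have \<tau>0: "0 \<le> \<tau> i" if "i \<le> n" for i using part(1)[OF that] s by simp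
  have \<xi>M: "\<xi> i \<in> borel_measurable M" if "i < n" for i
    using measurable_from_subalg[OF F_sub \<xi>F[OF that]] \<tau>0[of i] that by simp
  define u where "u m = refine \<tau> (2 ^ m)" for m :: nat
  define K where "K m = n * 2 ^ m" for m :: nat
  define \<delta> where "\<delta> m = (t - s) / 2 ^ m" for m :: nat
  define i where "i m k = k div 2 ^ m" for m k :: nat
  have iK: "i m k < n" if "k < K m" for m k using that unfolding i_def K_def by (simp add: less_mult_imp_div_less)
  have uu: "u m k = \<tau> (i m k) + real (k mod 2 ^ m) / 2 ^ m * (\<tau> (Suc (i m k)) - \<tau> (i m k))"
      "u m (Suc k) = \<tau> (i m k) + (real (k mod 2 ^ m) + 1) / 2 ^ m * (\<tau> (Suc (i m k)) - \<tau> (i m k))" for m k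
    unfolding u_def i_def using refine_Suc[of "2 ^ m" \<tau> k] by (simp_all add: refine_def)
  have uends: "u m 0 = s" "u m (K m) = t" for m
    unfolding u_def K_def using refine_mult[of "2 ^ m" \<tau> 0] refine_mult[of "2 ^ m" \<tau> n] \<tau> by simp_all
  have step: "u m (Suc k) - u m k = (\<tau> (Suc (i m k)) - \<tau> (i m k)) / 2 ^ m" for m k
    unfolding uu(1)[of m k] uu(2)[of m k] by (simp add: add_divide_distrib distrib_right)
  have umono: "u m k \<le> u m (Suc k)" and mesh: "u m (Suc k) - u m k \<le> \<delta> m" and uin: "\<tau> (i m k) \<le> u m k" "u m (Suc k) \<le> \<tau> (Suc (i m k))"
    if k: "k < K m" for m k
  proof -
    have n: "\<tau> (i m k) \<le> \<tau> (Suc (i m k))" using \<tau>(3) iK[OF k] .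
    have "0 \<le> (\<tau> (Suc (i m k)) - \<tau> (i m k)) / 2 ^ m" using n by simp
    then show "u m k \<le> u m (Suc k)" using step[of m k] by linarith
    show "u m (Suc k) - u m k \<le> \<delta> m"
      unfolding step \<delta>_def using part(1)[of "i m k"] part(2)[of "Suc (i m k)"] iK[OF k] by (intro divide_right_mono) auto
    show "\<tau> (i m k) \<le> u m k" unfolding uu(1)[of m k] using n by simp
    have "k mod 2 ^ m < 2 ^ m" by simp
    then have "real (k mod 2 ^ m) + 1 \<le> 2 ^ m" by (metis Suc_leI of_nat_Suc of_nat_le_iff of_nat_numeral of_nat_power add.commute)
    then have "(real (k mod 2 ^ m) + 1) / 2 ^ m \<le> 1" by simp
    from mult_right_mono[OF this, of "\<tau> (Suc (i m k)) - \<tau> (i m k)"] n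
    show "u m (Suc k) \<le> \<tau> (Suc (i m k))" unfolding uu(2)[of m k] by simp
  qed
  define c where "c m k \<omega> = \<xi> (i m k) \<omega> - (u m k - s)" for m k \<omega>
  define X where "X m \<omega> = (\<Sum>k<K m. c m k \<omega> * (W j (u m (Suc k)) \<omega> - W j (u m k) \<omega>))" for m \<omega>
  have cM: "c m k \<in> borel_measurable M" if "k < K m" for m k
    unfolding c_def[abs_def] using \<xi>M[OF iK[OF that]] by measurable
  have cF: "c m k \<in> borel_measurable (F (u m k))" if k: "k < K m" for m k
  proof -
    have "\<xi> (i m k) \<in> borel_measurable (F (u m k))"
      using measurable_from_subalg[OF F_mono[OF \<tau>0 uin(1)[OF k]] \<xi>F[OF iK[OF k]]] iK[OF k] by simp
    then show ?thesis unfolding c_def[abs_def] by measurable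
  qed
  have cmom: "all_moments M (c m k)" if k: "k < K m" for m k
  proof -
    obtain b where b: "\<And>\<omega>. \<omega> \<in> space M \<Longrightarrow> \<bar>\<xi> (i m k) \<omega>\<bar> \<le> b" using \<xi>b[OF iK[OF k]] by blast
    show ?thesis
    proof (rule all_moments_bounded[OF cM[OF k]])
      fix \<omega> assume "\<omega> \<in> space M"
      then show "norm (c m k \<omega>) \<le> b + \<bar>u m k - s\<bar>" using b[of \<omega>] by (simp add: c_def)
    qed
  qed
  have iso: "all_moments M (X m)" "(\<integral>\<omega>. (X m \<omega>)\<^sup>2 \<partial>M) = (\<Sum>k<K m. (\<integral>\<omega>. (c m k \<omega>)\<^sup>2 \<partial>M) * (u m (Suc k) - u m k))" for m
    using ito_isometry[OF j, of "u m" "K m" "c m", unfolded uends, OF s umono cF cmom] unfolding X_def[abs_def] by auto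
  \<comment> \<open>Refining does not change the integral of \<open>\<xi>\<close>; the part with \<open>v - s\<close> becomes a Riemann sum.\<close>
  have X_eq: "X m \<omega> = simple_integral (W j) n \<tau> \<xi> \<omega> - ((t - s) * W j t \<omega> - (\<Sum>k<K m. (u m (Suc k) - u m k) * W j (u m (Suc k)) \<omega>))" for m \<omega>
  proof -
    have "X m \<omega> = (\<Sum>k<K m. \<xi> (i m k) \<omega> * (W j (u m (Suc k)) \<omega> - W j (u m k) \<omega>)) - (\<Sum>k<K m. (u m k - u m 0) * (W j (u m (Suc k)) \<omega> - W j (u m k) \<omega>))"
      unfolding X_def c_def uends by (simp add: left_diff_distrib sum_subtractf)
    also have "(\<Sum>k<K m. (u m k - u m 0) * (W j (u m (Suc k)) \<omega> - W j (u m k) \<omega>)) = (t - s) * W j t \<omega> - (\<Sum>k<K m. (u m (Suc k) - u m k) * W j (u m (Suc k)) \<omega>)"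
      using sum_by_parts[of "u m" "\<lambda>k. W j (u m k) \<omega>" "K m"] by (simp add: uends)
    also have "(\<Sum>k<K m. \<xi> (i m k) \<omega> * (W j (u m (Suc k)) \<omega> - W j (u m k) \<omega>)) = simple_integral (W j) n \<tau> \<xi> \<omega>"
    proof -
      have "(\<Sum>k<K m. \<xi> (i m k) \<omega> * (W j (u m (Suc k)) \<omega> - W j (u m k) \<omega>))
        = (\<Sum>l<n. \<Sum>k\<in>{l * (2::nat) ^ m..<l * 2 ^ m + 2 ^ m}. \<xi> (i m k) \<omega> * (W j (u m (Suc k)) \<omega> - W j (u m k) \<omega>))"
        unfolding K_def by (rule sum.nat_group[symmetric])
      also have "\<dots> = (\<Sum>l<n. \<xi> l \<omega> * (\<Sum>k\<in>{l * (2::nat) ^ m..<l * 2 ^ m + 2 ^ m}. W j (u m (Suc k)) \<omega> - W j (u m k) \<omega>))"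
        unfolding sum_distrib_left
      proof (intro sum.cong refl)
        fix l k assume "k \<in> {l * (2::nat) ^ m..<l * 2 ^ m + 2 ^ m}"
        then have "i m k = l" unfolding i_def by (intro div_nat_eqI) (auto simp: mult.commute)
        then show "\<xi> (i m k) \<omega> * (W j (u m (Suc k)) \<omega> - W j (u m k) \<omega>) = \<xi> l \<omega> * (W j (u m (Suc k)) \<omega> - W j (u m k) \<omega>)" by simp
      qed
      also have "\<dots> = (\<Sum>l<n. \<xi> l \<omega> * (W j (\<tau> (Suc l)) \<omega> - W j (\<tau> l) \<omega>))"
      proof (intro sum.cong refl arg_cong2[where f="(*)"])
        fix l
        have "(\<Sum>k\<in>{l * (2::nat) ^ m..<l * 2 ^ m + 2 ^ m}. W j (u m (Suc k)) \<omega> - W j (u m k) \<omega>) = W j (u m (Suc l * 2 ^ m)) \<omega> - W j (u m (l * 2 ^ m)) \<omega>"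
          using sum_Suc_diff'[of "l * 2 ^ m" "l * 2 ^ m + 2 ^ m" "\<lambda>k. W j (u m k) \<omega>"] by (simp add: add.commute)
        then show "(\<Sum>k\<in>{l * (2::nat) ^ m..<l * 2 ^ m + 2 ^ m}. W j (u m (Suc k)) \<omega> - W j (u m k) \<omega>) = W j (\<tau> (Suc l)) \<omega> - W j (\<tau> l) \<omega>"
          unfolding u_def by (simp only: refine_mult zero_less_power zero_less_numeral)
      qed
      finally show ?thesis unfolding simple_integral_def .
    qed
    finally show ?thesis .
  qed
  have \<delta>0: "\<delta> \<longlonglongrightarrow> 0" unfolding \<delta>_def by (rule LIMSEQ_divide_realpow_zero) simp
  have lim: "AE \<omega> in M. (\<lambda>m. X m \<omega>) \<longlonglongrightarrow> simple_integral (W j) n \<tau> \<xi> \<omega> - time_weighted_integral j s t \<omega>"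
    using AE_continuous[OF j] time_integral_eq[OF j s st]
  proof eventually_elim
    fix \<omega> assume c0: "continuous_on {0..} (\<lambda>t. W j t \<omega>)" and ti: "time_integral j s t \<omega> = (LBINT v:{s..t}. (W j v \<omega> - W j s \<omega>))"
    have c: "continuous_on {s..t} (\<lambda>v. W j v \<omega>)" using c0 s by (elim continuous_on_subset) auto
    have c2: "continuous_on {s..t} (\<lambda>v. W j v \<omega> - W j s \<omega>)" using c by (intro continuous_intros)
    have "time_integral j s t \<omega> = integral {s..t} (\<lambda>v. W j v \<omega> - W j s \<omega>)"
      unfolding ti by (rule set_borel_integral_eq_integral(2)) (rule borel_integrable_atLeastAtMost'[OF c2])
    also have "\<dots> = integral {s..t} (\<lambda>v. W j v \<omega>) - (t - s) * W j s \<omega>"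
      using c st by (subst Henstock_Kurzweil_Integration.integral_diff) (auto intro!: integrable_continuous_real)
    finally have twi: "time_weighted_integral j s t \<omega> = (t - s) * W j t \<omega> - integral {s..t} (\<lambda>v. W j v \<omega>)"
      by (simp add: time_weighted_integral_def algebra_simps)
    have "(\<lambda>m. \<Sum>k<K m. (u m (Suc k) - u m k) * W j (u m (Suc k)) \<omega>) \<longlonglongrightarrow> integral {s..t} (\<lambda>v. W j v \<omega>)"
      by (rule right_Riemann_sums_converge[OF c umono uends mesh \<delta>0])
    then show "(\<lambda>m. X m \<omega>) \<longlonglongrightarrow> simple_integral (W j) n \<tau> \<xi> \<omega> - time_weighted_integral j s t \<omega>"
      unfolding X_eq twi by (intro tendsto_intros)
  qed
  \<comment> \<open>The isometry expresses the second moment of \<open>X m\<close> by the step function on the left, which differs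
    from \<open>\<xi> - H\<close> by at most the mesh \<open>\<delta> m\<close>.\<close>
  have point: "(\<Sum>k<K m. ennreal ((c m k \<omega>)\<^sup>2) * indicator {u m k<..u m (Suc k)} v)
     \<le> (2 * ennreal ((simple_process n \<tau> \<xi> v \<omega> - H v)\<^sup>2) + ennreal (2 * (\<delta> m)\<^sup>2)) * indicator {s..t} v" for m v \<omega>
  proof (cases "\<exists>k<K m. v \<in> {u m k<..u m (Suc k)}")
    case False
    then have "(\<Sum>k<K m. ennreal ((c m k \<omega>)\<^sup>2) * indicator {u m k<..u m (Suc k)} v) = 0" by (intro sum.neutral) auto
    then show ?thesis by simp
  next
    case True
    then obtain k where k: "k < K m" "v \<in> {u m k<..u m (Suc k)}" by blast
    have vi: "v \<in> {\<tau> (i m k)<..\<tau> (Suc (i m k))}" using uin[OF k(1)] k(2) by auto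
    have vst: "v \<in> {s..t}" using vi part(1)[of "i m k"] part(2)[of "Suc (i m k)"] iK[OF k(1)] by auto
    have "simple_process n \<tau> \<xi> v \<omega> = \<xi> (i m k) \<omega>"
      unfolding simple_process_def using \<tau>(3) iK[OF k(1)] vi by (intro sum_indicator_step)
    then have c: "c m k \<omega> = (simple_process n \<tau> \<xi> v \<omega> - H v) + (v - u m k)" by (simp add: c_def H(1)[OF vst])
    have "\<bar>v - u m k\<bar> \<le> \<bar>\<delta> m\<bar>" using k(2) mesh[OF k(1)] by auto
    then have "(v - u m k)\<^sup>2 \<le> (\<delta> m)\<^sup>2" by (simp add: abs_le_square_iff)
    moreover have "(a + b)\<^sup>2 \<le> 2 * a\<^sup>2 + 2 * b\<^sup>2" for a b :: real
      using zero_le_power2[of "a - b"] by (simp add: power2_eq_square algebra_simps)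
    ultimately have "(c m k \<omega>)\<^sup>2 \<le> 2 * (simple_process n \<tau> \<xi> v \<omega> - H v)\<^sup>2 + 2 * (\<delta> m)\<^sup>2" unfolding c by (smt (verit))
    then have "ennreal ((c m k \<omega>)\<^sup>2) \<le> ennreal (2 * (simple_process n \<tau> \<xi> v \<omega> - H v)\<^sup>2 + 2 * (\<delta> m)\<^sup>2)" by (rule ennreal_leI)
    also have "\<dots> = 2 * ennreal ((simple_process n \<tau> \<xi> v \<omega> - H v)\<^sup>2) + ennreal (2 * (\<delta> m)\<^sup>2)"
      by (simp add: ennreal_plus ennreal_mult)
    finally show ?thesis
      using sum_indicator_step[of "K m" "u m" k v "\<lambda>k. ennreal ((c m k \<omega>)\<^sup>2)"] umono k vst by simp
  qed
  have [measurable]: "\<And>i. i \<in> {..<n} \<Longrightarrow> \<xi> i \<in> borel_measurable M" using \<xi>M by simp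
  note [measurable] = H(2)
  have procM: "(\<lambda>(\<omega>, v). ennreal ((simple_process n \<tau> \<xi> v \<omega> - H v)\<^sup>2)) \<in> borel_measurable (M \<Otimes>\<^sub>M lborel)"
    unfolding simple_process_def by measurable
  have procv: "(\<lambda>v. ennreal ((simple_process n \<tau> \<xi> v \<omega> - H v)\<^sup>2)) \<in> borel_measurable lborel" for \<omega>
    unfolding simple_process_def by measurable
  have energy: "absmom M 1 (X m) \<le> 2 * ?A + ennreal (2 * (\<delta> m)\<^sup>2 * (t - s))" for m
  proof -
    have "absmom M 1 (X m) = ennreal (\<Sum>k<K m. (\<integral>\<omega>. (c m k \<omega>)\<^sup>2 \<partial>M) * (u m (Suc k) - u m k))"
      using iso[of m] absmom_eq_integral(1)[of M "X m" 1] by simp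
    also have "\<dots> = (\<Sum>k<K m. ennreal ((\<integral>\<omega>. (c m k \<omega>)\<^sup>2 \<partial>M) * (u m (Suc k) - u m k)))"
      by (rule sum_ennreal[symmetric]) (use umono in \<open>auto intro!: mult_nonneg_nonneg integral_nonneg\<close>)
    also have "\<dots> = (\<Sum>k<K m. \<integral>\<^sup>+\<omega>. ennreal ((c m k \<omega>)\<^sup>2) * emeasure lborel {u m k<..u m (Suc k)} \<partial>M)"
    proof (intro sum.cong refl)
      fix k assume "k \<in> {..<K m}"
      then have k: "k < K m" by simp
      have "ennreal ((\<integral>\<omega>. (c m k \<omega>)\<^sup>2 \<partial>M) * (u m (Suc k) - u m k)) = ennreal (\<integral>\<omega>. (c m k \<omega>)\<^sup>2 \<partial>M) * emeasure lborel {u m k<..u m (Suc k)}"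
        using umono[OF k] by (simp add: ennreal_mult)
      also have "ennreal (\<integral>\<omega>. (c m k \<omega>)\<^sup>2 \<partial>M) = (\<integral>\<^sup>+\<omega>. ennreal ((c m k \<omega>)\<^sup>2) \<partial>M)"
        by (rule nn_integral_eq_integral[symmetric]) (auto intro!: all_moments_integrable all_moments_power cmom k finite_measure_axioms)
      finally show "ennreal ((\<integral>\<omega>. (c m k \<omega>)\<^sup>2 \<partial>M) * (u m (Suc k) - u m k)) = (\<integral>\<^sup>+\<omega>. ennreal ((c m k \<omega>)\<^sup>2) * emeasure lborel {u m k<..u m (Suc k)} \<partial>M)"
        using cM[OF k] by (simp add: nn_integral_multc)
    qed
    also have "\<dots> = (\<integral>\<^sup>+\<omega>. (\<Sum>k<K m. ennreal ((c m k \<omega>)\<^sup>2) * emeasure lborel {u m k<..u m (Suc k)}) \<partial>M)"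
      using cM by (intro nn_integral_sum[symmetric]) auto
    also have "\<dots> = (\<integral>\<^sup>+\<omega>. (\<integral>\<^sup>+v. (\<Sum>k<K m. ennreal ((c m k \<omega>)\<^sup>2) * indicator {u m k<..u m (Suc k)} v) \<partial>lborel) \<partial>M)"
    proof (rule nn_integral_cong)
      fix \<omega>
      show "(\<Sum>k<K m. ennreal ((c m k \<omega>)\<^sup>2) * emeasure lborel {u m k<..u m (Suc k)})
        = (\<integral>\<^sup>+v. (\<Sum>k<K m. ennreal ((c m k \<omega>)\<^sup>2) * indicator {u m k<..u m (Suc k)} v) \<partial>lborel)"
        by (subst nn_integral_sum, simp, intro sum.cong refl nn_integral_cmult_indicator[symmetric], simp)
    qed
    also have "\<dots> \<le> (\<integral>\<^sup>+\<omega>. (\<integral>\<^sup>+v. (2 * ennreal ((simple_process n \<tau> \<xi> v \<omega> - H v)\<^sup>2) + ennreal (2 * (\<delta> m)\<^sup>2)) * indicator {s..t} v \<partial>lborel) \<partial>M)"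
      by (intro nn_integral_mono point)
    also have "\<dots> = (\<integral>\<^sup>+\<omega>. 2 * (\<integral>\<^sup>+v\<in>{s..t}. ennreal ((simple_process n \<tau> \<xi> v \<omega> - H v)\<^sup>2) \<partial>lborel) + ennreal (2 * (\<delta> m)\<^sup>2) * ennreal (t - s) \<partial>M)"
    proof (intro nn_integral_cong)
      fix \<omega>
      have "(\<integral>\<^sup>+v. (2 * ennreal ((simple_process n \<tau> \<xi> v \<omega> - H v)\<^sup>2) + ennreal (2 * (\<delta> m)\<^sup>2)) * indicator {s..t} v \<partial>lborel)
        = (\<integral>\<^sup>+v. 2 * (ennreal ((simple_process n \<tau> \<xi> v \<omega> - H v)\<^sup>2) * indicator {s..t} v) + ennreal (2 * (\<delta> m)\<^sup>2) * indicator {s..t} v \<partial>lborel)"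
        by (simp add: distrib_right mult.assoc)
      also have "\<dots> = 2 * (\<integral>\<^sup>+v\<in>{s..t}. ennreal ((simple_process n \<tau> \<xi> v \<omega> - H v)\<^sup>2) \<partial>lborel) + ennreal (2 * (\<delta> m)\<^sup>2) * ennreal (t - s)"
        using procv[of \<omega>] st by (subst nn_integral_add) (auto simp: nn_integral_cmult)
      finally show "(\<integral>\<^sup>+v. (2 * ennreal ((simple_process n \<tau> \<xi> v \<omega> - H v)\<^sup>2) + ennreal (2 * (\<delta> m)\<^sup>2)) * indicator {s..t} v \<partial>lborel) = \<dots>" .
    qed
    also have "\<dots> = 2 * ?A + ennreal (2 * (\<delta> m)\<^sup>2) * ennreal (t - s)"
    proof -
      have "(\<lambda>\<omega>. \<integral>\<^sup>+v\<in>{s..t}. ennreal ((simple_process n \<tau> \<xi> v \<omega> - H v)\<^sup>2) \<partial>lborel) \<in> borel_measurable M"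
        using procM by measurable
      then show ?thesis by (simp add: nn_integral_add nn_integral_cmult emeasure_space_1)
    qed
    also have "ennreal (2 * (\<delta> m)\<^sup>2) * ennreal (t - s) = ennreal (2 * (\<delta> m)\<^sup>2 * (t - s))" using st by (intro ennreal_mult[symmetric]) auto
    finally show ?thesis .
  qed
  show ?thesis
  proof (rule ennreal_le_epsilon)
    fix e :: real assume e: "0 < e"
    have "(\<lambda>m. 2 * (\<delta> m)\<^sup>2 * (t - s)) \<longlonglongrightarrow> 2 * 0\<^sup>2 * (t - s)" using \<delta>0 by (intro tendsto_intros)
    then have "eventually (\<lambda>m. 2 * (\<delta> m)\<^sup>2 * (t - s) < e) sequentially" using e by (intro order_tendstoD(2)) auto
    then obtain m0 where m0: "\<And>m. m \<ge> m0 \<Longrightarrow> 2 * (\<delta> m)\<^sup>2 * (t - s) < e" by (auto simp: eventually_sequentially)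
    have b: "absmom M 1 (X (m + m0)) \<le> 2 * ?A + ennreal e" for m
      by (rule order_trans[OF energy add_left_mono]) (use m0[of "m + m0"] in \<open>auto intro: ennreal_leI\<close>)
    have l: "AE \<omega> in M. (\<lambda>m. X (m + m0) \<omega>) \<longlonglongrightarrow> simple_integral (W j) n \<tau> \<xi> \<omega> - time_weighted_integral j s t \<omega>"
      using lim by eventually_elim (rule LIMSEQ_ignore_initial_segment)
    have "X m \<in> borel_measurable M" for m using iso[of m] by (simp add: all_moments_def)
    then show "absmom M 1 (\<lambda>\<omega>. simple_integral (W j) n \<tau> \<xi> \<omega> - time_weighted_integral j s t \<omega>) \<le> 2 * ?A + ennreal e"
      using absmom_Fatou[OF _ l b] by (simp add: Liminf_const)
  qed
qed

lemma time_integrand: "(LBINT u:{s..v}. 1) = max 0 (v - s :: real)"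
proof -
  have "(LBINT u:{s..v}. (1::real)) = measure lborel {s..v}"
    by (simp add: set_lebesgue_integral_def)
  then show ?thesis by (simp add: max_def)
qed

lemma time_weighted_integral_measurable: "j \<in> J \<Longrightarrow> 0 \<le> s \<Longrightarrow> s \<le> t \<Longrightarrow> time_weighted_integral j s t \<in> borel_measurable M"
  unfolding time_weighted_integral_def[abs_def]
  by (intro borel_measurable_diff borel_measurable_times borel_measurable_const W_measurable time_integral_measurable) auto

text \<open>
  Dyadic step functions approximate \<open>v - s\<close>; \<open>simple_integral_error\<close> gives the convergence of their integrals.
\<close>

lemma has_ito_integral_time:
  assumes j: "j \<in> J" and st: "0 \<le> s" "s \<le> t"
  shows "has_ito_integral M F (W j) s t (\<lambda>v _. LBINT u:{s..v}. 1) (time_weighted_integral j s t)"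
  unfolding has_ito_integral_def
proof (intro conjI)
  show "time_weighted_integral j s t \<in> borel_measurable M" by (rule time_weighted_integral_measurable[OF j st])
  show "(\<lambda>(v, \<omega>). LBINT u:{s..v}. 1 :: real) \<in> borel_measurable (lborel \<Otimes>\<^sub>M M)"
    unfolding time_integrand by measurable
  define \<tau> where "\<tau> m = dyadic_point s t m" for m
  define \<xi> where "\<xi> m k \<omega> = dyadic_point s t m k - s" for m k and \<omega> :: 'a
  define \<delta> where "\<delta> m = (t - s) / 2 ^ m" for m :: nat
  have gen: "s + real (Suc k) * y - (s + real k * y) = y" for k y by (simp add: algebra_simps)
  have \<tau>step: "\<tau> m (Suc k) - \<tau> m k = \<delta> m" for m k
    unfolding \<tau>_def \<delta>_def dyadic_point_def by (rule gen)
  have \<delta>nn: "0 \<le> \<delta> m" for m using st by (simp add: \<delta>_def)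
  have sd: "simple_data M F s t (2 ^ m) (\<tau> m) (\<xi> m)" for m
    unfolding simple_data_def
  proof (intro conjI allI impI)
    show "\<tau> m 0 = s" "\<tau> m (2 ^ m) = t" by (simp_all add: \<tau>_def dyadic_point_def)
    show "\<tau> m k \<le> \<tau> m (Suc k)" for k using \<tau>step[of m k] \<delta>nn[of m] by linarith
    show "\<xi> m k \<in> borel_measurable (F (\<tau> m k))" for k by (simp add: \<xi>_def[abs_def])
    show "\<exists>b. \<forall>\<omega>\<in>space M. \<bar>\<xi> m k \<omega>\<bar> \<le> b" for k unfolding \<xi>_def by blast
  qed
  have \<delta>0: "\<delta> \<longlonglongrightarrow> 0" unfolding \<delta>_def by (rule LIMSEQ_divide_realpow_zero) simp
  have cover: "\<exists>k<2 ^ m. v \<in> {\<tau> m k<..\<tau> m (Suc k)}" if v: "v \<in> {s<..t}" for v m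
  proof -
    have ex: "v \<le> \<tau> m (2 ^ m)" using v by (simp add: \<tau>_def dyadic_point_def)
    define k where "k = (LEAST k. v \<le> \<tau> m k)"
    have 1: "v \<le> \<tau> m k" unfolding k_def by (rule LeastI[of "\<lambda>k. v \<le> \<tau> m k", OF ex])
    have 2: "k \<le> 2 ^ m" unfolding k_def by (rule Least_le[of "\<lambda>k. v \<le> \<tau> m k", OF ex])
    have "k \<noteq> 0" using 1 v by (intro notI) (simp add: \<tau>_def dyadic_point_def)
    then obtain l where l: "k = Suc l" by (cases k) auto
    have "\<not> v \<le> \<tau> m l" using not_less_Least[of l "\<lambda>k. v \<le> \<tau> m k"] l unfolding k_def[symmetric] by simp
    then show ?thesis using 1 2 l by (intro exI[of _ l]) auto
  qed
  have pt: "ennreal ((simple_process (2 ^ m) (\<tau> m) (\<xi> m) v \<omega> - (LBINT u:{s..v}. 1))\<^sup>2) * indicator {s..t} v \<le> ennreal ((\<delta> m)\<^sup>2) * indicator {s..t} v" for m v \<omega>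
  proof (cases "v \<in> {s<..t}")
    case True
    obtain k where k: "k < 2 ^ m" "v \<in> {\<tau> m k<..\<tau> m (Suc k)}" using cover[OF True] by blast
    have "simple_process (2 ^ m) (\<tau> m) (\<xi> m) v \<omega> = \<xi> m k \<omega>"
      unfolding simple_process_def
    proof (rule sum_indicator_step[OF _ k])
      show "\<tau> m l \<le> \<tau> m (Suc l)" for l using \<tau>step[of m l] \<delta>nn[of m] by linarith
    qed
    then have "\<bar>simple_process (2 ^ m) (\<tau> m) (\<xi> m) v \<omega> - (LBINT u:{s..v}. 1)\<bar> \<le> \<bar>\<delta> m\<bar>"
      using k True \<tau>step[of m k] unfolding time_integrand \<xi>_def \<tau>_def[symmetric] by auto
    then show ?thesis by (intro mult_right_mono ennreal_leI) (auto simp: abs_le_square_iff)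
  next
    case False
    show ?thesis
    proof (cases "v = s")
      case True
      have "s \<le> \<tau> m k" for k unfolding \<tau>_def dyadic_point_def using st by simp
      then have "simple_process (2 ^ m) (\<tau> m) (\<xi> m) v \<omega> = 0"
        unfolding simple_process_def True by (intro sum.neutral) (auto simp: not_less)
      then show ?thesis unfolding time_integrand True by simp
    qed (use False in auto)
  qed
  define A where "A m = (\<integral>\<^sup>+\<omega>. (\<integral>\<^sup>+v\<in>{s..t}. ennreal ((simple_process (2 ^ m) (\<tau> m) (\<xi> m) v \<omega> - (LBINT u:{s..v}. 1))\<^sup>2) \<partial>lborel) \<partial>M)" for m
  have "A m \<le> (\<integral>\<^sup>+\<omega>. (\<integral>\<^sup>+v. ennreal ((\<delta> m)\<^sup>2) * indicator {s..t} v \<partial>lborel) \<partial>M)" for m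
    unfolding A_def by (intro nn_integral_mono pt)
  then have Ab: "A m \<le> ennreal ((\<delta> m)\<^sup>2 * (t - s))" for m
    using st by (simp add: nn_integral_cmult emeasure_space_1 ennreal_mult)
  have lim0: "(\<lambda>m. ennreal ((\<delta> m)\<^sup>2 * (t - s))) \<longlonglongrightarrow> 0"
  proof -
    have "(\<lambda>m. (\<delta> m)\<^sup>2 * (t - s)) \<longlonglongrightarrow> 0\<^sup>2 * (t - s)" using \<delta>0 by (intro tendsto_intros)
    then show ?thesis using tendsto_ennrealI by fastforce
  qed
  have A0: "A \<longlonglongrightarrow> 0" by (rule tendsto_sandwich[OF _ _ tendsto_const lim0]) (use Ab in auto)
  have "(\<lambda>m. \<integral>\<^sup>+\<omega>. ennreal ((simple_integral (W j) (2 ^ m) (\<tau> m) (\<xi> m) \<omega> - time_weighted_integral j s t \<omega>)\<^sup>2) \<partial>M) \<longlonglongrightarrow> 0"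
  proof (rule tendsto_sandwich[OF _ _ tendsto_const])
    show "(\<lambda>m. ennreal ((\<delta> m)\<^sup>2 * (t - s)) + ennreal ((\<delta> m)\<^sup>2 * (t - s))) \<longlonglongrightarrow> 0"
      using tendsto_add[OF lim0 lim0] by simp
    have "(\<integral>\<^sup>+\<omega>. ennreal ((simple_integral (W j) (2 ^ m) (\<tau> m) (\<xi> m) \<omega> - time_weighted_integral j s t \<omega>)\<^sup>2) \<partial>M) \<le> ennreal ((\<delta> m)\<^sup>2 * (t - s)) + ennreal ((\<delta> m)\<^sup>2 * (t - s))" for m
    proof -
      have "absmom M 1 (\<lambda>\<omega>. simple_integral (W j) (2 ^ m) (\<tau> m) (\<xi> m) \<omega> - time_weighted_integral j s t \<omega>) \<le> 2 * A m"
        unfolding A_def by (rule simple_integral_error[OF j st(1) sd]) (auto simp: time_integrand)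
      also have "\<dots> = A m + A m" by (simp add: mult_2)
      also have "\<dots> \<le> ennreal ((\<delta> m)\<^sup>2 * (t - s)) + ennreal ((\<delta> m)\<^sup>2 * (t - s))" by (intro add_mono Ab)
      finally show ?thesis by (simp add: absmom_def)
    qed
    then show "\<forall>\<^sub>F m in sequentially. (\<integral>\<^sup>+\<omega>. ennreal ((simple_integral (W j) (2 ^ m) (\<tau> m) (\<xi> m) \<omega> - time_weighted_integral j s t \<omega>)\<^sup>2) \<partial>M)
      \<le> ennreal ((\<delta> m)\<^sup>2 * (t - s)) + ennreal ((\<delta> m)\<^sup>2 * (t - s))" by simp
  qed simp
  with sd A0 show "\<exists>n \<tau> \<xi>. (\<forall>m. simple_data M F s t (n m) (\<tau> m) (\<xi> m)) \<and>
        (\<lambda>m. \<integral>\<^sup>+\<omega>. (\<integral>\<^sup>+v\<in>{s..t}.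
            ennreal ((simple_process (n m) (\<tau> m) (\<xi> m) v \<omega> - (LBINT u:{s..v}. 1))\<^sup>2) \<partial>lborel) \<partial>M) \<longlonglongrightarrow> 0 \<and>
        (\<lambda>m. \<integral>\<^sup>+\<omega>.
            ennreal ((simple_integral (W j) (n m) (\<tau> m) (\<xi> m) \<omega> - time_weighted_integral j s t \<omega>)\<^sup>2) \<partial>M) \<longlonglongrightarrow> 0"
    unfolding A_def[abs_def] by (intro exI[of _ "\<lambda>m. 2 ^ m"] exI[of _ \<tau>] exI[of _ \<xi>]) auto
qed

text \<open>
  By \<open>simple_integral_error\<close>, the integrals of any approximating sequence converge to the same variable.
\<close>

lemma has_ito_integral_time_unique:
  assumes j: "j \<in> J" and st: "0 \<le> s" "s \<le> t"
    and I: "has_ito_integral M F (W j) s t (\<lambda>v _. LBINT u:{s..v}. 1) I"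
  shows "AE \<omega> in M. I \<omega> = time_weighted_integral j s t \<omega>"
proof -
  let ?J = "time_weighted_integral j s t"
  have [measurable]: "I \<in> borel_measurable M" "?J \<in> borel_measurable M"
    using I time_weighted_integral_measurable[OF j st] by (auto simp: has_ito_integral_def)
  obtain n \<tau> \<xi> where sd: "\<And>m. simple_data M F s t (n m) (\<tau> m) (\<xi> m)"
    and A: "(\<lambda>m. \<integral>\<^sup>+\<omega>. (\<integral>\<^sup>+v\<in>{s..t}. ennreal ((simple_process (n m) (\<tau> m) (\<xi> m) v \<omega> - (LBINT u:{s..v}. 1))\<^sup>2) \<partial>lborel) \<partial>M) \<longlonglongrightarrow> 0" (is "?A \<longlonglongrightarrow> 0")
    and b: "(\<lambda>m. \<integral>\<^sup>+\<omega>. ennreal ((simple_integral (W j) (n m) (\<tau> m) (\<xi> m) \<omega> - I \<omega>)\<^sup>2) \<partial>M) \<longlonglongrightarrow> 0" (is "?b \<longlonglongrightarrow> 0")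
    using I unfolding has_ito_integral_def by blast
  have bound: "absmom M 1 (\<lambda>\<omega>. I \<omega> - ?J \<omega>) \<le> ennreal 4 * (?b m + (?A m + ?A m))" for m
  proof -
    let ?S = "simple_integral (W j) (n m) (\<tau> m) (\<xi> m)"
    have "?S \<in> borel_measurable M"
    proof -
      have "\<xi> m i \<in> borel_measurable M" "W j (\<tau> m i) \<in> borel_measurable M" "W j (\<tau> m (Suc i)) \<in> borel_measurable M" if "i < n m" for i
        using measurable_from_subalg[OF F_sub, of "\<tau> m i" "\<xi> m i"] sd[of m] simple_data_partition(1)[OF sd[of m], of i]
          simple_data_partition(1)[OF sd[of m], of "Suc i"] st that W_measurable[OF j]
        by (auto simp: simple_data_def)
      then show ?thesis unfolding simple_integral_def[abs_def]
        by (intro borel_measurable_sum borel_measurable_times borel_measurable_diff) auto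
    qed
    note [measurable] = this
    have "absmom M 1 (\<lambda>\<omega>. I \<omega> - ?J \<omega>) = absmom M 1 (\<lambda>\<omega>. (I \<omega> - ?S \<omega>) + (?S \<omega> - ?J \<omega>))" by simp
    also have "\<dots> \<le> ennreal (4 ^ 1) * (absmom M 1 (\<lambda>\<omega>. I \<omega> - ?S \<omega>) + absmom M 1 (\<lambda>\<omega>. ?S \<omega> - ?J \<omega>))"
      by (rule absmom_add) measurable
    also have "absmom M 1 (\<lambda>\<omega>. I \<omega> - ?S \<omega>) = ?b m" by (simp add: absmom_def power2_commute)
    also have "absmom M 1 (\<lambda>\<omega>. ?S \<omega> - ?J \<omega>) \<le> 2 * ?A m"
      by (rule simple_integral_error[OF j st(1) sd]) (auto simp: time_integrand)
    finally show ?thesis by (simp add: mult_2 mult_left_mono add_left_mono)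
  qed
  have "(\<lambda>m. ennreal 4 * (?b m + (?A m + ?A m))) \<longlonglongrightarrow> ennreal 4 * (0 + (0 + 0))"
    by (intro ennreal_tendsto_cmult tendsto_add A b) simp
  then have "absmom M 1 (\<lambda>\<omega>. I \<omega> - ?J \<omega>) \<le> ennreal 4 * (0 + (0 + 0))"
    using bound by (intro LIMSEQ_le_const) auto
  then have "(\<integral>\<^sup>+\<omega>. ennreal ((I \<omega> - ?J \<omega>)\<^sup>2) \<partial>M) = 0" by (simp add: absmom_def)
  then have "AE \<omega> in M. ennreal ((I \<omega> - ?J \<omega>)\<^sup>2) = 0" by (subst (asm) nn_integral_0_iff_AE) auto
  then show ?thesis by eventually_elim auto
qed

theorem ito_integral_time:
  assumes "j \<in> J" "0 \<le> s" "s \<le> t"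
  shows "AE \<omega> in M. ito_integral M F (W j) s t (\<lambda>v _. LBINT u:{s..v}. 1) \<omega> = time_weighted_integral j s t \<omega>"
  unfolding ito_integral_def
  by (rule has_ito_integral_time_unique[OF assms someI[of "has_ito_integral M F (W j) s t (\<lambda>v _. LBINT u:{s..v}. 1)", OF has_ito_integral_time[OF assms]]])

end

section \<open>The joint noise of two independent Brownian motions\<close>

locale brownian_pair = prob_space M + B: brownian M F "{1..d}" B + B': brownian M F "{2..d}" B'
  for M :: "'a measure" and F and d :: nat and B B' :: "nat \<Rightarrow> real \<Rightarrow> 'a \<Rightarrow> real" +
  assumes processes_indep: "independent_processes M {1..d} B {2..d} B'"
begin

text \<open>
  The label \<open>b\<close> selects one of the two Brownian motions, so that the pairs \<open>(k, b)\<close> index a single family of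
  independent algebras.
\<close>

definition interval_events :: "(nat \<Rightarrow> real) \<Rightarrow> nat \<Rightarrow> bool \<Rightarrow> 'a set set" where
  "interval_events t k b = (if b then B.incr_events (t k) (t (Suc k)) else B'.incr_events (t k) (t (Suc k)))"

lemma paths_indep:
  "indep_set (sets (generated_algebra M ({1..d} \<times> {0..}) (\<lambda>(j, t). B j t))) (sets (generated_algebra M ({2..d} \<times> {0..}) (\<lambda>(j, t). B' j t)))"
  using processes_indep by (simp add: independent_processes_def)

text \<open>
  Independence of the two processes separates the factors that belong to \<open>B\<close> and \<open>B'\<close>. Each of the two
  products then factorizes over the intervals, by the Brownian property of one process alone.
\<close>

lemma indep_interval_events:
  assumes t: "0 \<le> t 0" "\<And>k. t k \<le> t (Suc k)"
  shows "indep_sets (\<lambda>(k, b). interval_events t k b) ({..<N} \<times> UNIV)"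
proof (cases "N = 0")
  case True
  then show ?thesis by (simp add: indep_sets_def)
next
  case False
  have tpos: "0 \<le> t k" for k using t(1) lift_Suc_mono_le[of t 0 k, OF t(2)] by simp
  have sub: "interval_events t k b \<subseteq> events" for k b
    using B.incr_events_sub[OF tpos] B'.incr_events_sub[OF tpos] by (simp add: interval_events_def)
  have "prob (\<Inter>j\<in>{..<N} \<times> UNIV. A j) = (\<Prod>j\<in>{..<N} \<times> UNIV. prob (A j))"
    if A: "A \<in> Pi ({..<N} \<times> UNIV) (\<lambda>(k, b). interval_events t k b)" for A
  proof -
    define A1 A0 where "A1 = space M \<inter> (\<Inter>k\<in>{..<N}. A (k, True))" and "A0 = space M \<inter> (\<Inter>k\<in>{..<N}. A (k, False))"
    have mem: "A (k, b) \<in> interval_events t k b" if "k < N" for k b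
      using Pi_mem[OF A, of "(k, b)"] that by simp
    have mem1: "A (k, True) \<in> B.incr_events (t k) (t (Suc k))" and mem0: "A (k, False) \<in> B'.incr_events (t k) (t (Suc k))" if "k < N" for k
      using mem[OF that, of True] mem[OF that, of False] by (simp_all add: interval_events_def)
    have space: "A (k, b) \<subseteq> space M" if "k < N" for k b
      by (rule sets.sets_into_space[OF subsetD[OF sub mem[OF that]]])
    have INT_mem: "space M \<inter> (\<Inter>k\<in>{..<N}. C k) \<in> sets (generated_algebra M L X)"
      if "\<And>k. k < N \<Longrightarrow> C k \<in> sets (generated_algebra M L X)" for C and L :: "(nat \<times> real) set" and X
    proof (rule sets.Int)
      show "space M \<in> sets (generated_algebra M L X)"
        using sets.top[of "generated_algebra M L X"] unfolding space_generated_algebra .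
      show "(\<Inter>k\<in>{..<N}. C k) \<in> sets (generated_algebra M L X)"
        using False that by (intro sets.finite_INT) auto
    qed
    have "(\<Inter>j\<in>{..<N} \<times> UNIV. A j) = A1 \<inter> A0"
    proof
      show "(\<Inter>j\<in>{..<N} \<times> UNIV. A j) \<subseteq> A1 \<inter> A0"
        using space[of 0 True] False unfolding A1_def A0_def by auto
      show "A1 \<inter> A0 \<subseteq> (\<Inter>j\<in>{..<N} \<times> UNIV. A j)"
      proof (intro subsetI INT_I)
        fix y j assume "y \<in> A1 \<inter> A0" "j \<in> {..<N} \<times> (UNIV :: bool set)"
        then show "y \<in> A j" unfolding A1_def A0_def by (cases j; cases "snd j") auto
      qed
    qed
    moreover have "A1 \<in> sets (generated_algebra M ({1..d} \<times> {0..}) (\<lambda>(j, t). B j t))"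
    proof -
      have "A (k, True) \<in> sets (generated_algebra M ({1..d} \<times> {0..}) (\<lambda>(j, t). B j t))" if "k < N" for k
        using mem1[OF that] B.incr_events_path[OF tpos] by auto
      then show ?thesis unfolding A1_def by (rule INT_mem)
    qed
    moreover have "A0 \<in> sets (generated_algebra M ({2..d} \<times> {0..}) (\<lambda>(j, t). B' j t))"
    proof -
      have "A (k, False) \<in> sets (generated_algebra M ({2..d} \<times> {0..}) (\<lambda>(j, t). B' j t))" if "k < N" for k
        using mem0[OF that] B'.incr_events_path[OF tpos] by auto
      then show ?thesis unfolding A0_def by (rule INT_mem)
    qed
    ultimately have "prob (\<Inter>j\<in>{..<N} \<times> UNIV. A j) = prob A1 * prob A0"
      using indep_setD[OF paths_indep] by simp
    also have "prob A1 = (\<Prod>k\<in>{..<N}. prob (A (k, True)))" unfolding A1_def by (rule B.prob_INT_increments[OF t mem1])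
    also have "prob A0 = (\<Prod>k\<in>{..<N}. prob (A (k, False)))" unfolding A0_def by (rule B'.prob_INT_increments[OF t mem0])
    also have "(\<Prod>k\<in>{..<N}. prob (A (k, True))) * (\<Prod>k\<in>{..<N}. prob (A (k, False))) = (\<Prod>k\<in>{..<N}. \<Prod>b\<in>UNIV. prob (A (k, b)))"
      by (simp add: UNIV_bool prod.distrib mult.commute)
    also have "\<dots> = (\<Prod>j\<in>{..<N} \<times> UNIV. prob (A j))" by (simp add: prod.cartesian_product)
    finally show ?thesis .
  qed
  moreover have "space M \<in> interval_events t k b" for k b
    by (simp add: interval_events_def B.space_incr_events B'.space_incr_events del: One_nat_def)
  ultimately show ?thesis using False by (subst indep_sets_finite) (auto dest!: subsetD[OF sub])
qed

text \<open>
  The events described by the increments of both processes inside the intervals \<open>[t k, t (Suc k)]\<close> with \<open>k \<in> K\<close>.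
\<close>

definition noise_algebra :: "(nat \<Rightarrow> real) \<Rightarrow> nat set \<Rightarrow> 'a measure" where
  "noise_algebra t K = sigma (space M) (\<Union>k\<in>K. \<Union>b. interval_events t k b)"

lemma interval_events_Pow: "interval_events t k b \<subseteq> Pow (space M)"
  unfolding interval_events_def B.incr_events_def B'.incr_events_def using generated_events_Pow[of M] by auto

lemma space_noise_algebra [simp]: "space (noise_algebra t K) = space M"
  unfolding noise_algebra_def using interval_events_Pow by (subst space_measure_of) blast+

lemma sets_noise_algebra: "sets (noise_algebra t K) = sigma_sets (space M) (\<Union>k\<in>K. \<Union>b. interval_events t k b)"
  unfolding noise_algebra_def using interval_events_Pow by (subst sets_measure_of) blast+

lemma noise_algebra_mono: "K \<subseteq> K' \<Longrightarrow> subalgebra (noise_algebra t K') (noise_algebra t K)"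
  unfolding subalgebra_def sets_noise_algebra by (auto intro!: sigma_sets_mono')

lemma interval_algebra_measurable:
  assumes "k \<in> K" "f \<in> borel_measurable N" "space N = space M" "sets N \<subseteq> interval_events t k b"
  shows "f \<in> borel_measurable (noise_algebra t K)"
proof (rule measurable_from_subalg[OF _ assms(2)])
  show "subalgebra (noise_algebra t K) N"
    unfolding subalgebra_def sets_noise_algebra using assms by (auto intro!: sigma_sets.Basic)
qed

lemma noise_algebra_B:
  assumes "k \<in> K" "j \<in> {1..d}" "u \<in> {t k..t (Suc k)}"
  shows "(\<lambda>\<omega>. B j u \<omega> - B j (t k) \<omega>) \<in> borel_measurable (noise_algebra t K)"
  using measurable_generated_algebra[of "(j, u)" "{1..d} \<times> {t k..t (Suc k)}" "\<lambda>(j, u) \<omega>. B j u \<omega> - B j (t k) \<omega>" M] assms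
  by (intro interval_algebra_measurable[of k K _ "generated_algebra M ({1..d} \<times> {t k..t (Suc k)}) (\<lambda>(j, u) \<omega>. B j u \<omega> - B j (t k) \<omega>)" t True])
    (auto simp: interval_events_def B.incr_events_def simp del: One_nat_def)

lemma noise_algebra_B':
  assumes "k \<in> K" "j \<in> {2..d}" "u \<in> {t k..t (Suc k)}"
  shows "(\<lambda>\<omega>. B' j u \<omega> - B' j (t k) \<omega>) \<in> borel_measurable (noise_algebra t K)"
  using measurable_generated_algebra[of "(j, u)" "{2..d} \<times> {t k..t (Suc k)}" "\<lambda>(j, u) \<omega>. B' j u \<omega> - B' j (t k) \<omega>" M] assms
  by (intro interval_algebra_measurable[of k K _ "generated_algebra M ({2..d} \<times> {t k..t (Suc k)}) (\<lambda>(j, u) \<omega>. B' j u \<omega> - B' j (t k) \<omega>)" t False])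
    (auto simp: interval_events_def B'.incr_events_def simp del: One_nat_def)

lemma noise_algebra_sub:
  assumes t: "0 \<le> t 0" "\<And>k. t k \<le> t (Suc k)"
  shows "subalgebra M (noise_algebra t K)"
proof -
  have tpos: "0 \<le> t k" for k using t(1) lift_Suc_mono_le[of t 0 k, OF t(2)] by simp
  have "(\<Union>k\<in>K. \<Union>b. interval_events t k b) \<subseteq> events"
  proof (intro UN_least)
    show "interval_events t k b \<subseteq> events" for k b
      using B.incr_events_sub[OF tpos] B'.incr_events_sub[OF tpos] by (simp add: interval_events_def)
  qed
  from sets.sigma_sets_subset[OF this] show ?thesis unfolding subalgebra_def sets_noise_algebra by simp
qed

lemma noise_algebra_indep:
  assumes t: "0 \<le> t 0" "\<And>k. t k \<le> t (Suc k)"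
    and K: "K \<inter> K' = {}" "K \<subseteq> {..<N}" "K' \<subseteq> {..<N}"
  shows "indep_set (sets (noise_algebra t K)) (sets (noise_algebra t K'))"
proof -
  define Q where "Q b = (if b then K else K') \<times> (UNIV :: bool set)" for b
  have "indep_sets (\<lambda>(k, b). interval_events t k b) (\<Union>b\<in>UNIV. Q b)"
    by (rule indep_sets_mono_index[OF _ indep_interval_events[OF t, of N]]) (use K in \<open>auto simp: Q_def split: if_splits\<close>)
  moreover have "Int_stable (case i of (k, b) \<Rightarrow> interval_events t k b)" for i
  proof -
    have "Int_stable (generated_events M L X)" for L :: "(nat \<times> real) set" and X
      using sets.Int_stable[of "generated_algebra M L X"] by simp
    then show ?thesis by (simp add: interval_events_def B.incr_events_def B'.incr_events_def split: prod.split del: One_nat_def)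
  qed
  moreover have "disjoint_family_on Q UNIV" using K(1) by (auto simp: disjoint_family_on_def Q_def)
  ultimately have ind: "indep_sets (\<lambda>b. sigma_sets (space M) (\<Union>i\<in>Q b. case i of (k, b) \<Rightarrow> interval_events t k b)) UNIV"
    by (rule indep_sets_collect_sigma)
  have "(\<Union>i\<in>Q b. case i of (k, b) \<Rightarrow> interval_events t k b) = (\<Union>k\<in>(if b then K else K'). \<Union>b. interval_events t k b)" for b
    by (auto simp: Q_def)
  then show ?thesis unfolding indep_set_def sets_noise_algebra
    by (intro indep_sets_mono_sets[OF ind]) (auto split: bool.split)
qed

lemma expectation_levy:
  assumes "i \<in> {1..d}" "j \<in> {2..d}" "0 \<le> s" "s \<le> t"
  shows "(\<integral>\<omega>. levy_proxy B B' i j t s \<omega> \<partial>M) = 0"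
proof -
  let ?P = "generated_algebra M ({1..d} \<times> {0..}) (\<lambda>(j, t). B j t)" and ?P' = "generated_algebra M ({2..d} \<times> {0..}) (\<lambda>(j, t). B' j t)"
  have P: "B i u \<in> borel_measurable ?P" "B' j u \<in> borel_measurable ?P'" if "0 \<le> u" for u
    using measurable_generated_algebra[of "(i, u)" "{1..d} \<times> {0..}" "\<lambda>(j, t). B j t" M]
      measurable_generated_algebra[of "(j, u)" "{2..d} \<times> {0..}" "\<lambda>(j, t). B' j t" M] assms that by auto
  have "(\<integral>\<omega>. (B i t \<omega> - B i s \<omega>) * (B' j t \<omega> - B' j s \<omega>) \<partial>M) = (\<integral>\<omega>. (B i t \<omega> - B i s \<omega>) \<partial>M) * (\<integral>\<omega>. (B' j t \<omega> - B' j s \<omega>) \<partial>M)"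
  proof (rule indep_set_integral_mult[OF _ _ paths_indep])
    show "subalgebra M ?P" "subalgebra M ?P'"
      by (rule generated_algebra_subalgebra; auto intro: B.W_measurable B'.W_measurable)+
  qed (use assms P in \<open>auto intro!: borel_measurable_diff all_moments_integrable B.all_moments_increment B'.all_moments_increment finite_measure_axioms\<close>)
  then show ?thesis using B.expectation_increment[OF assms(1,3,4)] by (simp add: levy_proxy_def)
qed

text \<open>
  A version of \<open>eta\<close> that is measurable with respect to the increments on \<open>[s, t]\<close>; the Ito integral, being an
  arbitrary representative of its class, need not be.
\<close>

definition regular_eta :: "'m set \<Rightarrow> nat \<Rightarrow> nat \<Rightarrow> real \<Rightarrow> real \<Rightarrow> 'a \<Rightarrow> real" where
  "regular_eta S j1 j2 t s \<omega> =
     (if S \<noteq> {} \<and> j1 = 0 \<and> j2 \<noteq> 0 then B.time_weighted_integral j2 s t \<omega>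
      else if S \<noteq> {} \<and> j1 \<noteq> 0 \<and> j2 = 0 then B.time_integral j1 s t \<omega>
      else (incr B j1 t s \<omega> * incr B j2 t s \<omega> - (if j1 = j2 \<and> j1 \<noteq> 0 then t - s else 0)) / 2)"

lemma AE_eta_eq:
  assumes "j1 \<le> d" "j2 \<le> d" "0 \<le> s" "s \<le> t"
  shows "AE \<omega> in M. eta M F S B j1 j2 t s \<omega> = regular_eta S j1 j2 t s \<omega>"
proof -
  consider (1) "S \<noteq> {} \<and> j1 = 0 \<and> j2 \<noteq> 0" | (2) "S \<noteq> {} \<and> j1 \<noteq> 0 \<and> j2 = 0"
    | (3) "\<not> (S \<noteq> {} \<and> j1 = 0 \<and> j2 \<noteq> 0)" "\<not> (S \<noteq> {} \<and> j1 \<noteq> 0 \<and> j2 = 0)" by blast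
  then show ?thesis
  proof cases
    case 1
    then have "j2 \<in> {1..d}" using assms by auto
    from B.ito_integral_time[OF this assms(3,4)] show ?thesis
      by eventually_elim (use 1 in \<open>simp add: eta_def regular_eta_def\<close>)
  next
    case 2
    then have "j1 \<in> {1..d}" using assms by auto
    from B.time_integral_eq[OF this assms(3,4)] show ?thesis
      by eventually_elim (use 2 in \<open>simp add: eta_def regular_eta_def\<close>)
  next
    case 3
    then show ?thesis by (auto simp: eta_def regular_eta_def)
  qed
qed

end

locale brownian_steps = brownian_pair M F d B B' + weak_steps M I h hmax d \<sigma>
  for M :: "'a measure" and F and d :: nat and B B' and I :: "'i set" and h hmax and \<sigma> :: "nat \<Rightarrow> real ^ 'n \<Rightarrow> real ^ 'n"
begin

text \<open>
  The noise of a step over \<open>[a, b]\<close>, with \<open>N\<close> any algebra that contains the increments on this interval. Whole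
  steps and both half-steps are instances. Everything that is centered is so because it has expectation zero and
  is independent of \<open>G\<close>.
\<close>

lemma interval_noise:
  fixes a b :: "'i \<Rightarrow> real" and N :: "'i \<Rightarrow> 'a measure" and S :: "'m set"
  assumes ab: "\<And>i. i \<in> I \<Longrightarrow> 0 \<le> a i" "\<And>i. i \<in> I \<Longrightarrow> a i \<le> b i" "\<And>i. i \<in> I \<Longrightarrow> b i - a i \<le> h i"
    and NB: "\<And>i j u. i \<in> I \<Longrightarrow> j \<in> {1..d} \<Longrightarrow> u \<in> {a i..b i} \<Longrightarrow> (\<lambda>\<omega>. B j u \<omega> - B j (a i) \<omega>) \<in> borel_measurable (N i)"
    and NB': "\<And>i j. i \<in> I \<Longrightarrow> j \<in> {2..d} \<Longrightarrow> (\<lambda>\<omega>. B' j (b i) \<omega> - B' j (a i) \<omega>) \<in> borel_measurable (N i)"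
  shows interval_noise_incr: "\<And>i j. i \<in> I \<Longrightarrow> j \<in> {0..d} \<Longrightarrow> incr B j (b i) (a i) \<in> borel_measurable (N i)"
    and interval_noise_eta: "\<And>i j l. i \<in> I \<Longrightarrow> j \<in> {0..d} \<Longrightarrow> l \<in> {0..d} \<Longrightarrow> regular_eta S j l (b i) (a i) \<in> borel_measurable (N i)"
    and interval_noise_levy: "\<And>i j l. i \<in> I \<Longrightarrow> j \<in> {1..d} \<Longrightarrow> l \<in> {j<..d} \<Longrightarrow> levy_proxy B B' j l (b i) (a i) \<in> borel_measurable (N i)"
    and interval_step_noise: "(\<And>i. i \<in> I \<Longrightarrow> subalgebra M (G i)) \<Longrightarrow> (\<And>i. i \<in> I \<Longrightarrow> subalgebra M (N i)) \<Longrightarrow>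
      (\<And>i. i \<in> I \<Longrightarrow> indep_set (sets (G i)) (sets (N i))) \<Longrightarrow>
      step_noise G (\<lambda>j i. incr B j (b i) (a i)) (\<lambda>j l i. regular_eta S j l (b i) (a i)) (\<lambda>j l i. levy_proxy B B' j l (b i) (a i))"
proof -
  show m_incr: "\<And>i j. i \<in> I \<Longrightarrow> j \<in> {0..d} \<Longrightarrow> incr B j (b i) (a i) \<in> borel_measurable (N i)"
  proof -
    fix i j assume "i \<in> I" "j \<in> {0..d}"
    then show "incr B j (b i) (a i) \<in> borel_measurable (N i)"
      unfolding incr_def[abs_def] using NB[of i j "b i"] ab(2)[of i] by (cases "j = 0") auto
  qed
  have m_ti: "B.time_integral j (a i) (b i) \<in> borel_measurable (N i)" if "i \<in> I" "j \<in> {1..d}" for i j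
    by (rule B.time_integral_measurable[OF NB[OF that] ab(2)[OF that(1)]])
  have m_twi: "B.time_weighted_integral j (a i) (b i) \<in> borel_measurable (N i)" if "i \<in> I" "j \<in> {1..d}" for i j
    unfolding B.time_weighted_integral_def[abs_def] using m_ti[OF that] NB[OF that, of "b i"] ab(2)[OF that(1)] by simp
  show m_eta: "\<And>i j l. i \<in> I \<Longrightarrow> j \<in> {0..d} \<Longrightarrow> l \<in> {0..d} \<Longrightarrow> regular_eta S j l (b i) (a i) \<in> borel_measurable (N i)"
  proof -
    fix i j l assume A: "i \<in> I" "j \<in> {0..d}" "l \<in> {0..d}"
    show "regular_eta S j l (b i) (a i) \<in> borel_measurable (N i)"
      unfolding regular_eta_def[abs_def]
      using m_ti[OF A(1), of j] m_twi[OF A(1), of l] m_incr[OF A(1,2)] m_incr[OF A(1,3)] A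
      by (cases "S \<noteq> {} \<and> j = 0 \<and> l \<noteq> 0"; cases "S \<noteq> {} \<and> j \<noteq> 0 \<and> l = 0") auto
  qed
  show m_levy: "\<And>i j l. i \<in> I \<Longrightarrow> j \<in> {1..d} \<Longrightarrow> l \<in> {j<..d} \<Longrightarrow> levy_proxy B B' j l (b i) (a i) \<in> borel_measurable (N i)"
    unfolding levy_proxy_def[abs_def] using NB NB' ab(2) by (intro borel_measurable_times) auto
  assume G: "\<And>i. i \<in> I \<Longrightarrow> subalgebra M (G i)" and N: "\<And>i. i \<in> I \<Longrightarrow> subalgebra M (N i)"
    and ind: "\<And>i. i \<in> I \<Longrightarrow> indep_set (sets (G i)) (sets (N i))"
  have bound_order: "of_order r Z" if "\<And>i. i \<in> I \<Longrightarrow> Z i \<in> borel_measurable M"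
      "\<And>q i. i \<in> I \<Longrightarrow> absmom M q (Z i) \<le> ennreal (c q * (b i - a i) ^ (r * q))" "\<And>q. 0 \<le> c q"
    for r c and Z :: "'i \<Rightarrow> 'a \<Rightarrow> real"
  proof (rule of_orderI[OF that(1)])
    fix q
    have "absmom M q (Z i) \<le> ennreal (c q * h i ^ (r * q))" if i: "i \<in> I" for i
      using ab(2,3)[OF i] \<open>0 \<le> c q\<close>
      by (intro order_trans[OF \<open>i \<in> I \<Longrightarrow> absmom M q (Z i) \<le> _\<close>[OF i]] ennreal_leI mult_left_mono power_mono) auto
    then show "\<exists>C\<ge>0. \<forall>i\<in>I. absmom M q (Z i) \<le> ennreal (C * h i ^ (r * q))" using that(3) by blast
  qed
  define len where "len i \<omega> = b i - a i" for i and \<omega> :: 'a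
  have o_len: "of_order 2 len"
  proof (rule of_order_bounded[where K=1])
    fix i \<omega> assume i: "i \<in> I"
    show "(norm (len i \<omega>))\<^sup>2 \<le> 1 * h i ^ 2" using ab[OF i] by (simp add: len_def power_mono)
  qed (simp add: len_def[abs_def])
  have cen: "centered G Z" if "\<And>i. i \<in> I \<Longrightarrow> Z i \<in> borel_measurable (N i)" "of_order r Z" "\<And>i. i \<in> I \<Longrightarrow> (\<integral>\<omega>. Z i \<omega> \<partial>M) = 0"
    for Z :: "'i \<Rightarrow> 'a \<Rightarrow> real" and r
    by (rule centered_indep[OF G N ind that])
  define D where "D j i \<omega> = B j (b i) \<omega> - B j (a i) \<omega>" for j i \<omega>
  have incr_eq: "incr B 0 (b i) (a i) = len i" "j \<in> {1..d} \<Longrightarrow> incr B j (b i) (a i) = D j i" for i j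
    by (auto simp: incr_def len_def D_def)
  have mD: "D j i \<in> borel_measurable (N i)" if "j \<in> {1..d}" "i \<in> I" for i j
    unfolding D_def[abs_def] using NB[OF that(2,1)] ab(2)[OF that(2)] by auto
  have oD: "of_order 1 (D j)" if j: "j \<in> {1..d}" for j
  proof (rule bound_order)
    show "D j i \<in> borel_measurable M" if "i \<in> I" for i using measurable_from_subalg[OF N[OF that] mD[OF j that]] .
    show "absmom M q (D j i) \<le> ennreal (B.normal_moment_const q * (b i - a i) ^ (1 * q))" if "i \<in> I" for q i
      unfolding D_def[abs_def] using B.absmom_increment[OF j ab(1)[OF that] ab(2)[OF that]] by simp
  qed (rule B.normal_moment_const_nonneg)
  have eD: "(\<integral>\<omega>. D j i \<omega> \<partial>M) = 0" if "j \<in> {1..d}" "i \<in> I" for i j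
    unfolding D_def by (rule B.expectation_increment[OF that(1) ab(1)[OF that(2)] ab(2)[OF that(2)]])
  have cD: "centered G (D j)" if j: "j \<in> {1..d}" for j by (rule cen[OF mD[OF j] oD[OF j] eD[OF j]])
  have iD: "integrable M (D j i)" if "j \<in> {1..d}" "i \<in> I" for i j
    by (intro all_moments_integrable of_order_all_moments[OF oD[OF that(1)] that(2)] finite_measure_axioms)
  have o_ti: "of_order 3 (\<lambda>i. B.time_integral j (a i) (b i))" if j: "j \<in> {1..d}" for j
  proof (rule bound_order)
    show "B.time_integral j (a i) (b i) \<in> borel_measurable M" if "i \<in> I" for i
      using measurable_from_subalg[OF N[OF that] m_ti[OF that j]] .
    show "absmom M q (B.time_integral j (a i) (b i)) \<le> ennreal (B.normal_moment_const q * (b i - a i) ^ (3 * q))" if "i \<in> I" for q i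
      by (rule B.time_integral_moments(1)[OF j ab(1)[OF that] ab(2)[OF that]])
  qed (rule B.normal_moment_const_nonneg)
  have e_ti: "(\<integral>\<omega>. B.time_integral j (a i) (b i) \<omega> \<partial>M) = 0" if "j \<in> {1..d}" "i \<in> I" for i j
    by (rule B.time_integral_moments(3)[OF that(1) ab(1)[OF that(2)] ab(2)[OF that(2)]])
  have o_lD: "of_order 3 (\<lambda>i \<omega>. (b i - a i) * D j i \<omega>)" if j: "j \<in> {1..d}" for j
    using of_order_mult[OF o_len oD[OF j]] by (simp add: len_def numeral_3_eq_3)
  have twi_eq: "B.time_weighted_integral j (a i) (b i) = (\<lambda>\<omega>. (b i - a i) * D j i \<omega> - B.time_integral j (a i) (b i) \<omega>)" for j i
    by (auto simp: B.time_weighted_integral_def D_def)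
  have o_twi: "of_order 3 (\<lambda>i. B.time_weighted_integral j (a i) (b i))" if j: "j \<in> {1..d}" for j
    unfolding twi_eq by (rule of_order_diff[OF o_lD[OF j] o_ti[OF j]])
  have e_twi: "(\<integral>\<omega>. B.time_weighted_integral j (a i) (b i) \<omega> \<partial>M) = 0" if "j \<in> {1..d}" "i \<in> I" for i j
  proof -
    have "integrable M (B.time_integral j (a i) (b i))"
      by (intro all_moments_integrable B.time_integral_moments(2) that ab finite_measure_axioms)
    then show ?thesis unfolding twi_eq using iD[OF that] eD[OF that] e_ti[OF that] by simp
  qed
  have time_row: "of_order 3 (\<lambda>i. regular_eta S 0 j (b i) (a i)) \<and> centered G (\<lambda>i. regular_eta S 0 j (b i) (a i)) \<and>
      of_order 3 (\<lambda>i. regular_eta S j 0 (b i) (a i)) \<and> centered G (\<lambda>i. regular_eta S j 0 (b i) (a i))" if j: "j \<in> {1..d}" for j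
  proof (cases "S = {}")
    case True
    have eq: "regular_eta S 0 j (b i) (a i) = (\<lambda>\<omega>. (1 / 2) *\<^sub>R ((b i - a i) * D j i \<omega>))"
       "regular_eta S j 0 (b i) (a i) = (\<lambda>\<omega>. (1 / 2) *\<^sub>R ((b i - a i) * D j i \<omega>))" for i
      using j True by (auto simp: regular_eta_def incr_def D_def)
    have "centered G (\<lambda>i \<omega>. (b i - a i) * D j i \<omega>)"
      by (rule cen[OF _ o_lD[OF j]]) (use mD[OF j] eD[OF j] in auto)
    then show ?thesis unfolding eq using o_lD[OF j] by (intro conjI of_order_scaleR centered_scaleR)
  next
    case False
    have eq: "regular_eta S 0 j (b i) (a i) = B.time_weighted_integral j (a i) (b i)" "regular_eta S j 0 (b i) (a i) = B.time_integral j (a i) (b i)" for i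
      using j False by (auto simp: regular_eta_def)
    show ?thesis unfolding eq
      by (intro conjI o_twi[OF j] o_ti[OF j] cen[OF _ o_twi[OF j]] cen[OF _ o_ti[OF j]] m_twi m_ti e_twi e_ti j) auto
  qed
  have space_row: "of_order 2 (\<lambda>i. regular_eta S j l (b i) (a i)) \<and> centered G (\<lambda>i. regular_eta S j l (b i) (a i))"
    if j: "j \<in> {1..d}" and l: "l \<in> {1..d}" for j l
  proof -
    have eq: "regular_eta S j l (b i) (a i) = (\<lambda>\<omega>. (1 / 2) *\<^sub>R (D j i \<omega> *\<^sub>R D l i \<omega> - (if j = l then 1 else 0) *\<^sub>R len i \<omega>))" for i
      using j l by (auto simp: regular_eta_def incr_def D_def len_def)
    have o: "of_order 2 (\<lambda>i. regular_eta S j l (b i) (a i))"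
      unfolding eq using of_order_mult[OF oD[OF j] oD[OF l]] o_len
      by (intro of_order_scaleR of_order_diff) (simp_all add: numeral_2_eq_2)
    have "(\<integral>\<omega>. regular_eta S j l (b i) (a i) \<omega> \<partial>M) = 0" if i: "i \<in> I" for i
    proof -
      have "(\<integral>\<omega>. D j i \<omega> * D l i \<omega> \<partial>M) = (if j = l then b i - a i else 0)"
        unfolding D_def using B.expectation_increment_mult[OF j l _ ab(1)[OF i] ab(2)[OF i]] B.expectation_increment_sq[OF j ab(1)[OF i] ab(2)[OF i]]
        by (auto simp: power2_eq_square)
      moreover have "integrable M (\<lambda>\<omega>. D j i \<omega> * D l i \<omega>)"
        by (intro all_moments_integrable all_moments_mult of_order_all_moments[OF oD] i j l finite_measure_axioms)
      ultimately show ?thesis unfolding eq len_def by (simp add: prob_space)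
    qed
    then show ?thesis using o j l by (intro conjI cen[OF m_eta o]) auto
  qed
  have levy: "of_order 2 (\<lambda>i. levy_proxy B B' j l (b i) (a i)) \<and> centered G (\<lambda>i. levy_proxy B B' j l (b i) (a i))"
    if j: "j \<in> {1..d}" and l: "l \<in> {j<..d}" for j l
  proof -
    have l2: "l \<in> {2..d}" using j l by auto
    have o': "of_order 1 (\<lambda>i \<omega>. B' l (b i) \<omega> - B' l (a i) \<omega>)"
    proof (rule bound_order)
      show "(\<lambda>\<omega>. B' l (b i) \<omega> - B' l (a i) \<omega>) \<in> borel_measurable M" if "i \<in> I" for i
        using measurable_from_subalg[OF N[OF that] NB'[OF that l2]] .
      show "absmom M q (\<lambda>\<omega>. B' l (b i) \<omega> - B' l (a i) \<omega>) \<le> ennreal (B'.normal_moment_const q * (b i - a i) ^ (1 * q))" if "i \<in> I" for q i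
        using B'.absmom_increment[OF l2 ab(1)[OF that] ab(2)[OF that]] by simp
    qed (rule B'.normal_moment_const_nonneg)
    have o: "of_order 2 (\<lambda>i. levy_proxy B B' j l (b i) (a i))"
      using of_order_mult[OF oD[OF j] o'] by (simp add: levy_proxy_def[abs_def] D_def numeral_2_eq_2)
    show ?thesis using o j l l2 ab by (intro conjI cen[OF m_levy o] expectation_levy) auto
  qed
  have "of_order 4 (\<lambda>i. regular_eta S 0 0 (b i) (a i))"
  proof -
    have eq: "regular_eta S 0 0 (b i) (a i) = (\<lambda>\<omega>. (1 / 2) *\<^sub>R (len i \<omega> *\<^sub>R len i \<omega>))" for i
      by (auto simp: regular_eta_def incr_def len_def)
    show ?thesis unfolding eq using of_order_mult[OF o_len o_len] by (intro of_order_scaleR) simp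
  qed
  then show "step_noise G (\<lambda>j i. incr B j (b i) (a i)) (\<lambda>j l i. regular_eta S j l (b i) (a i)) (\<lambda>j l i. levy_proxy B B' j l (b i) (a i))"
    unfolding step_noise_def using o_len time_row space_row levy oD cD by (simp add: incr_eq)
qed

end

section \<open>The four schemes\<close>

locale antithetic_schemes = brownian_pair M F d B B' + smooth_coefficients d \<sigma>
  for M :: "'a measure" and F and d :: nat and B B' and \<sigma> :: "nat \<Rightarrow> real ^ 'n \<Rightarrow> real ^ 'n" +
  fixes T :: real and x :: "real ^ 'n" and S :: "'n set"
  assumes horizon_pos: "T > 0"
begin

text \<open>
  All schemes of level \<open>n\<close> use only the increments between the points of this grid. The coarse grid points are the
  even ones.
\<close>

definition half_time :: "nat \<Rightarrow> nat \<Rightarrow> real" where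
  "half_time n k = real k * (T / 2 ^ n / 2)"

lemma half_time_props: "0 \<le> half_time n 0" "half_time n k \<le> half_time n (Suc k)" "0 \<le> half_time n k"
proof -
  show "0 \<le> half_time n k" using horizon_pos by (simp add: half_time_def)
  have "half_time n (Suc k) = half_time n k + T / 2 ^ n / 2"
    unfolding half_time_def of_nat_Suc by (simp only: distrib_right mult_1 add.commute)
  then show "half_time n k \<le> half_time n (Suc k)" using horizon_pos by simp
  show "0 \<le> half_time n 0" by (simp add: half_time_def)
qed

lemma half_time_mono: "i \<le> j \<Longrightarrow> half_time n i \<le> half_time n j"
  by (rule lift_Suc_mono_le[of "half_time n", OF half_time_props(2)])

definition noise :: "nat \<Rightarrow> nat set \<Rightarrow> 'a measure" where "noise n = noise_algebra (half_time n)"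

lemma noise_facts:
  shows noise_sub: "subalgebra M (noise n K)"
    and noise_mono: "K \<subseteq> K' \<Longrightarrow> subalgebra (noise n K') (noise n K)"
    and noise_indep: "K \<inter> K' = {} \<Longrightarrow> K \<subseteq> {..<N} \<Longrightarrow> K' \<subseteq> {..<N} \<Longrightarrow> indep_set (sets (noise n K)) (sets (noise n K'))"
  unfolding noise_def
  by (rule noise_algebra_sub[OF half_time_props(1,2)], rule noise_algebra_mono, assumption,
      rule noise_algebra_indep[OF half_time_props(1,2)])

text \<open>
  The step \<open>(n, k)\<close> consists of the half-steps with numbers \<open>2 k\<close> and \<open>2 k + 1\<close>. Since the swapped scheme
  takes the second half first, there are two intermediate algebras: \<open>past1\<close> adds the first half to the past, and
  \<open>past2\<close> adds the second half.
\<close>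

definition past :: "nat \<times> nat \<Rightarrow> 'a measure" where "past i = noise (fst i) {..<2 * snd i}"
definition start :: "nat \<times> nat \<Rightarrow> real" where "start i = half_time (fst i) (2 * snd i)"
definition middle :: "nat \<times> nat \<Rightarrow> real" where "middle i = half_time (fst i) (2 * snd i + 1)"
definition finish :: "nat \<times> nat \<Rightarrow> real" where "finish i = half_time (fst i) (2 * snd i + 2)"
definition noise1 :: "nat \<times> nat \<Rightarrow> 'a measure" where "noise1 i = noise (fst i) {2 * snd i}"
definition noise2 :: "nat \<times> nat \<Rightarrow> 'a measure" where "noise2 i = noise (fst i) {2 * snd i + 1}"
definition noise12 :: "nat \<times> nat \<Rightarrow> 'a measure" where "noise12 i = noise (fst i) {2 * snd i, 2 * snd i + 1}"
definition past1 :: "nat \<times> nat \<Rightarrow> 'a measure" where "past1 i = noise (fst i) (insert (2 * snd i) {..<2 * snd i})"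
definition past2 :: "nat \<times> nat \<Rightarrow> 'a measure" where "past2 i = noise (fst i) (insert (2 * snd i + 1) {..<2 * snd i})"
definition past12 :: "nat \<times> nat \<Rightarrow> 'a measure" where "past12 i = noise (fst i) {..<2 * snd i + 2}"

lemmas algebra_defs = past_def noise1_def noise2_def noise12_def past1_def past2_def past12_def

lemma algebra_sub: "subalgebra M (past i)" "subalgebra M (noise1 i)" "subalgebra M (noise2 i)" "subalgebra M (noise12 i)"
  "subalgebra M (past1 i)" "subalgebra M (past2 i)"
  unfolding algebra_defs by (rule noise_sub)+

lemma algebra_mono: "subalgebra (past1 i) (past i)" "subalgebra (past2 i) (past i)" "subalgebra (past1 i) (noise1 i)" "subalgebra (past2 i) (noise2 i)"
  "subalgebra (past12 i) (past i)" "subalgebra (past12 i) (noise1 i)" "subalgebra (past12 i) (noise2 i)" "subalgebra (past12 i) (noise12 i)"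
  "subalgebra (noise12 i) (noise1 i)" "subalgebra (noise12 i) (noise2 i)"
  unfolding algebra_defs by (rule noise_mono, auto)+

lemma past_Suc: "past (n, Suc k) = past12 (n, k)"
  by (simp add: past_def past12_def)

lemma algebra_indep: "indep_set (sets (past i)) (sets (noise1 i))" "indep_set (sets (past i)) (sets (noise2 i))"
  "indep_set (sets (past i)) (sets (noise12 i))" "indep_set (sets (past1 i)) (sets (noise2 i))" "indep_set (sets (past2 i)) (sets (noise1 i))"
  unfolding algebra_defs by (rule noise_indep[where N="2 * snd i + 2"], auto)+

lemma times: "0 \<le> start i" "start i \<le> middle i" "middle i \<le> finish i" "start i \<le> finish i" "0 \<le> middle i"
  "middle i - start i = T / 2 ^ fst i / 2" "finish i - middle i = T / 2 ^ fst i / 2" "finish i - start i = T / 2 ^ fst i"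
  unfolding start_def middle_def finish_def
  by (auto intro: half_time_props half_time_mono) (auto simp: half_time_def field_simps)

lemma noise1_B: "j \<in> {1..d} \<Longrightarrow> u \<in> {start i..middle i} \<Longrightarrow> (\<lambda>\<omega>. B j u \<omega> - B j (start i) \<omega>) \<in> borel_measurable (noise1 i)"
  unfolding noise1_def noise_def start_def middle_def by (rule noise_algebra_B) auto

lemma noise2_B: "j \<in> {1..d} \<Longrightarrow> u \<in> {middle i..finish i} \<Longrightarrow> (\<lambda>\<omega>. B j u \<omega> - B j (middle i) \<omega>) \<in> borel_measurable (noise2 i)"
  unfolding noise2_def noise_def finish_def middle_def by (rule noise_algebra_B) auto

lemma noise1_B': "j \<in> {2..d} \<Longrightarrow> (\<lambda>\<omega>. B' j (middle i) \<omega> - B' j (start i) \<omega>) \<in> borel_measurable (noise1 i)"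
  unfolding noise1_def noise_def start_def middle_def by (rule noise_algebra_B') (auto intro: half_time_mono)

lemma noise2_B': "j \<in> {2..d} \<Longrightarrow> (\<lambda>\<omega>. B' j (finish i) \<omega> - B' j (middle i) \<omega>) \<in> borel_measurable (noise2 i)"
  unfolding noise2_def noise_def finish_def middle_def by (rule noise_algebra_B') (auto intro: half_time_mono)

lemma noise12_B:
  assumes "j \<in> {1..d}" "u \<in> {start i..finish i}"
  shows "(\<lambda>\<omega>. B j u \<omega> - B j (start i) \<omega>) \<in> borel_measurable (noise12 i)"
proof (cases "u \<le> middle i")
  case True
  then show ?thesis using assms by (intro measurable_from_subalg[OF algebra_mono(9) noise1_B]) auto
next
  case False
  have "(\<lambda>\<omega>. B j u \<omega> - B j (middle i) \<omega>) \<in> borel_measurable (noise12 i)"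
    using assms False noise2_B[OF assms(1)] by (intro measurable_from_subalg[OF algebra_mono(10)]) auto
  moreover have "(\<lambda>\<omega>. B j (middle i) \<omega> - B j (start i) \<omega>) \<in> borel_measurable (noise12 i)"
    using assms noise1_B[OF assms(1)] times by (intro measurable_from_subalg[OF algebra_mono(9)]) auto
  ultimately have "(\<lambda>\<omega>. (B j u \<omega> - B j (middle i) \<omega>) + (B j (middle i) \<omega> - B j (start i) \<omega>)) \<in> borel_measurable (noise12 i)"
    by (rule borel_measurable_add)
  then show ?thesis by simp
qed

lemma noise12_B':
  assumes "j \<in> {2..d}"
  shows "(\<lambda>\<omega>. B' j (finish i) \<omega> - B' j (start i) \<omega>) \<in> borel_measurable (noise12 i)"
proof -
  have "(\<lambda>\<omega>. (B' j (finish i) \<omega> - B' j (middle i) \<omega>) + (B' j (middle i) \<omega> - B' j (start i) \<omega>)) \<in> borel_measurable (noise12 i)"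
    by (intro borel_measurable_add measurable_from_subalg[OF algebra_mono(9) noise1_B'[OF assms]]
        measurable_from_subalg[OF algebra_mono(10) noise2_B'[OF assms]])
  then show ?thesis by simp
qed

end

sublocale antithetic_schemes \<subseteq> dyadic_filtration M T past
proof
  show "0 < T" by (rule horizon_pos)
  show "subalgebra M (past i)" for i by (rule algebra_sub)
  show "subalgebra (past (n, k)) (past (n, j))" if "j \<le> k" for n j k
    unfolding past_def fst_conv snd_conv by (rule noise_mono) (use that in auto)
qed

sublocale antithetic_schemes \<subseteq> brownian_steps M F d B B' "dyadic_steps" "\<lambda>i. T / 2 ^ fst i" T \<sigma>
  by unfold_locales

context antithetic_schemes
begin

text \<open>
  The coefficients of a step as families over all steps, for the interval with end \<open>b\<close> and start \<open>a\<close>.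
\<close>

definition W :: "(nat \<times> nat \<Rightarrow> real) \<Rightarrow> (nat \<times> nat \<Rightarrow> real) \<Rightarrow> nat \<Rightarrow> nat \<times> nat \<Rightarrow> 'a \<Rightarrow> real" where
  "W b a j i = incr B j (b i) (a i)"
definition \<Theta> :: "(nat \<times> nat \<Rightarrow> real) \<Rightarrow> (nat \<times> nat \<Rightarrow> real) \<Rightarrow> nat \<Rightarrow> nat \<Rightarrow> nat \<times> nat \<Rightarrow> 'a \<Rightarrow> real" where
  "\<Theta> b a j l i = regular_eta S j l (b i) (a i)"
definition \<Lambda> :: "(nat \<times> nat \<Rightarrow> real) \<Rightarrow> (nat \<times> nat \<Rightarrow> real) \<Rightarrow> nat \<Rightarrow> nat \<Rightarrow> nat \<times> nat \<Rightarrow> 'a \<Rightarrow> real" where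
  "\<Lambda> b a j l i = levy_proxy B B' j l (b i) (a i)"

lemma time_bounds: "middle i - start i \<le> T / 2 ^ fst i" "finish i - middle i \<le> T / 2 ^ fst i" "finish i - start i \<le> T / 2 ^ fst i"
proof -
  have half: "y / 2 \<le> y" if "0 \<le> y" for y :: real using that by simp
  have "0 \<le> T / 2 ^ fst i" using horizon_pos by simp
  then show "middle i - start i \<le> T / 2 ^ fst i" unfolding times(6) by (rule half)
  show "finish i - middle i \<le> T / 2 ^ fst i" unfolding times(7) by (rule half[OF \<open>0 \<le> T / 2 ^ fst i\<close>])
  show "finish i - start i \<le> T / 2 ^ fst i" unfolding times(8) ..
qed

lemma
  assumes i: "i \<in> dyadic_steps"
  shows first_half_incr: "j \<in> {0..d} \<Longrightarrow> W middle start j i \<in> borel_measurable (noise1 i)"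
    and first_half_eta: "j \<in> {0..d} \<Longrightarrow> l \<in> {0..d} \<Longrightarrow> \<Theta> middle start j l i \<in> borel_measurable (noise1 i)"
    and first_half_levy: "j \<in> {1..d} \<Longrightarrow> l \<in> {j<..d} \<Longrightarrow> \<Lambda> middle start j l i \<in> borel_measurable (noise1 i)"
proof -
  show "j \<in> {0..d} \<Longrightarrow> W middle start j i \<in> borel_measurable (noise1 i)"
    unfolding W_def by (rule interval_noise_incr[where a=start and b=middle and N=noise1, OF times(1) times(2) time_bounds(1) noise1_B noise1_B']; (assumption | rule i))
  show "j \<in> {0..d} \<Longrightarrow> l \<in> {0..d} \<Longrightarrow> \<Theta> middle start j l i \<in> borel_measurable (noise1 i)"
    unfolding \<Theta>_def by (rule interval_noise_eta[where a=start and b=middle and N=noise1, OF times(1) times(2) time_bounds(1) noise1_B noise1_B']; (assumption | rule i))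
  show "j \<in> {1..d} \<Longrightarrow> l \<in> {j<..d} \<Longrightarrow> \<Lambda> middle start j l i \<in> borel_measurable (noise1 i)"
    unfolding \<Lambda>_def by (rule interval_noise_levy[where a=start and b=middle and N=noise1, OF times(1) times(2) time_bounds(1) noise1_B noise1_B']; (assumption | rule i))
qed

lemma first_half_step_noise:
  assumes "\<And>i. subalgebra M (G i)" "\<And>i. indep_set (sets (G i)) (sets (noise1 i))"
  shows "step_noise G (W middle start) (\<Theta> middle start) (\<Lambda> middle start)"
  unfolding W_def[abs_def] \<Theta>_def[abs_def] \<Lambda>_def[abs_def]
  by (rule interval_step_noise[where a=start and b=middle and N=noise1, OF times(1) times(2) time_bounds(1) noise1_B noise1_B']; (assumption | rule assms | rule algebra_sub))

lemma
  assumes i: "i \<in> dyadic_steps"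
  shows second_half_incr: "j \<in> {0..d} \<Longrightarrow> W finish middle j i \<in> borel_measurable (noise2 i)"
    and second_half_eta: "j \<in> {0..d} \<Longrightarrow> l \<in> {0..d} \<Longrightarrow> \<Theta> finish middle j l i \<in> borel_measurable (noise2 i)"
    and second_half_levy: "j \<in> {1..d} \<Longrightarrow> l \<in> {j<..d} \<Longrightarrow> \<Lambda> finish middle j l i \<in> borel_measurable (noise2 i)"
proof -
  show "j \<in> {0..d} \<Longrightarrow> W finish middle j i \<in> borel_measurable (noise2 i)"
    unfolding W_def by (rule interval_noise_incr[where a=middle and b=finish and N=noise2, OF times(5) times(3) time_bounds(2) noise2_B noise2_B']; (assumption | rule i))
  show "j \<in> {0..d} \<Longrightarrow> l \<in> {0..d} \<Longrightarrow> \<Theta> finish middle j l i \<in> borel_measurable (noise2 i)"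
    unfolding \<Theta>_def by (rule interval_noise_eta[where a=middle and b=finish and N=noise2, OF times(5) times(3) time_bounds(2) noise2_B noise2_B']; (assumption | rule i))
  show "j \<in> {1..d} \<Longrightarrow> l \<in> {j<..d} \<Longrightarrow> \<Lambda> finish middle j l i \<in> borel_measurable (noise2 i)"
    unfolding \<Lambda>_def by (rule interval_noise_levy[where a=middle and b=finish and N=noise2, OF times(5) times(3) time_bounds(2) noise2_B noise2_B']; (assumption | rule i))
qed

lemma second_half_step_noise:
  assumes "\<And>i. subalgebra M (G i)" "\<And>i. indep_set (sets (G i)) (sets (noise2 i))"
  shows "step_noise G (W finish middle) (\<Theta> finish middle) (\<Lambda> finish middle)"
  unfolding W_def[abs_def] \<Theta>_def[abs_def] \<Lambda>_def[abs_def]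
  by (rule interval_step_noise[where a=middle and b=finish and N=noise2, OF times(5) times(3) time_bounds(2) noise2_B noise2_B']; (assumption | rule assms | rule algebra_sub))

lemma
  assumes i: "i \<in> dyadic_steps"
  shows whole_step_incr: "j \<in> {0..d} \<Longrightarrow> W finish start j i \<in> borel_measurable (noise12 i)"
    and whole_step_eta: "j \<in> {0..d} \<Longrightarrow> l \<in> {0..d} \<Longrightarrow> \<Theta> finish start j l i \<in> borel_measurable (noise12 i)"
    and whole_step_levy: "j \<in> {1..d} \<Longrightarrow> l \<in> {j<..d} \<Longrightarrow> \<Lambda> finish start j l i \<in> borel_measurable (noise12 i)"
proof -
  show "j \<in> {0..d} \<Longrightarrow> W finish start j i \<in> borel_measurable (noise12 i)"
    unfolding W_def by (rule interval_noise_incr[where a=start and b=finish and N=noise12, OF times(1) times(4) time_bounds(3) noise12_B noise12_B']; (assumption | rule i))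
  show "j \<in> {0..d} \<Longrightarrow> l \<in> {0..d} \<Longrightarrow> \<Theta> finish start j l i \<in> borel_measurable (noise12 i)"
    unfolding \<Theta>_def by (rule interval_noise_eta[where a=start and b=finish and N=noise12, OF times(1) times(4) time_bounds(3) noise12_B noise12_B']; (assumption | rule i))
  show "j \<in> {1..d} \<Longrightarrow> l \<in> {j<..d} \<Longrightarrow> \<Lambda> finish start j l i \<in> borel_measurable (noise12 i)"
    unfolding \<Lambda>_def by (rule interval_noise_levy[where a=start and b=finish and N=noise12, OF times(1) times(4) time_bounds(3) noise12_B noise12_B']; (assumption | rule i))
qed

lemma whole_step_step_noise:
  assumes "\<And>i. subalgebra M (G i)" "\<And>i. indep_set (sets (G i)) (sets (noise12 i))"
  shows "step_noise G (W finish start) (\<Theta> finish start) (\<Lambda> finish start)"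
  unfolding W_def[abs_def] \<Theta>_def[abs_def] \<Lambda>_def[abs_def]
  by (rule interval_step_noise[where a=start and b=finish and N=noise12, OF times(1) times(4) time_bounds(3) noise12_B noise12_B']; (assumption | rule assms | rule algebra_sub))

lemma whole_step_noise: "step_noise past (W finish start) (\<Theta> finish start) (\<Lambda> finish start)"
  by (rule whole_step_step_noise[OF algebra_sub(1) algebra_indep(3)])

end

sublocale antithetic_schemes \<subseteq> driven_scheme M T past d \<sigma> noise12 "W finish start" "\<Theta> finish start"
proof unfold_locales
  show "subalgebra M (noise12 i)" for i by (rule algebra_sub)
  show "indep_set (sets (past i)) (sets (noise12 i))" for i by (rule algebra_indep)
  show "of_order 2 (W finish start 0)"
    "j \<in> {1..d} \<Longrightarrow> of_order 1 (W finish start j) \<and> centered past (W finish start j)"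
    "j \<in> {1..d} \<Longrightarrow> l \<in> {1..d} \<Longrightarrow> of_order 2 (\<Theta> finish start j l) \<and> centered past (\<Theta> finish start j l)" for j l
    using whole_step_noise unfolding step_noise_def by blast+
  show "W finish start j i \<in> borel_measurable (noise12 i)" if "j \<le> d" "i \<in> dyadic_steps" for j i
    using whole_step_incr[OF that(2), of j] that(1) by simp
  show "\<Theta> finish start j l i \<in> borel_measurable (noise12 i)"
    if "j \<in> {1..d}" "l \<in> {1..d}" "i \<in> dyadic_steps" for j l i
    using whole_step_eta[OF that(3), of j l] that(1,2) by simp
qed

context antithetic_schemes
begin

lemma W_add: "W middle start j i \<omega> + W finish middle j i \<omega> = W finish start j i \<omega>"
  by (simp add: W_def incr_def)

text \<open>
  The identity behind the symmetric part of the cross terms: for \<open>w = w1 + w2\<close>, the product \<open>w\<^sub>j w\<^sub>l\<close> is the sum of the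
  half-step products and the symmetrized cross terms, and the corrections on the diagonal add up.
\<close>

lemma \<Theta>_add:
  assumes "j \<in> {1..d}" "l \<in> {1..d}"
  shows "\<Theta> middle start j l i \<omega> + \<Theta> finish middle j l i \<omega>
      + (W middle start j i \<omega> * W finish middle l i \<omega> + W finish middle j i \<omega> * W middle start l i \<omega>) / 2
    = \<Theta> finish start j l i \<omega>"
  using assms by (simp add: \<Theta>_def W_def regular_eta_def incr_def field_simps)

text \<open>
  The integrator with the regular version of \<open>eta\<close>. The schemes built from it are adapted to the noise algebras, and
  agree almost surely with the given ones (\<open>AE_schemes_eq\<close>).
\<close>

definition one_step :: "real \<Rightarrow> real \<Rightarrow> real \<Rightarrow> 'a \<Rightarrow> real ^ 'n \<Rightarrow> real ^ 'n" where
  "one_step \<epsilon> t s \<omega> = step_map \<epsilon> (\<lambda>j. incr B j t s \<omega>) (\<lambda>j l. regular_eta S j l t s \<omega>) (\<lambda>j l. levy_proxy B B' j l t s \<omega>)"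

lemma one_step_eq:
  "one_step \<epsilon> (b i) (a i) \<omega> = step_map \<epsilon> (\<lambda>j. W b a j i \<omega>) (\<lambda>j l. \<Theta> b a j l i \<omega>) (\<lambda>j l. \<Lambda> b a j l i \<omega>)"
  by (simp add: one_step_def W_def \<Theta>_def \<Lambda>_def)

definition coarse_path :: "real \<Rightarrow> nat \<times> nat \<Rightarrow> 'a \<Rightarrow> real ^ 'n" where
  "coarse_path \<epsilon> i \<omega> = coarse_scheme (\<lambda>t s. one_step \<epsilon> t s \<omega>) x T (Suc (fst i)) (snd i)"
definition fine_path :: "nat \<times> nat \<Rightarrow> 'a \<Rightarrow> real ^ 'n" where
  "fine_path i \<omega> = fine_scheme (\<lambda>t s. one_step 1 t s \<omega>) x T (Suc (fst i)) (snd i)"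
definition swapped_path :: "nat \<times> nat \<Rightarrow> 'a \<Rightarrow> real ^ 'n" where
  "swapped_path i \<omega> = swapped_fine_scheme (\<lambda>t s. one_step (-1) t s \<omega>) x T (Suc (fst i)) (snd i)"

lemma grid_eq: "grid T (Suc n) (real k) = start (n, k)" "grid T (Suc n) (real k + 1 / 2) = middle (n, k)" "grid T (Suc n) (real k + 1) = finish (n, k)"
  by (simp_all add: grid_def level_step_def start_def middle_def finish_def half_time_def field_simps)

lemma scheme_0: "coarse_path \<epsilon> (n, 0) \<omega> = x" "fine_path (n, 0) \<omega> = x" "swapped_path (n, 0) \<omega> = x"
  by (simp_all add: coarse_path_def fine_path_def swapped_path_def)

lemma coarse_Suc: "coarse_path \<epsilon> (n, Suc k) \<omega> = one_step \<epsilon> (finish (n, k)) (start (n, k)) \<omega> (coarse_path \<epsilon> (n, k) \<omega>)"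
  unfolding coarse_path_def fst_conv snd_conv coarse_scheme.simps grid_eq by (rule refl)

lemma fine_Suc: "fine_path (n, Suc k) \<omega> = one_step 1 (finish (n, k)) (middle (n, k)) \<omega> (one_step 1 (middle (n, k)) (start (n, k)) \<omega> (fine_path (n, k) \<omega>))"
  unfolding fine_path_def fst_conv snd_conv fine_scheme.simps grid_eq by (rule refl)

lemma swapped_Suc: "swapped_path (n, Suc k) \<omega> = one_step (-1) (middle (n, k)) (start (n, k)) \<omega> (one_step (-1) (finish (n, k)) (middle (n, k)) \<omega> (swapped_path (n, k) \<omega>))"
  unfolding swapped_path_def fst_conv snd_conv swapped_fine_scheme.simps grid_eq by (rule refl)

lemma one_step_measurable:
  assumes "Z \<in> borel_measurable N" "subalgebra N N'"
    and "\<And>j. j \<in> {0..d} \<Longrightarrow> W b a j i \<in> borel_measurable N'"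
      "\<And>j l. j \<in> {0..d} \<Longrightarrow> l \<in> {0..d} \<Longrightarrow> \<Theta> b a j l i \<in> borel_measurable N'"
      "\<And>j l. j \<in> {1..d} \<Longrightarrow> l \<in> {j<..d} \<Longrightarrow> \<Lambda> b a j l i \<in> borel_measurable N'"
  shows "(\<lambda>\<omega>. one_step \<epsilon> (b i) (a i) \<omega> (Z \<omega>)) \<in> borel_measurable N"
  unfolding one_step_eq by (intro step_map_measurable assms(1) measurable_from_subalg[OF assms(2)] assms(3-))

lemma state_processI:
  assumes "\<And>n \<omega>. Z (n, 0) \<omega> = x"
    and "\<And>n k. k < 2 ^ n \<Longrightarrow> Z (n, k) \<in> borel_measurable (past12 (n, k)) \<Longrightarrow> Z (n, Suc k) \<in> borel_measurable (past12 (n, k))"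
  shows "state_process Z"
  unfolding state_process_def
proof (intro allI impI)
  fix n k :: nat assume "k \<le> 2 ^ n"
  then show "Z (n, k) \<in> borel_measurable (past (n, k))"
  proof (induction k)
    case 0
    have "Z (n, 0) = (\<lambda>_. x)" using assms(1) by auto
    then show ?case by simp
  next
    case (Suc k)
    then have "Z (n, k) \<in> borel_measurable (past12 (n, k))"
      using measurable_from_subalg[OF algebra_mono(5)] by auto
    then show ?case unfolding past_Suc using Suc.prems by (intro assms(2)) auto
  qed
qed

lemma state_process_coarse: "state_process (coarse_path \<epsilon>)"
proof (rule state_processI)
  show "coarse_path \<epsilon> (n, 0) \<omega> = x" for n \<omega> by (rule scheme_0)
  fix n k :: nat assume k: "k < 2 ^ n" and Z: "coarse_path \<epsilon> (n, k) \<in> borel_measurable (past12 (n, k))"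
  then have i: "(n, k) \<in> dyadic_steps" by simp
  show "coarse_path \<epsilon> (n, Suc k) \<in> borel_measurable (past12 (n, k))"
    unfolding coarse_Suc[abs_def]
    by (rule one_step_measurable[OF Z algebra_mono(8) whole_step_incr[OF i] whole_step_eta[OF i] whole_step_levy[OF i]])
qed

lemma state_process_fine: "state_process fine_path"
proof (rule state_processI)
  show "fine_path (n, 0) \<omega> = x" for n \<omega> by (rule scheme_0)
  fix n k :: nat assume k: "k < 2 ^ n" and Z: "fine_path (n, k) \<in> borel_measurable (past12 (n, k))"
  then have i: "(n, k) \<in> dyadic_steps" by simp
  show "fine_path (n, Suc k) \<in> borel_measurable (past12 (n, k))"
    unfolding fine_Suc[abs_def]
    by (rule one_step_measurable[OF
          one_step_measurable[OF Z algebra_mono(6) first_half_incr[OF i] first_half_eta[OF i] first_half_levy[OF i]]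
          algebra_mono(7) second_half_incr[OF i] second_half_eta[OF i] second_half_levy[OF i]])
qed

lemma state_process_swapped: "state_process swapped_path"
proof (rule state_processI)
  show "swapped_path (n, 0) \<omega> = x" for n \<omega> by (rule scheme_0)
  fix n k :: nat assume k: "k < 2 ^ n" and Z: "swapped_path (n, k) \<in> borel_measurable (past12 (n, k))"
  then have i: "(n, k) \<in> dyadic_steps" by simp
  show "swapped_path (n, Suc k) \<in> borel_measurable (past12 (n, k))"
    unfolding swapped_Suc[abs_def]
    by (rule one_step_measurable[OF
          one_step_measurable[OF Z algebra_mono(7) second_half_incr[OF i] second_half_eta[OF i] second_half_levy[OF i]]
          algebra_mono(6) first_half_incr[OF i] first_half_eta[OF i] first_half_levy[OF i]])
qed

lemma coarse_pair: "antithetic_pair x (\<Lambda> finish start) (coarse_path 1) (coarse_path (-1))"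
  unfolding antithetic_pair_def
proof (intro conjI)
  show "state_process (coarse_path 1)" "state_process (coarse_path (-1))" by (rule state_process_coarse)+
  show "\<forall>n \<omega>. coarse_path 1 (n, 0) \<omega> = x \<and> coarse_path (- 1) (n, 0) \<omega> = x" by (simp add: scheme_0)
  show "\<forall>j\<in>{1..d}. \<forall>l\<in>{j<..d}. of_order 2 (\<Lambda> finish start j l) \<and> centered past (\<Lambda> finish start j l)"
    using whole_step_noise unfolding step_noise_def by blast
  define R where "R \<epsilon> i \<omega> = time_part (\<lambda>j l. \<Theta> finish start j l i \<omega>) (coarse_path \<epsilon> i \<omega>)" for \<epsilon> i \<omega>
  have "local_error past 2 (R \<epsilon>)" for \<epsilon>
    unfolding R_def[abs_def] by (rule local_error_time_part[OF whole_step_noise state_process_adapted[OF state_process_coarse]])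
  moreover have "coarse_path \<epsilon> (n, Suc k) \<omega> = coarse_path \<epsilon> (n, k) \<omega> + main (n, k) \<omega> (coarse_path \<epsilon> (n, k) \<omega>)
     + (\<epsilon> / 2) *\<^sub>R area_part (\<lambda>j l. \<Lambda> finish start j l (n, k) \<omega>) (coarse_path \<epsilon> (n, k) \<omega>) + R \<epsilon> (n, k) \<omega>" for \<epsilon> n k \<omega>
    unfolding coarse_Suc one_step_eq step_map_def R_def by (rule refl)
  ultimately show "\<exists>Rp Rm. local_error past 2 Rp \<and> local_error past 2 Rm \<and>
       (\<forall>n k \<omega>. k < 2 ^ n \<longrightarrow>
          coarse_path 1 (n, Suc k) \<omega> = coarse_path 1 (n, k) \<omega> + main (n, k) \<omega> (coarse_path 1 (n, k) \<omega>)
             + (1 / 2) *\<^sub>R area_part (\<lambda>j l. \<Lambda> finish start j l (n, k) \<omega>) (coarse_path 1 (n, k) \<omega>) + Rp (n, k) \<omega> \<and>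
          coarse_path (-1) (n, Suc k) \<omega> = coarse_path (-1) (n, k) \<omega> + main (n, k) \<omega> (coarse_path (-1) (n, k) \<omega>)
             + (-1 / 2) *\<^sub>R area_part (\<lambda>j l. \<Lambda> finish start j l (n, k) \<omega>) (coarse_path (-1) (n, k) \<omega>) + Rm (n, k) \<omega>)"
    by (intro exI[of _ "R 1"] exI[of _ "R (-1)"]) blast
qed

text \<open>
  The Levy proxies of the two half-steps, and the area spanned by the two increments.
\<close>

definition fine_area :: "nat \<Rightarrow> nat \<Rightarrow> nat \<times> nat \<Rightarrow> 'a \<Rightarrow> real" where
  "fine_area j l i \<omega> = \<Lambda> middle start j l i \<omega> + \<Lambda> finish middle j l i \<omega>
     + (W middle start j i \<omega> * W finish middle l i \<omega> - W finish middle j i \<omega> * W middle start l i \<omega>)"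

lemma half_step_noise:
  "step_noise past (W middle start) (\<Theta> middle start) (\<Lambda> middle start)"
  "step_noise past (W finish middle) (\<Theta> finish middle) (\<Lambda> finish middle)"
  "step_noise past1 (W finish middle) (\<Theta> finish middle) (\<Lambda> finish middle)"
  "step_noise past2 (W middle start) (\<Theta> middle start) (\<Lambda> middle start)"
  by (rule first_half_step_noise[OF algebra_sub(1) algebra_indep(1)], rule second_half_step_noise[OF algebra_sub(1) algebra_indep(2)],
      rule second_half_step_noise[OF algebra_sub(5) algebra_indep(4)], rule first_half_step_noise[OF algebra_sub(6) algebra_indep(5)])

text \<open>
  The area of the two increments is centered because the second increment is, given the past and the first one.
\<close>

lemma fine_area_noise:
  assumes j: "j \<in> {1..d}" and l: "l \<in> {j<..d}"
  shows "of_order 2 (fine_area j l) \<and> centered past (fine_area j l)"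
proof -
  have l1: "l \<in> {1..d}" using j l by auto
  have a: "of_order 2 (\<Lambda> middle start j l)" "centered past (\<Lambda> middle start j l)" "of_order 2 (\<Lambda> finish middle j l)" "centered past (\<Lambda> finish middle j l)"
    using half_step_noise(1,2) j l unfolding step_noise_def by blast+
  have w: "of_order 1 (W middle start i)" "of_order 1 (W finish middle i)" "centered past1 (W finish middle i)" if "i \<in> {1..d}" for i
    using half_step_noise(1,3) that unfolding step_noise_def by blast+
  have p: "of_order 2 (\<lambda>i \<omega>. W finish middle u i \<omega> * W middle start v i \<omega>)" "centered past (\<lambda>i \<omega>. W finish middle u i \<omega> * W middle start v i \<omega>)"
    if u: "u \<in> {1..d}" and v: "v \<in> {1..d}" for u v
  proof -
    show "of_order 2 (\<lambda>i \<omega>. W finish middle u i \<omega> * W middle start v i \<omega>)"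
      using of_order_mult[OF w(2)[OF u] w(1)[OF v]] by (simp add: numeral_2_eq_2)
    have "W middle start v i \<in> borel_measurable (past1 i)" if "i \<in> dyadic_steps" for i
      using first_half_incr[OF that, of v] v by (intro measurable_from_subalg[OF algebra_mono(3)]) auto
    then have "centered past1 (\<lambda>i \<omega>. W finish middle u i \<omega> *\<^sub>R W middle start v i \<omega>)"
      by (intro centered_mult[OF w(3)[OF u] w(2)[OF u] w(1)[OF v]])
    then show "centered past (\<lambda>i \<omega>. W finish middle u i \<omega> * W middle start v i \<omega>)"
      using centered_mono[OF _ algebra_mono(1)] by simp
  qed
  have d: "of_order 2 (\<lambda>i \<omega>. W finish middle l i \<omega> * W middle start j i \<omega> + (-1) *\<^sub>R (W finish middle j i \<omega> * W middle start l i \<omega>))"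
    "centered past (\<lambda>i \<omega>. W finish middle l i \<omega> * W middle start j i \<omega> + (-1) *\<^sub>R (W finish middle j i \<omega> * W middle start l i \<omega>))"
    by (intro of_order_add of_order_scaleR p j l1)
      (rule centered_add[OF p(2)[OF l1 j] centered_scaleR[OF p(2)[OF j l1]] p(1)[OF l1 j] of_order_scaleR[OF p(1)[OF j l1]]])
  have eq: "fine_area j l = (\<lambda>i \<omega>. (\<Lambda> middle start j l i \<omega> + \<Lambda> finish middle j l i \<omega>)
     + (W finish middle l i \<omega> * W middle start j i \<omega> + (-1) *\<^sub>R (W finish middle j i \<omega> * W middle start l i \<omega>)))"
    by (auto simp: fine_area_def fun_eq_iff)
  show ?thesis unfolding eq
    by (intro conjI of_order_add a d centered_add[OF centered_add[OF a(2,4,1,3)] d(2) of_order_add[OF a(1,3)] d(1)])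
qed

text \<open>
  Both schemes are expanded by \<open>composed_step_expansion\<close>, the swapped one with the half-steps exchanged and \<open>\<epsilon> = -1\<close>.
\<close>

lemma fine_pair: "antithetic_pair x fine_area fine_path swapped_path"
  unfolding antithetic_pair_def
proof (intro conjI)
  show "state_process fine_path" "state_process swapped_path" by (rule state_process_fine state_process_swapped)+
  show "\<forall>n \<omega>. fine_path (n, 0) \<omega> = x \<and> swapped_path (n, 0) \<omega> = x" by (simp add: scheme_0)
  show "\<forall>j\<in>{1..d}. \<forall>l\<in>{j<..d}. of_order 2 (fine_area j l) \<and> centered past (fine_area j l)"
    using fine_area_noise by blast
  have time: "W b a 0 i \<omega> = b i - a i" for b a i \<omega> by (simp add: W_def incr_def)
  obtain Rp where Rp: "local_error past 2 Rp" "\<And>i \<omega>. step_map 1 (\<lambda>j. W finish middle j i \<omega>) (\<lambda>j l. \<Theta> finish middle j l i \<omega>) (\<lambda>j l. \<Lambda> finish middle j l i \<omega>)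
            (step_map 1 (\<lambda>j. W middle start j i \<omega>) (\<lambda>j l. \<Theta> middle start j l i \<omega>) (\<lambda>j l. \<Lambda> middle start j l i \<omega>) (fine_path i \<omega>))
        = fine_path i \<omega> + main_part (\<lambda>j. W middle start j i \<omega> + W finish middle j i \<omega>)
              (\<lambda>j l. \<Theta> middle start j l i \<omega> + \<Theta> finish middle j l i \<omega> + (W middle start j i \<omega> * W finish middle l i \<omega> + W finish middle j i \<omega> * W middle start l i \<omega>) / 2) (fine_path i \<omega>)
          + (1 / 2) *\<^sub>R area_part (\<lambda>j l. \<Lambda> middle start j l i \<omega> + \<Lambda> finish middle j l i \<omega> + 1 * (W middle start j i \<omega> * W finish middle l i \<omega> - W finish middle j i \<omega> * W middle start l i \<omega>)) (fine_path i \<omega>)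
          + Rp i \<omega>"
    using composed_step_expansion[OF half_step_noise(1,3) state_process_adapted[OF state_process_fine] algebra_mono(1) algebra_sub(5)
      measurable_from_subalg[OF algebra_mono(3) first_half_incr] measurable_from_subalg[OF algebra_mono(3) first_half_eta]
      measurable_from_subalg[OF algebra_mono(3) first_half_levy] time, of 1] by (auto 0 0)
  obtain Rm where Rm: "local_error past 2 Rm" "\<And>i \<omega>. step_map (-1) (\<lambda>j. W middle start j i \<omega>) (\<lambda>j l. \<Theta> middle start j l i \<omega>) (\<lambda>j l. \<Lambda> middle start j l i \<omega>)
            (step_map (-1) (\<lambda>j. W finish middle j i \<omega>) (\<lambda>j l. \<Theta> finish middle j l i \<omega>) (\<lambda>j l. \<Lambda> finish middle j l i \<omega>) (swapped_path i \<omega>))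
        = swapped_path i \<omega> + main_part (\<lambda>j. W finish middle j i \<omega> + W middle start j i \<omega>)
              (\<lambda>j l. \<Theta> finish middle j l i \<omega> + \<Theta> middle start j l i \<omega> + (W finish middle j i \<omega> * W middle start l i \<omega> + W middle start j i \<omega> * W finish middle l i \<omega>) / 2) (swapped_path i \<omega>)
          + (-1 / 2) *\<^sub>R area_part (\<lambda>j l. \<Lambda> finish middle j l i \<omega> + \<Lambda> middle start j l i \<omega> + -1 * (W finish middle j i \<omega> * W middle start l i \<omega> - W middle start j i \<omega> * W finish middle l i \<omega>)) (swapped_path i \<omega>)
          + Rm i \<omega>"
    using composed_step_expansion[OF half_step_noise(2,4) state_process_adapted[OF state_process_swapped] algebra_mono(2) algebra_sub(6)
      measurable_from_subalg[OF algebra_mono(4) second_half_incr] measurable_from_subalg[OF algebra_mono(4) second_half_eta]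
      measurable_from_subalg[OF algebra_mono(4) second_half_levy] time, of "-1"] by (auto 0 0)
  have mainf: "main_part (\<lambda>j. W middle start j i \<omega> + W finish middle j i \<omega>)
     (\<lambda>j l. \<Theta> middle start j l i \<omega> + \<Theta> finish middle j l i \<omega> + (W middle start j i \<omega> * W finish middle l i \<omega> + W finish middle j i \<omega> * W middle start l i \<omega>) / 2) z = main i \<omega> z" for i \<omega> z
    by (rule main_part_cong[OF W_add \<Theta>_add])
  have mains: "main_part (\<lambda>j. W finish middle j i \<omega> + W middle start j i \<omega>)
     (\<lambda>j l. \<Theta> finish middle j l i \<omega> + \<Theta> middle start j l i \<omega> + (W finish middle j i \<omega> * W middle start l i \<omega> + W middle start j i \<omega> * W finish middle l i \<omega>) / 2) z = main i \<omega> z" for i \<omega> z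
    using W_add \<Theta>_add by (intro main_part_cong) (simp_all add: add_ac)
  have areas: "area_part (\<lambda>j l. \<Lambda> finish middle j l i \<omega> + \<Lambda> middle start j l i \<omega> + -1 * (W finish middle j i \<omega> * W middle start l i \<omega> - W middle start j i \<omega> * W finish middle l i \<omega>)) z
     = area_part (\<lambda>j l. fine_area j l i \<omega>) z" for i \<omega> z
    by (rule area_part_cong) (simp add: fine_area_def)
  have areaf: "area_part (\<lambda>j l. \<Lambda> middle start j l i \<omega> + \<Lambda> finish middle j l i \<omega> + 1 * (W middle start j i \<omega> * W finish middle l i \<omega> - W finish middle j i \<omega> * W middle start l i \<omega>)) z
     = area_part (\<lambda>j l. fine_area j l i \<omega>) z" for i \<omega> z
    by (rule area_part_cong) (simp add: fine_area_def)
  show "\<exists>Rp Rm. local_error past 2 Rp \<and> local_error past 2 Rm \<and>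
       (\<forall>n k \<omega>. k < 2 ^ n \<longrightarrow>
          fine_path (n, Suc k) \<omega> = fine_path (n, k) \<omega> + main (n, k) \<omega> (fine_path (n, k) \<omega>)
             + (1 / 2) *\<^sub>R area_part (\<lambda>j l. fine_area j l (n, k) \<omega>) (fine_path (n, k) \<omega>) + Rp (n, k) \<omega> \<and>
          swapped_path (n, Suc k) \<omega> = swapped_path (n, k) \<omega> + main (n, k) \<omega> (swapped_path (n, k) \<omega>)
             + (-1 / 2) *\<^sub>R area_part (\<lambda>j l. fine_area j l (n, k) \<omega>) (swapped_path (n, k) \<omega>) + Rm (n, k) \<omega>)"
    using Rp(2)[unfolded mainf areaf] Rm(2)[unfolded mains areas]
    by (intro exI[of _ Rp] exI[of _ Rm] conjI Rp(1) Rm(1) allI impI) (simp_all only: fine_Suc swapped_Suc one_step_eq)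
qed

lemma average_measurable:
  assumes "state_process Y" "state_process Z" "k \<le> 2 ^ n"
  shows "(\<lambda>\<omega>. (1 / 2) *\<^sub>R (Y (n, k) \<omega> + Z (n, k) \<omega>) :: real ^ 'n) \<in> borel_measurable M"
proof -
  have "Y (n, k) \<in> borel_measurable M" "Z (n, k) \<in> borel_measurable M"
    using measurable_from_subalg[OF G_sub[of "(n, k)"], of "Y (n, k)" borel]
      measurable_from_subalg[OF G_sub[of "(n, k)"], of "Z (n, k)" borel] assms
    unfolding state_process_def by blast+
  then show ?thesis by (intro borel_measurable_scaleR borel_measurable_const borel_measurable_add)
qed

lemma integrator_eq_one_step:
  assumes "\<And>j l. j \<in> {0..d} \<Longrightarrow> l \<in> {0..d} \<Longrightarrow> eta M F S B j l t s \<omega> = regular_eta S j l t s \<omega>"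
  shows "integrator \<epsilon> M F d S \<sigma> B B' t s \<omega> = one_step \<epsilon> t s \<omega>"
  unfolding integrator_def[abs_def] one_step_def step_map_eq[abs_def]
  using assms by (intro ext arg_cong2[where f="(+)"] sum.cong refl) auto

text \<open>
  Only finitely many coefficients occur on a level, so the exceptional null sets can be collected.
\<close>

lemma AE_schemes_eq:
  "AE \<omega> in M. \<forall>k\<le>2 ^ n.
     fine_average M F d S \<sigma> B B' x T (Suc n) k \<omega> = (1 / 2) *\<^sub>R (fine_path (n, k) \<omega> + swapped_path (n, k) \<omega>) \<and>
     coarse_average M F d S \<sigma> B B' x T (Suc n) k \<omega> = (1 / 2) *\<^sub>R (coarse_path 1 (n, k) \<omega> + coarse_path (-1) (n, k) \<omega>)"
proof -
  have "AE \<omega> in M. \<forall>k\<in>{..<2 ^ n}. \<forall>j\<in>{0..d}. \<forall>l\<in>{0..d}.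
      eta M F S B j l (middle (n, k)) (start (n, k)) \<omega> = regular_eta S j l (middle (n, k)) (start (n, k)) \<omega> \<and>
      eta M F S B j l (finish (n, k)) (middle (n, k)) \<omega> = regular_eta S j l (finish (n, k)) (middle (n, k)) \<omega> \<and>
      eta M F S B j l (finish (n, k)) (start (n, k)) \<omega> = regular_eta S j l (finish (n, k)) (start (n, k)) \<omega>"
    by (intro AE_finite_allI finite_atLeastAtMost finite_lessThan AE_conjI AE_eta_eq times) auto
  then show ?thesis
  proof eventually_elim
    fix \<omega> assume E: "\<forall>k\<in>{..<2 ^ n}. \<forall>j\<in>{0..d}. \<forall>l\<in>{0..d}.
      eta M F S B j l (middle (n, k)) (start (n, k)) \<omega> = regular_eta S j l (middle (n, k)) (start (n, k)) \<omega> \<and>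
      eta M F S B j l (finish (n, k)) (middle (n, k)) \<omega> = regular_eta S j l (finish (n, k)) (middle (n, k)) \<omega> \<and>
      eta M F S B j l (finish (n, k)) (start (n, k)) \<omega> = regular_eta S j l (finish (n, k)) (start (n, k)) \<omega>"
    have I: "integrator \<epsilon> M F d S \<sigma> B B' (middle (n, k)) (start (n, k)) \<omega> = one_step \<epsilon> (middle (n, k)) (start (n, k)) \<omega>"
      "integrator \<epsilon> M F d S \<sigma> B B' (finish (n, k)) (middle (n, k)) \<omega> = one_step \<epsilon> (finish (n, k)) (middle (n, k)) \<omega>"
      "integrator \<epsilon> M F d S \<sigma> B B' (finish (n, k)) (start (n, k)) \<omega> = one_step \<epsilon> (finish (n, k)) (start (n, k)) \<omega>"
      if "k < 2 ^ n" for k \<epsilon>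
      using E that by (auto intro!: integrator_eq_one_step)
    have c: "coarse_scheme (\<lambda>t s. integrator \<epsilon> M F d S \<sigma> B B' t s \<omega>) x T (Suc n) k = coarse_path \<epsilon> (n, k) \<omega>" if "k \<le> 2 ^ n" for k \<epsilon>
      using that
    proof (induction k)
      case (Suc k)
      then have k: "k < 2 ^ n" by simp
      show ?case unfolding coarse_Suc coarse_scheme.simps grid_eq I(3)[OF k] using Suc by simp
    qed (simp add: scheme_0)
    have f: "fine_scheme (\<lambda>t s. integrator 1 M F d S \<sigma> B B' t s \<omega>) x T (Suc n) k = fine_path (n, k) \<omega>" if "k \<le> 2 ^ n" for k
      using that
    proof (induction k)
      case (Suc k)
      then have k: "k < 2 ^ n" by simp
      show ?case unfolding fine_Suc fine_scheme.simps grid_eq I(1,2)[OF k] using Suc by simp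
    qed (simp add: scheme_0)
    have s: "swapped_fine_scheme (\<lambda>t s. integrator (-1) M F d S \<sigma> B B' t s \<omega>) x T (Suc n) k = swapped_path (n, k) \<omega>" if "k \<le> 2 ^ n" for k
      using that
    proof (induction k)
      case (Suc k)
      then have k: "k < 2 ^ n" by simp
      show ?case unfolding swapped_Suc swapped_fine_scheme.simps grid_eq I(1,2)[OF k] using Suc by simp
    qed (simp add: scheme_0)
    show "\<forall>k\<le>2 ^ n.
     fine_average M F d S \<sigma> B B' x T (Suc n) k \<omega> = (1 / 2) *\<^sub>R (fine_path (n, k) \<omega> + swapped_path (n, k) \<omega>) \<and>
     coarse_average M F d S \<sigma> B B' x T (Suc n) k \<omega> = (1 / 2) *\<^sub>R (coarse_path 1 (n, k) \<omega> + coarse_path (-1) (n, k) \<omega>)"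
      by (simp add: fine_average_def coarse_average_def c f s)
  qed
qed

end

section \<open>Strong error of the antithetic averages\<close>

text \<open>
  A moment of even exponent that is at least \<open>p\<close>, measured in units of \<open>h\<close>, controls the moment of exponent \<open>p\<close>.
\<close>

lemma powr_le_scaled_power:
  fixes y h p :: real
  assumes "0 \<le> y" "0 < h" "0 \<le> p" "p \<le> real (2 * q)"
  shows "y powr p \<le> h powr p * (1 + y ^ (2 * q) / h ^ (2 * q))"
proof (cases "y \<le> h")
  case True
  then have "y powr p \<le> h powr p * 1" using assms by (simp add: powr_mono2)
  also have "\<dots> \<le> h powr p * (1 + y ^ (2 * q) / h ^ (2 * q))" using assms by (intro mult_left_mono) auto
  finally show ?thesis .
next
  case False
  define z where "z = y / h"
  have z: "1 \<le> z" "y = h * z" using False assms by (auto simp: z_def)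
  have "z powr p \<le> z powr real (2 * q)" using z assms by (intro powr_mono) auto
  also have "z powr real (2 * q) = z ^ (2 * q)" using z by (intro powr_realpow) auto
  also have "\<dots> \<le> 1 + y ^ (2 * q) / h ^ (2 * q)" by (simp add: z_def power_divide)
  finally have "h powr p * z powr p \<le> h powr p * (1 + y ^ (2 * q) / h ^ (2 * q))"
    by (intro mult_left_mono) auto
  moreover have "y powr p = h powr p * z powr p" unfolding z(2) by (rule powr_mult)
  ultimately show ?thesis by simp
qed

theorem theorem2p1:
  fixes M :: "'a measure" and F :: "real \<Rightarrow> 'a measure"
    and d :: nat and S :: "'n::finite set"
    and \<sigma> :: "nat \<Rightarrow> real^'n \<Rightarrow> real^'n"
    and B B' :: "nat \<Rightarrow> real \<Rightarrow> 'a \<Rightarrow> real"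
    and T p :: real and x :: "real^'n"
  assumes "prob_space M" and "filtration_on M F"
    and "T > 0" and "d \<ge> 1"
    and "brownian_motion M F {1..d} B"
    and "brownian_motion M F {2..d} B'"
    and "independent_processes M {1..d} B {2..d} B'"
    and "degenerate_structure d S \<sigma>"
    and "\<And>j. j \<le> d \<Longrightarrow> Cb_infinity (\<sigma> j)"
    and "span_condition d S \<sigma>"
    and "p \<ge> 2"
  shows "\<exists>C>0. \<forall>L. \<forall>l\<in>{1..L}.
    (\<integral>\<^sup>+\<omega>. ennreal (MAX k\<in>{0..2 ^ (l - 1)}.
        norm (fine_average M F d S \<sigma> B B' x T l k \<omega>
            - coarse_average M F d S \<sigma> B B' x T l k \<omega>) powr p) \<partial>M)
      \<le> ennreal (C * level_step T (l - 1) powr p)"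
proof -
  interpret prob_space M by fact
  interpret antithetic_schemes M F d B B' \<sigma> T x S
    by unfold_locales (use assms in auto)
  define q where "q = nat \<lceil>p\<rceil>"
  have q: "q \<ge> 1" "p \<le> real (2 * q)" using assms(11) unfolding q_def by linarith+
  define D where "D n k \<omega> = (1 / 2) *\<^sub>R (fine_path (n, k) \<omega> + swapped_path (n, k) \<omega>) - (1 / 2) *\<^sub>R (coarse_path 1 (n, k) \<omega> + coarse_path (-1) (n, k) \<omega>)" for n k \<omega>
  define m where "m n \<omega> = (MAX k\<in>{..2 ^ n}. norm (D n k \<omega>) ^ (2 * q))" for n \<omega>
  obtain C where C: "C \<ge> 0" "\<And>n. (\<integral>\<^sup>+\<omega>. ennreal (m n \<omega>) \<partial>M) \<le> ennreal (C * (T / 2 ^ n) ^ (2 * q))"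
    using antithetic_averages_close[OF fine_pair coarse_pair q(1)] unfolding m_def D_def by blast
  have meas: "m n \<in> borel_measurable M" for n
  proof -
    have "D n k \<in> borel_measurable M" if "k \<le> 2 ^ n" for k
      unfolding D_def[abs_def] using that
      by (intro borel_measurable_diff average_measurable state_process_fine state_process_swapped state_process_coarse)
    then show ?thesis unfolding m_def[abs_def]
      by (intro borel_measurable_Max) (auto intro!: borel_measurable_power borel_measurable_norm)
  qed
  have bound: "(\<integral>\<^sup>+\<omega>. ennreal (MAX k\<in>{0..2 ^ n}. norm (fine_average M F d S \<sigma> B B' x T (Suc n) k \<omega>
            - coarse_average M F d S \<sigma> B B' x T (Suc n) k \<omega>) powr p) \<partial>M) \<le> ennreal ((C + 1) * (T / 2 ^ n) powr p)" for n
  proof -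
    define h where "h = T / 2 ^ n"
    have h: "h > 0" using assms(3) by (simp add: h_def)
    have m0: "0 \<le> m n \<omega>" for \<omega> unfolding m_def by (rule Max_ge_iff[THEN iffD2]) auto
    have "(\<integral>\<^sup>+\<omega>. ennreal (MAX k\<in>{0..2 ^ n}. norm (fine_average M F d S \<sigma> B B' x T (Suc n) k \<omega>
            - coarse_average M F d S \<sigma> B B' x T (Suc n) k \<omega>) powr p) \<partial>M)
        \<le> (\<integral>\<^sup>+\<omega>. ennreal (h powr p) * (1 + ennreal (1 / h ^ (2 * q)) * ennreal (m n \<omega>)) \<partial>M)"
    proof (rule nn_integral_mono_AE, use AE_schemes_eq[of n] in eventually_elim)
      fix \<omega> assume E: "\<forall>k\<le>2 ^ n.
     fine_average M F d S \<sigma> B B' x T (Suc n) k \<omega> = (1 / 2) *\<^sub>R (fine_path (n, k) \<omega> + swapped_path (n, k) \<omega>) \<and>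
     coarse_average M F d S \<sigma> B B' x T (Suc n) k \<omega> = (1 / 2) *\<^sub>R (coarse_path 1 (n, k) \<omega> + coarse_path (-1) (n, k) \<omega>)"
      have "(MAX k\<in>{0..2 ^ n}. norm (fine_average M F d S \<sigma> B B' x T (Suc n) k \<omega>
            - coarse_average M F d S \<sigma> B B' x T (Suc n) k \<omega>) powr p) \<le> h powr p * (1 + m n \<omega> / h ^ (2 * q))"
      proof (rule Max.boundedI)
        fix y assume "y \<in> (\<lambda>k. norm (fine_average M F d S \<sigma> B B' x T (Suc n) k \<omega>
            - coarse_average M F d S \<sigma> B B' x T (Suc n) k \<omega>) powr p) ` {0..2 ^ n}"
        then obtain k where k: "k \<le> 2 ^ n" "y = norm (D n k \<omega>) powr p" using E by (auto simp: D_def)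
        have "y \<le> h powr p * (1 + norm (D n k \<omega>) ^ (2 * q) / h ^ (2 * q))"
          unfolding k(2) using h q(2) assms(11) by (intro powr_le_scaled_power) auto
        also have "\<dots> \<le> h powr p * (1 + m n \<omega> / h ^ (2 * q))"
          using h k(1) unfolding m_def by (intro mult_left_mono add_left_mono divide_right_mono Max_ge) auto
        finally show "y \<le> h powr p * (1 + m n \<omega> / h ^ (2 * q))" .
      qed auto
      then have "ennreal (MAX k\<in>{0..2 ^ n}. norm (fine_average M F d S \<sigma> B B' x T (Suc n) k \<omega>
            - coarse_average M F d S \<sigma> B B' x T (Suc n) k \<omega>) powr p) \<le> ennreal (h powr p * (1 + (1 / h ^ (2 * q)) * m n \<omega>))"
        by (intro ennreal_leI) simp
      also have "\<dots> = ennreal (h powr p) * (1 + ennreal (1 / h ^ (2 * q)) * ennreal (m n \<omega>))"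
      proof -
        have nn: "0 \<le> 1 / h ^ (2 * q)" "0 \<le> (1 / h ^ (2 * q)) * m n \<omega>" using h m0[of \<omega>] by simp_all
        have "ennreal (h powr p * (1 + (1 / h ^ (2 * q)) * m n \<omega>)) = ennreal (h powr p) * ennreal (1 + (1 / h ^ (2 * q)) * m n \<omega>)"
          using nn by (intro ennreal_mult) auto
        also have "ennreal (1 + (1 / h ^ (2 * q)) * m n \<omega>) = 1 + ennreal ((1 / h ^ (2 * q)) * m n \<omega>)"
          using nn(2) by (simp only: ennreal_plus zero_le_one ennreal_1)
        also have "ennreal ((1 / h ^ (2 * q)) * m n \<omega>) = ennreal (1 / h ^ (2 * q)) * ennreal (m n \<omega>)"
          using nn(1) m0 by (rule ennreal_mult)
        finally show ?thesis .
      qed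
      finally show "ennreal (MAX k\<in>{0..2 ^ n}. norm (fine_average M F d S \<sigma> B B' x T (Suc n) k \<omega>
            - coarse_average M F d S \<sigma> B B' x T (Suc n) k \<omega>) powr p)
        \<le> ennreal (h powr p) * (1 + ennreal (1 / h ^ (2 * q)) * ennreal (m n \<omega>))" .
    qed
    also have "\<dots> = ennreal (h powr p) * (1 + ennreal (1 / h ^ (2 * q)) * (\<integral>\<^sup>+\<omega>. ennreal (m n \<omega>) \<partial>M))"
      using meas[of n] by (simp add: nn_integral_cmult nn_integral_add emeasure_space_1)
    also have "\<dots> \<le> ennreal (h powr p) * (1 + ennreal (1 / h ^ (2 * q)) * ennreal (C * h ^ (2 * q)))"
      using C(2)[of n] unfolding h_def by (intro mult_left_mono add_left_mono) auto
    also have "ennreal (1 / h ^ (2 * q)) * ennreal (C * h ^ (2 * q)) = ennreal C"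
      using h C(1) by (simp add: ennreal_mult[symmetric])
    also have "ennreal (h powr p) * (1 + ennreal C) = ennreal ((C + 1) * h powr p)"
    proof -
      have "1 + ennreal C = ennreal (C + 1)" using C(1) by (simp add: ennreal_plus add.commute)
      moreover have "ennreal (h powr p) * ennreal (C + 1) = ennreal ((C + 1) * h powr p)"
        using C(1) by (subst ennreal_mult[symmetric]) (auto simp: mult.commute)
      ultimately show ?thesis by (simp only:)
    qed
    finally show ?thesis unfolding h_def .
  qed
  show ?thesis
  proof (intro exI[of _ "C + 1"] conjI allI ballI)
    show "C + 1 > 0" using C(1) by simp
    fix L l :: nat assume "l \<in> {1..L}"
    then obtain n where n: "l = Suc n" by (cases l) auto
    show "(\<integral>\<^sup>+\<omega>. ennreal (MAX k\<in>{0..2 ^ (l - 1)}.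
        norm (fine_average M F d S \<sigma> B B' x T l k \<omega>
            - coarse_average M F d S \<sigma> B B' x T l k \<omega>) powr p) \<partial>M)
      \<le> ennreal ((C + 1) * level_step T (l - 1) powr p)"
      using bound[of n] by (simp add: n level_step_def)
  qed
qed

end
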